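(* Assume that the drift coefficients $B_1,B_2,B_3,B_4$ are globally Lipschitz, i.e. there is $C>0$ with $|B_j(x)-B_j(y)|\le C|x-y|$ for all $x,y$, that each $B_j\in C^4_{\uparrow}$, and that $\sup_t\mathbf E[|\xi_t|^\ell]<\infty$ for all $\ell>0$ and $\sup_t\mathbf E[|\delta_t|^\ell]<\infty$, $\sup_t\mathbf E[|\varepsilon_t|^\ell]<\infty$, $\sup_t\mathbf E[|\zeta_t|^\ell]<\infty$ for all $\ell\ge 0$. Let $m\in\{1,\dots,M\}$ and assume that (a) there exists a constant $\chi>0$ such that $\mathrm Y_m(\theta_m)\le-\chi|\theta_m-\theta_{m,0}|^2$ for all $\theta_m\in\Theta_m$, and (b) $\operatorname{rank}\Delta_{m,0}=q_m$. Then, as $n\to\infty$, $$\mathbf E_{\mathbb X_n}\Bigl[\log \mathrm L_{m,n}\bigl(\mathbb X_n,\hat\theta_{m,n}(\mathbb X_n)\bigr)-\mathbf E_{\mathbb Z_n}\bigl[\log \mathrm L_{m,n}\bigl(\mathbb Z_n,\hat\theta_{m,n}(\mathbb X_n)\bigr)\bigr]\Bigr]=q_m+o_p(1).$$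
   Context: True model. Let $p_1,p_2,k_1,k_2,r_1,\dots,r_4$ be fixed positive integers with $k_1\le p_1$, $k_2\le p_2$, and $p=p_1+p_2$. On a stochastic basis $(\Omega,\mathscr F,\{\mathscr F_t\},\mathbf P)$ satisfying the usual conditions, $W_1,\dots,W_4$ are independent standard Wiener processes of dimensions $r_1,\dots,r_4$; $\mathbf E$ is expectation under $\mathbf P$. For constant matrices $\mathbf S_{j,0}$ and constant vectors $c_j$ of matching dimensions, $d\xi_t=B_1(\xi_t)dt+\mathbf S_{1,0}dW_{1,t}$, $\xi_0=c_1$ (in $\mathbb R^{k_1}$); $d\delta_t=B_2(\delta_t)dt+\mathbf S_{2,0}dW_{2,t}$, $\delta_0=c_2$ (in $\mathbb R^{p_1}$); $d\varepsilon_t=B_3(\varepsilon_t)dt+\mathbf S_{3,0}dW_{3,t}$, $\varepsilon_0=c_3$ (in $\mathbb R^{p_2}$); $d\zeta_t=B_4(\zeta_t)dt+\mathbf S_{4,0}dW_{4,t}$, $\zeta_0=c_4$ (in $\mathbb R^{k_2}$), $t\ge 0$. The observable process is $\mathbb X_t=(\mathbb X_{1,t}^\top,\mathbb X_{2,t}^\top)^\top\in\mathbb R^p$ with $\mathbb X_{1,t}=\mathbf\Lambda_{x_1,0}\xi_t+\delta_t$, $\mathbb X_{2,t}=\mathbf\Lambda_{x_2,0}\eta_t+\varepsilon_t$, $\eta_t=\mathbf B_0\eta_t+\mathbf\Gamma_0\xi_t+\zeta_t$, where $\mathbf\Lambda_{x_1,0}\in\mathbb R^{p_1\times k_1}$ has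 full column rank, $\mathbf\Lambda_{x_2,0}\in\mathbb R^{p_2\times k_2}$, $\mathbf\Gamma_0\in\mathbb R^{k_2\times k_1}$, $\mathbf B_0\in\mathbb R^{k_2\times k_2}$ has zero diagonal and $\mathbf\Psi_0=\mathbb I_{k_2}-\mathbf B_0$ is non-singular. Put $\mathbf\Sigma_{\xi\xi,0}=\mathbf S_{1,0}\mathbf S_{1,0}^\top$, $\mathbf\Sigma_{\delta\delta,0}=\mathbf S_{2,0}\mathbf S_{2,0}^\top$, $\mathbf\Sigma_{\varepsilon\varepsilon,0}=\mathbf S_{3,0}\mathbf S_{3,0}^\top$, $\mathbf\Sigma_{\zeta\zeta,0}=\mathbf S_{4,0}\mathbf S_{4,0}^\top$; $\mathbf\Sigma_{\delta\delta,0}$ and $\mathbf\Sigma_{\varepsilon\varepsilon,0}$ are positive definite. $\mathbf\Sigma_0$ is the symmetric $p\times p$ block matrix with blocks $\mathbf\Sigma_0^{11}=\mathbf\Lambda_{x_1,0}\mathbf\Sigma_{\xi\xi,0}\mathbf\Lambda_{x_1,0}^\top+\mathbf\Sigma_{\delta\delta,0}$, $\mathbf\Sigma_0^{12}=\mathbf\Lambda_{x_1,0}\mathbf\Sigma_{\xi\xi,0}\mathbf\Gamma_0^\top\mathbf\Psi_0^{-1\top}\mathbf\Lambda_{x_2,0}^\top$, $\mathbf\Sigma_0^{22}=\mathbf\Lambda_{x_2,0}\mathbf\Psi_0^{-1}(\mathbf\Gamma_0\mathbf\Sigma_{\xi\xi,0}\mathbf\Gamma_0^\top+\mathbf\Sigma_{\zeta\zeta,0})\mathbf\Psi_0^{-1\top}\mathbf\Lambda_{x_2,0}^\top+\mathbf\Sigma_{\varepsilon\varepsilon,0}$.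 Observations. $T>0$ is fixed, $h_n=T/n$, $t_i^n=ih_n$, $\mathbb X_n=(\mathbb X_{t_i^n})_{0\le i\le n}$. $\mathbb Z_n$ is an i.i.d. copy of $\mathbb X_n$ (independent, same law); $\mathbf E_{\mathbb X_n}$, $\mathbf E_{\mathbb Z_n}$ denote expectation under the laws of $\mathbb X_n$, $\mathbb Z_n$. Competing models. For each $m\in\{1,\dots,M\}$, $\Theta_m\subset\mathbb R^{q_m}$ is convex and compact, with locally Lipschitz boundary. Model $m$ with parameter $\theta=\theta_m\in\Theta_m$ has the same form as the true model (same drifts, initial values and Wiener processes), with the constant matrices replaced by matrices of the same sizes $\mathbf\Lambda^\theta_{x_1,m}$ (full column rank), $\mathbf\Lambda^\theta_{x_2,m}$, $\mathbf\Gamma^\theta_m$, $\mathbf B^\theta_m$ (zero diagonal, $\mathbf\Psi^\theta_m=\mathbb I_{k_2}-\mathbf B^\theta_m$ non-singular), $\mathbf S^\theta_{1,m},\dots,\mathbf S^\theta_{4,m}$; $\mathbf\Sigma^\theta_{\xi\xi,m},\mathbf\Sigma^\theta_{\delta\delta,m},\mathbf\Sigma^\theta_{\varepsilon\varepsilon,m},\mathbf\Sigma^\theta_{\zeta\zeta,m}$ are $\mathbf S^\theta_{j,m}\mathbf S^{\theta\top}_{j,m}$, $j=1,2,3,4$ respectively, with $\mathbf\Sigma^\theta_{\delta\delta,m},\mathbf\Sigma^\theta_{\varepsilon\varepsilon,m}$ positive definite. $\mathbf\Sigma_m(\theta_m)$ is defined by the same block formula as $\mathbf\Sigma_0$ with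 these matrices. There exists $\theta_{m,0}\in\operatorname{Int}\Theta_m$ with $\mathbf\Sigma_0=\mathbf\Sigma_m(\theta_{m,0})$. Each model is assumed identifiable; the identifiability condition used is (a) of the claim. Quasi-likelihood and estimator. For matrices $A,B$ of the same size $A[B]=\operatorname{tr}(AB^\top)$; $x^{\otimes2}=xx^\top$. For data $x_n=(x_0,\dots,x_n)$ with increments $\Delta_ix=x_i-x_{i-1}$, $$\mathrm L_{m,n}(x_n,\theta_m)=\prod_{i=1}^n\frac{1}{(2\pi h_n)^{p/2}(\det\mathbf\Sigma_m(\theta_m))^{1/2}}\exp\Bigl(-\frac1{2h_n}\mathbf\Sigma_m(\theta_m)^{-1}\bigl[(\Delta_ix)^{\otimes2}\bigr]\Bigr),$$ and the quasi-maximum likelihood estimator $\hat\theta_{m,n}(\mathbb X_n)$ is defined by $\mathrm L_{m,n}(\mathbb X_n,\hat\theta_{m,n}(\mathbb X_n))=\sup_{\theta_m\in\Theta_m}\mathrm L_{m,n}(\mathbb X_n,\theta_m)$. Further notation. $\Delta_{m,0}=\frac{\partial}{\partial\theta^\top}\operatorname{vech}\mathbf\Sigma_m(\theta_m)|_{\theta_m=\theta_{m,0}}$ (vech = half-vectorization), and $$\mathrm Y_m(\theta_m)=-\tfrac12\bigl(\mathbf\Sigma_m(\theta_m)^{-1}-\mathbf\Sigma_m(\theta_{m,0})^{-1}\bigr)\bigl[\mathbf\Sigma_m(\theta_{m,0})\bigr]-\tfrac12\log\frac{\det\mathbf\Sigma_m(\theta_m)}{\det\mathbf\Sigma_m(\theta_{m,0})}.$$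 $C^k_\uparrow(\mathbb R^d)$ is the set of functions on $\mathbb R^d$ that are continuously differentiable up to order $k$ and that, together with all these derivatives, have polynomial growth, i.e. are bounded in norm by $C(1+|x|)^C$ for some $C>0$. *)

theory Defs
  imports "HOL-Probability.Probability" "HOL-Library.Uprod"
begin

section \<open>Matrices\<close>

text \<open>A matrix of size \<open>m \<times> n\<close> has type \<open>real ^ 'n ^ 'm\<close>; the row index type comes last.\<close>

definition pos_def :: "real ^ 'n ^ 'n \<Rightarrow> bool" where
  "pos_def A \<longleftrightarrow> transpose A = A \<and> (\<forall>x. x \<noteq> 0 \<longrightarrow> 0 < x \<bullet> (A *v x))"

definition full_column_rank :: "real ^ 'n ^ 'm \<Rightarrow> bool" where
  "full_column_rank A \<longleftrightarrow> rank A = CARD('n)"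

definition zero_diagonal :: "real ^ 'n ^ 'n \<Rightarrow> bool" where
  "zero_diagonal A \<longleftrightarrow> (\<forall>i. A $ i $ i = 0)"

text \<open>\<open>mat_bracket A B\<close> is \<open>A[B] = tr (A B\<^sup>T)\<close>, and \<open>outer_square x\<close> is \<open>x x\<^sup>T\<close>.\<close>

definition mat_bracket :: "real ^ 'n ^ 'm \<Rightarrow> real ^ 'n ^ 'm \<Rightarrow> real" where
  "mat_bracket A B = trace (A ** transpose B)"

definition outer_square :: "real ^ 'n \<Rightarrow> real ^ 'n ^ 'n" where
  "outer_square x = (\<chi> i j. x $ i * x $ j)"

definition stack_vec :: "real ^ 'm \<Rightarrow> real ^ 'n \<Rightarrow> real ^ ('m + 'n)" where
  "stack_vec x y = (\<chi> i. case i of Inl a \<Rightarrow> x $ a | Inr b \<Rightarrow> y $ b)"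

definition sym_block ::
  "real ^ 'm ^ 'm \<Rightarrow> real ^ 'n ^ 'm \<Rightarrow> real ^ 'n ^ 'n \<Rightarrow> real ^ ('m + 'n) ^ ('m + 'n)" where
  "sym_block A B D = (\<chi> i j.
     case i of
       Inl a \<Rightarrow> (case j of Inl a' \<Rightarrow> A $ a $ a' | Inr b' \<Rightarrow> B $ a $ b')
     | Inr b \<Rightarrow> (case j of Inl a' \<Rightarrow> transpose B $ b $ a' | Inr b' \<Rightarrow> D $ b $ b'))"

instance uprod :: (finite) finite
proof
  have "(UNIV :: 'a uprod set) \<subseteq> (\<lambda>(x, y). Upair x y) ` UNIV"
  proof
    fix u :: "'a uprod"
    show "u \<in> (\<lambda>(x, y). Upair x y) ` UNIV"
      by (cases u) auto
  qed
  then show "finite (UNIV :: 'a uprod set)"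
    by (rule finite_subset) simp
qed

text \<open>
  Half-vectorization. The \<open>n (n + 1) / 2\<close> coordinates are indexed by the unordered pairs
  of indices instead of being listed in a fixed order. For each pair one of the two mirror entries
  is taken; \<open>vech\<close> is only applied to symmetric matrices, where they coincide.
\<close>

definition vech :: "real ^ 'n ^ 'n \<Rightarrow> real ^ ('n uprod)" where
  "vech A = (\<chi> u. let (i, j) = (SOME ij. u = Upair (fst ij) (snd ij)) in A $ i $ j)"


section \<open>Function classes and domains\<close>

definition poly_growth :: "('a::real_normed_vector \<Rightarrow> 'b::real_normed_vector) \<Rightarrow> bool" where
  "poly_growth f \<longleftrightarrow> (\<exists>C>0. \<forall>x. norm (f x) \<le> C * (1 + norm x) powr C)"

text \<open>
  \<open>C_up k f\<close> is the class \<open>C\<^sup>k\<close> with polynomial growth of the function and of all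
  (iterated partial) derivatives up to order \<open>k\<close>.
\<close>

fun C_up :: "nat \<Rightarrow> ('a::euclidean_space \<Rightarrow> 'b::real_normed_vector) \<Rightarrow> bool" where
  "C_up 0 f \<longleftrightarrow> continuous_on UNIV f \<and> poly_growth f"
| "C_up (Suc k) f \<longleftrightarrow> poly_growth f \<and> (\<forall>x. f differentiable (at x)) \<and>
     (\<forall>b\<in>Basis. C_up k (\<lambda>x. frechet_derivative f (at x) b))"

text \<open>
  Near each boundary point, after a choice of a direction \<open>v\<close>, the set is the region below the
  graph of a Lipschitz function over the hyperplane orthogonal to \<open>v\<close>.
\<close>

definition locally_Lipschitz_boundary :: "'a::euclidean_space set \<Rightarrow> bool" where
  "locally_Lipschitz_boundary S \<longleftrightarrow>
     (\<forall>x\<in>frontier S. \<exists>U v g L.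
        open U \<and> x \<in> U \<and> norm v = 1 \<and> L-lipschitz_on {y. y \<bullet> v = 0} g \<and>
        frontier S \<inter> U = {y\<in>U. y \<bullet> v = g (y - (y \<bullet> v) *\<^sub>R v)} \<and>
        interior S \<inter> U = {y\<in>U. y \<bullet> v < g (y - (y \<bullet> v) *\<^sub>R v)})"


section \<open>Stochastic basis, Wiener processes and diffusions with constant diffusion matrix\<close>

text \<open>Time runs through the reals \<open>t \<ge> 0\<close>; values of filtrations and processes at negative
  times are never used.\<close>

definition stochastic_basis :: "'w measure \<Rightarrow> (real \<Rightarrow> 'w measure) \<Rightarrow> bool" where
  "stochastic_basis M F \<longleftrightarrow>
     prob_space M \<and> complete_measure M \<and>
     (\<forall>t\<ge>0. subalgebra M (F t)) \<and>
     (\<forall>s t. 0 \<le> s \<and> s \<le> t \<longrightarrow> sets (F s) \<subseteq> sets (F t)) \<and>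
     null_sets M \<subseteq> sets (F 0) \<and>
     (\<forall>t\<ge>0. sets (F t) = (\<Inter>s\<in>{t<..}. sets (F s)))"

definition adapted_process ::
  "(real \<Rightarrow> 'w measure) \<Rightarrow> (real \<Rightarrow> 'w \<Rightarrow> 'b::topological_space) \<Rightarrow> bool" where
  "adapted_process F Y \<longleftrightarrow> (\<forall>t\<ge>0. Y t \<in> borel_measurable (F t))"

text \<open>The increment over \<open>[s, t]\<close> has law \<open>N(0, (t - s) I)\<close> and is independent of the past.\<close>

definition wiener_process ::
  "'w measure \<Rightarrow> (real \<Rightarrow> 'w measure) \<Rightarrow> (real \<Rightarrow> 'w \<Rightarrow> real ^ 'r) \<Rightarrow> bool" where
  "wiener_process M F W \<longleftrightarrow>
     adapted_process F W \<and>
     (AE \<omega> in M. W 0 \<omega> = 0 \<and> continuous_on {0..} (\<lambda>t. W t \<omega>)) \<and>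
     (\<forall>s t. 0 \<le> s \<and> s < t \<longrightarrow>
        distributed M lborel (\<lambda>\<omega>. W t \<omega> - W s \<omega>)
          (\<lambda>x. ennreal (\<Prod>i\<in>UNIV. normal_density 0 (sqrt (t - s)) (x $ i))) \<and>
        prob_space.indep_set M (sets (F s))
          {(\<lambda>\<omega>. W t \<omega> - W s \<omega>) -` A \<inter> space M | A. A \<in> sets borel})"

definition process_sigma ::
  "'w measure \<Rightarrow> (real \<Rightarrow> 'w \<Rightarrow> 'b::topological_space) \<Rightarrow> 'w set set" where
  "process_sigma M Y =
     sigma_sets (space M) {Y t -` A \<inter> space M | t A. 0 \<le> t \<and> A \<in> sets borel}"

text \<open>
  Solution of \<open>dY = B(Y) dt + S dW\<close>, \<open>Y\<^sub>0 = c\<close>, in integral form. As \<open>S\<close> is constant, the stochastic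
  integral of \<open>S\<close> over \<open>[0, t]\<close> is \<open>S W\<^sub>t\<close>.
\<close>

definition sde_solution ::
  "'w measure \<Rightarrow> (real \<Rightarrow> 'w measure) \<Rightarrow> (real \<Rightarrow> 'w \<Rightarrow> real ^ 'r) \<Rightarrow>
   (real ^ 'd \<Rightarrow> real ^ 'd) \<Rightarrow> real ^ 'r ^ 'd \<Rightarrow> real ^ 'd \<Rightarrow> (real \<Rightarrow> 'w \<Rightarrow> real ^ 'd) \<Rightarrow> bool" where
  "sde_solution M F W B S c Y \<longleftrightarrow>
     adapted_process F Y \<and>
     (AE \<omega> in M. continuous_on {0..} (\<lambda>t. Y t \<omega>) \<and>
        (\<forall>t\<ge>0. ((\<lambda>s. B (Y s \<omega>)) has_integral (Y t \<omega> - c - S *v W t \<omega>)) {0..t}))"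

definition bounded_moment ::
  "'w measure \<Rightarrow> (real \<Rightarrow> 'w \<Rightarrow> 'b::real_normed_vector) \<Rightarrow> real \<Rightarrow> bool" where
  "bounded_moment M Y l \<longleftrightarrow> (SUP t\<in>{0..}. \<integral>\<^sup>+ \<omega>. ennreal (norm (Y t \<omega>) powr l) \<partial>M) < \<infinity>"


section \<open>Structural equation models\<close>

record ('k1::finite, 'k2::finite, 'p1::finite, 'p2::finite,
        'r1::finite, 'r2::finite, 'r3::finite, 'r4::finite) sem =
  Lambda_x1 :: "real ^ 'k1 ^ 'p1"
  Lambda_x2 :: "real ^ 'k2 ^ 'p2"
  Gamma_mat :: "real ^ 'k1 ^ 'k2"
  B_mat :: "real ^ 'k2 ^ 'k2"
  S1 :: "real ^ 'r1 ^ 'k1"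
  S2 :: "real ^ 'r2 ^ 'p1"
  S3 :: "real ^ 'r3 ^ 'p2"
  S4 :: "real ^ 'r4 ^ 'k2"

definition Psi_mat where
  "Psi_mat P = mat 1 - B_mat P"

definition Sigma_xixi where
  "Sigma_xixi P = S1 P ** transpose (S1 P)"

definition Sigma_deltadelta where
  "Sigma_deltadelta P = S2 P ** transpose (S2 P)"

definition Sigma_epsilonepsilon where
  "Sigma_epsilonepsilon P = S3 P ** transpose (S3 P)"

definition Sigma_zetazeta where
  "Sigma_zetazeta P = S4 P ** transpose (S4 P)"

definition admissible_sem ::
  "('k1::finite, 'k2::finite, 'p1::finite, 'p2::finite,
    'r1::finite, 'r2::finite, 'r3::finite, 'r4::finite) sem \<Rightarrow> bool" where
  "admissible_sem P \<longleftrightarrow>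
     full_column_rank (Lambda_x1 P) \<and> zero_diagonal (B_mat P) \<and> invertible (Psi_mat P) \<and>
     pos_def (Sigma_deltadelta P) \<and> pos_def (Sigma_epsilonepsilon P)"

definition Sigma_sem ::
  "('k1::finite, 'k2::finite, 'p1::finite, 'p2::finite,
    'r1::finite, 'r2::finite, 'r3::finite, 'r4::finite) sem \<Rightarrow> real ^ ('p1 + 'p2) ^ ('p1 + 'p2)" where
  "Sigma_sem P =
     (let L1 = Lambda_x1 P; L2 = Lambda_x2 P; G = Gamma_mat P; Pinv = matrix_inv (Psi_mat P)
      in sym_block
           (L1 ** Sigma_xixi P ** transpose L1 + Sigma_deltadelta P)
           (L1 ** Sigma_xixi P ** transpose G ** transpose Pinv ** transpose L2)
           (L2 ** Pinv ** (G ** Sigma_xixi P ** transpose G + Sigma_zetazeta P)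
              ** transpose Pinv ** transpose L2 + Sigma_epsilonepsilon P))"

definition observable ::
  "('k1::finite, 'k2::finite, 'p1::finite, 'p2::finite,
    'r1::finite, 'r2::finite, 'r3::finite, 'r4::finite) sem \<Rightarrow>
   (real \<Rightarrow> 'w \<Rightarrow> real ^ 'k1) \<Rightarrow> (real \<Rightarrow> 'w \<Rightarrow> real ^ 'k2) \<Rightarrow>
   (real \<Rightarrow> 'w \<Rightarrow> real ^ 'p1) \<Rightarrow> (real \<Rightarrow> 'w \<Rightarrow> real ^ 'p2) \<Rightarrow>
   real \<Rightarrow> 'w \<Rightarrow> real ^ ('p1 + 'p2)" where
  "observable P \<xi> \<eta> \<delta> \<epsilon> t \<omega> =
     stack_vec (Lambda_x1 P *v \<xi> t \<omega> + \<delta> t \<omega>) (Lambda_x2 P *v \<eta> t \<omega> + \<epsilon> t \<omega>)"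


section \<open>Quasi-likelihood, quasi-maximum likelihood estimator, and related quantities\<close>

text \<open>
  A data set is a function on \<open>{..n}\<close>, extended by \<open>undefined\<close>. \<open>sample_law\<close> is
  the law of the observed sample, hence also the law of an independent copy of it.
\<close>

definition data_space :: "nat \<Rightarrow> (nat \<Rightarrow> 'b::topological_space) measure" where
  "data_space n = PiM {..n} (\<lambda>_. borel)"

definition sample ::
  "real \<Rightarrow> nat \<Rightarrow> (real \<Rightarrow> 'w \<Rightarrow> 'b) \<Rightarrow> 'w \<Rightarrow> nat \<Rightarrow> 'b" where
  "sample T n X \<omega> = (\<lambda>i\<in>{..n}. X (real i * (T / real n)) \<omega>)"

definition sample_law ::
  "'w measure \<Rightarrow> real \<Rightarrow> nat \<Rightarrow> (real \<Rightarrow> 'w \<Rightarrow> 'b::topological_space) \<Rightarrow> (nat \<Rightarrow> 'b) measure" where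
  "sample_law M T n X = distr M (data_space n) (sample T n X)"

definition quasi_likelihood ::
  "real \<Rightarrow> nat \<Rightarrow> ('q \<Rightarrow> real ^ 'p ^ 'p) \<Rightarrow> (nat \<Rightarrow> real ^ 'p) \<Rightarrow> 'q \<Rightarrow> real" where
  "quasi_likelihood T n \<Sigma> x \<theta> =
     (let h = T / real n in
      \<Prod>i=1..n. 1 / ((2 * pi * h) powr (real CARD('p) / 2) * det (\<Sigma> \<theta>) powr (1 / 2)) *
        exp (- 1 / (2 * h) * mat_bracket (matrix_inv (\<Sigma> \<theta>)) (outer_square (x i - x (i - 1)))))"

text \<open>
  A quasi-maximum likelihood estimator from \<open>n\<close> increments is a measurable map from the data to
  the parameter set that maximizes the quasi-likelihood at almost every observed sample.
\<close>

definition is_qmle ::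
  "'w measure \<Rightarrow> real \<Rightarrow> nat \<Rightarrow> (real \<Rightarrow> 'w \<Rightarrow> real ^ 'p) \<Rightarrow> (real ^ 'q \<Rightarrow> real ^ 'p ^ 'p) \<Rightarrow>
   (real ^ 'q) set \<Rightarrow> ((nat \<Rightarrow> real ^ 'p) \<Rightarrow> real ^ 'q) \<Rightarrow> bool" where
  "is_qmle M T n X \<Sigma> \<Theta> est \<longleftrightarrow>
     est \<in> borel_measurable (data_space n) \<and>
     (\<forall>x\<in>space (data_space n). est x \<in> \<Theta>) \<and>
     (AE \<omega> in M.
        quasi_likelihood T n \<Sigma> (sample T n X \<omega>) (est (sample T n X \<omega>)) =
          (SUP \<theta>\<in>\<Theta>. quasi_likelihood T n \<Sigma> (sample T n X \<omega>) \<theta>))"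

definition Y_fun :: "('q \<Rightarrow> real ^ 'p ^ 'p) \<Rightarrow> 'q \<Rightarrow> 'q \<Rightarrow> real" where
  "Y_fun \<Sigma> \<theta>0 \<theta> =
     - 1 / 2 * mat_bracket (matrix_inv (\<Sigma> \<theta>) - matrix_inv (\<Sigma> \<theta>0)) (\<Sigma> \<theta>0)
     - 1 / 2 * ln (det (\<Sigma> \<theta>) / det (\<Sigma> \<theta>0))"

definition Delta_mat ::
  "(real ^ 'q \<Rightarrow> real ^ 'p ^ 'p) \<Rightarrow> real ^ 'q \<Rightarrow> real ^ 'q ^ ('p uprod)" where
  "Delta_mat \<Sigma> \<theta>0 = jacobian (\<lambda>\<theta>. vech (\<Sigma> \<theta>)) (at \<theta>0)"

text \<open>
  A parametric model with parameter set \<open>\<Theta>\<close> which contains the true covariance at \<open>\<theta>0\<close>.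
  The last two conditions make explicit the regularity in the parameter that is needed for the
  quasi-maximum likelihood estimator and the Jacobian at \<open>\<theta>0\<close> to be meaningful.
\<close>

definition competing_model ::
  "(real ^ 'q \<Rightarrow> ('k1::finite, 'k2::finite, 'p1::finite, 'p2::finite,
       'r1::finite, 'r2::finite, 'r3::finite, 'r4::finite) sem) \<Rightarrow>
   (real ^ 'q) set \<Rightarrow> real ^ 'q \<Rightarrow>
   ('k1, 'k2, 'p1, 'p2, 'r1, 'r2, 'r3, 'r4) sem \<Rightarrow> bool" where
  "competing_model P \<Theta> \<theta>0 P0 \<longleftrightarrow>
     convex \<Theta> \<and> compact \<Theta> \<and> locally_Lipschitz_boundary \<Theta> \<and>
     (\<forall>\<theta>\<in>\<Theta>. admissible_sem (P \<theta>)) \<and>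
     \<theta>0 \<in> interior \<Theta> \<and> Sigma_sem P0 = Sigma_sem (P \<theta>0) \<and>
     continuous_on \<Theta> (\<lambda>\<theta>. Sigma_sem (P \<theta>)) \<and>
     (\<lambda>\<theta>. Sigma_sem (P \<theta>)) differentiable (at \<theta>0)"

end

theory Submission
  imports Defs
begin

text \<open>
  With \<open>Q\<^sub>n = T\<^sup>-\<^sup>1 \<Sum>\<^sub>i \<Delta>\<^sub>iX \<Delta>\<^sub>iX\<^sup>T\<close> the log-likelihood is
  \<open>- n/2 (p log (2\<pi>h\<^sub>n) + log det \<Sigma>(\<theta>) + \<Sigma>(\<theta>)\<^sup>-\<^sup>1[Q\<^sub>n])\<close>. All terms that do not depend on the data cancel
  in the difference, and the expected bias is \<open>- n/2 E[K\<^sub>n[H\<^sub>n - E H\<^sub>n]]\<close> with \<open>H\<^sub>n = Q\<^sub>n - \<Sigma>\<^sub>0\<close> and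
  \<open>K\<^sub>n = \<Sigma>(\<theta>\<^sub>n)\<^sup>-\<^sup>1 - \<Sigma>\<^sub>0\<^sup>-\<^sup>1\<close>, where \<open>\<theta>\<^sub>n\<close> is the estimator.

  The estimator minimizes \<open>- 2 Y(\<theta>) + K(\<theta>)[H\<^sub>n]\<close>. By condition (a) this gives \<open>|K\<^sub>n| \<le> C |H\<^sub>n|\<close>
  everywhere on \<open>\<Theta>\<close>, and \<open>K\<^sub>n[H\<^sub>n] = - w\<^sup>T J\<^sup>-\<^sup>1 w + o(|H\<^sub>n|\<^sup>2)\<close> for small \<open>H\<^sub>n\<close>, where \<open>w\<close> is linear in \<open>H\<^sub>n\<close> and
  \<open>J\<close> is twice the Gaussian information matrix, invertible because of (a).

  Since the drift contributes only \<open>O(h\<^sub>n)\<close> to the increments, \<open>H\<^sub>n = G\<^sub>n + R\<^sub>n\<close>, where \<open>G\<^sub>n\<close> is the centred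
  empirical covariance of the Gaussian noise and \<open>E |R\<^sub>n|\<^sup>2 = O(n\<^sup>-\<^sup>2)\<close>; the cross terms of noise and drift are
  orthogonal martingale increments. By Isserlis' formula \<open>n Cov(w(G\<^sub>n)) = 2 J\<close>, so that
  \<open>n E[K\<^sub>n[H\<^sub>n - E H\<^sub>n]] \<rightarrow> - 2 tr (J\<^sup>-\<^sup>1 J) = - 2 q\<close>. Fourth moments of \<open>G\<^sub>n\<close> control the event that \<open>H\<^sub>n\<close>
  is not small, so no rate of convergence of the estimator is required.
\<close>

section \<open>Matrices and the Gaussian divergence\<close>

text \<open>The parameter map is continuous on \<open>\<Theta>\<close> and differentiable at
  \<open>\<theta>0\<close>, so \<open>Y_fun\<close> has no second-order Taylor expansion to start
  from. The Gaussian divergence is instead treated as a function of the covariance matrix: along the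
  segment between two covariances it equals half of a trace that is already quadratic in their
  difference, and one derivative of \<open>\<Sigma>\<close> then yields the quadratic form of
  \<open>J\<close>. The rates are forced by the factor n in front of the expectation: n E|R|^2 must
  vanish. Over a step of length h the noise has size sqrt h and the drift size h, so a termwise
  bound of the n cross products gives E|R|^2 = O(h), which is just too weak. The drift increment is
  therefore split into h times its value at the left end, whose products with the noise are
  orthogonal, and a remainder of size h^(3/2). The expansion of K[H] is pathwise, with error e|H|^2
  for small H. Moving to expectations costs e times a bounded quantity plus a constant depending on
  e times quantities that vanish with n, so e can be made small after n.\<close>

lemma mat_bracket_eq_inner: "mat_bracket A B = A \<bullet> (B :: real^'n^'m)"
  by (simp add: mat_bracket_def trace_def matrix_matrix_mult_def transpose_def inner_vec_def)

lemma norm_transpose: "norm (transpose A) = norm (A :: real^'n^'m)"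
proof -
  have "transpose A \<bullet> transpose A = A \<bullet> A"
    unfolding inner_vec_def by (simp add: transpose_def) (rule sum.swap)
  then show ?thesis by (simp add: norm_eq_sqrt_inner)
qed

lemma abs_trace_mult_le: "\<bar>trace (A ** B)\<bar> \<le> norm (A :: real^'n^'m) * norm (B :: real^'m^'n)"
proof -
  have "trace (A ** B) = A \<bullet> transpose B"
    by (metis mat_bracket_def mat_bracket_eq_inner transpose_transpose)
  then show ?thesis
    by (metis Cauchy_Schwarz_ineq2 norm_transpose)
qed

text \<open>The norm on matrices is the Frobenius norm: each entry of the product is the inner
  product of a row and a column, so Cauchy-Schwarz entry by entry gives submultiplicativity with
  constant 1.\<close>

lemma norm_matrix_mult_le: "norm (A ** B) \<le> norm (A :: real^'n^'m) * norm (B :: real^'k^'n)"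
proof -
  have sq: "(norm C)\<^sup>2 = (\<Sum>i\<in>UNIV. (norm (C $ i))\<^sup>2)" for C :: "real^'c^'d"
    by (simp add: norm_vec_def L2_set_def sum_nonneg)
  have sqt: "(norm B)\<^sup>2 = (\<Sum>j\<in>UNIV. (norm (column j B))\<^sup>2)"
  proof -
    have "transpose B $ j = column j B" for j
      by (simp add: column_def transpose_def)
    then show ?thesis
      using sq[of "transpose B"] by (simp only: norm_transpose)
  qed
  have ent: "(A ** B) $ i $ j = A $ i \<bullet> column j B" for i j
    by (simp add: matrix_matrix_mult_def column_def inner_vec_def)
  have "(norm (A ** B))\<^sup>2 = (\<Sum>i\<in>UNIV. \<Sum>j\<in>UNIV. (A $ i \<bullet> column j B)\<^sup>2)"
    unfolding sq by (simp add: norm_vec_def L2_set_def sum_nonneg ent)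
  also have "\<dots> \<le> (\<Sum>i\<in>UNIV. \<Sum>j\<in>UNIV. (norm (A $ i))\<^sup>2 * (norm (column j B))\<^sup>2)"
    by (intro sum_mono) (metis Cauchy_Schwarz_ineq power2_norm_eq_inner)
  also have "\<dots> = (norm A)\<^sup>2 * (norm B)\<^sup>2"
    by (simp only: sq[of A] sqt sum_product)
  finally show ?thesis
    using power2_le_imp_le[of "norm (A ** B)" "norm A * norm B"] by (simp add: power_mult_distrib)
qed

lemma bounded_bilinear_matrix_mult:
  "bounded_bilinear ((**) :: real^'n^'m \<Rightarrow> real^'k^'n \<Rightarrow> real^'k^'m)"
proof
  fix A A' :: "real^'n^'m" and B B' :: "real^'k^'n" and r :: real
  show "(A + A') ** B = A ** B + A' ** B"
    by (simp add: matrix_matrix_mult_def vec_eq_iff distrib_right sum.distrib)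
  show "A ** (B + B') = A ** B + A ** B'"
    by (rule matrix_add_ldistrib)
  show "(r *\<^sub>R A) ** B = r *\<^sub>R (A ** B)"
    by (simp add: matrix_matrix_mult_def vec_eq_iff sum_distrib_left mult.assoc)
  show "A ** (r *\<^sub>R B) = r *\<^sub>R (A ** B)"
    by (simp add: matrix_matrix_mult_def vec_eq_iff sum_distrib_left mult.left_commute)
  show "\<exists>K. \<forall>(A :: real^'n^'m) (B :: real^'k^'n). norm (A ** B) \<le> norm A * norm B * K"
    by (intro exI[of _ 1] allI) (simp add: norm_matrix_mult_le)
qed

interpretation matrix_mult: bounded_bilinear "(**) :: real^'n^'m \<Rightarrow> real^'k^'n \<Rightarrow> real^'k^'m"
  by (rule bounded_bilinear_matrix_mult)

lemma trace_scaleR: "trace (c *\<^sub>R A) = c * trace (A :: real^'n^'n)"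
  by (simp add: trace_def sum_distrib_left)

section \<open>Inverses, determinants and positive definite matrices\<close>

lemma matrix_inv_mult:
  fixes A :: "real^'n^'n"
  assumes "invertible A"
  shows "A ** matrix_inv A = mat 1" "matrix_inv A ** A = mat 1"
  using someI_ex[OF assms[unfolded invertible_def]] unfolding matrix_inv_def by auto

lemma matrix_inv_unique:
  fixes A :: "real^'n^'n"
  assumes "A ** B = mat 1"
  shows "matrix_inv A = B"
proof -
  have "invertible A"
    using assms invertible_right_inverse by blast
  then show ?thesis
    by (metis assms matrix_inv_mult(2) matrix_mul_assoc matrix_mul_lid matrix_mul_rid)
qed

text \<open>Resolvent identity. The derivative of the inverse and the derivative of the divergence
  along a segment both rest on it.\<close>

lemma matrix_inv_diff:
  fixes A B :: "real^'n^'n"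
  assumes "invertible A" "invertible B"
  shows "matrix_inv A - matrix_inv B = - (matrix_inv A ** (A - B) ** matrix_inv B)"
  using matrix_inv_mult[OF assms(1)] matrix_inv_mult[OF assms(2)]
  by (simp add: matrix_mult.diff_left matrix_mult.diff_right matrix_mul_assoc[symmetric])

lemma continuous_on_matrix_mult [continuous_intros]:
  fixes f :: "'a::topological_space \<Rightarrow> real^'n^'m" and g :: "'a \<Rightarrow> real^'k^'n"
  assumes "continuous_on S f" "continuous_on S g"
  shows "continuous_on S (\<lambda>x. f x ** g x)"
  unfolding matrix_matrix_mult_def
  by (intro continuous_on_vec_lambda continuous_intros assms)

lemma continuous_on_det [continuous_intros]:
  fixes f :: "'a::topological_space \<Rightarrow> real^'n^'n"
  assumes "continuous_on S f"
  shows "continuous_on S (\<lambda>x. det (f x))"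
  unfolding det_def by (intro continuous_intros assms)

text \<open>Cramer's rule. It presents every entry of the inverse as a quotient of polynomials in
  the entries, from which continuity of the inverse is read off.\<close>

lemma matrix_inv_entry:
  fixes A :: "real^'n^'n"
  assumes "invertible A"
  shows "matrix_inv A $ k $ l = det (\<chi> i j. if j = k then axis l 1 $ i else A $ i $ j) / det A"
proof -
  have "A *v (matrix_inv A *v axis l 1) = axis l 1"
    by (simp add: matrix_vector_mul_assoc matrix_inv_mult[OF assms])
  moreover have "det A \<noteq> 0"
    using assms invertible_det_nz by blast
  ultimately have "matrix_inv A *v axis l 1 =
      (\<chi> k. det (\<chi> i j. if j = k then axis l 1 $ i else A $ i $ j) / det A)"
    using cramer by blast
  moreover have "(matrix_inv A *v axis l 1) $ k = matrix_inv A $ k $ l"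
    by (simp add: matrix_vector_mult_def axis_def if_distrib cong: if_cong)
  ultimately show ?thesis by simp
qed

lemma continuous_on_matrix_inv [continuous_intros]:
  fixes f :: "'a::topological_space \<Rightarrow> real^'n^'n"
  assumes f: "continuous_on S f" and inv: "\<And>x. x \<in> S \<Longrightarrow> invertible (f x)"
  shows "continuous_on S (\<lambda>x. matrix_inv (f x))"
proof -
  have "continuous_on S (\<lambda>x. \<chi> k l.
      det (\<chi> i j. if j = k then axis l 1 $ i else f x $ i $ j) / det (f x))"
  proof (intro continuous_on_vec_lambda continuous_on_divide continuous_on_det f)
    fix k l i j
    show "continuous_on S (\<lambda>x. if j = k then axis l (1::real) $ i else f x $ i $ j)"
      by (cases "j = k") (auto intro!: continuous_intros f)
  qed (use inv invertible_det_nz in blast)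
  then show ?thesis
    by (rule continuous_on_eq) (simp add: vec_eq_iff matrix_inv_entry inv)
qed

lemma pos_def_invertible:
  assumes "pos_def (A :: real^'n^'n)"
  shows "invertible A"
proof -
  have "A *v x = 0 \<Longrightarrow> x = 0" for x
    using assms unfolding pos_def_def by (metis inner_zero_right less_irrefl)
  then show ?thesis
    by (simp add: invertible_left_inverse matrix_left_invertible_ker)
qed

lemma pos_def_convex_comb:
  assumes "pos_def (A :: real^'n^'n)" "pos_def B" "0 \<le> t" "t \<le> 1"
  shows "pos_def ((1 - t) *\<^sub>R A + t *\<^sub>R B)"
  unfolding pos_def_def
proof (intro conjI allI impI)
  show "transpose ((1 - t) *\<^sub>R A + t *\<^sub>R B) = (1 - t) *\<^sub>R A + t *\<^sub>R B"
    using assms unfolding pos_def_def by (simp add: transpose_def vec_eq_iff)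
  fix x :: "real^'n" assume "x \<noteq> 0"
  then have p: "0 < x \<bullet> (A *v x)" "0 < x \<bullet> (B *v x)"
    using assms unfolding pos_def_def by auto
  have "x \<bullet> (((1 - t) *\<^sub>R A + t *\<^sub>R B) *v x) = (1 - t) * (x \<bullet> (A *v x)) + t * (x \<bullet> (B *v x))"
    by (simp add: matrix_vector_mult_add_rdistrib inner_add_right scaleR_matrix_vector_assoc[symmetric])
  moreover have "\<dots> > 0"
    using p assms(3,4) by (cases "t = 0") (auto intro!: add_nonneg_pos)
  ultimately show "0 < x \<bullet> (((1 - t) *\<^sub>R A + t *\<^sub>R B) *v x)" by simp
qed

lemma pos_def_mat_1: "pos_def (mat 1 :: real^'n^'n)"
  by (simp add: pos_def_def)

text \<open>The segment from the identity to \<open>A\<close> consists of positive definite, hence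
  invertible, matrices. The determinant has no zero on it and starts at 1, so the intermediate value
  theorem forbids a change of sign.\<close>

lemma pos_def_det_pos:
  assumes A: "pos_def (A :: real^'n^'n)"
  shows "0 < det A"
proof (rule ccontr)
  let ?d = "\<lambda>t. det ((1 - t) *\<^sub>R mat 1 + t *\<^sub>R A)"
  assume "\<not> 0 < det A"
  then have "?d 1 \<le> 0" "0 \<le> ?d 0" by simp_all
  moreover have "continuous_on {0..1} ?d" by (intro continuous_intros)
  ultimately obtain t where t: "0 \<le> t" "t \<le> 1" "?d t = 0"
    using IVT2'[of ?d 1 0 0] by auto
  then show False
    using pos_def_invertible[OF pos_def_convex_comb[OF pos_def_mat_1 A t(1,2)]] invertible_det_nz
    by blast
qed

lemma transpose_matrix_inv:
  assumes "transpose (A :: real^'n^'n) = A" "invertible A"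
  shows "transpose (matrix_inv A) = matrix_inv A"
proof -
  have "A ** transpose (matrix_inv A) = mat 1"
    by (metis assms matrix_inv_mult(2) matrix_transpose_mul transpose_mat)
  then show ?thesis
    by (metis matrix_inv_unique)
qed

text \<open>Jacobi's formula at the identity, from the Leibniz expansion: only the identity
  permutation contributes to first order.\<close>

lemma has_real_derivative_det_at_mat_1:
  fixes E :: "real^'n^'n"
  shows "((\<lambda>s. det (mat 1 + s *\<^sub>R E)) has_real_derivative trace E) (at 0)"
proof -
  let ?P = "{p. p permutes (UNIV :: 'n set)}"
  define D where "D p = of_int (sign p) *
      (\<Sum>i\<in>UNIV. E $ i $ p i * (\<Prod>j\<in>UNIV - {i}. (mat 1 :: real^'n^'n) $ j $ p j))" for p :: "'n \<Rightarrow> 'n"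
  have "((\<lambda>s. \<Prod>i\<in>UNIV. (mat 1 + s *\<^sub>R E) $ i $ p i) has_real_derivative
      (\<Sum>i\<in>UNIV. E $ i $ p i * (\<Prod>j\<in>UNIV - {i}. (mat 1 + 0 *\<^sub>R E) $ j $ p j))) (at 0)" for p
    by (rule has_field_derivative_prod) (auto intro!: derivative_eq_intros)
  then have "((\<lambda>s. \<Sum>p\<in>?P. of_int (sign p) * (\<Prod>i\<in>UNIV. (mat 1 + s *\<^sub>R E) $ i $ p i))
      has_real_derivative (\<Sum>p\<in>?P. D p)) (at 0)"
    unfolding D_def by (intro DERIV_sum DERIV_cmult) simp
  \<comment> \<open>A permutation other than the identity moves at least two points. After the
    product rule has removed one factor, an off-diagonal zero of the identity matrix is still
    left.\<close>
  moreover have "D p = 0" if p: "p permutes UNIV" "p \<noteq> id" for p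
  proof -
    have "(\<Prod>j\<in>UNIV - {i}. (mat 1 :: real^'n^'n) $ j $ p j) = 0" for i
    proof -
      obtain k where k: "p k \<noteq> k" using p(2) by (auto simp: fun_eq_iff)
      have "p (p k) \<noteq> p k" using k permutes_inj[OF p(1)] by (auto dest: injD)
      then obtain j where "j \<noteq> i" "p j \<noteq> j" using k by metis
      then show ?thesis
        by (intro prod_zero) (auto simp: mat_def intro!: bexI[of _ j])
    qed
    then show ?thesis unfolding D_def by (simp only: mult_zero_right sum.neutral_const)
  qed
  then have "(\<Sum>p\<in>?P. D p) = (\<Sum>p\<in>{id}. D p)"
    by (intro sum.mono_neutral_right) (auto simp: permutes_id)
  moreover have "D id = trace E"
    by (simp add: D_def trace_def mat_def)
  ultimately show ?thesis
    by (simp add: det_def)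
qed

text \<open>Factoring out \<open>A + t *\<^sub>R K\<close> moves the base point to the
  identity.\<close>

lemma has_real_derivative_det_line:
  fixes A K :: "real^'n^'n"
  assumes inv: "invertible (A + t *\<^sub>R K)"
  shows "((\<lambda>s. det (A + s *\<^sub>R K)) has_real_derivative
    det (A + t *\<^sub>R K) * trace (matrix_inv (A + t *\<^sub>R K) ** K)) (at t)"
proof -
  let ?A = "A + t *\<^sub>R K"
  have "A + s *\<^sub>R K = ?A ** (mat 1 + (s - t) *\<^sub>R (matrix_inv ?A ** K))" for s
  proof -
    have "?A ** (mat 1 + (s - t) *\<^sub>R (matrix_inv ?A ** K)) = ?A + (s - t) *\<^sub>R ((?A ** matrix_inv ?A) ** K)"
      by (simp add: matrix_add_ldistrib matrix_mult.scaleR_right matrix_mul_assoc)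
    then show ?thesis
      by (simp add: matrix_inv_mult[OF inv] algebra_simps)
  qed
  then have eq: "det (A + s *\<^sub>R K) = det ?A * det (mat 1 + (s - t) *\<^sub>R (matrix_inv ?A ** K))" for s
    by (metis det_mul)
  have "((\<lambda>s. det (mat 1 + (s - t) *\<^sub>R (matrix_inv ?A ** K))) has_real_derivative
      trace (matrix_inv ?A ** K) * 1) (at t)"
    by (rule DERIV_chain2[where f="\<lambda>s. det (mat 1 + s *\<^sub>R (matrix_inv ?A ** K))" and g="\<lambda>s. s - t"])
      (auto intro!: derivative_eq_intros has_real_derivative_det_at_mat_1)
  then have "((\<lambda>s. det ?A * det (mat 1 + (s - t) *\<^sub>R (matrix_inv ?A ** K))) has_real_derivative
      det ?A * trace (matrix_inv ?A ** K)) (at t)"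
    by (auto intro!: derivative_eq_intros)
  moreover have "(\<lambda>s. det (A + s *\<^sub>R K)) =
      (\<lambda>s. det ?A * det (mat 1 + (s - t) *\<^sub>R (matrix_inv ?A ** K)))"
    by (rule ext) (rule eq)
  ultimately show ?thesis
    by (simp only:)
qed

text \<open>With \<open>M s = (A + s K)\<^sup>-\<^sup>1\<close>, the derivative of \<open>s \<mapsto> M s [A] + ln det (A + s K)\<close> is
  \<open>s tr (M s K M s K)\<close>; compare with \<open>s\<^sup>2 / 2\<close> by Cauchy's mean value theorem.\<close>

lemma gaussian_divergence_mean_value:
  fixes A B :: "real^'n^'n"
  assumes A: "pos_def A" and B: "pos_def B"
  obtains t where "0 \<le> t" "t \<le> 1"
    "(matrix_inv B - matrix_inv A) \<bullet> A + ln (det B / det A) =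
      1/2 * trace (matrix_inv (A + t *\<^sub>R (B - A)) ** (B - A) ** matrix_inv (A + t *\<^sub>R (B - A)) ** (B - A))"
proof -
  define K where "K = B - A"
  define M where "M s = matrix_inv (A + s *\<^sub>R K)" for s
  define g where "g s = M s \<bullet> A + ln (det (A + s *\<^sub>R K))" for s
  have path: "A + s *\<^sub>R K = (1 - s) *\<^sub>R A + s *\<^sub>R B" for s
    by (simp add: K_def algebra_simps)
  have pd: "pos_def (A + s *\<^sub>R K)" if "0 \<le> s" "s \<le> 1" for s
    unfolding path using pos_def_convex_comb[OF A B that] .
  have sym: "transpose A = A" "transpose K = K"
    using A B unfolding pos_def_def K_def by (auto simp: transpose_def vec_eq_iff)
  have inner_tr: "C \<bullet> A = trace (C ** A)" for C
    by (metis mat_bracket_def mat_bracket_eq_inner sym(1))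
  \<comment> \<open>Continuity at the end points 0 and 1 is needed from both sides, so the
    derivative is computed on an open set around [0, 1].\<close>
  define U where "U = {s. 0 < det (A + s *\<^sub>R K)}"
  have openU: "open U"
    unfolding U_def by (intro open_Collect_less continuous_intros)
  have cM: "continuous_on U M"
    unfolding M_def by (intro continuous_intros) (auto simp: U_def invertible_det_nz)
  have U: "s \<in> U" if "0 \<le> s" "s \<le> 1" for s
    unfolding U_def using pos_def_det_pos[OF pd[OF that]] by simp
  have dg: "(g has_real_derivative s * trace (M s ** K ** M s ** K)) (at s)"
    if "s \<in> U" for s
  proof -
    have invs: "invertible (A + r *\<^sub>R K)" if "r \<in> U" for r
      using that by (auto simp: U_def invertible_det_nz)
    have "((\<lambda>r. M r \<bullet> A) has_real_derivative - ((M s ** K ** M s) \<bullet> A)) (at s)"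
    proof -
      have lim: "((\<lambda>r. - ((M r ** K ** M s) \<bullet> A)) \<longlongrightarrow> - ((M s ** K ** M s) \<bullet> A)) (at s)"
      proof -
        have "continuous_on U (\<lambda>r. - ((M r ** K ** M s) \<bullet> A))"
          by (intro continuous_intros cM)
        then show ?thesis
          using that openU by (simp add: continuous_on_eq_continuous_at isCont_def)
      qed
      have "eventually (\<lambda>r. r \<in> U) (at s)"
        using that openU eventually_at_topological by blast
      then have "eventually (\<lambda>r. - ((M r ** K ** M s) \<bullet> A) = (M r \<bullet> A - M s \<bullet> A) / (r - s)) (at s)"
        using eventually_neq_at_within[of s s UNIV]
      proof eventually_elim
        case (elim r)
        have "M r - M s = - (M r ** ((r - s) *\<^sub>R K) ** M s)"
          unfolding M_def using matrix_inv_diff[OF invs[OF elim(1)] invs[OF that]]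
          by (simp add: algebra_simps)
        also have "\<dots> = - ((r - s) *\<^sub>R (M r ** K ** M s))"
          by (simp add: matrix_mult.scaleR_right matrix_mult.scaleR_left)
        finally have "M r \<bullet> A - M s \<bullet> A = - ((r - s) *\<^sub>R (M r ** K ** M s)) \<bullet> A"
          by (metis inner_diff_left)
        then show ?case using elim(2) by simp
      qed
      then show ?thesis
        unfolding has_field_derivative_iff by (rule Lim_transform_eventually[OF lim])
    qed
    moreover have "((\<lambda>r. ln (det (A + r *\<^sub>R K))) has_real_derivative trace (M s ** K)) (at s)"
      using that has_real_derivative_det_line[OF invs[OF that]] unfolding U_def M_def
      by (auto intro!: derivative_eq_intros)
    ultimately have "(g has_real_derivative - ((M s ** K ** M s) \<bullet> A) + trace (M s ** K)) (at s)"
      unfolding g_def by (rule DERIV_add)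
    moreover have "- ((M s ** K ** M s) \<bullet> A) + trace (M s ** K) = s * trace (M s ** K ** M s ** K)"
    proof -
      \<comment> \<open>Inserting \<open>M s ** (A + s *\<^sub>R K)\<close>, which is the identity,
        splits the trace so that one part cancels against the derivative of the first summand of
        \<open>g\<close>.\<close>
      have "M s ** K = M s ** K ** (M s ** (A + s *\<^sub>R K))"
        using matrix_inv_mult(2)[OF invs[OF that]] by (simp add: M_def)
      also have "\<dots> = M s ** K ** M s ** A + s *\<^sub>R (M s ** K ** M s ** K)"
        by (simp add: matrix_add_ldistrib matrix_mul_assoc matrix_mult.scaleR_right)
      finally have "trace (M s ** K) = trace (M s ** K ** M s ** A) + s * trace (M s ** K ** M s ** K)"
        by (metis trace_add trace_scaleR)
      then show ?thesis by (simp add: inner_tr)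
    qed
    ultimately show ?thesis by simp
  qed
  have "\<exists>t>0. t < 1 \<and> (g 1 - g 0) * t = (1\<^sup>2/2 - 0\<^sup>2/2) * (t * trace (M t ** K ** M t ** K))"
  proof (rule GMVT'[where f=g and g="\<lambda>s. s\<^sup>2/2" and f'="\<lambda>t. t * trace (M t ** K ** M t ** K)" and g'="\<lambda>t. t"])
    show "isCont g z" if "0 \<le> z" "z \<le> 1" for z
      using dg[OF U[OF that]] DERIV_isCont by blast
    show "(g has_real_derivative z * trace (M z ** K ** M z ** K)) (at z)" if "0 < z" "z < 1" for z
      using dg[OF U] that by simp
    show "((\<lambda>s. s\<^sup>2/2) has_real_derivative z) (at z)" for z :: real
      by (auto intro!: derivative_eq_intros)
  qed simp_all
  then obtain t where t: "0 < t" "t < 1"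
    "(g 1 - g 0) * t = (1\<^sup>2/2 - 0\<^sup>2/2) * (t * trace (M t ** K ** M t ** K))" by blast
  then have "t * (g 1 - g 0) = t * (1/2 * trace (M t ** K ** M t ** K))"
    by (simp add: field_simps)
  then have "g 1 - g 0 = 1/2 * trace (M t ** K ** M t ** K)"
    using t(1) by simp
  moreover have "g 1 - g 0 = (matrix_inv B - matrix_inv A) \<bullet> A + ln (det B / det A)"
    using pos_def_det_pos[OF A] pos_def_det_pos[OF B]
    by (simp add: g_def M_def K_def ln_div inner_diff_left)
  ultimately show ?thesis
    using t(1,2) by (intro that[of t]) (auto simp: M_def K_def)
qed

lemma isCont_matrix_inv:
  fixes A :: "real^'n^'n"
  assumes "invertible A"
  shows "isCont matrix_inv A"
proof -
  let ?U = "{B :: real^'n^'n. det B \<noteq> 0}"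
  have "open ?U"
    by (intro open_Collect_neq continuous_intros)
  moreover have "continuous_on ?U matrix_inv"
    by (intro continuous_intros) (auto simp: invertible_det_nz)
  moreover have "A \<in> ?U"
    using assms by (simp add: invertible_det_nz)
  ultimately show ?thesis
    by (simp add: continuous_on_eq_continuous_at)
qed

text \<open>By the resolvent identity the linearization error is the difference of the two inverses
  times \<open>B - A\<close> times the inverse of \<open>A\<close>, up to sign. Divided by |B - A|
  it is dominated by |B^-1 - A^-1| |A^-1|, so continuity of the inverse already gives the
  derivative.\<close>

lemma has_derivative_matrix_inv:
  fixes A :: "real^'n^'n"
  assumes A: "invertible A"
  shows "(matrix_inv has_derivative (\<lambda>H. - (matrix_inv A ** H ** matrix_inv A))) (at A)"
  unfolding has_derivative_at_within
proof
  show "bounded_linear (\<lambda>H. - (matrix_inv A ** H ** matrix_inv A))"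
    by (intro bounded_linear_minus bounded_linear_compose[OF matrix_mult.bounded_linear_left]
        matrix_mult.bounded_linear_right)
  let ?M = "matrix_inv A"
  let ?r = "\<lambda>B. (matrix_inv B - ?M - - (?M ** (B - A) ** ?M)) /\<^sub>R norm (B - A)"
  have "((\<lambda>B. norm (matrix_inv B - ?M) * norm ?M) \<longlongrightarrow> norm (?M - ?M) * norm ?M) (at A)"
    using isCont_matrix_inv[OF A] unfolding isCont_def by (intro tendsto_intros)
  then have lim: "((\<lambda>B. norm (matrix_inv B - ?M) * norm ?M) \<longlongrightarrow> 0) (at A)" by simp
  have "eventually (\<lambda>B. B \<in> {B. det B \<noteq> 0}) (at A)"
    using A by (intro eventually_at_in_open' open_Collect_neq continuous_intros)
      (auto simp: invertible_det_nz)
  then have "eventually (\<lambda>B. norm (?r B) \<le> norm (matrix_inv B - ?M) * norm ?M) (at A)"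
  proof eventually_elim
    case (elim B)
    then have B: "invertible B" by (simp add: invertible_det_nz)
    have "- (N ** X ** ?M) - - (?M ** X ** ?M) = - ((N - ?M) ** X ** ?M)" for N X
      by (simp add: matrix_mult.diff_left)
    then have "matrix_inv B - ?M - - (?M ** (B - A) ** ?M) = - ((matrix_inv B - ?M) ** (B - A) ** ?M)"
      by (metis matrix_inv_diff[OF B A])
    then have "norm (matrix_inv B - ?M - - (?M ** (B - A) ** ?M))
        \<le> norm (matrix_inv B - ?M) * norm (B - A) * norm ?M"
      by (simp only: norm_minus_cancel) (meson norm_matrix_mult_le mult_right_mono norm_ge_zero order_trans)
    then show ?case
      by (cases "B = A") (simp_all add: divide_simps mult.commute mult.left_commute)
  qed
  then show "(?r \<longlongrightarrow> 0) (at A)"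
    by (rule Lim_null_comparison[OF _ lim])
qed

text \<open>By cyclicity of the trace the difference is tr((P - Q)(P + Q)). It serves to replace the
  inverse at an unknown intermediate covariance by the one at \<open>\<theta>0\<close>, and the
  difference of covariances by the differential.\<close>

lemma trace_square_diff_le:
  fixes P Q :: "real^'n^'n"
  shows "\<bar>trace (P ** P) - trace (Q ** Q)\<bar> \<le> norm (P - Q) * (norm (P - Q) + 2 * norm Q)"
proof -
  have "trace (P ** P) - trace (Q ** Q) = trace ((P - Q) ** (P + Q))"
    using trace_mul_sym[of P Q]
    by (simp add: matrix_mult.diff_left matrix_mult.add_right trace_sub trace_add)
  also have "\<bar>\<dots>\<bar> \<le> norm (P - Q) * norm (P + Q)"
    by (rule abs_trace_mult_le)
  also have "norm (P + Q) \<le> norm (P - Q) + 2 * norm Q"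
  proof -
    have "P + Q = (P - Q) + (Q + Q)" by (simp add: algebra_simps)
    then have "norm (P + Q) \<le> norm (P - Q) + norm (Q + Q)"
      by (metis norm_triangle_ineq)
    then show ?thesis using norm_triangle_ineq[of Q Q] by linarith
  qed
  finally show ?thesis
    by (simp add: mult_left_mono)
qed

text \<open>By the mean value formula -2Y is half the trace of the square of \<open>Mt ** K\<close>
  with \<open>K = \<Sigma> \<theta> - A\<close>. Being quadratic in \<open>K\<close>, it needs only
  K = D u + o(|u|) and \<open>Mt\<close> near \<open>M\<close>, that is, one derivative of
  \<open>\<Sigma>\<close> at \<open>\<theta>0\<close>.\<close>

lemma gaussian_divergence_expansion:
  fixes \<Sigma> :: "real^'q \<Rightarrow> real^'p^'p"
  assumes pd: "\<And>\<theta>. \<theta> \<in> \<Theta> \<Longrightarrow> pos_def (\<Sigma> \<theta>)" and \<theta>0: "\<theta>0 \<in> \<Theta>"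
    and D: "(\<Sigma> has_derivative D) (at \<theta>0)" and e: "0 < e"
  defines "M \<equiv> matrix_inv (\<Sigma> \<theta>0)"
  shows "\<exists>d>0. \<forall>\<theta>\<in>\<Theta>. norm (\<theta> - \<theta>0) < d \<longrightarrow>
    norm (matrix_inv (\<Sigma> \<theta>) - M + M ** D (\<theta> - \<theta>0) ** M) \<le> e * norm (\<theta> - \<theta>0) \<and>
    \<bar>- 2 * Y_fun \<Sigma> \<theta>0 \<theta> - 1/2 * trace (M ** D (\<theta> - \<theta>0) ** M ** D (\<theta> - \<theta>0))\<bar>
      \<le> e * (norm (\<theta> - \<theta>0))\<^sup>2"
proof -
  define A where "A = \<Sigma> \<theta>0"
  have A: "pos_def A" unfolding A_def by (rule pd[OF \<theta>0])
  have M: "M = matrix_inv A" by (simp add: M_def A_def)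
  have bl: "bounded_linear D" using D by (rule has_derivative_bounded_linear)
  obtain b where b: "0 < b" "\<And>u. norm (D u) \<le> b * norm u"
    using bounded_linear.pos_bounded[OF bl] by (auto simp: mult.commute)
  have "((\<lambda>\<theta>. matrix_inv (\<Sigma> \<theta>)) has_derivative (\<lambda>u. - (M ** D u ** M))) (at \<theta>0)"
    using has_derivative_compose[OF D, of matrix_inv] has_derivative_matrix_inv[OF pos_def_invertible[OF A]]
    by (simp add: M A_def)
  then obtain d1 where d1: "0 < d1" "\<And>\<theta>. norm (\<theta> - \<theta>0) < d1 \<Longrightarrow>
      norm (matrix_inv (\<Sigma> \<theta>) - M + M ** D (\<theta> - \<theta>0) ** M) \<le> e * norm (\<theta> - \<theta>0)"
    using e unfolding has_derivative_at_alt M_def by auto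
  \<comment> \<open>The constant produced by \<open>trace_square_diff_le\<close> for
    \<open>Mt ** K\<close> and \<open>M ** D u\<close>: the first factor comes from their distance,
    the second adds twice the size of \<open>M ** D u\<close>.\<close>
  define C where "C = (b + 1 + norm M) * (b + 1 + norm M + 2 * (norm M * b))"
  have C: "0 < C"
    unfolding C_def using b(1) by (intro mult_pos_pos add_pos_nonneg) auto
  \<comment> \<open>The cap 1 keeps |K| below (b + 1)|u|; the cap e / C makes the trace error at
    most e|u|^2.\<close>
  define \<eta> where "\<eta> = min 1 (e / C)"
  have \<eta>: "0 < \<eta>" "\<eta> \<le> 1" "\<eta> * C \<le> e"
    using C e by (auto simp: \<eta>_def min_def field_simps)
  obtain r where r: "0 < r" "\<And>B. norm (B - A) < r \<Longrightarrow> norm (matrix_inv B - M) < \<eta>"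
    using isCont_matrix_inv[OF pos_def_invertible[OF A]] \<eta>(1) unfolding M
    by (metis (no_types, lifting) LIM_eq isCont_def diff_self norm_zero)
  obtain d2 where d2: "0 < d2" "\<And>\<theta>. norm (\<theta> - \<theta>0) < d2 \<Longrightarrow>
      norm (\<Sigma> \<theta> - A - D (\<theta> - \<theta>0)) \<le> \<eta> * norm (\<theta> - \<theta>0)"
    using D \<eta>(1) unfolding has_derivative_at_alt A_def by blast
  \<comment> \<open>The three radii serve the differential of the inverse, the differential of
    \<open>\<Sigma>\<close>, and |t K| < r, which keeps \<open>Mt\<close> within \<eta> of
    \<open>M\<close>.\<close>
  define d where "d = min d1 (min d2 (r / (b + 1)))"
  have d: "0 < d" using d1 d2 r b by (simp add: d_def)
  moreover have "\<bar>- 2 * Y_fun \<Sigma> \<theta>0 \<theta> - 1/2 * trace (M ** D (\<theta> - \<theta>0) ** M ** D (\<theta> - \<theta>0))\<bar>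
      \<le> e * (norm (\<theta> - \<theta>0))\<^sup>2" if \<theta>: "\<theta> \<in> \<Theta>" "norm (\<theta> - \<theta>0) < d" for \<theta>
  proof -
    define u where "u = \<theta> - \<theta>0"
    define K where "K = \<Sigma> \<theta> - A"
    obtain t where t: "0 \<le> t" "t \<le> 1"
      "(matrix_inv (\<Sigma> \<theta>) - M) \<bullet> A + ln (det (\<Sigma> \<theta>) / det A) =
       1/2 * trace (matrix_inv (A + t *\<^sub>R K) ** K ** matrix_inv (A + t *\<^sub>R K) ** K)"
      using gaussian_divergence_mean_value[OF A pd[OF \<theta>(1)]] unfolding M K_def by blast
    define Mt where "Mt = matrix_inv (A + t *\<^sub>R K)"
    have Y: "- 2 * Y_fun \<Sigma> \<theta>0 \<theta> = 1/2 * trace ((Mt ** K) ** (Mt ** K))"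
      using t(3) by (simp add: Y_fun_def mat_bracket_eq_inner A_def[symmetric] M[symmetric] Mt_def matrix_mul_assoc)
    have ud: "norm u < d2" "norm u < r / (b + 1)" using \<theta>(2) by (auto simp: u_def d_def)
    have K1: "norm (K - D u) \<le> \<eta> * norm u"
      using d2(2) ud(1) by (simp add: K_def u_def)
    have K2: "norm K \<le> (b + 1) * norm u"
    proof -
      have "norm K \<le> norm (K - D u) + norm (D u)"
        by (metis diff_add_cancel norm_triangle_ineq)
      also have "\<dots> \<le> 1 * norm u + b * norm u"
        using K1 b(2)[of u] \<eta>(2) by (meson add_mono mult_right_mono norm_ge_zero order_trans)
      finally show ?thesis by (simp add: algebra_simps)
    qed
    have "norm (t *\<^sub>R K) \<le> 1 * ((b + 1) * norm u)"
      using t K2 by (simp only: norm_scaleR) (intro mult_mono, auto)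
    also have "\<dots> < r"
      using ud(2) b(1) by (simp add: field_simps)
    finally have Mt: "norm (Mt - M) \<le> \<eta>"
      using r(2)[of "A + t *\<^sub>R K"] by (simp add: Mt_def)
    have PQ: "norm (Mt ** K - M ** D u) \<le> \<eta> * (b + 1 + norm M) * norm u"
    proof -
      have "Mt ** K - M ** D u = (Mt - M) ** K + M ** (K - D u)"
        by (simp add: matrix_mult.diff_left matrix_mult.diff_right)
      also have "norm \<dots> \<le> norm (Mt - M) * norm K + norm M * norm (K - D u)"
        by (meson add_mono norm_matrix_mult_le norm_triangle_le)
      also have "\<dots> \<le> \<eta> * ((b + 1) * norm u) + norm M * (\<eta> * norm u)"
        using Mt K1 K2 \<eta>(1) by (intro add_mono mult_mono) auto
      finally show ?thesis by (simp add: algebra_simps)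
    qed
    have Q: "norm (M ** D u) \<le> norm M * (b * norm u)"
      by (meson b(2) norm_matrix_mult_le mult_left_mono norm_ge_zero order_trans)
    have PQ1: "norm (Mt ** K - M ** D u) \<le> (b + 1 + norm M) * norm u"
    proof -
      have "\<eta> * ((b + 1 + norm M) * norm u) \<le> 1 * ((b + 1 + norm M) * norm u)"
        using \<eta> b(1) by (intro mult_right_mono) auto
      then show ?thesis using PQ by (simp add: mult.assoc)
    qed
    have "\<bar>trace ((Mt ** K) ** (Mt ** K)) - trace ((M ** D u) ** (M ** D u))\<bar>
        \<le> norm (Mt ** K - M ** D u) * (norm (Mt ** K - M ** D u) + 2 * norm (M ** D u))"
      by (rule trace_square_diff_le)
    also have "\<dots> \<le> (\<eta> * (b + 1 + norm M) * norm u) *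
        ((b + 1 + norm M) * norm u + 2 * (norm M * (b * norm u)))"
      using PQ PQ1 Q \<eta>(1) b(1) by (intro mult_mono add_mono) auto
    also have "\<dots> = \<eta> * C * (norm u)\<^sup>2"
      by (simp add: C_def power2_eq_square algebra_simps)
    also have "\<dots> \<le> e * (norm u)\<^sup>2"
      using \<eta>(3) by (rule mult_right_mono) simp
    finally have "\<bar>trace ((Mt ** K) ** (Mt ** K)) - trace ((M ** D u) ** (M ** D u))\<bar> \<le> e * (norm u)\<^sup>2" .
    then show ?thesis
      unfolding Y u_def[symmetric] by (simp add: matrix_mul_assoc abs_if split: if_splits)
  qed
  ultimately show ?thesis
    using d1 by (intro exI[of _ d]) (auto simp: d_def)
qed

section \<open>Minimum contrast estimators\<close>

text \<open>Deterministic core of the estimator's expansion, for a minimizer of v(\<theta>) +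
  K(\<theta>)[H]. Near \<open>\<theta>0\<close> the objective is u.Ju / 2 - w(H).u up to o(|H|^2),
  with minimizer z = J^-1 w(H). Comparing the values at the true minimizer and at z, strong
  convexity gives |u - z| = o(|H|), and K[H] is then -w(H).z up to o(|H|^2). Consistency is not a
  separate step: the global lower bound on \<open>v\<close> confines every minimizer to distance
  O(|H|).\<close>

lemma m_estimator_expansion:
  fixes K :: "real^'q \<Rightarrow> 'e::euclidean_space" and v :: "real^'q \<Rightarrow> real"
    and J :: "real^'q^'q" and L :: "real^'q \<Rightarrow> 'e"
  assumes int: "\<theta>0 \<in> interior \<Theta>" and c: "0 < c"
    and vc: "\<And>\<theta>. \<theta> \<in> \<Theta> \<Longrightarrow> c * (norm (\<theta> - \<theta>0))\<^sup>2 \<le> v \<theta>"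
    and Kbd: "\<And>\<theta>. \<theta> \<in> \<Theta> \<Longrightarrow> norm (K \<theta>) \<le> k"
    and L: "linear L" and J: "transpose J = J"
    and expand: "\<And>e. 0 < e \<Longrightarrow> \<exists>d>0. \<forall>\<theta>\<in>\<Theta>. norm (\<theta> - \<theta>0) < d \<longrightarrow>
      norm (K \<theta> + L (\<theta> - \<theta>0)) \<le> e * norm (\<theta> - \<theta>0) \<and>
      \<bar>v \<theta> - 1/2 * ((\<theta> - \<theta>0) \<bullet> (J *v (\<theta> - \<theta>0)))\<bar> \<le> e * (norm (\<theta> - \<theta>0))\<^sup>2"
  defines "w \<equiv> \<lambda>H. \<chi> i. L (axis i 1) \<bullet> H"
    and "minimal \<equiv> \<lambda>\<theta> H. \<theta> \<in> \<Theta> \<and> (\<forall>\<theta>'\<in>\<Theta>. v \<theta> + K \<theta> \<bullet> H \<le> v \<theta>' + K \<theta>' \<bullet> H)"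
  shows "invertible J"
    and "\<exists>C. \<forall>\<theta> H. minimal \<theta> H \<longrightarrow> norm (K \<theta>) \<le> C * norm H"
    and "\<And>e. 0 < e \<Longrightarrow> \<exists>d>0. \<forall>\<theta> H. minimal \<theta> H \<longrightarrow> norm H < d \<longrightarrow>
      \<bar>K \<theta> \<bullet> H + w H \<bullet> (matrix_inv J *v w H)\<bar> \<le> e * (norm H)\<^sup>2"
proof -
  have \<theta>0: "\<theta>0 \<in> \<Theta>" using int interior_subset by blast
  have L0: "L 0 = 0" using L by (rule linear_0)
  obtain d0 where d0: "0 < d0" "\<And>u. norm u < d0 \<Longrightarrow> \<theta>0 + u \<in> \<Theta>"
  proof -
    obtain r where r: "0 < r" "ball \<theta>0 r \<subseteq> \<Theta>" using int mem_interior by blast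
    show ?thesis
      by (rule that[OF r(1)]) (use r(2) in \<open>auto simp: subset_iff dist_norm\<close>)
  qed
  \<comment> \<open>At \<open>\<theta>0\<close> itself both error bounds of the expansion are 0,
    which forces these values.\<close>
  have zero: "v \<theta>0 = 0" "K \<theta>0 = 0"
    using expand[of 1] \<theta>0 by (auto simp: L0)
  obtain l where l: "0 < l" "\<And>u. norm (L u) \<le> l * norm u"
    using linear_bounded_pos[OF L] by blast
  \<comment> \<open>The components of \<open>w\<close> are chosen so that \<open>w\<close> is the
    adjoint of \<open>L\<close>.\<close>
  have wL: "w H \<bullet> u = L u \<bullet> H" for H u
  proof -
    have "L u = L (\<Sum>i\<in>UNIV. u $ i *\<^sub>R axis i 1)"
      by (metis basis_expansion scalar_mult_eq_scaleR)
    also have "\<dots> = (\<Sum>i\<in>UNIV. u $ i *\<^sub>R L (axis i 1))"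
      by (simp add: linear_sum[OF L] linear_scale[OF L])
    finally show ?thesis
      by (simp add: w_def inner_vec_def inner_sum_left mult.commute)
  qed
  have w_le: "norm (w H) \<le> l * norm H" for H
  proof -
    have "(norm (w H))\<^sup>2 = L (w H) \<bullet> H" by (simp add: power2_norm_eq_inner wL)
    also have "\<dots> \<le> (l * norm (w H)) * norm H"
      using l(2)[of "w H"] by (meson mult_right_mono norm_cauchy_schwarz norm_ge_zero order_trans)
    finally have "norm (w H) * norm (w H) \<le> norm (w H) * (l * norm H)"
      by (simp add: power2_eq_square algebra_simps)
    then show ?thesis
      by (cases "norm (w H) = 0") (use l in \<open>auto simp: mult_le_cancel_left\<close>)
  qed
  \<comment> \<open>The vector is shrunk into the ball where the expansion holds with error c/2.
    There c|x|^2 <= v <= x.Jx / 2 + c|x|^2 / 2, and both sides scale quadratically.\<close>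
  have Jpos: "c * (norm u)\<^sup>2 \<le> u \<bullet> (J *v u)" for u
  proof (cases "u = 0")
    case False
    obtain d where d: "0 < d" "\<And>\<theta>. \<theta> \<in> \<Theta> \<Longrightarrow> norm (\<theta> - \<theta>0) < d \<Longrightarrow>
        \<bar>v \<theta> - 1/2 * ((\<theta> - \<theta>0) \<bullet> (J *v (\<theta> - \<theta>0)))\<bar> \<le> c/2 * (norm (\<theta> - \<theta>0))\<^sup>2"
      using expand[of "c/2"] c by auto
    define s where "s = min d d0 / (2 * norm u)"
    have s: "0 < s" using d d0 False by (simp add: s_def)
    have "norm (s *\<^sub>R u) = min d d0 / 2"
      using False d d0 by (simp add: s_def)
    then have su: "norm (s *\<^sub>R u) < min d d0"
      using d d0 by linarith
    then have "\<bar>v (\<theta>0 + s *\<^sub>R u) - 1/2 * ((s *\<^sub>R u) \<bullet> (J *v (s *\<^sub>R u)))\<bar> \<le> c/2 * (norm (s *\<^sub>R u))\<^sup>2"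
      using d(2)[OF d0(2)[of "s *\<^sub>R u"]] by (simp del: norm_scaleR)
    moreover have "c * (norm (s *\<^sub>R u))\<^sup>2 \<le> v (\<theta>0 + s *\<^sub>R u)"
      using vc[OF d0(2)[of "s *\<^sub>R u"]] su by (simp del: norm_scaleR)
    ultimately have "c * (norm (s *\<^sub>R u))\<^sup>2 \<le> (s *\<^sub>R u) \<bullet> (J *v (s *\<^sub>R u))"
      by linarith
    then have "s\<^sup>2 * (c * (norm u)\<^sup>2) \<le> s\<^sup>2 * (u \<bullet> (J *v u))"
      by (simp add: matrix_vector_mult_scaleR power2_eq_square mult_ac)
    then show ?thesis using s by simp
  qed simp
  show inv: "invertible J"
  proof -
    have "J *v u = 0 \<Longrightarrow> u = 0" for u
      using Jpos[of u] c by (simp add: mult_le_0_iff)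
    then show ?thesis
      by (simp add: invertible_left_inverse matrix_left_invertible_ker)
  qed
  have Jsym: "x \<bullet> (J *v y) = y \<bullet> (J *v x)" for x y
    by (metis J dot_lmul_matrix inner_commute transpose_matrix_vector)
  have JJ: "J *v (matrix_inv J *v x) = x" for x
    by (simp add: matrix_vector_mul_assoc matrix_inv_mult[OF inv])
  have Jinv_le: "c * norm (matrix_inv J *v x) \<le> norm x" for x
  proof -
    let ?y = "matrix_inv J *v x"
    have "c * (norm ?y)\<^sup>2 \<le> ?y \<bullet> x" using Jpos[of ?y] JJ[of x] by simp
    also have "\<dots> \<le> norm ?y * norm x" by (rule norm_cauchy_schwarz)
    finally have "norm ?y * (c * norm ?y) \<le> norm ?y * norm x"
      by (simp add: power2_eq_square algebra_simps)
    then show ?thesis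
      by (cases "norm ?y = 0") (auto simp: mult_le_cancel_left)
  qed
  \<comment> \<open>Close to \<open>\<theta>0\<close> the expansion gives the slope 1 + l. Farther
    away the distance is at least \<open>d\<close>, and the uniform bound \<open>k\<close> is at
    most k / d times the distance.\<close>
  obtain C0 where C0: "0 < C0" "\<And>\<theta>. \<theta> \<in> \<Theta> \<Longrightarrow> norm (K \<theta>) \<le> C0 * norm (\<theta> - \<theta>0)"
  proof -
    obtain d where d: "0 < d" "\<And>\<theta>. \<theta> \<in> \<Theta> \<Longrightarrow> norm (\<theta> - \<theta>0) < d \<Longrightarrow>
        norm (K \<theta> + L (\<theta> - \<theta>0)) \<le> 1 * norm (\<theta> - \<theta>0)"
      using expand[of 1] by auto
    have k: "0 \<le> k" using Kbd[OF \<theta>0] zero by simp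
    show ?thesis
    proof (rule that[of "1 + l + k / d"])
      show "0 < 1 + l + k / d" using l k d by (auto intro!: add_pos_nonneg)
      fix \<theta> assume \<theta>: "\<theta> \<in> \<Theta>"
      let ?u = "\<theta> - \<theta>0"
      show "norm (K \<theta>) \<le> (1 + l + k / d) * norm ?u"
      proof (cases "norm ?u < d")
        case True
        have "norm (K \<theta>) \<le> norm (K \<theta> + L ?u) + norm (L ?u)"
          by (metis add_diff_cancel_right' norm_triangle_ineq4)
        also have "\<dots> \<le> 1 * norm ?u + l * norm ?u"
          using d(2)[OF \<theta> True] l(2)[of ?u] by linarith
        also have "\<dots> \<le> (1 + l + k / d) * norm ?u"
          using k d by (simp add: algebra_simps)
        finally show ?thesis .
      next
        case False
        have "norm (K \<theta>) \<le> k" by (rule Kbd[OF \<theta>])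
        also have "k \<le> k / d * norm ?u"
          using mult_left_mono[of d "norm ?u" "k / d"] False k d(1) by simp
        also have "\<dots> \<le> (1 + l + k / d) * norm ?u"
          using l by (intro mult_right_mono) auto
        finally show ?thesis .
      qed
    qed
  qed
  \<comment> \<open>A minimizer does at least as well as \<open>\<theta>0\<close>, where the
    objective is 0, so c|u|^2 <= v <= |K| |H| <= C0 |u| |H|.\<close>
  have rate: "norm (\<theta> - \<theta>0) \<le> C0 / c * norm H" if "minimal \<theta> H" for \<theta> H
  proof -
    have \<theta>: "\<theta> \<in> \<Theta>" using that by (simp add: minimal_def)
    have "c * (norm (\<theta> - \<theta>0))\<^sup>2 \<le> v \<theta>" by (rule vc[OF \<theta>])
    also have "\<dots> \<le> - (K \<theta> \<bullet> H)"
      using that \<theta>0 zero unfolding minimal_def by fastforce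
    also have "\<dots> \<le> norm (K \<theta>) * norm H"
      using Cauchy_Schwarz_ineq2[of "K \<theta>" H] by linarith
    also have "\<dots> \<le> (C0 * norm (\<theta> - \<theta>0)) * norm H"
      using C0(2)[OF \<theta>] by (rule mult_right_mono) simp
    finally have "norm (\<theta> - \<theta>0) * (c * norm (\<theta> - \<theta>0)) \<le> norm (\<theta> - \<theta>0) * (C0 * norm H)"
      by (simp add: power2_eq_square algebra_simps)
    then have "c * norm (\<theta> - \<theta>0) \<le> C0 * norm H"
      by (cases "norm (\<theta> - \<theta>0) = 0") (use C0(1) in \<open>auto simp: mult_le_cancel_left\<close>)
    then show ?thesis using c by (simp add: field_simps)
  qed
  show "\<exists>C. \<forall>\<theta> H. minimal \<theta> H \<longrightarrow> norm (K \<theta>) \<le> C * norm H"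
  proof (intro exI[of _ "C0 * (C0 / c)"] allI impI)
    fix \<theta> H assume m: "minimal \<theta> H"
    then have "norm (K \<theta>) \<le> C0 * norm (\<theta> - \<theta>0)" by (intro C0(2)) (simp add: minimal_def)
    also have "\<dots> \<le> C0 * (C0 / c * norm H)" using rate[OF m] C0(1) by (intro mult_left_mono) auto
    finally show "norm (K \<theta>) \<le> C0 * (C0 / c) * norm H" by (simp add: mult.assoc)
  qed
  fix e :: real assume e: "0 < e"
  define m where "m = max (C0 / c) (l / c)"
  have m: "0 < m" using C0 l c by (simp add: m_def less_max_iff_disj)
  \<comment> \<open>\<open>q \<eta>\<close> collects the relative error of the final estimate:
    \<eta> m from replacing K by -L, and the square root from the distance between the minimizer and
    z, paired with |w(H)| <= l|H|. It tends to 0 with \<eta>.\<close>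
  define q where "q \<eta> = \<eta> * m + sqrt (4 * \<eta> * (m\<^sup>2 + m) / c) * l" for \<eta> :: real
  have "(q \<longlongrightarrow> q 0) (at_right 0)"
    unfolding q_def using c by (intro tendsto_intros) simp
  then have "eventually (\<lambda>\<eta>. q \<eta> < e) (at_right 0)"
    by (rule order_tendstoD(2)) (use e in \<open>simp add: q_def\<close>)
  then have "eventually (\<lambda>\<eta>. q \<eta> < e \<and> 0 < \<eta>) (at_right 0)"
    using eventually_at_right_less[of "0::real"] by eventually_elim simp
  then obtain \<eta> where \<eta>: "q \<eta> < e" "0 < \<eta>"
    using eventually_happens trivial_limit_at_right_real by blast
  obtain d where d: "0 < d" "\<And>\<theta>. \<theta> \<in> \<Theta> \<Longrightarrow> norm (\<theta> - \<theta>0) < d \<Longrightarrow>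
      norm (K \<theta> + L (\<theta> - \<theta>0)) \<le> \<eta> * norm (\<theta> - \<theta>0) \<and>
      \<bar>v \<theta> - 1/2 * ((\<theta> - \<theta>0) \<bullet> (J *v (\<theta> - \<theta>0)))\<bar> \<le> \<eta> * (norm (\<theta> - \<theta>0))\<^sup>2"
    using expand[OF \<eta>(2)] by auto
  define d' where "d' = min d d0 / m"
  have d': "0 < d'" using d d0 m by (simp add: d'_def)
  show "\<exists>d>0. \<forall>\<theta> H. minimal \<theta> H \<longrightarrow> norm H < d \<longrightarrow>
      \<bar>K \<theta> \<bullet> H + w H \<bullet> (matrix_inv J *v w H)\<bar> \<le> e * (norm H)\<^sup>2"
  proof (intro exI[of _ d'] conjI d' allI impI)
    fix \<theta> H assume min: "minimal \<theta> H" and H: "norm H < d'"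
    define u where "u = \<theta> - \<theta>0"
    define z where "z = matrix_inv J *v w H"
    have \<theta>: "\<theta> \<in> \<Theta>" using min by (simp add: minimal_def)
    have mH: "m * norm H < min d d0" using H m by (simp add: d'_def field_simps)
    have u_le: "norm u \<le> m * norm H"
      using rate[OF min] unfolding u_def m_def
      by (meson max.cobounded1 mult_right_mono norm_ge_zero order_trans)
    have z_le: "norm z \<le> m * norm H"
    proof -
      have "c * norm z \<le> l * norm H"
        using Jinv_le[of "w H"] w_le[of H] unfolding z_def by linarith
      then have "norm z \<le> l / c * norm H" using c by (simp add: field_simps)
      then show ?thesis unfolding m_def
        by (meson max.cobounded2 mult_right_mono norm_ge_zero order_trans)
    qed
    have f: "\<bar>v (\<theta>0 + x) + K (\<theta>0 + x) \<bullet> H - (1/2 * (x \<bullet> (J *v x)) - w H \<bullet> x)\<bar>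
        \<le> \<eta> * (m\<^sup>2 + m) * (norm H)\<^sup>2"
      and Kx: "norm (K (\<theta>0 + x) + L x) \<le> \<eta> * (m * norm H)"
      if x: "\<theta>0 + x \<in> \<Theta>" "norm x \<le> m * norm H" for x
    proof -
      have 1: "norm (K (\<theta>0 + x) + L x) \<le> \<eta> * norm x"
        "\<bar>v (\<theta>0 + x) - 1/2 * (x \<bullet> (J *v x))\<bar> \<le> \<eta> * (norm x)\<^sup>2"
        using d(2)[OF x(1)] x(2) mH by auto
      show 2: "norm (K (\<theta>0 + x) + L x) \<le> \<eta> * (m * norm H)"
        using 1(1) x(2) \<eta>(2) by (meson mult_left_mono less_imp_le order_trans)
      have "\<bar>v (\<theta>0 + x) + K (\<theta>0 + x) \<bullet> H - (1/2 * (x \<bullet> (J *v x)) - w H \<bullet> x)\<bar>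
          = \<bar>(v (\<theta>0 + x) - 1/2 * (x \<bullet> (J *v x))) + (K (\<theta>0 + x) + L x) \<bullet> H\<bar>"
        by (simp add: wL inner_add_left)
      also have "\<dots> \<le> \<eta> * (norm x)\<^sup>2 + norm (K (\<theta>0 + x) + L x) * norm H"
        using 1(2) Cauchy_Schwarz_ineq2[of "K (\<theta>0 + x) + L x" H] by linarith
      also have "\<dots> \<le> \<eta> * (m * norm H)\<^sup>2 + \<eta> * (m * norm H) * norm H"
        using 2 x(2) \<eta>(2) by (intro add_mono mult_left_mono mult_right_mono power_mono) auto
      finally show "\<bar>v (\<theta>0 + x) + K (\<theta>0 + x) \<bullet> H - (1/2 * (x \<bullet> (J *v x)) - w H \<bullet> x)\<bar>
        \<le> \<eta> * (m\<^sup>2 + m) * (norm H)\<^sup>2"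
        by (simp add: power2_eq_square algebra_simps)
    qed
    have z\<Theta>: "\<theta>0 + z \<in> \<Theta>" using d0(2)[of z] z_le mH by simp
    have u\<Theta>: "\<theta>0 + u \<in> \<Theta>" using \<theta> by (simp add: u_def)
    have Jz: "J *v z = w H" by (simp add: z_def JJ)
    \<comment> \<open>Completing the square: as J z = w(H), the J-length of u - z is twice the
      excess of the quadratic model at u over its minimum, taken at z.\<close>
    have "c * (norm (u - z))\<^sup>2 \<le> (u - z) \<bullet> (J *v (u - z))" by (rule Jpos)
    also have "\<dots> = u \<bullet> (J *v u) - 2 * (w H \<bullet> u) + w H \<bullet> z"
      using Jsym[of z u] by (simp add: matrix_vector_mult_diff_distrib inner_diff_left inner_diff_right Jz inner_commute)
    also have "\<dots> = 2 * ((1/2 * (u \<bullet> (J *v u)) - w H \<bullet> u) - (1/2 * (z \<bullet> (J *v z)) - w H \<bullet> z))"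
      by (simp add: Jz inner_commute)
    \<comment> \<open>The minimizer does not exceed the competitor z in the true objective. Passing
      to the quadratic model at both points costs one error each, doubled by the factor 2.\<close>
    also have "\<dots> \<le> 4 * (\<eta> * (m\<^sup>2 + m) * (norm H)\<^sup>2)"
    proof -
      have "v (\<theta>0 + u) + K (\<theta>0 + u) \<bullet> H \<le> v (\<theta>0 + z) + K (\<theta>0 + z) \<bullet> H"
        using min z\<Theta> by (auto simp: minimal_def u_def)
      moreover have "2 * (x - y) \<le> 4 * B" if "a \<le> b" "- (a - x) \<le> B" "b - y \<le> B" for a b x y B :: real
        using that by argo
      ultimately show ?thesis
        using abs_le_D2[OF f[OF u\<Theta> u_le]] abs_le_D1[OF f[OF z\<Theta> z_le]] by blast
    qed
    finally have "(norm (u - z))\<^sup>2 \<le> (4 * \<eta> * (m\<^sup>2 + m) / c) * (norm H)\<^sup>2"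
      using c by (simp add: field_simps)
    then have "norm (u - z) \<le> sqrt ((4 * \<eta> * (m\<^sup>2 + m) / c) * (norm H)\<^sup>2)"
      by (rule real_le_rsqrt)
    then have uz: "norm (u - z) \<le> sqrt (4 * \<eta> * (m\<^sup>2 + m) / c) * norm H"
      by (simp only: real_sqrt_mult[of _ "(norm H)\<^sup>2"] real_sqrt_abs abs_norm_cancel)
    have "\<theta>0 + u = \<theta>" by (simp add: u_def)
    then have "K \<theta> \<bullet> H + w H \<bullet> z = (K (\<theta>0 + u) + L u) \<bullet> H - w H \<bullet> (u - z)"
      by (simp add: inner_add_left inner_diff_right wL)
    then have "\<bar>K \<theta> \<bullet> H + w H \<bullet> z\<bar>
        \<le> norm (K (\<theta>0 + u) + L u) * norm H + norm (w H) * norm (u - z)"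
      using Cauchy_Schwarz_ineq2[of "K (\<theta>0 + u) + L u" H] Cauchy_Schwarz_ineq2[of "w H" "u - z"]
      by linarith
    also have "\<dots> \<le> \<eta> * (m * norm H) * norm H
        + (l * norm H) * (sqrt (4 * \<eta> * (m\<^sup>2 + m) / c) * norm H)"
      using Kx[OF u\<Theta> u_le] w_le[of H] uz l(1)
      by (intro add_mono mult_mono) (auto intro: order_trans[OF norm_ge_zero])
    also have "\<dots> = q \<eta> * (norm H)\<^sup>2"
      by (simp add: q_def power2_eq_square algebra_simps)
    also have "\<dots> \<le> e * (norm H)\<^sup>2"
      using \<eta>(1) by (intro mult_right_mono) auto
    finally show "\<bar>K \<theta> \<bullet> H + w H \<bullet> (matrix_inv J *v w H)\<bar> \<le> e * (norm H)\<^sup>2"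
      by (simp add: z_def)
  qed
qed

section \<open>From the pathwise expansion to expectations\<close>

lemma (in prob_space) expectation_square_le:
  fixes X :: "'a \<Rightarrow> real"
  assumes "X \<in> borel_measurable M" "integrable M (\<lambda>x. (X x)\<^sup>2)"
  shows "(expectation X)\<^sup>2 \<le> expectation (\<lambda>x. (X x)\<^sup>2)"
proof -
  have "integrable M X"
    using assms square_integrable_imp_integrable by blast
  then show ?thesis
    using variance_positive[of X] variance_eq[of X] assms(2) by simp
qed

text \<open>Substitute for a tail estimate. If \<open>r\<close> dominates, its square suffices;
  otherwise |g| >= d/2, and |g|^2 is at most 4/d^2 times |g|^4, which is of smaller order in
  expectation.\<close>

lemma square_tail_le:
  fixes g r :: "'e::real_normed_vector"
  assumes "0 < d" "d \<le> norm (g + r)"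
  shows "(norm (g + r))\<^sup>2 \<le> 4 * (norm r)\<^sup>2 + 8 / d\<^sup>2 * norm g ^ 4"
proof (cases "norm g \<le> norm r")
  case True
  have "norm (g + r) \<le> 2 * norm r"
    using norm_triangle_ineq[of g r] True by linarith
  then have "(norm (g + r))\<^sup>2 \<le> (2 * norm r)\<^sup>2" by (rule power_mono) simp
  moreover have "0 \<le> 8 / d\<^sup>2 * norm g ^ 4" by simp
  moreover have "(2 * norm r)\<^sup>2 = 4 * (norm r)\<^sup>2" by (simp add: power_mult_distrib)
  ultimately show ?thesis by linarith
next
  case False
  have le: "norm (g + r) \<le> 2 * norm g"
    using norm_triangle_ineq[of g r] False by linarith
  then have "d\<^sup>2 \<le> (2 * norm g)\<^sup>2" using assms by (intro power_mono) auto
  then have "d\<^sup>2 * (norm g)\<^sup>2 \<le> (4 * (norm g)\<^sup>2) * (norm g)\<^sup>2"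
    by (intro mult_right_mono) (auto simp: power_mult_distrib)
  then have "d\<^sup>2 * (norm g)\<^sup>2 \<le> 4 * norm g ^ 4"
    by (simp add: power2_eq_square power4_eq_xxxx mult.assoc)
  then have "(norm g)\<^sup>2 \<le> 4 / d\<^sup>2 * norm g ^ 4"
    using assms(1) by (simp add: field_simps)
  moreover have "(norm (g + r))\<^sup>2 \<le> 2 * (norm g)\<^sup>2 + 2 * (norm r)\<^sup>2"
  proof -
    have "(norm (g + r))\<^sup>2 \<le> (norm g + norm r)\<^sup>2" by (intro power_mono norm_triangle_ineq) simp
    also have "\<dots> \<le> 2 * (norm g)\<^sup>2 + 2 * (norm r)\<^sup>2"
      using zero_le_power2[of "norm g - norm r"] by (simp add: power2_diff power2_sum)
    finally show ?thesis .
  qed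
  moreover have "8 / d\<^sup>2 * norm g ^ 4 = 2 * (4 / d\<^sup>2 * norm g ^ 4)" by simp
  moreover have "0 \<le> (norm r)\<^sup>2" by simp
  ultimately show ?thesis by linarith
qed

text \<open>Young's inequality with a free weight. The weight \<open>e\<close> keeps the coefficient
  of |g|^2 small; the weight h^3 later balances the noise against the drift remainder.\<close>

lemma mult_le_weighted_squares:
  fixes a b \<eta> :: real
  assumes "0 < \<eta>"
  shows "2 * (a * b) \<le> \<eta> * a\<^sup>2 + b\<^sup>2 / \<eta>"
proof -
  have "0 \<le> (\<eta> * a - b)\<^sup>2 / \<eta>" using assms by simp
  also have "\<dots> = \<eta> * a\<^sup>2 + b\<^sup>2 / \<eta> - 2 * (a * b)"
    using assms by (simp add: power2_eq_square field_simps)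
  finally show ?thesis by simp
qed

text \<open>Intended reading: \<open>g\<close> is the Gaussian part, \<open>r\<close> the drift
  part, \<open>r'\<close> the mean of \<open>r\<close>, and \<open>Q\<close> the limiting quadratic
  form. The only multiple of |g|^2 carries the factor \<open>e\<close>; the possibly huge constant
  multiplies only terms whose expectation is o(1/n). When g + r is large and the expansion says
  nothing, the linear bound on \<open>K\<close> and \<open>square_tail_le\<close> take over.\<close>

lemma quadratic_remainder_le:
  fixes K g r r' :: "'e::euclidean_space" and Q :: "'e \<Rightarrow> real"
  assumes K: "norm K \<le> C * norm (g + r)" and C: "0 \<le> C" and b: "0 \<le> b" and d: "0 < d" and e: "0 < e"
    and small: "norm (g + r) < d \<Longrightarrow> \<bar>K \<bullet> (g + r) + Q (g + r)\<bar> \<le> e * (norm (g + r))\<^sup>2"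
    and Qb: "\<And>x. \<bar>Q x\<bar> \<le> b * (norm x)\<^sup>2"
    and Qd: "\<And>x y. \<bar>Q (x + y) - Q x\<bar> \<le> b * (2 * (norm x * norm y) + (norm y)\<^sup>2)"
  shows "\<bar>K \<bullet> (g + r - r') + Q g\<bar> \<le> (2 + b + C) * e * (norm g)\<^sup>2 +
    (2 * e + 4 * (C + b) + 8 * (C + b) / d\<^sup>2 + (b + C) * (1 / e + 2)) *
      ((norm r)\<^sup>2 + norm g ^ 4 + (norm r')\<^sup>2)"
proof -
  let ?h = "g + r"
  have h2: "(norm ?h)\<^sup>2 \<le> 2 * (norm g)\<^sup>2 + 2 * (norm r)\<^sup>2"
  proof -
    have "(norm ?h)\<^sup>2 \<le> (norm g + norm r)\<^sup>2" by (intro power_mono norm_triangle_ineq) simp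
    also have "\<dots> \<le> 2 * (norm g)\<^sup>2 + 2 * (norm r)\<^sup>2"
      using zero_le_power2[of "norm g - norm r"] by (simp add: power2_diff power2_sum)
    finally show ?thesis .
  qed
  have 1: "\<bar>K \<bullet> ?h + Q ?h\<bar> \<le> e * (2 * (norm g)\<^sup>2 + 2 * (norm r)\<^sup>2)
      + (C + b) * (4 * (norm r)\<^sup>2 + 8 / d\<^sup>2 * norm g ^ 4)"
  proof (cases "norm ?h < d")
    case True
    have "\<bar>K \<bullet> ?h + Q ?h\<bar> \<le> e * (2 * (norm g)\<^sup>2 + 2 * (norm r)\<^sup>2)"
      using small[OF True] mult_left_mono[OF h2, of e] e by linarith
    moreover have "0 \<le> (C + b) * (4 * (norm r)\<^sup>2 + 8 / d\<^sup>2 * norm g ^ 4)"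
      using C b by (intro mult_nonneg_nonneg add_nonneg_nonneg) auto
    ultimately show ?thesis by linarith
  next
    case False
    have "\<bar>K \<bullet> ?h\<bar> \<le> norm K * norm ?h" by (rule Cauchy_Schwarz_ineq2)
    also have "\<dots> \<le> (C * norm ?h) * norm ?h" by (rule mult_right_mono[OF K]) simp
    finally have "\<bar>K \<bullet> ?h + Q ?h\<bar> \<le> (C + b) * (norm ?h)\<^sup>2"
      using Qb[of ?h] by (simp add: power2_eq_square algebra_simps)
    also have "\<dots> \<le> (C + b) * (4 * (norm r)\<^sup>2 + 8 / d\<^sup>2 * norm g ^ 4)"
      using square_tail_le[OF d, of g r] False C b by (intro mult_left_mono) auto
    finally have "\<bar>K \<bullet> ?h + Q ?h\<bar> \<le> (C + b) * (4 * (norm r)\<^sup>2 + 8 / d\<^sup>2 * norm g ^ 4)" .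
    moreover have "0 \<le> e * (2 * (norm g)\<^sup>2 + 2 * (norm r)\<^sup>2)" using e by simp
    ultimately show ?thesis by linarith
  qed
  have 2: "\<bar>Q ?h - Q g\<bar> \<le> b * (e * (norm g)\<^sup>2 + (1/e + 1) * (norm r)\<^sup>2)"
  proof -
    have "2 * (norm g * norm r) + (norm r)\<^sup>2 \<le> e * (norm g)\<^sup>2 + (1/e + 1) * (norm r)\<^sup>2"
      using mult_le_weighted_squares[OF e, of "norm g" "norm r"] by (simp add: algebra_simps)
    then show ?thesis using Qd[of g r] mult_left_mono[OF _ b] by (meson order_trans)
  qed
  have 3: "\<bar>K \<bullet> r'\<bar> \<le> C * (e * (norm g)\<^sup>2 + (norm r)\<^sup>2 + (1/e + 1) * (norm r')\<^sup>2)"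
  proof -
    have "\<bar>K \<bullet> r'\<bar> \<le> norm K * norm r'" by (rule Cauchy_Schwarz_ineq2)
    also have "\<dots> \<le> (C * norm ?h) * norm r'" by (rule mult_right_mono[OF K]) simp
    also have "\<dots> \<le> (C * (norm g + norm r)) * norm r'"
      by (intro mult_right_mono mult_left_mono norm_triangle_ineq C) simp
    also have "\<dots> = C * (norm g * norm r' + norm r * norm r')" by (simp add: algebra_simps)
    also have "\<dots> \<le> C * (e * (norm g)\<^sup>2 + (norm r)\<^sup>2 + (1/e + 1) * (norm r')\<^sup>2)"
    proof (intro mult_left_mono C)
      have "0 \<le> norm g * norm r'" "0 \<le> norm r * norm r'" by simp_all
      moreover have "2 * (norm r * norm r') \<le> (norm r)\<^sup>2 + (norm r')\<^sup>2"
        using mult_le_weighted_squares[of 1 "norm r" "norm r'"] by simp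
      moreover have "(1/e + 1) * (norm r')\<^sup>2 = (norm r')\<^sup>2 / e + (norm r')\<^sup>2"
        by (simp add: algebra_simps)
      ultimately show "norm g * norm r' + norm r * norm r'
          \<le> e * (norm g)\<^sup>2 + (norm r)\<^sup>2 + (1/e + 1) * (norm r')\<^sup>2"
        using mult_le_weighted_squares[OF e, of "norm g" "norm r'"] by linarith
    qed
    finally show ?thesis .
  qed
  define x where "x = (norm g)\<^sup>2"
  define y where "y = (norm r)\<^sup>2"
  define z where "z = norm g ^ 4"
  define y' where "y' = (norm r')\<^sup>2"
  have nn: "0 \<le> x" "0 \<le> y" "0 \<le> z" "0 \<le> y'" by (simp_all add: x_def y_def z_def y'_def)
  have "\<bar>K \<bullet> (g + r - r') + Q g\<bar> \<le> \<bar>K \<bullet> ?h + Q ?h\<bar> + \<bar>Q ?h - Q g\<bar> + \<bar>K \<bullet> r'\<bar>"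
    by (simp add: inner_diff_right abs_if)
  also have "\<dots> \<le> (e * (2 * x + 2 * y) + (C + b) * (4 * y + 8 / d\<^sup>2 * z)) +
      b * (e * x + (1/e + 1) * y) + C * (e * x + y + (1/e + 1) * y')"
    using 1 2 3 unfolding x_def y_def z_def y'_def by linarith
  also have "\<dots> = (2 + b + C) * e * x + ((2 * e + 4 * (C + b) + b * (1/e + 1) + C) * y
      + 8 * (C + b) / d\<^sup>2 * z + C * (1/e + 1) * y')"
    by (simp add: algebra_simps)
  also have "\<dots> \<le> (2 + b + C) * e * x +
      (2 * e + 4 * (C + b) + 8 * (C + b) / d\<^sup>2 + (b + C) * (1/e + 2)) * (y + z + y')"
  proof -
    define s where "s = 8 * (C + b) / d\<^sup>2"
    have p: "0 \<le> s" "0 \<le> C / e" "0 \<le> b / e" using C b e by (auto simp: s_def)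
    have q1: "(b + C) * (1/e + 2) = b/e + C/e + 2 * b + 2 * C"
      using e by (simp add: field_simps)
    have q2: "b * (1/e + 1) = b/e + b" "C * (1/e + 1) = C/e + C"
      by (auto simp: distrib_left)
    have "(2 * e + 4 * (C + b) + b * (1/e + 1) + C) * y
        \<le> (2 * e + 4 * (C + b) + 8 * (C + b) / d\<^sup>2 + (b + C) * (1/e + 2)) * y"
      unfolding q1 q2 s_def[symmetric] using p e C b by (intro mult_right_mono[OF _ nn(2)]) argo
    moreover have "8 * (C + b) / d\<^sup>2 * z
        \<le> (2 * e + 4 * (C + b) + 8 * (C + b) / d\<^sup>2 + (b + C) * (1/e + 2)) * z"
      unfolding q1 q2 s_def[symmetric] using p e C b by (intro mult_right_mono[OF _ nn(3)]) argo
    moreover have "C * (1/e + 1) * y'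
        \<le> (2 * e + 4 * (C + b) + 8 * (C + b) / d\<^sup>2 + (b + C) * (1/e + 2)) * y'"
      unfolding q1 q2 s_def[symmetric] using p e C b by (intro mult_right_mono[OF _ nn(4)]) argo
    ultimately show ?thesis
      unfolding distrib_left[of _ "y + z" y'] distrib_left[of _ y z] by linarith
  qed
  finally show ?thesis by (simp add: x_def y_def z_def y'_def)
qed

lemma LIMSEQ_zero_if_le_combination:
  fixes x y :: "nat \<Rightarrow> real"
  assumes y: "y \<longlonglongrightarrow> 0" and B: "0 \<le> B"
    and le: "\<And>e. 0 < e \<Longrightarrow> \<exists>C. \<forall>n\<ge>1. \<bar>x n\<bar> \<le> e * B + C * y n"
  shows "x \<longlonglongrightarrow> 0"
proof (rule LIMSEQ_I)
  fix r :: real assume r: "0 < r"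
  define e where "e = r / (2 * (B + 1))"
  have e: "0 < e" "e * B < r / 2" using r B by (auto simp: e_def field_simps)
  obtain C where C: "\<forall>n\<ge>1. \<bar>x n\<bar> \<le> e * B + C * y n" using le[OF e(1)] by blast
  have "(\<lambda>n. C * y n) \<longlonglongrightarrow> C * 0" by (intro tendsto_intros y)
  then have "eventually (\<lambda>n. C * y n < r / 2) sequentially"
    by (rule order_tendstoD(2)) (use r in simp)
  then obtain N where N: "\<And>n. n \<ge> N \<Longrightarrow> C * y n < r / 2"
    by (auto simp: eventually_sequentially)
  show "\<exists>no. \<forall>n\<ge>no. norm (x n - 0) < r"
  proof (intro exI[of _ "max N 1"] allI impI)
    fix n assume "max N 1 \<le> n"
    then have "\<bar>x n\<bar> \<le> e * B + C * y n" "C * y n < r / 2" using C N by auto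
    then show "norm (x n - 0) < r" using e(2) by simp
  qed
qed

text \<open>The difference between K[H - E H] and -Q(G) is controlled by
  \<open>quadratic_remainder_le\<close>. As E G = 0, centring H means subtracting E R only, and n E
  Q(G) is the trace of \<open>Ji\<close> against 2 J, that is, twice the dimension.\<close>

lemma (in prob_space) expectation_m_estimator_limit:
  fixes G R K :: "nat \<Rightarrow> 'a \<Rightarrow> 'e::euclidean_space" and L :: "'q::finite \<Rightarrow> 'e" and J Ji :: "real^'q^'q"
  defines "H \<equiv> \<lambda>n x. G n x + R n x" and "w \<equiv> \<lambda>h. \<chi> i. L i \<bullet> h"
  assumes meas [measurable]: "\<And>n. G n \<in> borel_measurable M" "\<And>n. R n \<in> borel_measurable M"
      "\<And>n. K n \<in> borel_measurable M"
    and K_le: "\<And>n. 1 \<le> n \<Longrightarrow> AE x in M. norm (K n x) \<le> C * norm (H n x)"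
    and K_expand: "\<And>e. 0 < e \<Longrightarrow> \<exists>d>0. \<forall>n\<ge>1. AE x in M. norm (H n x) < d \<longrightarrow>
      \<bar>K n x \<bullet> H n x + w (H n x) \<bullet> (Ji *v w (H n x))\<bar> \<le> e * (norm (H n x))\<^sup>2"
    and G4: "\<And>n. 1 \<le> n \<Longrightarrow> integrable M (\<lambda>x. norm (G n x) ^ 4)"
      "\<And>n. 1 \<le> n \<Longrightarrow> (real n)\<^sup>2 * expectation (\<lambda>x. norm (G n x) ^ 4) \<le> B"
    and R2: "\<And>n. 1 \<le> n \<Longrightarrow> integrable M (\<lambda>x. (norm (R n x))\<^sup>2)"
      "(\<lambda>n. real n * expectation (\<lambda>x. (norm (R n x))\<^sup>2)) \<longlonglongrightarrow> 0"
    and G0: "\<And>n. 1 \<le> n \<Longrightarrow> expectation (G n) = 0"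
    and cov: "\<And>n i j. 1 \<le> n \<Longrightarrow>
      real n * expectation (\<lambda>x. (L i \<bullet> G n x) * (L j \<bullet> G n x)) = 2 * J $ i $ j"
    and J: "transpose J = J" "Ji ** J = mat 1"
  shows "\<And>n. 1 \<le> n \<Longrightarrow> integrable M (\<lambda>x. K n x \<bullet> (H n x - expectation (H n)))"
    and "(\<lambda>n. real n * expectation (\<lambda>x. K n x \<bullet> (H n x - expectation (H n)))) \<longlonglongrightarrow> - 2 * real CARD('q)"
proof -
  define Q where "Q h = w h \<bullet> (Ji *v w h)" for h
  have lw: "linear w"
    by (rule linearI) (simp_all add: w_def vec_eq_iff inner_add_right)
  obtain l where l: "0 < l" "\<And>h. norm (w h) \<le> l * norm h"
    using linear_bounded_pos[OF lw] by blast
  obtain j where j: "0 < j" "\<And>y. norm (Ji *v y) \<le> j * norm y"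
    using linear_bounded_pos[OF matrix_vector_mul_linear[of Ji]] by blast
  define b where "b = l * j * l"
  have b: "0 \<le> b" using l j by (simp add: b_def)
  have bil: "\<bar>w x \<bullet> (Ji *v w y)\<bar> \<le> b * (norm x * norm y)" for x y
  proof -
    have "\<bar>w x \<bullet> (Ji *v w y)\<bar> \<le> norm (w x) * norm (Ji *v w y)" by (rule Cauchy_Schwarz_ineq2)
    also have "norm (Ji *v w y) \<le> j * (l * norm y)"
      using j(2)[of "w y"] mult_left_mono[OF l(2)[of y], of j] j(1) by linarith
    then have "norm (w x) * norm (Ji *v w y) \<le> (l * norm x) * (j * (l * norm y))"
      using l(2)[of x] l(1) by (intro mult_mono) auto
    finally show ?thesis by (simp add: b_def mult_ac)
  qed
  have Qb: "\<bar>Q x\<bar> \<le> b * (norm x)\<^sup>2" for x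
    using bil[of x x] by (simp add: Q_def power2_eq_square)
  have Qd: "\<bar>Q (x + y) - Q x\<bar> \<le> b * (2 * (norm x * norm y) + (norm y)\<^sup>2)" for x y
  proof -
    have "Q (x + y) - Q x = w x \<bullet> (Ji *v w y) + w y \<bullet> (Ji *v w x) + w y \<bullet> (Ji *v w y)"
      by (simp add: Q_def linear_add[OF lw] matrix_vector_right_distrib inner_add_left inner_add_right)
    also have "\<bar>\<dots>\<bar> \<le> b * (norm x * norm y) + b * (norm y * norm x) + b * (norm y * norm y)"
      using bil[of x y] bil[of y x] bil[of y y] by linarith
    also have "\<dots> = b * (2 * (norm x * norm y) + (norm y)\<^sup>2)"
      by (simp add: power2_eq_square algebra_simps)
    finally show ?thesis .
  qed
  \<comment> \<open>The bound on \<open>K\<close> comes without a sign for its constant.\<close>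
  define C' where "C' = \<bar>C\<bar>"
  have C': "0 \<le> C'" by (simp add: C'_def)
  have K_le': "AE x in M. norm (K n x) \<le> C' * norm (H n x)" if "1 \<le> n" for n
    using K_le[OF that]
  proof eventually_elim
    case (elim x)
    have "C * norm (H n x) \<le> C' * norm (H n x)" by (intro mult_right_mono) (auto simp: C'_def)
    with elim show ?case by linarith
  qed
  have G2: "integrable M (\<lambda>x. (norm (G n x))\<^sup>2)" if n: "1 \<le> n" for n
    using G4(1)[OF n] square_integrable_imp_integrable[of "\<lambda>x. (norm (G n x))\<^sup>2"]
    by (simp add: power_mult[symmetric])
  \<comment> \<open>Jensen turns the fourth-moment bound into a bound for the square of this number,
    and a <= a^2 + 1 removes the square.\<close>
  have nG2: "real n * expectation (\<lambda>x. (norm (G n x))\<^sup>2) \<le> B + 1" if n: "1 \<le> n" for n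
  proof -
    have "(real n * expectation (\<lambda>x. (norm (G n x))\<^sup>2))\<^sup>2
        \<le> (real n)\<^sup>2 * expectation (\<lambda>x. norm (G n x) ^ 4)"
      using expectation_square_le[of "\<lambda>x. (norm (G n x))\<^sup>2"] G4(1)[OF n]
      by (simp add: power_mult_distrib power_mult[symmetric] mult_left_mono)
    then have "(real n * expectation (\<lambda>x. (norm (G n x))\<^sup>2))\<^sup>2 \<le> B"
      using G4(2)[OF n] by linarith
    moreover have "a \<le> a\<^sup>2 + 1" for a :: real
      using zero_le_power2[of "a - 1/2"] by (simp add: power2_diff power2_eq_square field_simps)
    ultimately show ?thesis by (meson add_right_mono order_trans)
  qed
  have iG: "integrable M (G n)" and iR: "integrable M (R n)" if n: "1 \<le> n" for n
  proof -
    show "integrable M (G n)"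
      using square_integrable_imp_integrable[of "\<lambda>x. norm (G n x)"] G2[OF n]
      by (simp add: integrable_norm_iff)
    show "integrable M (R n)"
      using square_integrable_imp_integrable[of "\<lambda>x. norm (R n x)"] R2(1)[OF n]
      by (simp add: integrable_norm_iff)
  qed
  have EH: "expectation (H n) = expectation (R n)" if n: "1 \<le> n" for n
    unfolding H_def using iG[OF n] iR[OF n] G0[OF n] by simp
  have r_le: "(norm (expectation (R n)))\<^sup>2 \<le> expectation (\<lambda>x. (norm (R n x))\<^sup>2)" if n: "1 \<le> n" for n
  proof -
    have "(norm (expectation (R n)))\<^sup>2 \<le> (expectation (\<lambda>x. norm (R n x)))\<^sup>2"
      by (intro power_mono integral_norm_bound) simp
    also have "\<dots> \<le> expectation (\<lambda>x. (norm (R n x))\<^sup>2)"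
      by (rule expectation_square_le) (use R2(1)[OF n] in auto)
    finally show ?thesis .
  qed
  have wi: "integrable M (\<lambda>x. (L i \<bullet> G n x) * (L k \<bullet> G n x))" if n: "1 \<le> n" for n i k
  proof (rule Bochner_Integration.integrable_bound)
    show "integrable M (\<lambda>x. norm (L i) * norm (L k) * (norm (G n x))\<^sup>2)"
      using G2[OF n] by simp
    show "AE x in M. norm ((L i \<bullet> G n x) * (L k \<bullet> G n x)) \<le> norm (norm (L i) * norm (L k) * (norm (G n x))\<^sup>2)"
    proof (intro AE_I2)
      fix x
      have "\<bar>L i \<bullet> G n x\<bar> * \<bar>L k \<bullet> G n x\<bar> \<le> (norm (L i) * norm (G n x)) * (norm (L k) * norm (G n x))"
        by (intro mult_mono Cauchy_Schwarz_ineq2) auto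
      then show "norm ((L i \<bullet> G n x) * (L k \<bullet> G n x)) \<le> norm (norm (L i) * norm (L k) * (norm (G n x))\<^sup>2)"
        by (simp add: abs_mult power2_eq_square mult_ac)
    qed
  qed simp
  have Q_sum: "Q (G n x) = (\<Sum>i\<in>UNIV. \<Sum>k\<in>UNIV. Ji $ i $ k * ((L i \<bullet> G n x) * (L k \<bullet> G n x)))" for n x
    by (simp add: Q_def w_def inner_vec_def matrix_vector_mult_def sum_distrib_left mult_ac)
  have iQ: "integrable M (\<lambda>x. Q (G n x))" if n: "1 \<le> n" for n
    unfolding Q_sum using wi[OF n] by (intro Bochner_Integration.integrable_sum integrable_mult_right) auto
  have EQ: "real n * expectation (\<lambda>x. Q (G n x)) = 2 * real CARD('q)" if n: "1 \<le> n" for n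
  proof -
    have "real n * expectation (\<lambda>x. Q (G n x)) =
        (\<Sum>i\<in>UNIV. \<Sum>k\<in>UNIV. Ji $ i $ k * (real n * expectation (\<lambda>x. (L i \<bullet> G n x) * (L k \<bullet> G n x))))"
      unfolding Q_sum using wi[OF n]
      by (subst Bochner_Integration.integral_sum Bochner_Integration.integrable_sum;
          simp add: sum_distrib_left mult_ac)+
    also have "\<dots> = 2 * (\<Sum>i\<in>UNIV. \<Sum>k\<in>UNIV. Ji $ i $ k * J $ k $ i)"
    proof -
      have "J $ i $ k = J $ k $ i" for i k using J(1) by (metis transpose_def vec_lambda_beta)
      then show ?thesis by (simp add: cov[OF n] sum_distrib_left mult_ac)
    qed
    also have "(\<Sum>i\<in>UNIV. \<Sum>k\<in>UNIV. Ji $ i $ k * J $ k $ i) = trace (Ji ** J)"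
      by (simp add: trace_def matrix_matrix_mult_def)
    also have "\<dots> = real CARD('q)" by (simp add: J(2) trace_I)
    finally show ?thesis .
  qed
  define D where "D n x = K n x \<bullet> (H n x - expectation (H n)) + Q (G n x)" for n x
  define S where "S n x = (norm (R n x))\<^sup>2 + norm (G n x) ^ 4 + (norm (expectation (R n)))\<^sup>2" for n x
  have [measurable]: "D n \<in> borel_measurable M" for n
    unfolding D_def H_def Q_sum by measurable
  have D_le: "\<exists>c. \<forall>n\<ge>1. AE x in M. \<bar>D n x\<bar> \<le> (2 + b + C') * e * (norm (G n x))\<^sup>2 + c * S n x"
    if e: "0 < e" for e
  proof -
    obtain d where d: "0 < d" "\<And>n. 1 \<le> n \<Longrightarrow> AE x in M. norm (H n x) < d \<longrightarrow>
        \<bar>K n x \<bullet> H n x + Q (H n x)\<bar> \<le> e * (norm (H n x))\<^sup>2"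
      using K_expand[OF e] unfolding Q_def by blast
    show ?thesis
    proof (intro exI allI impI)
      fix n :: nat assume n: "1 \<le> n"
      show "AE x in M. \<bar>D n x\<bar> \<le> (2 + b + C') * e * (norm (G n x))\<^sup>2 +
        (2 * e + 4 * (C' + b) + 8 * (C' + b) / d\<^sup>2 + (b + C') * (1 / e + 2)) * S n x"
        using K_le'[OF n] d(2)[OF n]
      proof eventually_elim
        case (elim x)
        have "\<bar>K n x \<bullet> (G n x + R n x - expectation (R n)) + Q (G n x)\<bar> \<le> (2 + b + C') * e * (norm (G n x))\<^sup>2 +
            (2 * e + 4 * (C' + b) + 8 * (C' + b) / d\<^sup>2 + (b + C') * (1 / e + 2)) *
              ((norm (R n x))\<^sup>2 + norm (G n x) ^ 4 + (norm (expectation (R n)))\<^sup>2)"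
          using elim unfolding H_def by (intro quadratic_remainder_le[OF _ C' b d(1) e _ Qb Qd]) blast+
        then show ?case
          unfolding D_def S_def EH[OF n] unfolding H_def .
      qed
    qed
  qed
  have iS: "integrable M (S n)" if n: "1 \<le> n" for n
    unfolding S_def using R2(1)[OF n] G4(1)[OF n] by simp
  \<comment> \<open>Integrability is read off from the pathwise bound with e = 1.\<close>
  have iD: "integrable M (D n)" if n: "1 \<le> n" for n
  proof -
    obtain c where c: "AE x in M. \<bar>D n x\<bar> \<le> (2 + b + C') * 1 * (norm (G n x))\<^sup>2 + c * S n x"
      using D_le[of 1] n by auto
    show ?thesis
    proof (rule Bochner_Integration.integrable_bound)
      show "integrable M (\<lambda>x. (2 + b + C') * 1 * (norm (G n x))\<^sup>2 + c * S n x)"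
        using G2[OF n] iS[OF n] by simp
      show "AE x in M. norm (D n x) \<le> norm ((2 + b + C') * 1 * (norm (G n x))\<^sup>2 + c * S n x)"
        using c by eventually_elim simp
    qed simp
  qed
  show int: "integrable M (\<lambda>x. K n x \<bullet> (H n x - expectation (H n)))" if n: "1 \<le> n" for n
    using Bochner_Integration.integrable_diff[OF iD[OF n] iQ[OF n]] by (simp add: D_def)
  \<comment> \<open>Vanishing majorant of n E S: the factor 2 pays for R and for its mean, and n
    E|G|^4 <= B / n by the fourth-moment hypothesis.\<close>
  define y where "y n = 2 * (real n * expectation (\<lambda>x. (norm (R n x))\<^sup>2)) + \<bar>B\<bar> / real n" for n
  have "(\<lambda>n. real n * expectation (D n)) \<longlonglongrightarrow> 0"
  proof (rule LIMSEQ_zero_if_le_combination[where B = "(2 + b + C') * (\<bar>B\<bar> + 1)"])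
    have "y \<longlonglongrightarrow> 2 * 0 + 0"
      unfolding y_def by (intro tendsto_intros R2(2) lim_const_over_n)
    then show "y \<longlonglongrightarrow> 0" by simp
    show "0 \<le> (2 + b + C') * (\<bar>B\<bar> + 1)" using b C' by simp
    fix e :: real assume e: "0 < e"
    obtain c where c: "\<And>n. 1 \<le> n \<Longrightarrow> AE x in M. \<bar>D n x\<bar> \<le> (2 + b + C') * e * (norm (G n x))\<^sup>2 + c * S n x"
      using D_le[OF e] by blast
    show "\<exists>c. \<forall>n\<ge>1. \<bar>real n * expectation (D n)\<bar> \<le> e * ((2 + b + C') * (\<bar>B\<bar> + 1)) + c * y n"
    proof (intro exI[of _ "\<bar>c\<bar>"] allI impI)
      fix n :: nat assume n: "1 \<le> n"
      have "\<bar>expectation (D n)\<bar> \<le> expectation (\<lambda>x. \<bar>D n x\<bar>)"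
        using integral_norm_bound[of M "D n"] by simp
      also have "\<dots> \<le> expectation (\<lambda>x. (2 + b + C') * e * (norm (G n x))\<^sup>2 + c * S n x)"
        using c[OF n] iD[OF n] G2[OF n] iS[OF n] by (intro integral_mono_AE) auto
      also have "\<dots> = (2 + b + C') * e * expectation (\<lambda>x. (norm (G n x))\<^sup>2) + c * expectation (S n)"
        using G2[OF n] iS[OF n] by simp
      finally have "real n * \<bar>expectation (D n)\<bar> \<le>
          real n * ((2 + b + C') * e * expectation (\<lambda>x. (norm (G n x))\<^sup>2) + c * expectation (S n))"
        by (rule mult_left_mono) simp
      also have "\<dots> = (2 + b + C') * e * (real n * expectation (\<lambda>x. (norm (G n x))\<^sup>2)) + c * (real n * expectation (S n))"
        by (simp add: algebra_simps)
      also have "\<dots> \<le> (2 + b + C') * e * (\<bar>B\<bar> + 1) + \<bar>c\<bar> * y n"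
      proof (rule add_mono)
        show "(2 + b + C') * e * (real n * expectation (\<lambda>x. (norm (G n x))\<^sup>2)) \<le> (2 + b + C') * e * (\<bar>B\<bar> + 1)"
          using nG2[OF n] b C' e by (intro mult_left_mono) auto
        have ES: "expectation (S n) = expectation (\<lambda>x. (norm (R n x))\<^sup>2) + expectation (\<lambda>x. norm (G n x) ^ 4)
            + (norm (expectation (R n)))\<^sup>2"
          unfolding S_def using R2(1)[OF n] G4(1)[OF n] by (simp add: prob_space)
        have "real n * expectation (\<lambda>x. norm (G n x) ^ 4) \<le> \<bar>B\<bar> / real n"
          using G4(2)[OF n] n by (simp add: field_simps power2_eq_square)
        moreover have "real n * (norm (expectation (R n)))\<^sup>2 \<le> real n * expectation (\<lambda>x. (norm (R n x))\<^sup>2)"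
          using r_le[OF n] by (intro mult_left_mono) auto
        ultimately have Sy: "real n * expectation (S n) \<le> y n"
          unfolding ES y_def distrib_left by linarith
        have "0 \<le> real n * expectation (S n)"
          unfolding ES by (intro mult_nonneg_nonneg add_nonneg_nonneg integral_nonneg) auto
        then have "c * (real n * expectation (S n)) \<le> \<bar>c\<bar> * (real n * expectation (S n))"
          by (intro mult_right_mono) auto
        also have "\<dots> \<le> \<bar>c\<bar> * y n" using Sy by (intro mult_left_mono) auto
        finally show "c * (real n * expectation (S n)) \<le> \<bar>c\<bar> * y n" .
      qed
      finally show "\<bar>real n * expectation (D n)\<bar> \<le> e * ((2 + b + C') * (\<bar>B\<bar> + 1)) + \<bar>c\<bar> * y n"
        by (simp add: abs_mult mult_ac)
    qed
  qed
  then have "(\<lambda>n. real n * expectation (D n) - 2 * real CARD('q)) \<longlonglongrightarrow> 0 - 2 * real CARD('q)"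
    by (intro tendsto_intros)
  then have "(\<lambda>n. real n * expectation (D n) - 2 * real CARD('q)) \<longlonglongrightarrow> - 2 * real CARD('q)"
    by simp
  moreover have "eventually (\<lambda>n. real n * expectation (D n) - 2 * real CARD('q) =
      real n * expectation (\<lambda>x. K n x \<bullet> (H n x - expectation (H n)))) sequentially"
    using eventually_ge_at_top[of "1::nat"]
  proof eventually_elim
    case (elim n)
    have "expectation (D n) = expectation (\<lambda>x. K n x \<bullet> (H n x - expectation (H n))) + expectation (\<lambda>x. Q (G n x))"
      unfolding D_def using int[OF elim] iQ[OF elim] by (rule Bochner_Integration.integral_add)
    then show ?case using EQ[OF elim] by (simp add: distrib_left)
  qed
  ultimately show "(\<lambda>n. real n * expectation (\<lambda>x. K n x \<bullet> (H n x - expectation (H n)))) \<longlonglongrightarrow> - 2 * real CARD('q)"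
    by (rule Lim_transform_eventually)
qed

section \<open>Moments of Gaussian empirical covariances\<close>

lemma borel_measurable_vec_nth [measurable (raw)]:
  fixes f :: "'a \<Rightarrow> ('b::euclidean_space) ^ 'n"
  assumes "f \<in> borel_measurable M"
  shows "(\<lambda>x. f x $ i) \<in> borel_measurable M"
  by (rule borel_measurable_continuous_on[OF _ assms]) (intro continuous_intros)

lemma borel_measurable_vec_lambda:
  fixes f :: "'n::finite \<Rightarrow> 'a \<Rightarrow> 'b::euclidean_space"
  assumes "\<And>i. f i \<in> borel_measurable M"
  shows "(\<lambda>x. \<chi> i. f i x) \<in> borel_measurable M"
  using assms by (auto simp: borel_measurable_euclidean_space[of "\<lambda>x. \<chi> i. f i x"] Basis_vec_def inner_axis
      intro!: borel_measurable_inner)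

section \<open>Independence of families of events\<close>

context prob_space
begin

lemma indep_sets_image:
  assumes indep: "indep_sets (\<lambda>k. F (f k)) I" and inj: "inj_on f I"
  shows "indep_sets F (f ` I)"
proof (rule indep_setsI)
  show "F i \<subseteq> events" if "i \<in> f ` I" for i
    using that indep unfolding indep_sets_def by auto
  fix A J assume J: "J \<noteq> {}" "J \<subseteq> f ` I" "finite J" "\<forall>j\<in>J. A j \<in> F j"
  obtain L where L: "L \<subseteq> I" "J = f ` L" using J(2) by (meson subset_image_iff)
  have injL: "inj_on f L" using inj L(1) inj_on_subset by blast
  have "finite L" using J(3) L(2) injL finite_image_iff by blast
  then have "prob (\<Inter>k\<in>L. A (f k)) = (\<Prod>k\<in>L. prob (A (f k)))"
    using J L by (intro indep_setsD[OF indep]) auto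
  then show "prob (\<Inter>j\<in>J. A j) = (\<Prod>j\<in>J. prob (A j))"
    by (simp add: L(2) prod.reindex[OF injL])
qed

text \<open>Independent blocks with independent members give jointly independent members. Closure
  under intersection lets the chosen events of one block be merged into a single event of
  \<open>A j\<close>. Applied to the time steps of one Wiener process and to the four
  processes.\<close>

lemma indep_sets_blocks:
  assumes outer: "indep_sets A J"
    and Int: "\<And>j. j \<in> J \<Longrightarrow> Int_stable (A j)"
    and blk: "\<And>k. k \<in> K \<Longrightarrow> blk k \<in> J" "\<And>k. k \<in> K \<Longrightarrow> B k \<subseteq> A (blk k)"
    and inner: "\<And>j. j \<in> J \<Longrightarrow> indep_sets B {k \<in> K. blk k = j}"
  shows "indep_sets B K"
proof (rule indep_setsI)
  show "B k \<subseteq> events" if "k \<in> K" for k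
    using blk[OF that] outer that unfolding indep_sets_def by blast
  fix S L assume L: "L \<noteq> {}" "L \<subseteq> K" "finite L" "\<forall>k\<in>L. S k \<in> B k"
  let ?L = "\<lambda>j. {k \<in> L. blk k = j}"
  have INT_in: "(\<Inter>k\<in>N. S k) \<in> A j" if "finite N" "N \<noteq> {}" "N \<subseteq> ?L j" "j \<in> J" for N j
    using that
  proof (induction N rule: finite_ne_induct)
    case (singleton k)
    then show ?case using L blk(2)[of k] by auto
  next
    case (insert k N)
    have "S k \<in> A j" using insert.prems L blk(2)[of k] by auto
    then show ?case using insert Int[of j] by (auto simp: Int_stable_def)
  qed
  have "(\<Inter>k\<in>L. S k) = (\<Inter>j\<in>blk ` L. \<Inter>k\<in>?L j. S k)" by auto
  also have "prob \<dots> = (\<Prod>j\<in>blk ` L. prob (\<Inter>k\<in>?L j. S k))"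
    using L blk by (intro indep_setsD[OF outer] ballI INT_in) auto
  also have "\<dots> = (\<Prod>j\<in>blk ` L. \<Prod>k\<in>?L j. prob (S k))"
  proof (rule prod.cong[OF refl])
    fix j assume j: "j \<in> blk ` L"
    then have "j \<in> J" using L blk by auto
    then show "prob (\<Inter>k\<in>?L j. S k) = (\<Prod>k\<in>?L j. prob (S k))"
      using j L by (intro indep_setsD[OF inner]) auto
  qed
  also have "\<dots> = (\<Prod>k\<in>L. prob (S k))"
    by (rule prod.image_gen[OF L(3), symmetric])
  finally show "prob (\<Inter>k\<in>L. S k) = (\<Prod>k\<in>L. prob (S k))" .
qed

lemma Int_stable_vimage: "Int_stable {X -` A \<inter> space M | A. A \<in> sets N}"
  unfolding Int_stable_def
proof safe
  fix A B assume "A \<in> sets N" "B \<in> sets N"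
  then show "\<exists>C. (X -` A \<inter> space M) \<inter> (X -` B \<inter> space M) = X -` C \<inter> space M \<and> C \<in> sets N"
    by (intro exI[of _ "A \<inter> B"]) auto
qed

text \<open>Induction on the largest index: the intersection of the earlier events lies in the
  sigma-algebra at that index, from which the last increment is independent. Measurability of the
  intersection is carried along.\<close>

lemma indep_sets_increments:
  fixes D :: "nat \<Rightarrow> 'a \<Rightarrow> 'b::topological_space" and F :: "nat \<Rightarrow> 'a measure"
  assumes sub: "\<And>i. subalgebra M (F i)"
    and mono: "\<And>i j. i \<le> j \<Longrightarrow> sets (F i) \<subseteq> sets (F j)"
    and meas: "\<And>i. D i \<in> borel_measurable (F (Suc i))"
    and indep: "\<And>i. indep_set (sets (F i)) {D i -` A \<inter> space M | A. A \<in> sets borel}"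
  shows "indep_sets (\<lambda>i. {D i -` A \<inter> space M | A. A \<in> sets borel}) UNIV"
proof (rule indep_setsI)
  show "{D i -` A \<inter> space M | A. A \<in> sets borel} \<subseteq> events" for i
    using indep_setD_ev2[OF indep[of i]] .
  fix S :: "nat \<Rightarrow> 'a set" and J :: "nat set"
  assume J: "J \<noteq> {}" "finite J" and S: "\<forall>j\<in>J. S j \<in> {D j -` A \<inter> space M | A. A \<in> sets borel}"
  \<comment> \<open>Intersecting with \<open>space M\<close> makes the empty family a valid start of
    the induction, with probability 1.\<close>
  have "prob (space M \<inter> (\<Inter>j\<in>J. S j)) = (\<Prod>j\<in>J. prob (S j)) \<and>
      (\<forall>n. (\<forall>j\<in>J. j < n) \<longrightarrow> space M \<inter> (\<Inter>j\<in>J. S j) \<in> sets (F n))"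
    using J(2) S
  proof (induction J rule: finite_linorder_max_induct)
    case empty
    have "space M \<in> sets (F n)" for n
      using sub[of n] by (metis sets.top subalgebra_def)
    then show ?case by (simp add: prob_space)
  next
    case (insert b J)
    let ?I = "space M \<inter> (\<Inter>j\<in>J. S j)"
    have Sb: "S b \<in> {D b -` A \<inter> space M | A. A \<in> sets borel}" using insert.prems by simp
    have IH: "prob ?I = (\<Prod>j\<in>J. prob (S j))" "?I \<in> sets (F b)"
      using insert by auto
    have eq: "space M \<inter> (\<Inter>j\<in>insert b J. S j) = ?I \<inter> S b" by auto
    have "prob (?I \<inter> S b) = prob ?I * prob (S b)"
      using IH(2) Sb by (rule indep_setD[OF indep])
    then have "prob (space M \<inter> (\<Inter>j\<in>insert b J. S j)) = (\<Prod>j\<in>insert b J. prob (S j))"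
      unfolding eq using insert.hyps IH(1) by (subst prod.insert) (auto simp: mult.commute)
    moreover have "space M \<inter> (\<Inter>j\<in>insert b J. S j) \<in> sets (F n)" if "\<forall>j\<in>insert b J. j < n" for n
    proof -
      have "S b \<in> sets (F (Suc b))"
        using Sb meas[of b] sub[of "Suc b"] unfolding subalgebra_def measurable_def by auto
      then have "S b \<in> sets (F n)" using mono[of "Suc b" n] that by auto
      moreover have "?I \<in> sets (F n)" using IH(2) mono[of b n] that by auto
      ultimately show ?thesis unfolding eq by auto
    qed
    ultimately show ?case by blast
  qed
  moreover have "space M \<inter> (\<Inter>j\<in>J. S j) = (\<Inter>j\<in>J. S j)" using J(1) S by fastforce
  ultimately show "prob (\<Inter>j\<in>J. S j) = (\<Prod>j\<in>J. prob (S j))" by simp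
qed

text \<open>Probabilities of coordinate boxes factor by Tonelli, since the density and the indicator
  of a box are both products over coordinates. Boxes with \<open>UNIV\<close> in the remaining
  coordinates, each of mass 1, yield the marginals and the independence of subfamilies.\<close>

lemma distributed_product_density_coordinates:
  fixes X :: "'a \<Rightarrow> real ^ 'n" and f :: "real \<Rightarrow> real"
  assumes X: "distributed M lborel X (\<lambda>x. ennreal (\<Prod>i\<in>UNIV. f (x $ i)))"
    and f [measurable]: "f \<in> borel_measurable borel" and f0: "\<And>x. 0 \<le> f x"
    and f1: "(\<integral>\<^sup>+x. ennreal (f x) \<partial>lborel) = 1"
  shows "indep_sets (\<lambda>k. {(\<lambda>\<omega>. X \<omega> $ k) -` A \<inter> space M | A. A \<in> sets borel}) UNIV"
    and "distributed M lborel (\<lambda>\<omega>. X \<omega> $ k) (\<lambda>x. ennreal (f x))"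
proof -
  have [measurable]: "X \<in> borel_measurable M" using X by (simp add: distributed_def)
  have Xk: "(\<lambda>\<omega>. X \<omega> $ k) \<in> borel_measurable M" for k
    by measurable
  define \<mu> where "\<mu> A = (\<integral>\<^sup>+x. ennreal (f x) * indicator A x \<partial>lborel)" for A
  have box: "emeasure M (\<Inter>k\<in>UNIV. (\<lambda>\<omega>. X \<omega> $ k) -` A k \<inter> space M) = (\<Prod>k\<in>UNIV. \<mu> (A k))"
    if A: "\<And>k. A k \<in> sets borel" for A :: "'n \<Rightarrow> real set"
  proof -
    note A [measurable]
    have inj: "inj_on (\<lambda>i::'n. axis i (1::real)) UNIV" by (auto simp: inj_on_def axis_eq_axis)
    have Basis: "(Basis :: (real^'n) set) = (\<lambda>i. axis i 1) ` UNIV"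
      by (auto simp: Basis_vec_def)
    \<comment> \<open>The product rule for \<open>lborel\<close> runs over \<open>Basis\<close>;
      \<open>axis_index\<close> recovers the coordinate from the basis vector.\<close>
    let ?g = "\<lambda>b x. ennreal (f x) * indicator (A (axis_index (b :: real^'n))) x"
    have "(\<Inter>k\<in>UNIV. (\<lambda>\<omega>. X \<omega> $ k) -` A k \<inter> space M) = {\<omega> \<in> space M. \<forall>k. X \<omega> $ k \<in> A k}" by auto
    then have "emeasure M (\<Inter>k\<in>UNIV. (\<lambda>\<omega>. X \<omega> $ k) -` A k \<inter> space M)
        = (\<integral>\<^sup>+\<omega>. indicator {\<omega> \<in> space M. \<forall>k. X \<omega> $ k \<in> A k} \<omega> \<partial>M)"
      by (simp only:) (rule nn_integral_indicator[symmetric], measurable)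
    also have "\<dots> = (\<integral>\<^sup>+\<omega>. (\<Prod>k\<in>UNIV. indicator (A k) (X \<omega> $ k)) \<partial>M)"
      by (intro nn_integral_cong) (auto simp: indicator_def)
    also have "\<dots> = (\<integral>\<^sup>+x. ennreal (\<Prod>i\<in>UNIV. f (x $ i)) * (\<Prod>k\<in>UNIV. indicator (A k) (x $ k)) \<partial>lborel)"
      by (rule distributed_nn_integral[OF X, symmetric]) simp
    also have "\<dots> = (\<integral>\<^sup>+x. (\<Prod>b\<in>Basis. ?g b (x \<bullet> b)) \<partial>lborel)"
      by (intro nn_integral_cong)
        (simp add: Basis prod.reindex[OF inj] prod_ennreal[symmetric] f0 prod.distrib inner_axis)
    also have "\<dots> = (\<Prod>b\<in>Basis. \<integral>\<^sup>+x. ?g b x \<partial>lborel)"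
      by (rule nn_integral_lborel_prod) auto
    also have "\<dots> = (\<Prod>k\<in>UNIV. \<mu> (A k))"
      by (simp add: Basis prod.reindex[OF inj] \<mu>_def)
    finally show ?thesis .
  qed
  have \<mu>1: "\<mu> UNIV = 1" using f1 by (simp add: \<mu>_def)
  have single: "emeasure M ((\<lambda>\<omega>. X \<omega> $ k) -` B \<inter> space M) = \<mu> B" if B: "B \<in> sets borel" for B k
  proof -
    let ?A = "\<lambda>l. if l = k then B else UNIV"
    have "(\<lambda>\<omega>. X \<omega> $ k) -` B \<inter> space M = (\<Inter>l\<in>UNIV. (\<lambda>\<omega>. X \<omega> $ l) -` ?A l \<inter> space M)"
      by (auto split: if_splits)
    also have "emeasure M \<dots> = (\<Prod>l\<in>UNIV. \<mu> (?A l))" using B by (intro box) auto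
    also have "\<dots> = (\<Prod>l\<in>UNIV. if l = k then \<mu> B else 1)"
      by (intro prod.cong) (auto simp: \<mu>1)
    finally show ?thesis by simp
  qed
  show "distributed M lborel (\<lambda>\<omega>. X \<omega> $ k) (\<lambda>x. ennreal (f x))"
    unfolding distributed_def
  proof (intro conjI)
    show "distr M lborel (\<lambda>\<omega>. X \<omega> $ k) = density lborel (\<lambda>x. ennreal (f x))"
    proof (rule measure_eqI)
      fix B assume "B \<in> sets (distr M lborel (\<lambda>\<omega>. X \<omega> $ k))"
      then have B: "B \<in> sets borel" by simp
      then show "emeasure (distr M lborel (\<lambda>\<omega>. X \<omega> $ k)) B = emeasure (density lborel (\<lambda>x. ennreal (f x))) B"
        using single[OF B, of k] by (simp add: emeasure_distr emeasure_density \<mu>_def)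
    qed simp
  qed simp_all
  show "indep_sets (\<lambda>k. {(\<lambda>\<omega>. X \<omega> $ k) -` A \<inter> space M | A. A \<in> sets borel}) UNIV"
  proof (rule indep_setsI)
    show "{(\<lambda>\<omega>. X \<omega> $ k) -` A \<inter> space M | A. A \<in> sets borel} \<subseteq> events" for k
      using Xk[of k] by (auto simp: measurable_sets_borel)
    fix S :: "'n \<Rightarrow> 'a set" and J :: "'n set"
    assume J: "J \<noteq> {}" "finite J"
      and S: "\<forall>k\<in>J. S k \<in> {(\<lambda>\<omega>. X \<omega> $ k) -` A \<inter> space M | A. A \<in> sets borel}"
    then obtain A where A: "\<And>k. k \<in> J \<Longrightarrow> A k \<in> sets borel \<and> S k = (\<lambda>\<omega>. X \<omega> $ k) -` A k \<inter> space M"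
      by (simp only: mem_Collect_eq) metis
    let ?A = "\<lambda>k. if k \<in> J then A k else UNIV"
    have "emeasure M (\<Inter>k\<in>J. S k) = emeasure M (\<Inter>k\<in>UNIV. (\<lambda>\<omega>. X \<omega> $ k) -` ?A k \<inter> space M)"
      using J(1) A by (intro arg_cong[where f="emeasure M"]) (fastforce split: if_splits)
    also have "\<dots> = (\<Prod>k\<in>UNIV. \<mu> (?A k))" using A by (intro box) auto
    also have "\<dots> = (\<Prod>k\<in>J. \<mu> (A k))"
      by (intro prod.mono_neutral_cong_right) (auto simp: \<mu>1)
    also have "\<dots> = (\<Prod>k\<in>J. emeasure M (S k))"
      using A single by (intro prod.cong) auto
    finally show "prob (\<Inter>k\<in>J. S k) = (\<Prod>k\<in>J. prob (S k))"
      by (simp add: emeasure_eq_measure prod_ennreal prod_nonneg)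
  qed
qed

end

section \<open>Moments of standard normal variables\<close>

definition std_normal_moment :: "nat \<Rightarrow> real" where
  "std_normal_moment k = (\<integral>x. std_normal_density x * x ^ k \<partial>lborel)"

lemma std_normal_moment_simps:
  "std_normal_moment 0 = 1" "std_normal_moment (Suc 0) = 0" "std_normal_moment (Suc (Suc 0)) = 1"
  "std_normal_moment (Suc (Suc (Suc 0))) = 0" "std_normal_moment (Suc (Suc (Suc (Suc 0)))) = 3"
  using integral_std_normal_moment_even[of 0] integral_std_normal_moment_even[of 1]
    integral_std_normal_moment_even[of 2] integral_std_normal_moment_odd[of 0]
    integral_std_normal_moment_odd[of 1]
  by (simp_all add: std_normal_moment_def fact_numeral numeral_eq_Suc)

context prob_space
begin

lemma std_normal_power:
  assumes "distributed M lborel X std_normal_density"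
  shows "integrable M (\<lambda>\<omega>. X \<omega> ^ k)" "expectation (\<lambda>\<omega>. X \<omega> ^ k) = std_normal_moment k"
  using distributed_integrable[OF assms, of "\<lambda>x. x ^ k"] distributed_integral[OF assms, of "\<lambda>x. x ^ k"]
    integrable_std_normal_moment[of k]
  by (simp_all add: std_normal_moment_def)

text \<open>Isserlis' formula in the independent case. A product with repetitions is a product of
  powers over the distinct indices, \<open>e\<close> being the multiplicity. The powers are
  integrated separately, and the pattern of coincidences decides through the moments 1, 0, 1, 0,
  3.\<close>

lemma expectation_four_std_normals:
  fixes g :: "'k \<Rightarrow> 'a \<Rightarrow> real"
  assumes indep: "indep_vars (\<lambda>_. borel) g K"
    and dist: "\<And>k. k \<in> K \<Longrightarrow> distributed M lborel (g k) std_normal_density"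
    and in_K: "a \<in> K" "b \<in> K" "c \<in> K" "d \<in> K"
  shows "integrable M (\<lambda>\<omega>. g a \<omega> * g b \<omega> * g c \<omega> * g d \<omega>)"
    and "expectation (\<lambda>\<omega>. g a \<omega> * g b \<omega> * g c \<omega> * g d \<omega>) =
      of_bool (a = b) * of_bool (c = d) + of_bool (a = c) * of_bool (b = d) + of_bool (a = d) * of_bool (b = c)"
proof -
  let ?S = "{a, b, c, d}"
  define e :: "'k \<Rightarrow> nat" where "e x = of_bool (x = a) + of_bool (x = b) + of_bool (x = c) + of_bool (x = d)" for x
  have single: "(\<Prod>x\<in>?S. g x \<omega> ^ of_bool (x = y)) = g y \<omega>" if "y \<in> ?S" for y \<omega>
  proof -
    have "(\<Prod>x\<in>?S. g x \<omega> ^ of_bool (x = y)) = (\<Prod>x\<in>?S. if x = y then g x \<omega> else 1)"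
      by (intro prod.cong) auto
    also have "\<dots> = g y \<omega>" by (subst prod.delta) (use that in auto)
    finally show ?thesis .
  qed
  have eq: "g a \<omega> * g b \<omega> * g c \<omega> * g d \<omega> = (\<Prod>x\<in>?S. g x \<omega> ^ e x)" for \<omega>
    unfolding e_def power_add prod.distrib by (simp only: single insertI1 insertI2)
  have ind: "indep_vars (\<lambda>_. borel) (\<lambda>x \<omega>. g x \<omega> ^ e x) ?S"
  proof -
    have "indep_vars (\<lambda>_. borel) g ?S" by (rule indep_vars_subset[OF indep]) (use in_K in auto)
    then show ?thesis by (rule indep_vars_compose2) simp
  qed
  have int: "integrable M (\<lambda>\<omega>. g x \<omega> ^ e x)" if "x \<in> ?S" for x
    using that in_K by (intro std_normal_power dist) auto
  show "integrable M (\<lambda>\<omega>. g a \<omega> * g b \<omega> * g c \<omega> * g d \<omega>)"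
    unfolding eq by (rule indep_vars_integrable[OF _ ind int]) auto
  have "expectation (\<lambda>\<omega>. g a \<omega> * g b \<omega> * g c \<omega> * g d \<omega>) = (\<Prod>x\<in>?S. expectation (\<lambda>\<omega>. g x \<omega> ^ e x))"
    unfolding eq by (rule indep_vars_lebesgue_integral[OF _ ind int]) auto
  also have "\<dots> = (\<Prod>x\<in>?S. std_normal_moment (e x))"
    using in_K by (intro prod.cong std_normal_power dist) auto
  also have "\<dots> = of_bool (a = b) * of_bool (c = d) + of_bool (a = c) * of_bool (b = d) + of_bool (a = d) * of_bool (b = c)"
    by (cases "a = b"; cases "a = c"; cases "a = d"; cases "b = c"; cases "b = d"; cases "c = d")
      (auto simp: e_def prod.insert_if std_normal_moment_simps)
  finally show "expectation (\<lambda>\<omega>. g a \<omega> * g b \<omega> * g c \<omega> * g d \<omega>) =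
      of_bool (a = b) * of_bool (c = d) + of_bool (a = c) * of_bool (b = d) + of_bool (a = d) * of_bool (b = c)" .
qed

lemma expectation_two_std_normals:
  fixes g :: "'k \<Rightarrow> 'a \<Rightarrow> real"
  assumes indep: "indep_vars (\<lambda>_. borel) g K"
    and dist: "\<And>k. k \<in> K \<Longrightarrow> distributed M lborel (g k) std_normal_density"
    and in_K: "a \<in> K" "b \<in> K"
  shows "integrable M (\<lambda>\<omega>. g a \<omega> * g b \<omega>)"
    and "expectation (\<lambda>\<omega>. g a \<omega> * g b \<omega>) = of_bool (a = b)"
proof -
  have "integrable M (\<lambda>\<omega>. g a \<omega> * g b \<omega>) \<and> expectation (\<lambda>\<omega>. g a \<omega> * g b \<omega>) = of_bool (a = b)"
  proof (cases "a = b")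
    case True
    then show ?thesis
      using std_normal_power[OF dist[OF in_K(1)], of 2] by (simp add: power2_eq_square std_normal_moment_simps numeral_2_eq_2)
  next
    case False
    have ind: "indep_vars (\<lambda>_. borel) g {a, b}" by (rule indep_vars_subset[OF indep]) (use in_K in auto)
    have int: "integrable M (g x)" if "x \<in> {a, b}" for x
      using std_normal_power(1)[OF dist, of x 1] that in_K by auto
    have "expectation (g a) = 0" using std_normal_power(2)[OF dist[OF in_K(1)], of 1]
      by (simp add: std_normal_moment_simps)
    then show ?thesis
      using indep_vars_lebesgue_integral[OF _ ind int] indep_vars_integrable[OF _ ind int] False by simp
  qed
  then show "integrable M (\<lambda>\<omega>. g a \<omega> * g b \<omega>)"
    "expectation (\<lambda>\<omega>. g a \<omega> * g b \<omega>) = of_bool (a = b)" by auto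
qed

lemma integrable_power_if_integrable_power4:
  fixes X :: "'a \<Rightarrow> real"
  assumes [measurable]: "X \<in> borel_measurable M" and "integrable M (\<lambda>\<omega>. X \<omega> ^ 4)" "k \<le> 4"
  shows "integrable M (\<lambda>\<omega>. X \<omega> ^ k)"
proof (rule Bochner_Integration.integrable_bound)
  show "integrable M (\<lambda>\<omega>. 1 + X \<omega> ^ 4)" using assms by simp
  have "\<bar>x\<bar> ^ k \<le> 1 + x ^ 4" for x :: real
  proof (cases "\<bar>x\<bar> \<le> 1")
    case True
    have "\<bar>x\<bar> ^ k \<le> 1" using True by (simp add: power_le_one)
    moreover have "0 \<le> x ^ 4" by simp
    ultimately show ?thesis by linarith
  next
    case False
    then have "\<bar>x\<bar> ^ k \<le> \<bar>x\<bar> ^ 4" using assms(3) by (intro power_increasing) auto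
    then show ?thesis by (simp add: power_even_abs)
  qed
  then show "AE \<omega> in M. norm (X \<omega> ^ k) \<le> norm (1 + X \<omega> ^ 4)"
    by (intro AE_I2) (simp add: power_abs)
qed simp

text \<open>In the expansion of (X + S)^4 the terms with a linear factor X or S have mean 0, leaving
  E X^4 + 6 E X^2 E S^2 + E S^4. The middle term is why the second moment is part of the induction,
  and k + 6ck + 3c^2 k <= 3(c + 1)^2 k closes it.\<close>

lemma fourth_moment_sum:
  fixes X :: "'i \<Rightarrow> 'a \<Rightarrow> real" and k :: real
  assumes "finite I" "indep_vars (\<lambda>_. borel) X I"
    and "\<And>i. i \<in> I \<Longrightarrow> integrable M (\<lambda>\<omega>. X i \<omega> ^ 4)"
    and "\<And>i. i \<in> I \<Longrightarrow> expectation (X i) = 0"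
    and "\<And>i. i \<in> I \<Longrightarrow> expectation (\<lambda>\<omega>. X i \<omega> ^ 4) \<le> k" and k: "0 \<le> k"
  shows "integrable M (\<lambda>\<omega>. (\<Sum>i\<in>I. X i \<omega>) ^ 4) \<and> expectation (\<lambda>\<omega>. \<Sum>i\<in>I. X i \<omega>) = 0 \<and>
    expectation (\<lambda>\<omega>. (\<Sum>i\<in>I. X i \<omega>)\<^sup>2) \<le> card I * sqrt k \<and>
    expectation (\<lambda>\<omega>. (\<Sum>i\<in>I. X i \<omega>) ^ 4) \<le> 3 * (card I)\<^sup>2 * k"
  using assms(1-5)
proof (induction I rule: finite_induct)
  case (insert i I)
  let ?S = "\<lambda>\<omega>. \<Sum>i\<in>I. X i \<omega>"
  have rv [measurable]: "random_variable borel (X j)" if "j \<in> insert i I" for j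
    using insert.prems(1) that by (auto simp: indep_vars_def)
  have [measurable]: "random_variable borel ?S" "random_variable borel (X i)"
    using rv by (auto intro!: borel_measurable_sum)
  have ind: "indep_var borel (X i) borel ?S"
    by (rule indep_vars_sum[OF insert.hyps insert.prems(1)])
  have IH: "integrable M (\<lambda>\<omega>. ?S \<omega> ^ 4)" "expectation ?S = 0"
    "expectation (\<lambda>\<omega>. (?S \<omega>)\<^sup>2) \<le> card I * sqrt k" "expectation (\<lambda>\<omega>. ?S \<omega> ^ 4) \<le> 3 * (card I)\<^sup>2 * k"
    using insert.IH[OF indep_vars_subset[OF insert.prems(1)]] insert.prems(2-4) by auto
  have X: "integrable M (\<lambda>\<omega>. X i \<omega> ^ 4)" "expectation (X i) = 0" "expectation (\<lambda>\<omega>. X i \<omega> ^ 4) \<le> k"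
    using insert.prems by auto
  have iX: "integrable M (\<lambda>\<omega>. X i \<omega> ^ m)" and iS: "integrable M (\<lambda>\<omega>. ?S \<omega> ^ m)" if "m \<le> 4" for m
    using integrable_power_if_integrable_power4[OF _ X(1) that]
      integrable_power_if_integrable_power4[OF _ IH(1) that] by auto
  have indp: "indep_var borel (\<lambda>\<omega>. X i \<omega> ^ m) borel (\<lambda>\<omega>. ?S \<omega> ^ l)" for m l
    using indep_var_compose[OF ind, of "\<lambda>x. x ^ m" borel "\<lambda>x. x ^ l" borel] by (simp add: comp_def)
  have iXS: "integrable M (\<lambda>\<omega>. X i \<omega> ^ m * ?S \<omega> ^ l)"
    and eXS: "expectation (\<lambda>\<omega>. X i \<omega> ^ m * ?S \<omega> ^ l) = expectation (\<lambda>\<omega>. X i \<omega> ^ m) * expectation (\<lambda>\<omega>. ?S \<omega> ^ l)"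
    if "m \<le> 4" "l \<le> 4" for m l
    using indep_var_integrable[OF indp iX[OF that(1)] iS[OF that(2)]]
      indep_var_lebesgue_integral[OF indp iX[OF that(1)] iS[OF that(2)]] by auto
  have X2: "expectation (\<lambda>\<omega>. (X i \<omega>)\<^sup>2) \<le> sqrt k"
  proof (rule real_le_rsqrt)
    have "(expectation (\<lambda>\<omega>. (X i \<omega>)\<^sup>2))\<^sup>2 \<le> expectation (\<lambda>\<omega>. ((X i \<omega>)\<^sup>2)\<^sup>2)"
      using variance_positive[of "\<lambda>\<omega>. (X i \<omega>)\<^sup>2"] variance_eq[of "\<lambda>\<omega>. (X i \<omega>)\<^sup>2"] iX[of 2] X(1)
      by (simp add: power_mult[symmetric])
    then show "(expectation (\<lambda>\<omega>. (X i \<omega>)\<^sup>2))\<^sup>2 \<le> k"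
      using X(3) by (simp add: power_mult[symmetric])
  qed
  have exp4: "(\<Sum>j\<in>insert i I. X j \<omega>) ^ 4 = X i \<omega> ^ 4 * ?S \<omega> ^ 0 + 4 * (X i \<omega> ^ 3 * ?S \<omega> ^ 1)
      + 6 * (X i \<omega> ^ 2 * ?S \<omega> ^ 2) + 4 * (X i \<omega> ^ 1 * ?S \<omega> ^ 3) + X i \<omega> ^ 0 * ?S \<omega> ^ 4" for \<omega>
    using insert.hyps by (simp add: algebra_simps power2_eq_square power3_eq_cube power4_eq_xxxx)
  have exp2: "(\<Sum>j\<in>insert i I. X j \<omega>)\<^sup>2 = X i \<omega> ^ 2 * ?S \<omega> ^ 0 + 2 * (X i \<omega> ^ 1 * ?S \<omega> ^ 1)
      + X i \<omega> ^ 0 * ?S \<omega> ^ 2" for \<omega>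
    using insert.hyps by (simp add: algebra_simps power2_eq_square)
  have "integrable M (\<lambda>\<omega>. (\<Sum>j\<in>insert i I. X j \<omega>) ^ 4)"
    unfolding exp4 using iXS[of 4 0] iXS[of 3 1] iXS[of 2 2] iXS[of 1 3] iXS[of 0 4] by simp
  moreover have "expectation (\<lambda>\<omega>. \<Sum>j\<in>insert i I. X j \<omega>) = 0"
    using insert.hyps iX[of 1] iS[of 1] X(2) IH(2) by simp
  moreover have "expectation (\<lambda>\<omega>. (\<Sum>j\<in>insert i I. X j \<omega>)\<^sup>2) \<le> card (insert i I) * sqrt k"
  proof -
    have "expectation (\<lambda>\<omega>. (\<Sum>j\<in>insert i I. X j \<omega>)\<^sup>2) = expectation (\<lambda>\<omega>. (X i \<omega>)\<^sup>2) + expectation (\<lambda>\<omega>. (?S \<omega>)\<^sup>2)"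
      unfolding exp2 using iXS[of 2 0] iXS[of 1 1] iXS[of 0 2] eXS[of 1 1] eXS[of 2 0] eXS[of 0 2] X(2) IH(2) by (simp add: prob_space)
    then show ?thesis using X2 IH(3) insert.hyps by (simp add: algebra_simps)
  qed
  moreover have "expectation (\<lambda>\<omega>. (\<Sum>j\<in>insert i I. X j \<omega>) ^ 4) \<le> 3 * (card (insert i I))\<^sup>2 * k"
  proof -
    have e: "expectation (\<lambda>\<omega>. (\<Sum>j\<in>insert i I. X j \<omega>) ^ 4) = expectation (\<lambda>\<omega>. X i \<omega> ^ 4)
        + 6 * (expectation (\<lambda>\<omega>. (X i \<omega>)\<^sup>2) * expectation (\<lambda>\<omega>. (?S \<omega>)\<^sup>2)) + expectation (\<lambda>\<omega>. ?S \<omega> ^ 4)"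
      unfolding exp4 using iXS[of 4 0] iXS[of 3 1] iXS[of 2 2] iXS[of 1 3] iXS[of 0 4] eXS[of 4 0] eXS[of 3 1] eXS[of 2 2] eXS[of 1 3] eXS[of 0 4] X(2) IH(2)
      by (simp add: prob_space)
    have "expectation (\<lambda>\<omega>. (X i \<omega>)\<^sup>2) * expectation (\<lambda>\<omega>. (?S \<omega>)\<^sup>2) \<le> sqrt k * (card I * sqrt k)"
      using X2 IH(3) k by (intro mult_mono) (auto intro!: integral_nonneg)
    also have "\<dots> = card I * k" using k by (simp add: mult.assoc[symmetric])
    finally have "expectation (\<lambda>\<omega>. (\<Sum>j\<in>insert i I. X j \<omega>) ^ 4) \<le> k + 6 * (card I * k) + 3 * (card I)\<^sup>2 * k"
      unfolding e using X(3) IH(4) by linarith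
    also have "\<dots> \<le> 3 * (card (insert i I))\<^sup>2 * k"
      using insert.hyps k by (simp add: power2_eq_square algebra_simps)
    finally show ?thesis .
  qed
  ultimately show ?case by blast
qed simp

end

section \<open>Centred empirical covariance of standard normal vectors\<close>

definition empirical_cov_error :: "nat \<Rightarrow> (nat \<times> 'c \<Rightarrow> 'a \<Rightarrow> real) \<Rightarrow> 'a \<Rightarrow> real^'c^'c" where
  "empirical_cov_error n g \<omega> =
    (\<chi> c d. (\<Sum>i<n. g (i, c) \<omega> * g (i, d) \<omega> - of_bool (c = d)) / real n)"

lemma norm_pow4_le_sum:
  fixes A :: "real^'n^'m"
  shows "norm A ^ 4 \<le> real (CARD('m) * CARD('n)) * (\<Sum>i\<in>UNIV. \<Sum>j\<in>UNIV. (A $ i $ j) ^ 4)"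
proof -
  have "(norm A)\<^sup>2 = (\<Sum>i\<in>UNIV. \<Sum>j\<in>UNIV. (A $ i $ j)\<^sup>2)"
    by (simp add: norm_vec_def L2_set_def sum_nonneg)
  also have "\<dots> = (\<Sum>(i, j)\<in>UNIV. (A $ i $ j)\<^sup>2)"
    by (simp add: sum.cartesian_product)
  finally have "(norm A)\<^sup>2 = (\<Sum>(i, j)\<in>UNIV. (A $ i $ j)\<^sup>2)" .
  moreover have "norm A ^ 4 = ((norm A)\<^sup>2)\<^sup>2" by (simp add: power_mult[symmetric])
  ultimately have "norm A ^ 4 = (\<Sum>(i, j)\<in>UNIV. (A $ i $ j)\<^sup>2)\<^sup>2" by (simp only:)
  also have "\<dots> \<le> (\<Sum>p\<in>UNIV. (case p of (i, j) \<Rightarrow> (A $ i $ j)\<^sup>2)\<^sup>2) * real (card (UNIV :: ('m \<times> 'n) set))"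
    by (rule sum_squared_le_sum_of_squares)
  also have "(\<Sum>p\<in>UNIV. (case p of (i, j) \<Rightarrow> (A $ i $ j)\<^sup>2)\<^sup>2) = (\<Sum>i\<in>UNIV. \<Sum>j\<in>UNIV. (A $ i $ j) ^ 4)"
    by (simp add: sum.cartesian_product case_prod_unfold power_mult[symmetric])
  finally show ?thesis by (simp add: mult.commute)
qed

lemma power2_add_le: "(a + b)\<^sup>2 \<le> 2 * (a\<^sup>2 + b\<^sup>2 :: real)"
  using sum_squares_bound[of a b] by (simp add: power2_sum)

lemma power4_add_le: "(a + b) ^ 4 \<le> 8 * (a ^ 4 + b ^ 4 :: real)"
proof -
  have "((a + b)\<^sup>2)\<^sup>2 \<le> (2 * (a\<^sup>2 + b\<^sup>2))\<^sup>2"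
    by (intro power_mono power2_add_le) simp
  also have "\<dots> = 4 * (a\<^sup>2 + b\<^sup>2)\<^sup>2" by (simp only: power_mult_distrib) simp
  also have "\<dots> \<le> 4 * (2 * ((a\<^sup>2)\<^sup>2 + (b\<^sup>2)\<^sup>2))"
    by (intro mult_left_mono power2_add_le) simp
  finally show ?thesis by (simp add: power_mult[symmetric])
qed

text \<open>Cyclicity of the trace: congruence by \<open>S\<close> has congruence by its transpose
  as adjoint, so functionals of S Z S^T become functionals of Z.\<close>

lemma inner_congruence:
  fixes A :: "real^'p^'p" and S :: "real^'c^'p" and Z :: "real^'c^'c"
  shows "A \<bullet> (S ** Z ** transpose S) = (transpose S ** A ** S) \<bullet> Z"
proof -
  have inner: "X \<bullet> Y = trace (X ** transpose Y)" for X Y :: "real^'m^'k"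
    by (metis mat_bracket_def mat_bracket_eq_inner)
  have "A \<bullet> (S ** Z ** transpose S) = trace (A ** S ** (transpose Z ** transpose S))"
    by (simp add: inner matrix_transpose_mul matrix_mul_assoc)
  also have "\<dots> = trace (transpose Z ** transpose S ** (A ** S))"
    by (rule trace_mul_sym)
  also have "\<dots> = trace (transpose S ** A ** S ** transpose Z)"
    by (subst trace_mul_sym[of _ "transpose Z"]) (simp add: matrix_mul_assoc)
  finally show ?thesis by (simp add: inner)
qed

text \<open>With \<Sigma> = S S^T the right-hand side is tr(A \<Sigma> B \<Sigma>), the shape in
  which the covariance of the Gaussian part meets the information matrix.\<close>

lemma inner_congruence_congruence:
  fixes A B :: "real^'p^'p" and S :: "real^'c^'p"
  assumes "transpose B = B"
  shows "(transpose S ** A ** S) \<bullet> (transpose S ** B ** S)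
    = trace (A ** (S ** transpose S) ** B ** (S ** transpose S))"
proof -
  have "(transpose S ** A ** S) \<bullet> (transpose S ** B ** S)
      = A \<bullet> (S ** (transpose S ** B ** S) ** transpose S)"
    by (simp add: inner_congruence)
  also have "\<dots> = trace (A ** transpose (S ** (transpose S ** B ** S) ** transpose S))"
    by (metis mat_bracket_def mat_bracket_eq_inner)
  also have "transpose (S ** (transpose S ** B ** S) ** transpose S) = S ** transpose S ** B ** (S ** transpose S)"
    by (simp add: matrix_transpose_mul assms matrix_mul_assoc)
  finally show ?thesis by (simp add: matrix_mul_assoc)
qed

lemma transpose_congruence:
  fixes A :: "real^'p^'p" and S :: "real^'c^'p"
  assumes "transpose A = A"
  shows "transpose (transpose S ** A ** S) = transpose S ** A ** S"
  by (simp add: matrix_transpose_mul assms matrix_mul_assoc)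

context prob_space
begin

context
  fixes g :: "nat \<times> 'c::finite \<Rightarrow> 'a \<Rightarrow> real" and n :: nat
  assumes indep: "indep_vars (\<lambda>_. borel) g ({..<n} \<times> UNIV)"
    and dist: "\<And>i c. i < n \<Longrightarrow> distributed M lborel (g (i, c)) std_normal_density"
    and n: "1 \<le> n"
begin

lemma factor_std_normal: "k \<in> {..<n} \<times> UNIV \<Longrightarrow> distributed M lborel (g k) std_normal_density"
  using dist by (cases k) auto

lemma factor_measurable: "i < n \<Longrightarrow> g (i, c) \<in> borel_measurable M"
  using dist by (auto simp: distributed_def)

text \<open>Of the three pairings in Isserlis' formula, centring removes the one inside each factor;
  the two crossed ones survive only for equal time indices.\<close>

lemma product_error_covariance:
  assumes "i < n" "l < n"
  shows "integrable M (\<lambda>\<omega>. (g (i, c) \<omega> * g (i, d) \<omega> - of_bool (c = d)) * (g (l, c') \<omega> * g (l, d') \<omega> - of_bool (c' = d')))"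
    and "expectation (\<lambda>\<omega>. (g (i, c) \<omega> * g (i, d) \<omega> - of_bool (c = d)) * (g (l, c') \<omega> * g (l, d') \<omega> - of_bool (c' = d')))
      = of_bool (i = l) * (of_bool (c = c') * of_bool (d = d') + of_bool (c = d') * of_bool (d = c'))"
proof -
  let ?K = "{..<n} \<times> (UNIV :: 'c set)"
  have eq: "(g (i, c) \<omega> * g (i, d) \<omega> - of_bool (c = d)) * (g (l, c') \<omega> * g (l, d') \<omega> - of_bool (c' = d')) =
      g (i, c) \<omega> * g (i, d) \<omega> * g (l, c') \<omega> * g (l, d') \<omega>
      - of_bool (c' = d') * (g (i, c) \<omega> * g (i, d) \<omega>) - of_bool (c = d) * (g (l, c') \<omega> * g (l, d') \<omega>)
      + of_bool (c = d) * of_bool (c' = d')" for \<omega>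
    by (simp add: algebra_simps)
  note four = expectation_four_std_normals[OF indep factor_std_normal, of "(i, c)" "(i, d)" "(l, c')" "(l, d')"]
  note two = expectation_two_std_normals[OF indep factor_std_normal, of "(i, c)" "(i, d)"]
    expectation_two_std_normals[OF indep factor_std_normal, of "(l, c')" "(l, d')"]
  have in_K: "(i, c) \<in> ?K" "(i, d) \<in> ?K" "(l, c') \<in> ?K" "(l, d') \<in> ?K" using assms by auto
  show "integrable M (\<lambda>\<omega>. (g (i, c) \<omega> * g (i, d) \<omega> - of_bool (c = d)) * (g (l, c') \<omega> * g (l, d') \<omega> - of_bool (c' = d')))"
    unfolding eq using four(1)[OF _ in_K] two(1)[OF _ in_K(1,2)] two(3)[OF _ in_K(3,4)] by simp
  have "expectation (\<lambda>\<omega>. (g (i, c) \<omega> * g (i, d) \<omega> - of_bool (c = d)) * (g (l, c') \<omega> * g (l, d') \<omega> - of_bool (c' = d')))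
     = of_bool (c = d) * of_bool (c' = d') + of_bool ((i, c) = (l, c')) * of_bool ((i, d) = (l, d'))
       + of_bool ((i, c) = (l, d')) * of_bool ((i, d) = (l, c'))
       - of_bool (c' = d') * of_bool (c = d) - of_bool (c = d) * of_bool (c' = d')
       + of_bool (c = d) * of_bool (c' = d')"
    unfolding eq using four[OF _ in_K] two(1,2)[OF _ in_K(1,2)] two(3,4)[OF _ in_K(3,4)] by (simp add: prob_space)
  then show "expectation (\<lambda>\<omega>. (g (i, c) \<omega> * g (i, d) \<omega> - of_bool (c = d)) * (g (l, c') \<omega> * g (l, d') \<omega> - of_bool (c' = d')))
      = of_bool (i = l) * (of_bool (c = c') * of_bool (d = d') + of_bool (c = d') * of_bool (d = c'))"
    by (cases "i = l") simp_all
qed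

lemma product_error_mean:
  assumes "i < n"
  shows "integrable M (\<lambda>\<omega>. g (i, c) \<omega> * g (i, d) \<omega> - of_bool (c = d))"
    and "expectation (\<lambda>\<omega>. g (i, c) \<omega> * g (i, d) \<omega> - of_bool (c = d)) = 0"
  using expectation_two_std_normals[OF indep factor_std_normal, of "(i, c)" "(i, d)"] assms by (simp_all add: prob_space)

text \<open>From (xy - b)^4 <= 8((xy)^4 + 1) and 2(xy)^4 <= x^8 + y^8; this is where the eighth
  Gaussian moment enters.\<close>

lemma product_error_pow4:
  assumes "i < n"
  shows "integrable M (\<lambda>\<omega>. (g (i, c) \<omega> * g (i, d) \<omega> - of_bool (c = d)) ^ 4)"
    and "expectation (\<lambda>\<omega>. (g (i, c) \<omega> * g (i, d) \<omega> - of_bool (c = d)) ^ 4) \<le> 8 * (std_normal_moment 8 + 1)"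
proof -
  have le: "(x * y - of_bool b) ^ 4 \<le> 4 * (x ^ 8 + y ^ 8) + 8" for x y :: real and b
  proof -
    have "(x * y - of_bool b) ^ 4 \<le> 8 * ((x * y) ^ 4 + (- of_bool b) ^ 4)"
      using power4_add_le[of "x * y" "- of_bool b"] by simp
    moreover have "2 * (x * y) ^ 4 \<le> x ^ 8 + y ^ 8"
      using sum_squares_bound[of "x ^ 4" "y ^ 4"] by (simp add: power_mult_distrib power_mult[symmetric] mult.assoc)
    moreover have "(- of_bool b :: real) ^ 4 \<le> 1" by simp
    ultimately show ?thesis by argo
  qed
  have int: "integrable M (\<lambda>\<omega>. 4 * (g (i, c) \<omega> ^ 8 + g (i, d) \<omega> ^ 8) + 8)"
    using std_normal_power[OF dist[OF assms], of _ 8] by simp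
  note factor_measurable[OF assms, measurable]
  show i4: "integrable M (\<lambda>\<omega>. (g (i, c) \<omega> * g (i, d) \<omega> - of_bool (c = d)) ^ 4)"
  proof (rule Bochner_Integration.integrable_bound[OF int])
    show "AE \<omega> in M. norm ((g (i, c) \<omega> * g (i, d) \<omega> - of_bool (c = d)) ^ 4)
        \<le> norm (4 * (g (i, c) \<omega> ^ 8 + g (i, d) \<omega> ^ 8) + 8)"
      using le by (intro AE_I2) (simp add: power_even_abs order_trans[OF le abs_ge_self] del: of_bool_eq_iff)
  qed measurable
  have "expectation (\<lambda>\<omega>. (g (i, c) \<omega> * g (i, d) \<omega> - of_bool (c = d)) ^ 4)
      \<le> expectation (\<lambda>\<omega>. 4 * (g (i, c) \<omega> ^ 8 + g (i, d) \<omega> ^ 8) + 8)"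
    by (intro integral_mono i4 int le)
  also have "\<dots> = 8 * (std_normal_moment 8 + 1)"
    using std_normal_power[OF dist[OF assms], of _ 8] by (simp add: prob_space)
  finally show "expectation (\<lambda>\<omega>. (g (i, c) \<omega> * g (i, d) \<omega> - of_bool (c = d)) ^ 4) \<le> 8 * (std_normal_moment 8 + 1)" .
qed

text \<open>The double sum over time indices reduces to its diagonal, which leaves a single factor
  1/n. The constant 24 is the 3 of \<open>fourth_moment_sum\<close> times the 8 of
  \<open>product_error_pow4\<close>.\<close>

lemma empirical_cov_error_entry:
  shows "integrable M (\<lambda>\<omega>. empirical_cov_error n g \<omega> $ c $ d)"
    and "expectation (\<lambda>\<omega>. empirical_cov_error n g \<omega> $ c $ d) = 0"
    and "integrable M (\<lambda>\<omega>. empirical_cov_error n g \<omega> $ c $ d * empirical_cov_error n g \<omega> $ c' $ d')"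
    and "real n * expectation (\<lambda>\<omega>. empirical_cov_error n g \<omega> $ c $ d * empirical_cov_error n g \<omega> $ c' $ d')
      = of_bool (c = c') * of_bool (d = d') + of_bool (c = d') * of_bool (d = c')"
    and "integrable M (\<lambda>\<omega>. (empirical_cov_error n g \<omega> $ c $ d) ^ 4)"
    and "(real n)\<^sup>2 * expectation (\<lambda>\<omega>. (empirical_cov_error n g \<omega> $ c $ d) ^ 4) \<le> 24 * (std_normal_moment 8 + 1)"
proof -
  let ?x = "\<lambda>c d i \<omega>. g (i, c) \<omega> * g (i, d) \<omega> - of_bool (c = d)"
  note mean = product_error_mean
  show "integrable M (\<lambda>\<omega>. empirical_cov_error n g \<omega> $ c $ d)"
    unfolding empirical_cov_error_def vec_lambda_beta
    by (intro integrable_divide Bochner_Integration.integrable_sum mean(1)) simp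
  show "expectation (\<lambda>\<omega>. empirical_cov_error n g \<omega> $ c $ d) = 0"
  proof -
    have "expectation (\<lambda>\<omega>. \<Sum>i<n. ?x c d i \<omega>) = (\<Sum>i<n. expectation (?x c d i))"
      by (rule Bochner_Integration.integral_sum) (use mean(1) in auto)
    then show ?thesis
      unfolding empirical_cov_error_def by (simp add: mean(2))
  qed
  have prod: "empirical_cov_error n g \<omega> $ c $ d * empirical_cov_error n g \<omega> $ c' $ d'
      = (\<Sum>i<n. \<Sum>l<n. ?x c d i \<omega> * ?x c' d' l \<omega>) / (real n * real n)" for \<omega>
    by (simp add: empirical_cov_error_def sum_product)
  show "integrable M (\<lambda>\<omega>. empirical_cov_error n g \<omega> $ c $ d * empirical_cov_error n g \<omega> $ c' $ d')"
    unfolding prod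
    by (intro integrable_divide Bochner_Integration.integrable_sum product_error_covariance) auto
  have "expectation (\<lambda>\<omega>. empirical_cov_error n g \<omega> $ c $ d * empirical_cov_error n g \<omega> $ c' $ d')
      = (\<Sum>i<n. \<Sum>l<n. expectation (\<lambda>\<omega>. ?x c d i \<omega> * ?x c' d' l \<omega>)) / (real n * real n)"
  proof -
    have "expectation (\<lambda>\<omega>. \<Sum>i<n. \<Sum>l<n. ?x c d i \<omega> * ?x c' d' l \<omega>)
        = (\<Sum>i<n. expectation (\<lambda>\<omega>. \<Sum>l<n. ?x c d i \<omega> * ?x c' d' l \<omega>))"
      by (rule Bochner_Integration.integral_sum)
        (intro Bochner_Integration.integrable_sum product_error_covariance, auto)
    also have "\<dots> = (\<Sum>i<n. \<Sum>l<n. expectation (\<lambda>\<omega>. ?x c d i \<omega> * ?x c' d' l \<omega>))"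
      by (intro sum.cong refl Bochner_Integration.integral_sum product_error_covariance) auto
    finally show ?thesis unfolding prod by simp
  qed
  also have "\<dots> = (\<Sum>i<n. \<Sum>l<n. if i = l then of_bool (c = c') * of_bool (d = d') + of_bool (c = d') * of_bool (d = c') else 0)
      / (real n * real n)"
    by (intro arg_cong[where f="\<lambda>x. x / _"] sum.cong refl)
      (simp add: product_error_covariance(2) del: of_bool_eq_iff)
  also have "\<dots> = (of_bool (c = c') * of_bool (d = d') + of_bool (c = d') * of_bool (d = c')) / real n"
    using n by (simp add: sum.delta)
  finally show "real n * expectation (\<lambda>\<omega>. empirical_cov_error n g \<omega> $ c $ d * empirical_cov_error n g \<omega> $ c' $ d')
      = of_bool (c = c') * of_bool (d = d') + of_bool (c = d') * of_bool (d = c')"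
    using n by simp
  \<comment> \<open>Each summand uses only the coordinates with time index \<open>i\<close>;
    grouping an independent family along disjoint index sets preserves independence.\<close>
  have iv: "indep_vars (\<lambda>_. borel) (\<lambda>i. ?x c d i) {..<n}"
  proof -
    have "indep_vars (\<lambda>i. PiM ({i} \<times> UNIV) (\<lambda>_. borel)) (\<lambda>i \<omega>. restrict (\<lambda>k. g k \<omega>) ({i} \<times> UNIV)) {..<n}"
      by (rule indep_vars_restrict[OF indep]) (auto simp: disjoint_family_on_def)
    then have "indep_vars (\<lambda>_. borel)
        (\<lambda>i \<omega>. (\<lambda>f. f (i, c) * f (i, d) - of_bool (c = d)) (restrict (\<lambda>k. g k \<omega>) ({i} \<times> UNIV))) {..<n}"
      by (rule indep_vars_compose2) (auto intro!: borel_measurable_diff borel_measurable_times measurable_component_singleton)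
    then show ?thesis by simp
  qed
  have m0: "0 \<le> std_normal_moment 8"
    unfolding std_normal_moment_def by (intro Bochner_Integration.integral_nonneg) simp
  have S4: "integrable M (\<lambda>\<omega>. (\<Sum>i<n. ?x c d i \<omega>) ^ 4)"
    "expectation (\<lambda>\<omega>. (\<Sum>i<n. ?x c d i \<omega>) ^ 4) \<le> 3 * (real n)\<^sup>2 * (8 * (std_normal_moment 8 + 1))"
    using fourth_moment_sum[OF finite_lessThan iv, of "8 * (std_normal_moment 8 + 1)"]
      product_error_pow4 mean(2) m0 by (simp_all del: of_bool_eq_iff)
  have p4: "(empirical_cov_error n g \<omega> $ c $ d) ^ 4 = (\<Sum>i<n. ?x c d i \<omega>) ^ 4 / real n ^ 4" for \<omega>
    by (simp add: empirical_cov_error_def power_divide)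
  show "integrable M (\<lambda>\<omega>. (empirical_cov_error n g \<omega> $ c $ d) ^ 4)"
    unfolding p4 using S4(1) by (rule integrable_divide)
  have "(real n)\<^sup>2 * expectation (\<lambda>\<omega>. (empirical_cov_error n g \<omega> $ c $ d) ^ 4)
      = expectation (\<lambda>\<omega>. (\<Sum>i<n. ?x c d i \<omega>) ^ 4) / (real n)\<^sup>2"
    unfolding p4 using n by (simp add: field_simps power2_eq_square power4_eq_xxxx)
  also have "\<dots> \<le> 3 * (real n)\<^sup>2 * (8 * (std_normal_moment 8 + 1)) / (real n)\<^sup>2"
    by (rule divide_right_mono[OF S4(2)]) simp
  also have "\<dots> = 24 * (std_normal_moment 8 + 1)" using n by simp
  finally show "(real n)\<^sup>2 * expectation (\<lambda>\<omega>. (empirical_cov_error n g \<omega> $ c $ d) ^ 4) \<le> 24 * (std_normal_moment 8 + 1)" .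
qed

lemma empirical_cov_error_measurable:
  "empirical_cov_error n g \<in> borel_measurable M"
  unfolding empirical_cov_error_def
  by (intro borel_measurable_vec_lambda borel_measurable_divide borel_measurable_sum
      borel_measurable_diff borel_measurable_times factor_measurable) auto

text \<open>The two crossed pairings contribute A[B] and A[B^T]; symmetry of \<open>B\<close> merges
  them, which is the origin of the factor 2.\<close>

lemma empirical_cov_error_inner_covariance:
  fixes A B :: "real^'c^'c"
  assumes B: "transpose B = B"
  shows "real n * expectation (\<lambda>\<omega>. (A \<bullet> empirical_cov_error n g \<omega>) * (B \<bullet> empirical_cov_error n g \<omega>)) = 2 * (A \<bullet> B)"
proof -
  note E = empirical_cov_error_entry
  let ?Z = "empirical_cov_error n g"
  have prod: "(A \<bullet> ?Z \<omega>) * (B \<bullet> ?Z \<omega>) = (\<Sum>c\<in>UNIV. \<Sum>d\<in>UNIV. \<Sum>c'\<in>UNIV. \<Sum>d'\<in>UNIV.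
      (A $ c $ d * B $ c' $ d') * (?Z \<omega> $ c $ d * ?Z \<omega> $ c' $ d'))" for \<omega>
    unfolding inner_vec_def inner_real_def
    by (simp only: sum_distrib_right) (simp only: sum_distrib_left mult_ac)
  have "real n * expectation (\<lambda>\<omega>. (A \<bullet> ?Z \<omega>) * (B \<bullet> ?Z \<omega>)) =
    (\<Sum>c\<in>UNIV. \<Sum>d\<in>UNIV. \<Sum>c'\<in>UNIV. \<Sum>d'\<in>UNIV.
      (A $ c $ d * B $ c' $ d') * (real n * expectation (\<lambda>\<omega>. ?Z \<omega> $ c $ d * ?Z \<omega> $ c' $ d')))"
    unfolding prod using E(3) by (simp add: sum_distrib_left mult_ac)
  also have "\<dots> = (\<Sum>c\<in>UNIV. \<Sum>d\<in>UNIV. \<Sum>c'\<in>UNIV. \<Sum>d'\<in>UNIV.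
      (A $ c $ d * B $ c' $ d') * (of_bool (c = c') * of_bool (d = d') + of_bool (c = d') * of_bool (d = c')))"
    by (simp only: E(4))
  also have "\<dots> = (\<Sum>c\<in>UNIV. \<Sum>d\<in>UNIV. A $ c $ d * B $ c $ d + A $ c $ d * B $ d $ c)"
  proof (intro sum.cong refl)
    fix c d
    have "(\<Sum>c'\<in>UNIV. \<Sum>d'\<in>UNIV. (A $ c $ d * B $ c' $ d') * (of_bool (c = c') * of_bool (d = d') + of_bool (c = d') * of_bool (d = c')))
      = (\<Sum>c'\<in>UNIV. \<Sum>d'\<in>UNIV. if d = d' then (if c = c' then A $ c $ d * B $ c' $ d' else 0) else 0)
        + (\<Sum>c'\<in>UNIV. \<Sum>d'\<in>UNIV. if c = d' then (if d = c' then A $ c $ d * B $ c' $ d' else 0) else 0)"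
      by (simp only: sum.distrib[symmetric]) (intro sum.cong refl, simp add: distrib_left)
    also have "\<dots> = A $ c $ d * B $ c $ d + A $ c $ d * B $ d $ c"
      by simp
    finally show "(\<Sum>c'\<in>UNIV. \<Sum>d'\<in>UNIV. (A $ c $ d * B $ c' $ d') * (of_bool (c = c') * of_bool (d = d') + of_bool (c = d') * of_bool (d = c')))
      = A $ c $ d * B $ c $ d + A $ c $ d * B $ d $ c" .
  qed
  also have "\<dots> = 2 * (A \<bullet> B)"
  proof -
    have "B $ d $ c = B $ c $ d" for c d using B by (metis transpose_def vec_lambda_beta)
    then show ?thesis by (simp add: inner_vec_def sum_distrib_left)
  qed
  finally show ?thesis .
qed

text \<open>Transfers the entrywise moments to S Z S^T. The power |S|^8 is |S|^2 to the fourth; one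
  factor for the number of entries comes from \<open>norm_pow4_le_sum\<close>, the other from
  summing over the entries.\<close>

lemma congruence_empirical_cov_error:
  fixes S :: "real^'c^'p"
  defines "G \<equiv> \<lambda>\<omega>. S ** empirical_cov_error n g \<omega> ** transpose S"
  shows "G \<in> borel_measurable M"
    and "expectation G = 0"
    and "integrable M (\<lambda>\<omega>. norm (G \<omega>) ^ 4)"
    and "(real n)\<^sup>2 * expectation (\<lambda>\<omega>. norm (G \<omega>) ^ 4)
      \<le> (norm S) ^ 8 * (real (CARD('c) * CARD('c)))\<^sup>2 * (24 * (std_normal_moment 8 + 1))"
    and "transpose B = B \<Longrightarrow> real n * expectation (\<lambda>\<omega>. (A \<bullet> G \<omega>) * (B \<bullet> G \<omega>))
      = 2 * trace (A ** (S ** transpose S) ** B ** (S ** transpose S))"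
proof -
  note E = empirical_cov_error_entry
  let ?Z = "empirical_cov_error n g"
  have Zm [measurable]: "?Z \<in> borel_measurable M" by (rule empirical_cov_error_measurable)
  show Gm: "G \<in> borel_measurable M"
    unfolding G_def by (rule borel_measurable_continuous_on[OF _ Zm]) (intro continuous_intros)
  let ?N = "real (CARD('c) * CARD('c))"
  have G4: "norm (G \<omega>) ^ 4 \<le> norm S ^ 8 * ?N * (\<Sum>c\<in>UNIV. \<Sum>d\<in>UNIV. (?Z \<omega> $ c $ d) ^ 4)" for \<omega>
  proof -
    have "norm (G \<omega>) \<le> norm (S ** ?Z \<omega>) * norm (transpose S)"
      unfolding G_def by (rule norm_matrix_mult_le)
    also have "\<dots> \<le> (norm S * norm (?Z \<omega>)) * norm S"
      unfolding norm_transpose by (intro mult_right_mono norm_matrix_mult_le) simp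
    finally have "norm (G \<omega>) ^ 4 \<le> ((norm S * norm (?Z \<omega>)) * norm S) ^ 4" by (rule power_mono) simp
    also have "\<dots> = norm S ^ 8 * norm (?Z \<omega>) ^ 4"
      by (simp add: power_mult_distrib power_add[symmetric] mult_ac)
    also have "\<dots> \<le> norm S ^ 8 * (?N * (\<Sum>c\<in>UNIV. \<Sum>d\<in>UNIV. (?Z \<omega> $ c $ d) ^ 4))"
      by (intro mult_left_mono norm_pow4_le_sum) simp
    finally show ?thesis by (simp add: mult.assoc)
  qed
  have iU: "integrable M (\<lambda>\<omega>. norm S ^ 8 * ?N * (\<Sum>c\<in>UNIV. \<Sum>d\<in>UNIV. (?Z \<omega> $ c $ d) ^ 4))"
    by (intro integrable_mult_right Bochner_Integration.integrable_sum E(5))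
  show iG: "integrable M (\<lambda>\<omega>. norm (G \<omega>) ^ 4)"
  proof (rule Bochner_Integration.integrable_bound[OF iU])
    show "AE \<omega> in M. norm (norm (G \<omega>) ^ 4) \<le> norm (norm S ^ 8 * ?N * (\<Sum>c\<in>UNIV. \<Sum>d\<in>UNIV. (?Z \<omega> $ c $ d) ^ 4))"
    proof (rule AE_I2)
      fix \<omega>
      have "norm (norm (G \<omega>) ^ 4) = norm (G \<omega>) ^ 4" by simp
      then show "norm (norm (G \<omega>) ^ 4) \<le> norm (norm S ^ 8 * ?N * (\<Sum>c\<in>UNIV. \<Sum>d\<in>UNIV. (?Z \<omega> $ c $ d) ^ 4))"
        using order_trans[OF G4 abs_ge_self] by (simp only: real_norm_def)
    qed
  qed (use Gm in measurable)
  have "expectation (\<lambda>\<omega>. norm (G \<omega>) ^ 4) \<le> expectation (\<lambda>\<omega>. norm S ^ 8 * ?N * (\<Sum>c\<in>UNIV. \<Sum>d\<in>UNIV. (?Z \<omega> $ c $ d) ^ 4))"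
    by (intro integral_mono iG iU G4)
  also have "\<dots> = norm S ^ 8 * ?N * (\<Sum>c\<in>UNIV. \<Sum>d\<in>UNIV. expectation (\<lambda>\<omega>. (?Z \<omega> $ c $ d) ^ 4))"
    using E(5) by simp
  finally have "(real n)\<^sup>2 * expectation (\<lambda>\<omega>. norm (G \<omega>) ^ 4)
      \<le> (real n)\<^sup>2 * (norm S ^ 8 * ?N * (\<Sum>c\<in>UNIV. \<Sum>d\<in>UNIV. expectation (\<lambda>\<omega>. (?Z \<omega> $ c $ d) ^ 4)))"
    by (rule mult_left_mono) simp
  also have "\<dots> = norm S ^ 8 * ?N * (\<Sum>c\<in>UNIV. \<Sum>d\<in>UNIV. (real n)\<^sup>2 * expectation (\<lambda>\<omega>. (?Z \<omega> $ c $ d) ^ 4))"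
    by (simp only: sum_distrib_left mult_ac)
  also have "\<dots> \<le> norm S ^ 8 * ?N * (\<Sum>c\<in>(UNIV::'c set). \<Sum>d\<in>(UNIV::'c set). 24 * (std_normal_moment 8 + 1))"
    by (intro mult_left_mono sum_mono E(6)) simp_all
  also have "\<dots> = (norm S) ^ 8 * ?N\<^sup>2 * (24 * (std_normal_moment 8 + 1))"
    by (simp add: power2_eq_square)
  finally show "(real n)\<^sup>2 * expectation (\<lambda>\<omega>. norm (G \<omega>) ^ 4)
      \<le> (norm S) ^ 8 * ?N\<^sup>2 * (24 * (std_normal_moment 8 + 1))" .
  have inner: "A \<bullet> G \<omega> = (transpose S ** A ** S) \<bullet> ?Z \<omega>" for A :: "real^'p^'p" and \<omega>
    unfolding G_def by (rule inner_congruence)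
  show "expectation G = 0"
  proof -
    have iG1: "integrable M G"
      using integrable_power_if_integrable_power4[of "\<lambda>\<omega>. norm (G \<omega>)" 1] iG Gm
      by (simp add: integrable_norm_iff)
    have "b \<bullet> expectation G = 0" for b
    proof -
      have "b \<bullet> expectation G = expectation (\<lambda>\<omega>. b \<bullet> G \<omega>)"
        using iG1 by simp
      also have "\<dots> = expectation (\<lambda>\<omega>. \<Sum>c\<in>UNIV. \<Sum>d\<in>UNIV. (transpose S ** b ** S) $ c $ d * ?Z \<omega> $ c $ d)"
        unfolding inner by (simp add: inner_vec_def)
      also have "\<dots> = 0" using E(1,2) by simp
      finally show ?thesis .
    qed
    then show ?thesis by (metis inner_eq_zero_iff)
  qed
  show "real n * expectation (\<lambda>\<omega>. (A \<bullet> G \<omega>) * (B \<bullet> G \<omega>))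
      = 2 * trace (A ** (S ** transpose S) ** B ** (S ** transpose S))" if "transpose B = B"
    unfolding inner
    by (simp only: empirical_cov_error_inner_covariance[OF transpose_congruence[OF that]]
        inner_congruence_congruence[OF that])
qed

end

end

section \<open>The drift remainder in the quadratic covariation\<close>

definition outer :: "real^'m \<Rightarrow> real^'n \<Rightarrow> real^'n^'m" where
  "outer x y = (\<chi> i j. x $ i * y $ j)"

lemma bounded_bilinear_outer: "bounded_bilinear (outer :: real^'m \<Rightarrow> real^'n \<Rightarrow> real^'n^'m)"
  and norm_outer: "norm (outer (x :: real^'m) (y :: real^'n)) = norm x * norm y"
proof -
  have n: "norm (outer x y) = norm x * norm y" for x :: "real^'m" and y :: "real^'n"
  proof -
    have row: "outer x y $ i = (x $ i) *\<^sub>R y" for i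
      by (simp add: outer_def vec_eq_iff)
    have "(norm (outer x y))\<^sup>2 = (\<Sum>i\<in>UNIV. (x $ i)\<^sup>2 * (norm y)\<^sup>2)"
      by (simp add: norm_vec_def[of "outer x y"] L2_set_def sum_nonneg row power_mult_distrib)
    also have "\<dots> = (norm x)\<^sup>2 * (norm y)\<^sup>2"
      by (simp add: norm_vec_def[of x] L2_set_def sum_nonneg sum_distrib_right)
    finally show ?thesis
      by (metis norm_ge_zero power2_eq_imp_eq mult_nonneg_nonneg power_mult_distrib)
  qed
  then show "norm (outer x y) = norm x * norm y" .
  show "bounded_bilinear (outer :: real^'m \<Rightarrow> real^'n \<Rightarrow> real^'n^'m)"
  proof
    show "\<exists>K. \<forall>(x :: real^'m) (y :: real^'n). norm (outer x y) \<le> norm x * norm y * K"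
      by (intro exI[of _ 1]) (simp add: n)
  qed (simp_all add: outer_def vec_eq_iff algebra_simps)
qed

interpretation outer: bounded_bilinear "outer :: real^'m \<Rightarrow> real^'n \<Rightarrow> real^'n^'m"
  by (rule bounded_bilinear_outer)

lemma outer_square_eq_outer: "outer_square x = outer x x"
  by (simp add: outer_square_def outer_def)

lemma matrix_mult_outer: "A ** outer x y = outer (A *v x) y"
  by (simp add: outer_def matrix_matrix_mult_def matrix_vector_mult_def vec_eq_iff sum_distrib_right mult.assoc)

lemma outer_congruence: "S ** outer x x ** transpose S = outer (S *v x) (S *v x)"
  by (simp add: outer_def matrix_matrix_mult_def matrix_vector_mult_def transpose_def vec_eq_iff
      sum_distrib_left sum_distrib_right sum_product mult_ac)

lemma norm_pow4_vec_le_sum: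
  fixes x :: "real^'n"
  shows "norm x ^ 4 \<le> real CARD('n) * (\<Sum>i\<in>UNIV. (x $ i) ^ 4)"
proof -
  have "norm x ^ 4 = ((norm x)\<^sup>2)\<^sup>2" by (simp add: power_mult[symmetric])
  also have "(norm x)\<^sup>2 = (\<Sum>i\<in>UNIV. (x $ i)\<^sup>2)" by (simp add: norm_vec_def L2_set_def sum_nonneg)
  also have "(\<Sum>i\<in>UNIV. (x $ i)\<^sup>2)\<^sup>2 \<le> (\<Sum>i\<in>UNIV. ((x $ i)\<^sup>2)\<^sup>2) * real CARD('n)"
    by (rule sum_squared_le_sum_of_squares)
  finally show ?thesis by (simp add: mult.commute power_mult[symmetric])
qed

lemma power2_sum3_le: "(x + y + z)\<^sup>2 \<le> 3 * (x\<^sup>2 + y\<^sup>2 + z\<^sup>2 :: real)"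
proof -
  have "3 * (x\<^sup>2 + y\<^sup>2 + z\<^sup>2) - (x + y + z)\<^sup>2 = (x - y)\<^sup>2 + (y - z)\<^sup>2 + (x - z)\<^sup>2"
    by (simp add: power2_eq_square algebra_simps)
  moreover have "0 \<le> (x - y)\<^sup>2 + (y - z)\<^sup>2 + (x - z)\<^sup>2" by simp
  ultimately show ?thesis by argo
qed

context prob_space
begin

lemma integrable_mult_if_square_integrable:
  fixes X Y :: "'a \<Rightarrow> real"
  assumes [measurable]: "X \<in> borel_measurable M" "Y \<in> borel_measurable M"
    and "integrable M (\<lambda>\<omega>. (X \<omega>)\<^sup>2)" "integrable M (\<lambda>\<omega>. (Y \<omega>)\<^sup>2)"
  shows "integrable M (\<lambda>\<omega>. X \<omega> * Y \<omega>)"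
proof (rule Bochner_Integration.integrable_bound)
  show "integrable M (\<lambda>\<omega>. (X \<omega>)\<^sup>2 + (Y \<omega>)\<^sup>2)" using assms by simp
  have "\<bar>x * y\<bar> \<le> x\<^sup>2 + y\<^sup>2" for x y :: real
  proof -
    have "2 * \<bar>x * y\<bar> \<le> x\<^sup>2 + y\<^sup>2"
      using sum_squares_bound[of "\<bar>x\<bar>" "\<bar>y\<bar>"] by (simp add: abs_mult mult.assoc)
    moreover have "0 \<le> \<bar>x * y\<bar>" by simp
    ultimately show ?thesis by argo
  qed
  then show "AE \<omega> in M. norm (X \<omega> * Y \<omega>) \<le> norm ((X \<omega>)\<^sup>2 + (Y \<omega>)\<^sup>2)"
    by (intro AE_I2) simp
qed simp

text \<open>Discrete form of the Ito isometry: the past sum times \<open>b m\<close> is known before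
  the step, so it is independent of the centred \<open>g m\<close> and the cross term has mean 0.
  Second moments therefore grow like n instead of n^2.\<close>

lemma martingale_transform_second_moment:
  fixes F :: "nat \<Rightarrow> 'a measure" and g b :: "nat \<Rightarrow> 'a \<Rightarrow> real"
  assumes sub: "\<And>i. subalgebra M (F i)" and mono: "\<And>i j. i \<le> j \<Longrightarrow> sets (F i) \<subseteq> sets (F j)"
    and g: "\<And>i. i < n \<Longrightarrow> g i \<in> borel_measurable (F (Suc i))"
    and indep: "\<And>i. i < n \<Longrightarrow> indep_set (sets (F i)) {g i -` A \<inter> space M | A. A \<in> sets borel}"
    and g1: "\<And>i. i < n \<Longrightarrow> integrable M (g i)" "\<And>i. i < n \<Longrightarrow> expectation (g i) = 0"
    and b: "\<And>i. i < n \<Longrightarrow> b i \<in> borel_measurable (F i)"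
    and b2: "\<And>i. i < n \<Longrightarrow> integrable M (\<lambda>\<omega>. (b i \<omega>)\<^sup>2)"
    and gb2: "\<And>i. i < n \<Longrightarrow> integrable M (\<lambda>\<omega>. (g i \<omega> * b i \<omega>)\<^sup>2)"
      "\<And>i. i < n \<Longrightarrow> expectation (\<lambda>\<omega>. (g i \<omega> * b i \<omega>)\<^sup>2) \<le> K"
  shows "integrable M (\<lambda>\<omega>. (\<Sum>i<n. g i \<omega> * b i \<omega>)\<^sup>2)"
    and "expectation (\<lambda>\<omega>. (\<Sum>i<n. g i \<omega> * b i \<omega>)\<^sup>2) \<le> real n * K"
proof -
  have FM: "X \<in> borel_measurable M" if "X \<in> borel_measurable (F i)" for X :: "'a \<Rightarrow> real" and i
    using that sub[of i] measurable_from_subalg by blast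
  have FF: "X \<in> borel_measurable (F j)" if "X \<in> borel_measurable (F i)" "i \<le> j" for X :: "'a \<Rightarrow> real" and i j
  proof -
    have "subalgebra (F j) (F i)"
      using sub[of i] sub[of j] mono[OF that(2)] unfolding subalgebra_def by simp
    then show ?thesis using that(1) measurable_from_subalg by blast
  qed
  have "m \<le> n \<Longrightarrow> (\<lambda>\<omega>. \<Sum>i<m. g i \<omega> * b i \<omega>) \<in> borel_measurable (F m) \<and>
      integrable M (\<lambda>\<omega>. (\<Sum>i<m. g i \<omega> * b i \<omega>)\<^sup>2) \<and>
      expectation (\<lambda>\<omega>. (\<Sum>i<m. g i \<omega> * b i \<omega>)\<^sup>2) \<le> real m * K" for m
  proof (induction m)
    case (Suc m)
    let ?S = "\<lambda>\<omega>. \<Sum>i<m. g i \<omega> * b i \<omega>"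
    have m: "m < n" using Suc.prems by simp
    have IH: "?S \<in> borel_measurable (F m)" "integrable M (\<lambda>\<omega>. (?S \<omega>)\<^sup>2)" "expectation (\<lambda>\<omega>. (?S \<omega>)\<^sup>2) \<le> real m * K"
      using Suc by auto
    note [measurable] = FM[OF g[OF m]] FM[OF b[OF m]] FM[OF IH(1)]
    have Sb: "(\<lambda>\<omega>. ?S \<omega> * b m \<omega>) \<in> borel_measurable (F m)"
      using IH(1) b[OF m] by (rule borel_measurable_times)
    have iSb: "integrable M (\<lambda>\<omega>. ?S \<omega> * b m \<omega>)"
      by (rule integrable_mult_if_square_integrable) (use IH(2) b2[OF m] in auto)
    have iv: "indep_var borel (\<lambda>\<omega>. ?S \<omega> * b m \<omega>) borel (g m)"
      unfolding indep_var_def indep_vars_def2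
    proof
      show "\<forall>i\<in>UNIV. random_variable (case_bool borel borel i) (case_bool (\<lambda>\<omega>. ?S \<omega> * b m \<omega>) (g m) i)"
        by (auto split: bool.split)
      have "indep_sets (case_bool (sets (F m)) {g m -` A \<inter> space M | A. A \<in> sets borel}) UNIV"
        using indep[OF m] unfolding indep_set_def .
      then show "indep_sets (\<lambda>i. {case_bool (\<lambda>\<omega>. ?S \<omega> * b m \<omega>) (g m) i -` A \<inter> space M | A. A \<in> sets (case_bool borel borel i)}) UNIV"
      proof (rule indep_sets_mono_sets)
        fix i :: bool
        have "space (F m) = space M" using sub[of m] by (simp add: subalgebra_def)
        then have "{(\<lambda>\<omega>. ?S \<omega> * b m \<omega>) -` A \<inter> space M | A. A \<in> sets borel} \<subseteq> sets (F m)"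
          using measurable_sets[OF Sb] by auto
        then show "{case_bool (\<lambda>\<omega>. ?S \<omega> * b m \<omega>) (g m) i -` A \<inter> space M | A. A \<in> sets (case_bool borel borel i)}
            \<subseteq> case_bool (sets (F m)) {g m -` A \<inter> space M | A. A \<in> sets borel} i"
          by (cases i) auto
      qed
    qed
    have cross: "integrable M (\<lambda>\<omega>. (?S \<omega> * b m \<omega>) * g m \<omega>)" "expectation (\<lambda>\<omega>. (?S \<omega> * b m \<omega>) * g m \<omega>) = 0"
      using indep_var_integrable[OF iv iSb g1(1)[OF m]] indep_var_lebesgue_integral[OF iv iSb g1(1)[OF m]] g1(2)[OF m]
      by auto
    have sq: "(\<Sum>i<Suc m. g i \<omega> * b i \<omega>)\<^sup>2 = (?S \<omega>)\<^sup>2 + 2 * ((?S \<omega> * b m \<omega>) * g m \<omega>) + (g m \<omega> * b m \<omega>)\<^sup>2" for \<omega>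
      by (simp add: power2_sum)
    have "(\<lambda>\<omega>. \<Sum>i<Suc m. g i \<omega> * b i \<omega>) \<in> borel_measurable (F (Suc m))"
      using FF[OF IH(1), of "Suc m"] g[OF m] FF[OF b[OF m], of "Suc m"] by simp
    moreover have "integrable M (\<lambda>\<omega>. (\<Sum>i<Suc m. g i \<omega> * b i \<omega>)\<^sup>2)"
      unfolding sq by (intro Bochner_Integration.integrable_add integrable_mult_right IH(2) cross(1) gb2(1)[OF m])
    moreover have "expectation (\<lambda>\<omega>. (\<Sum>i<Suc m. g i \<omega> * b i \<omega>)\<^sup>2)
        = expectation (\<lambda>\<omega>. (?S \<omega>)\<^sup>2) + expectation (\<lambda>\<omega>. (g m \<omega> * b m \<omega>)\<^sup>2)"
      unfolding sq using IH(2) cross gb2(1)[OF m] by simp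
    then have "expectation (\<lambda>\<omega>. (\<Sum>i<Suc m. g i \<omega> * b i \<omega>)\<^sup>2) \<le> real (Suc m) * K"
      using IH(3) gb2(2)[OF m] by (simp add: algebra_simps)
    ultimately show ?case by blast
  qed simp
  from this[of n] show "integrable M (\<lambda>\<omega>. (\<Sum>i<n. g i \<omega> * b i \<omega>)\<^sup>2)"
    "expectation (\<lambda>\<omega>. (\<Sum>i<n. g i \<omega> * b i \<omega>)\<^sup>2) \<le> real n * K" by auto
qed

text \<open>Over one step of length h = T / n the noise \<open>U\<close> has size h^(1/2), and
  \<open>D\<close> is h times \<open>b i\<close>, known at the left end, plus \<rho> of size
  h^(3/2). Orthogonality handles the noise against \<open>b i\<close>; Cauchy-Schwarz handles the
  noise against \<rho> and the squares of \<open>D\<close>. Each of these sums has size h, whence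
  the order h^2 for the second moment.\<close>

lemma quadratic_covariation_remainder:
  fixes F :: "nat \<Rightarrow> 'a measure" and g :: "nat \<times> 'c::finite \<Rightarrow> 'a \<Rightarrow> real"
    and b \<rho> :: "nat \<Rightarrow> 'a \<Rightarrow> real^'p" and S :: "real^'c^'p" and T :: real
  assumes n: "1 \<le> n" and T: "0 < T"
    and sub: "\<And>i. subalgebra M (F i)" and mono: "\<And>i j. i \<le> j \<Longrightarrow> sets (F i) \<subseteq> sets (F j)"
    and gF: "\<And>i c. i < n \<Longrightarrow> g (i, c) \<in> borel_measurable (F (Suc i))"
    and indep: "\<And>i c. i < n \<Longrightarrow> indep_set (sets (F i)) {g (i, c) -` A \<inter> space M | A. A \<in> sets borel}"
    and dist: "\<And>i c. i < n \<Longrightarrow> distributed M lborel (g (i, c)) std_normal_density"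
    and bF: "\<And>i. i < n \<Longrightarrow> b i \<in> borel_measurable (F i)"
    and b4: "\<And>i. i < n \<Longrightarrow> integrable M (\<lambda>\<omega>. norm (b i \<omega>) ^ 4)"
      "\<And>i. i < n \<Longrightarrow> expectation (\<lambda>\<omega>. norm (b i \<omega>) ^ 4) \<le> K"
    and \<rho>M: "\<And>i. i < n \<Longrightarrow> \<rho> i \<in> borel_measurable M"
    and \<rho>4: "\<And>i. i < n \<Longrightarrow> integrable M (\<lambda>\<omega>. norm (\<rho> i \<omega>) ^ 4)"
      "\<And>i. i < n \<Longrightarrow> expectation (\<lambda>\<omega>. norm (\<rho> i \<omega>) ^ 4) \<le> K * (T / n) ^ 6"
  defines "U \<equiv> \<lambda>i \<omega>. sqrt (T / n) *\<^sub>R (S *v (\<chi> c. g (i, c) \<omega>))"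
    and "D \<equiv> \<lambda>i \<omega>. (T / n) *\<^sub>R b i \<omega> + \<rho> i \<omega>"
  defines "R \<equiv> \<lambda>\<omega>. (1 / T) *\<^sub>R (\<Sum>i<n. outer (U i \<omega>) (D i \<omega>) + outer (D i \<omega>) (U i \<omega>) + outer (D i \<omega>) (D i \<omega>))"
  shows "(1 / T) *\<^sub>R (\<Sum>i<n. outer_square (U i \<omega> + D i \<omega>))
      = S ** transpose S + S ** empirical_cov_error n g \<omega> ** transpose S + R \<omega>"
    and "R \<in> borel_measurable M"
    and "integrable M (\<lambda>\<omega>. (norm (R \<omega>))\<^sup>2)"
    and "expectation (\<lambda>\<omega>. (norm (R \<omega>))\<^sup>2) \<le> 3 / T\<^sup>2 *
      (2 * T * (norm S)\<^sup>2 * real CARD('c) * real CARD('p) * (3 + K) + 2 * (norm S)\<^sup>2 * T\<^sup>2 * (3 * (real CARD('c))\<^sup>2 + K)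
        + 8 * T\<^sup>2 * (K + K * T\<^sup>2)) * (T / n)\<^sup>2"
proof -
  define h where "h = T / n"
  have h: "0 < h" "real n * h = T" using n T by (simp_all add: h_def)
  have hT: "h \<le> T" using n T by (simp add: h_def field_simps)
  define G where "G i \<omega> = (\<chi> c. g (i, c) \<omega>)" for i \<omega>
  define s where "s = norm S"
  have s: "0 \<le> s" by (simp add: s_def)
  have gM [measurable]: "g (i, c) \<in> borel_measurable M" if "i < n" for i c
    using dist[OF that] by (simp add: distributed_def)
  have GM: "G i \<in> borel_measurable M" if "i < n" for i
    unfolding G_def using gM[OF that] by (rule borel_measurable_vec_lambda)
  have bM: "b i \<in> borel_measurable M" if "i < n" for i
    using measurable_from_subalg[OF sub bF[OF that]] .
  have K0: "0 \<le> K"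
  proof -
    have "0 \<le> expectation (\<lambda>\<omega>. norm (b 0 \<omega>) ^ 4)" by (intro Bochner_Integration.integral_nonneg) simp
    also have "\<dots> \<le> K" using b4(2)[of 0] n by simp
    finally show ?thesis .
  qed
  have U: "U i \<omega> = sqrt h *\<^sub>R (S *v G i \<omega>)" for i \<omega> by (simp add: U_def G_def h_def)
  have D: "D i \<omega> = h *\<^sub>R b i \<omega> + \<rho> i \<omega>" for i \<omega> by (simp add: D_def h_def)
  show "(1 / T) *\<^sub>R (\<Sum>i<n. outer_square (U i \<omega> + D i \<omega>))
      = S ** transpose S + S ** empirical_cov_error n g \<omega> ** transpose S + R \<omega>"
  proof -
    \<comment> \<open>Sum of outer squares minus n times the identity. Congruence by
      \<open>S\<close> and multiplication by h, with n h = T, then produce the two leading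
      terms.\<close>
    have Z: "real n *\<^sub>R empirical_cov_error n g \<omega> = (\<Sum>i<n. outer (G i \<omega>) (G i \<omega>)) - real n *\<^sub>R mat 1"
      using n by (simp add: vec_eq_iff empirical_cov_error_def outer_def G_def mat_def sum_subtractf if_distrib cong: if_cong)
    have "(\<Sum>i<n. outer (U i \<omega>) (U i \<omega>)) = h *\<^sub>R (\<Sum>i<n. S ** outer (G i \<omega>) (G i \<omega>) ** transpose S)"
      using h by (simp add: U outer.scaleR_left outer.scaleR_right outer_congruence scaleR_sum_right)
    also have "\<dots> = h *\<^sub>R (S ** (\<Sum>i<n. outer (G i \<omega>) (G i \<omega>)) ** transpose S)"
      by (simp add: matrix_mult.sum_left matrix_mult.sum_right)
    also have "(\<Sum>i<n. outer (G i \<omega>) (G i \<omega>)) = real n *\<^sub>R (empirical_cov_error n g \<omega> + mat 1)"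
      using Z by (simp add: scaleR_add_right)
    also have "h *\<^sub>R (S ** (real n *\<^sub>R (empirical_cov_error n g \<omega> + mat 1)) ** transpose S)
        = T *\<^sub>R (S ** empirical_cov_error n g \<omega> ** transpose S + S ** transpose S)"
      using h(2) by (simp add: matrix_mult.scaleR_left matrix_mult.scaleR_right matrix_mult.add_left
          matrix_mult.add_right mult.commute)
    finally have "(\<Sum>i<n. outer (U i \<omega>) (U i \<omega>)) = T *\<^sub>R (S ** empirical_cov_error n g \<omega> ** transpose S + S ** transpose S)" .
    moreover have "(\<Sum>i<n. outer_square (U i \<omega> + D i \<omega>)) = (\<Sum>i<n. outer (U i \<omega>) (U i \<omega>))
        + (\<Sum>i<n. outer (U i \<omega>) (D i \<omega>) + outer (D i \<omega>) (U i \<omega>) + outer (D i \<omega>) (D i \<omega>))"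
      by (simp add: outer_square_eq_outer outer.add_left outer.add_right sum.distrib)
    ultimately show ?thesis
      using T by (simp add: R_def scaleR_add_right)
  qed
  \<comment> \<open>Martingale part of the cross term: the noise against the drift frozen at the
    left end point.\<close>
  define A where "A \<omega> = (\<Sum>i<n. outer (G i \<omega>) (b i \<omega>))" for \<omega>
  have R_le: "norm (R \<omega>) \<le> (1 / T) * (2 * (h * sqrt h * s * norm (A \<omega>))
      + 2 * (sqrt h * s * (\<Sum>i<n. norm (G i \<omega>) * norm (\<rho> i \<omega>))) + (\<Sum>i<n. (norm (D i \<omega>))\<^sup>2))" for \<omega>
  proof -
    let ?UD = "\<Sum>i<n. outer (U i \<omega>) (D i \<omega>)"
    have tr: "outer x y = transpose (outer y x)" for x :: "real^'k" and y :: "real^'l"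
      by (simp add: outer_def transpose_def vec_eq_iff)
    have "(\<Sum>i<n. outer (D i \<omega>) (U i \<omega>)) = transpose ?UD"
      by (subst tr) (simp add: transpose_def vec_eq_iff)
    then have eq: "R \<omega> = (1 / T) *\<^sub>R (?UD + transpose ?UD + (\<Sum>i<n. outer (D i \<omega>) (D i \<omega>)))"
      by (simp add: R_def sum.distrib)
    have UD: "?UD = (h * sqrt h) *\<^sub>R (S ** A \<omega>) + sqrt h *\<^sub>R (\<Sum>i<n. S ** outer (G i \<omega>) (\<rho> i \<omega>))"
      by (simp add: A_def U D outer.add_right outer.scaleR_left outer.scaleR_right matrix_mult_outer
          matrix_mult.sum_right sum.distrib scaleR_sum_right mult.commute scaleR_add_right)
    have "norm ?UD \<le> h * sqrt h * s * norm (A \<omega>) + sqrt h * s * (\<Sum>i<n. norm (G i \<omega>) * norm (\<rho> i \<omega>))"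
    proof -
      have "norm ((h * sqrt h) *\<^sub>R (S ** A \<omega>)) \<le> h * sqrt h * (s * norm (A \<omega>))"
        using h mult_left_mono[OF norm_matrix_mult_le[of S "A \<omega>"], of "h * sqrt h"] by (simp add: s_def)
      moreover have "norm (sqrt h *\<^sub>R (\<Sum>i<n. S ** outer (G i \<omega>) (\<rho> i \<omega>)))
          \<le> sqrt h * (\<Sum>i<n. s * (norm (G i \<omega>) * norm (\<rho> i \<omega>)))"
      proof -
        have "norm (\<Sum>i<n. S ** outer (G i \<omega>) (\<rho> i \<omega>)) \<le> (\<Sum>i<n. s * (norm (G i \<omega>) * norm (\<rho> i \<omega>)))"
          unfolding s_def norm_outer[symmetric] by (intro sum_norm_le norm_matrix_mult_le)
        then show ?thesis using h by (simp add: mult_left_mono)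
      qed
      ultimately show ?thesis
        unfolding UD using norm_triangle_ineq[of "(h * sqrt h) *\<^sub>R (S ** A \<omega>)" "sqrt h *\<^sub>R (\<Sum>i<n. S ** outer (G i \<omega>) (\<rho> i \<omega>))"]
        by (simp add: sum_distrib_left mult.assoc)
    qed
    moreover have "norm (\<Sum>i<n. outer (D i \<omega>) (D i \<omega>)) \<le> (\<Sum>i<n. (norm (D i \<omega>))\<^sup>2)"
      by (intro sum_norm_le) (simp add: norm_outer power2_eq_square)
    moreover have "norm (?UD + transpose ?UD + (\<Sum>i<n. outer (D i \<omega>) (D i \<omega>)))
        \<le> norm ?UD + norm ?UD + norm (\<Sum>i<n. outer (D i \<omega>) (D i \<omega>))"
    proof -
      have "norm (X + Y + Z) \<le> norm X + norm Y + norm Z" for X Y Z :: "real^'p^'p"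
        using norm_triangle_ineq[of "X + Y" Z] norm_triangle_ineq[of X Y] by linarith
      from this[of ?UD "transpose ?UD"] show ?thesis by (simp only: norm_transpose)
    qed
    ultimately have "norm (?UD + transpose ?UD + (\<Sum>i<n. outer (D i \<omega>) (D i \<omega>)))
        \<le> 2 * (h * sqrt h * s * norm (A \<omega>))
      + 2 * (sqrt h * s * (\<Sum>i<n. norm (G i \<omega>) * norm (\<rho> i \<omega>))) + (\<Sum>i<n. (norm (D i \<omega>))\<^sup>2)"
      by argo
    then show ?thesis
      unfolding eq using T by (simp add: divide_right_mono)
  qed
  \<comment> \<open>Integrable majorant of |R|^2 built from sums with explicitly bounded
    expectations. The weight h^3 in the product of |G|^2 and |\<rho>|^2 balances the two sides:
    since E|\<rho>|^4 is of order h^6, both h^3 |G|^4 and |\<rho>|^4 / h^3 have order h^3.\<close>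
  define V where "V \<omega> = 3 / T\<^sup>2 * (4 * h ^ 3 * s\<^sup>2 * (\<Sum>c\<in>UNIV. \<Sum>a\<in>UNIV. (\<Sum>i<n. g (i, c) \<omega> * b i \<omega> $ a)\<^sup>2)
      + 4 * h * s\<^sup>2 * (real n * (\<Sum>i<n. 1/2 * (h ^ 3 * (real CARD('c) * (\<Sum>c\<in>UNIV. g (i, c) \<omega> ^ 4)) + norm (\<rho> i \<omega>) ^ 4 / h ^ 3)))
      + real n * (\<Sum>i<n. 8 * (h ^ 4 * norm (b i \<omega>) ^ 4 + norm (\<rho> i \<omega>) ^ 4)))" for \<omega>
  have RV: "(norm (R \<omega>))\<^sup>2 \<le> V \<omega>" for \<omega>
  proof -
    let ?x = "2 * (h * sqrt h * s * norm (A \<omega>))"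
    let ?y = "2 * (sqrt h * s * (\<Sum>i<n. norm (G i \<omega>) * norm (\<rho> i \<omega>)))"
    let ?z = "\<Sum>i<n. (norm (D i \<omega>))\<^sup>2"
    have "(norm (R \<omega>))\<^sup>2 \<le> ((1 / T) * (?x + ?y + ?z))\<^sup>2"
      by (rule power_mono[OF R_le]) simp
    also have "\<dots> = (1 / T\<^sup>2) * (?x + ?y + ?z)\<^sup>2"
      by (simp add: power_divide)
    also have "\<dots> \<le> (1 / T\<^sup>2) * (3 * (?x\<^sup>2 + ?y\<^sup>2 + ?z\<^sup>2))"
      by (intro mult_left_mono power2_sum3_le) simp
    also have "\<dots> = 3 / T\<^sup>2 * (?x\<^sup>2 + ?y\<^sup>2 + ?z\<^sup>2)" by simp
    also have "\<dots> \<le> V \<omega>"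
      unfolding V_def
    proof (intro mult_left_mono add_mono)
      have "(norm (A \<omega>))\<^sup>2 = (\<Sum>c\<in>UNIV. \<Sum>a\<in>UNIV. (\<Sum>i<n. g (i, c) \<omega> * b i \<omega> $ a)\<^sup>2)"
        by (simp add: norm_vec_def L2_set_def sum_nonneg A_def outer_def G_def)
      moreover have "?x\<^sup>2 = 4 * h ^ 3 * s\<^sup>2 * (norm (A \<omega>))\<^sup>2"
        using h by (simp add: power_mult_distrib power3_eq_cube power2_eq_square)
      ultimately show "?x\<^sup>2 \<le> 4 * h ^ 3 * s\<^sup>2 * (\<Sum>c\<in>UNIV. \<Sum>a\<in>UNIV. (\<Sum>i<n. g (i, c) \<omega> * b i \<omega> $ a)\<^sup>2)"
        by simp
      have "?y\<^sup>2 = 4 * h * s\<^sup>2 * (\<Sum>i<n. norm (G i \<omega>) * norm (\<rho> i \<omega>))\<^sup>2"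
        using h by (simp add: power_mult_distrib)
      also have "\<dots> \<le> 4 * h * s\<^sup>2 * (real n * (\<Sum>i<n. 1/2 * (h ^ 3 * (real CARD('c) * (\<Sum>c\<in>UNIV. g (i, c) \<omega> ^ 4)) + norm (\<rho> i \<omega>) ^ 4 / h ^ 3)))"
      proof (intro mult_left_mono)
        have "(\<Sum>i<n. norm (G i \<omega>) * norm (\<rho> i \<omega>))\<^sup>2 \<le> (\<Sum>i<n. (norm (G i \<omega>) * norm (\<rho> i \<omega>))\<^sup>2) * real n"
          using sum_squared_le_sum_of_squares[of "\<lambda>i. norm (G i \<omega>) * norm (\<rho> i \<omega>)" "{..<n}"] by simp
        also have "\<dots> \<le> (\<Sum>i<n. 1/2 * (h ^ 3 * (real CARD('c) * (\<Sum>c\<in>UNIV. g (i, c) \<omega> ^ 4)) + norm (\<rho> i \<omega>) ^ 4 / h ^ 3)) * real n"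
        proof (intro mult_right_mono sum_mono)
          fix i
          have "2 * ((norm (G i \<omega>))\<^sup>2 * (norm (\<rho> i \<omega>))\<^sup>2) \<le> h ^ 3 * ((norm (G i \<omega>))\<^sup>2)\<^sup>2 + ((norm (\<rho> i \<omega>))\<^sup>2)\<^sup>2 / h ^ 3"
            by (rule mult_le_weighted_squares) (use h in simp)
          then have "2 * (norm (G i \<omega>) * norm (\<rho> i \<omega>))\<^sup>2 \<le> h ^ 3 * norm (G i \<omega>) ^ 4 + norm (\<rho> i \<omega>) ^ 4 / h ^ 3"
            by (simp add: power_mult_distrib power_mult[symmetric])
          moreover have "h ^ 3 * norm (G i \<omega>) ^ 4 \<le> h ^ 3 * (real CARD('c) * (\<Sum>c\<in>UNIV. g (i, c) \<omega> ^ 4))"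
            using norm_pow4_vec_le_sum[of "G i \<omega>"] h by (intro mult_left_mono) (auto simp: G_def)
          ultimately show "(norm (G i \<omega>) * norm (\<rho> i \<omega>))\<^sup>2
              \<le> 1/2 * (h ^ 3 * (real CARD('c) * (\<Sum>c\<in>UNIV. g (i, c) \<omega> ^ 4)) + norm (\<rho> i \<omega>) ^ 4 / h ^ 3)"
            by argo
        qed simp
        finally show "(\<Sum>i<n. norm (G i \<omega>) * norm (\<rho> i \<omega>))\<^sup>2
            \<le> real n * (\<Sum>i<n. 1/2 * (h ^ 3 * (real CARD('c) * (\<Sum>c\<in>UNIV. g (i, c) \<omega> ^ 4)) + norm (\<rho> i \<omega>) ^ 4 / h ^ 3))"
          by (simp only: mult.commute)
      qed (use h in simp)
      finally show "?y\<^sup>2 \<le> 4 * h * s\<^sup>2 * (real n * (\<Sum>i<n. 1/2 * (h ^ 3 * (real CARD('c) * (\<Sum>c\<in>UNIV. g (i, c) \<omega> ^ 4)) + norm (\<rho> i \<omega>) ^ 4 / h ^ 3)))" .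
      have "?z\<^sup>2 \<le> (\<Sum>i<n. ((norm (D i \<omega>))\<^sup>2)\<^sup>2) * real n"
        using sum_squared_le_sum_of_squares[of "\<lambda>i. (norm (D i \<omega>))\<^sup>2" "{..<n}"] by simp
      also have "\<dots> \<le> (\<Sum>i<n. 8 * (h ^ 4 * norm (b i \<omega>) ^ 4 + norm (\<rho> i \<omega>) ^ 4)) * real n"
      proof (intro mult_right_mono sum_mono)
        fix i
        have "norm (D i \<omega>) \<le> h * norm (b i \<omega>) + norm (\<rho> i \<omega>)"
          unfolding D using h norm_triangle_ineq[of "h *\<^sub>R b i \<omega>" "\<rho> i \<omega>"] by simp
        then have "norm (D i \<omega>) ^ 4 \<le> (h * norm (b i \<omega>) + norm (\<rho> i \<omega>)) ^ 4"
          by (rule power_mono) simp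
        also have "\<dots> \<le> 8 * ((h * norm (b i \<omega>)) ^ 4 + norm (\<rho> i \<omega>) ^ 4)"
          by (rule power4_add_le)
        finally show "((norm (D i \<omega>))\<^sup>2)\<^sup>2 \<le> 8 * (h ^ 4 * norm (b i \<omega>) ^ 4 + norm (\<rho> i \<omega>) ^ 4)"
          by (simp add: power_mult_distrib power_mult[symmetric])
      qed simp
      finally show "?z\<^sup>2 \<le> real n * (\<Sum>i<n. 8 * (h ^ 4 * norm (b i \<omega>) ^ 4 + norm (\<rho> i \<omega>) ^ 4))"
        by (simp only: mult.commute)
    qed simp
    finally show ?thesis .
  qed
  have moment: "integrable M (\<lambda>\<omega>. g (i, c) \<omega> ^ k)" "expectation (\<lambda>\<omega>. g (i, c) \<omega> ^ k) = std_normal_moment k"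
    if "i < n" for i c k
    using std_normal_power[OF dist[OF that]] by auto
  have m4: "std_normal_moment 4 = 3"
    using std_normal_moment_simps(5) by (simp add: eval_nat_numeral)
  have comp4: "(b i \<omega> $ a) ^ 4 \<le> norm (b i \<omega>) ^ 4" for i \<omega> a
    using power_mono[OF component_le_norm_cart[of "b i \<omega>" a], of 4] by (simp add: power_even_abs)
  have ba: "(\<lambda>\<omega>. b i \<omega> $ a) \<in> borel_measurable (F i)" if "i < n" for i a
    using bF[OF that] by (rule borel_measurable_vec_nth)
  have baM [measurable]: "(\<lambda>\<omega>. b i \<omega> $ a) \<in> borel_measurable M" if "i < n" for i a
    using bM[OF that] by (rule borel_measurable_vec_nth)
  have ba4: "integrable M (\<lambda>\<omega>. (b i \<omega> $ a) ^ 4)" if "i < n" for i a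
    by (rule Bochner_Integration.integrable_bound[OF b4(1)[OF that]])
      (use baM[OF that] comp4 in \<open>auto simp: power_even_abs\<close>)
  \<comment> \<open>The product is separated by (g b)^2 <= (g^4 + |b|^4) / 2, with Gaussian fourth
    moment 3.\<close>
  have gb: "integrable M (\<lambda>\<omega>. (g (i, c) \<omega> * b i \<omega> $ a)\<^sup>2)"
    "expectation (\<lambda>\<omega>. (g (i, c) \<omega> * b i \<omega> $ a)\<^sup>2) \<le> (3 + K) / 2" if i: "i < n" for i c a
  proof -
    have le: "(g (i, c) \<omega> * b i \<omega> $ a)\<^sup>2 \<le> (g (i, c) \<omega> ^ 4 + norm (b i \<omega>) ^ 4) / 2" for \<omega>
    proof -
      have "2 * ((g (i, c) \<omega>)\<^sup>2 * (b i \<omega> $ a)\<^sup>2) \<le> g (i, c) \<omega> ^ 4 + (b i \<omega> $ a) ^ 4"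
        using sum_squares_bound[of "(g (i, c) \<omega>)\<^sup>2" "(b i \<omega> $ a)\<^sup>2"] by (simp add: power_mult[symmetric] mult.assoc)
      then have "(g (i, c) \<omega>)\<^sup>2 * (b i \<omega> $ a)\<^sup>2 \<le> (g (i, c) \<omega> ^ 4 + norm (b i \<omega>) ^ 4) / 2"
        using comp4[of i \<omega> a] by argo
      then show ?thesis by (simp add: power_mult_distrib)
    qed
    have int: "integrable M (\<lambda>\<omega>. (g (i, c) \<omega> ^ 4 + norm (b i \<omega>) ^ 4) / 2)"
      using moment(1)[OF i] b4(1)[OF i] by simp
    show 1: "integrable M (\<lambda>\<omega>. (g (i, c) \<omega> * b i \<omega> $ a)\<^sup>2)"
      by (rule Bochner_Integration.integrable_bound[OF int])
        (use gM[OF i] baM[OF i] le in \<open>auto intro!: AE_I2 order_trans[OF le]\<close>)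
    have "expectation (\<lambda>\<omega>. (g (i, c) \<omega> * b i \<omega> $ a)\<^sup>2) \<le> expectation (\<lambda>\<omega>. (g (i, c) \<omega> ^ 4 + norm (b i \<omega>) ^ 4) / 2)"
      by (intro integral_mono 1 int le)
    also have "\<dots> \<le> (3 + K) / 2"
      using moment[OF i] b4[OF i] by (simp add: m4)
    finally show "expectation (\<lambda>\<omega>. (g (i, c) \<omega> * b i \<omega> $ a)\<^sup>2) \<le> (3 + K) / 2" .
  qed
  have A: "integrable M (\<lambda>\<omega>. (\<Sum>i<n. g (i, c) \<omega> * b i \<omega> $ a)\<^sup>2)"
    "expectation (\<lambda>\<omega>. (\<Sum>i<n. g (i, c) \<omega> * b i \<omega> $ a)\<^sup>2) \<le> real n * ((3 + K) / 2)" for c a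
  proof -
    have g1: "integrable M (g (i, c))" "expectation (g (i, c)) = 0" if "i < n" for i
      using moment[OF that, of c 1] by (simp_all add: std_normal_moment_simps)
    have b2: "integrable M (\<lambda>\<omega>. (b i \<omega> $ a)\<^sup>2)" if "i < n" for i
      by (rule integrable_power_if_integrable_power4) (use ba4[OF that] baM[OF that] in auto)
    show "integrable M (\<lambda>\<omega>. (\<Sum>i<n. g (i, c) \<omega> * b i \<omega> $ a)\<^sup>2)"
      by (rule martingale_transform_second_moment(1)[where F = F and g = "\<lambda>i. g (i, c)" and
            b = "\<lambda>i \<omega>. b i \<omega> $ a" and n = n and K = "(3 + K) / 2", OF sub mono gF indep g1 ba b2 gb])
    show "expectation (\<lambda>\<omega>. (\<Sum>i<n. g (i, c) \<omega> * b i \<omega> $ a)\<^sup>2) \<le> real n * ((3 + K) / 2)"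
      by (rule martingale_transform_second_moment(2)[where F = F and g = "\<lambda>i. g (i, c)" and
            b = "\<lambda>i \<omega>. b i \<omega> $ a" and n = n and K = "(3 + K) / 2", OF sub mono gF indep g1 ba b2 gb])
  qed
  have iV: "integrable M V"
    unfolding V_def using A(1) moment(1) \<rho>4(1) b4(1)
    by (intro integrable_mult_right Bochner_Integration.integrable_add Bochner_Integration.integrable_sum integrable_divide) auto
  have DM: "D i \<in> borel_measurable M" if "i < n" for i
    unfolding D_def using bM[OF that] \<rho>M[OF that] by measurable
  have UM: "U i \<in> borel_measurable M" if "i < n" for i
  proof -
    have "(\<lambda>x. sqrt h *\<^sub>R (S *v x)) \<in> borel_measurable borel"
      by (intro borel_measurable_continuous_onI continuous_intros linear_continuous_on
          matrix_vector_mul_bounded_linear)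
    from measurable_compose[OF GM[OF that] this] show ?thesis
      by (simp add: U[abs_def])
  qed
  have cont_outer: "(\<lambda>p. outer (fst p) (snd p)) \<in> borel_measurable (borel :: ((real^'p) \<times> (real^'p)) measure)"
    by (intro borel_measurable_continuous_onI outer.continuous_on continuous_intros)
  have outerM: "(\<lambda>\<omega>. outer (X \<omega>) (Y \<omega>)) \<in> borel_measurable M"
    if "X \<in> borel_measurable M" "Y \<in> borel_measurable M" for X Y :: "'a \<Rightarrow> real^'p"
    using measurable_compose[OF borel_measurable_Pair[OF that] cont_outer] by simp
  show RM: "R \<in> borel_measurable M"
    unfolding R_def using DM UM
    by (intro borel_measurable_scaleR borel_measurable_const borel_measurable_sum borel_measurable_add outerM) auto
  show iR: "integrable M (\<lambda>\<omega>. (norm (R \<omega>))\<^sup>2)"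
    by (rule Bochner_Integration.integrable_bound[OF iV]) (use RM RV in \<open>auto intro!: AE_I2 order_trans[OF RV]\<close>)
  have "expectation (\<lambda>\<omega>. (norm (R \<omega>))\<^sup>2) \<le> expectation V"
    by (intro integral_mono iR iV RV)
  also have "expectation V = 3 / T\<^sup>2 * (4 * h ^ 3 * s\<^sup>2 * (\<Sum>c\<in>(UNIV::'c set). \<Sum>a\<in>(UNIV::'p set). expectation (\<lambda>\<omega>. (\<Sum>i<n. g (i, c) \<omega> * b i \<omega> $ a)\<^sup>2))
      + 4 * h * s\<^sup>2 * (real n * (\<Sum>i<n. 1/2 * (h ^ 3 * (real CARD('c) * (\<Sum>c\<in>(UNIV::'c set). 3)) + expectation (\<lambda>\<omega>. norm (\<rho> i \<omega>) ^ 4) / h ^ 3)))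
      + real n * (\<Sum>i<n. 8 * (h ^ 4 * expectation (\<lambda>\<omega>. norm (b i \<omega>) ^ 4) + expectation (\<lambda>\<omega>. norm (\<rho> i \<omega>) ^ 4))))"
  proof -
    have iG4: "integrable M (\<lambda>\<omega>. \<Sum>c\<in>UNIV. g (i, c) \<omega> ^ 4)" if "i < n" for i
      using moment(1)[OF that] by (intro Bochner_Integration.integrable_sum) auto
    have eG4: "expectation (\<lambda>\<omega>. \<Sum>c\<in>UNIV. g (i, c) \<omega> ^ 4) = (\<Sum>c\<in>(UNIV::'c set). 3)" if "i < n" for i
      using moment[OF that] by (subst Bochner_Integration.integral_sum) (auto simp: m4)
    have i1: "integrable M (\<lambda>\<omega>. 1/2 * (h ^ 3 * (real CARD('c) * (\<Sum>c\<in>UNIV. g (i, c) \<omega> ^ 4)) + norm (\<rho> i \<omega>) ^ 4 / h ^ 3))"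
      and i2: "integrable M (\<lambda>\<omega>. 8 * (h ^ 4 * norm (b i \<omega>) ^ 4 + norm (\<rho> i \<omega>) ^ 4))"
      and e1: "expectation (\<lambda>\<omega>. 1/2 * (h ^ 3 * (real CARD('c) * (\<Sum>c\<in>UNIV. g (i, c) \<omega> ^ 4)) + norm (\<rho> i \<omega>) ^ 4 / h ^ 3))
        = 1/2 * (h ^ 3 * (real CARD('c) * (\<Sum>c\<in>(UNIV::'c set). 3)) + expectation (\<lambda>\<omega>. norm (\<rho> i \<omega>) ^ 4) / h ^ 3)"
      and e2: "expectation (\<lambda>\<omega>. 8 * (h ^ 4 * norm (b i \<omega>) ^ 4 + norm (\<rho> i \<omega>) ^ 4))
        = 8 * (h ^ 4 * expectation (\<lambda>\<omega>. norm (b i \<omega>) ^ 4) + expectation (\<lambda>\<omega>. norm (\<rho> i \<omega>) ^ 4))"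
      if "i < n" for i
      using iG4[OF that] eG4[OF that] \<rho>4(1)[OF that] b4(1)[OF that] by simp_all
    have S1: "integrable M (\<lambda>\<omega>. \<Sum>c\<in>(UNIV::'c set). \<Sum>a\<in>(UNIV::'p set). (\<Sum>i<n. g (i, c) \<omega> * b i \<omega> $ a)\<^sup>2)"
      "expectation (\<lambda>\<omega>. \<Sum>c\<in>(UNIV::'c set). \<Sum>a\<in>(UNIV::'p set). (\<Sum>i<n. g (i, c) \<omega> * b i \<omega> $ a)\<^sup>2)
        = (\<Sum>c\<in>(UNIV::'c set). \<Sum>a\<in>(UNIV::'p set). expectation (\<lambda>\<omega>. (\<Sum>i<n. g (i, c) \<omega> * b i \<omega> $ a)\<^sup>2))"
      using A(1) by simp_all
    have SUM: "integrable M (\<lambda>\<omega>. \<Sum>i<n. f i \<omega>)" "expectation (\<lambda>\<omega>. \<Sum>i<n. f i \<omega>) = (\<Sum>i<n. e i)"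
      if "\<And>i. i < n \<Longrightarrow> integrable M (f i)" "\<And>i. i < n \<Longrightarrow> expectation (f i) = e i" for f e
      using that by (auto intro!: Bochner_Integration.integrable_sum simp: Bochner_Integration.integral_sum)
    have S2: "integrable M (\<lambda>\<omega>. \<Sum>i<n. 1/2 * (h ^ 3 * (real CARD('c) * (\<Sum>c\<in>UNIV. g (i, c) \<omega> ^ 4)) + norm (\<rho> i \<omega>) ^ 4 / h ^ 3))"
      "expectation (\<lambda>\<omega>. \<Sum>i<n. 1/2 * (h ^ 3 * (real CARD('c) * (\<Sum>c\<in>UNIV. g (i, c) \<omega> ^ 4)) + norm (\<rho> i \<omega>) ^ 4 / h ^ 3))
        = (\<Sum>i<n. 1/2 * (h ^ 3 * (real CARD('c) * (\<Sum>c\<in>(UNIV::'c set). 3)) + expectation (\<lambda>\<omega>. norm (\<rho> i \<omega>) ^ 4) / h ^ 3))"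
      by (rule SUM[OF i1 e1]; assumption)+
    have S3: "integrable M (\<lambda>\<omega>. \<Sum>i<n. 8 * (h ^ 4 * norm (b i \<omega>) ^ 4 + norm (\<rho> i \<omega>) ^ 4))"
      "expectation (\<lambda>\<omega>. \<Sum>i<n. 8 * (h ^ 4 * norm (b i \<omega>) ^ 4 + norm (\<rho> i \<omega>) ^ 4))
        = (\<Sum>i<n. 8 * (h ^ 4 * expectation (\<lambda>\<omega>. norm (b i \<omega>) ^ 4) + expectation (\<lambda>\<omega>. norm (\<rho> i \<omega>) ^ 4)))"
      by (rule SUM[OF i2 e2]; assumption)+
    show ?thesis
      unfolding V_def S2(2)[symmetric] S3(2)[symmetric] S1(2)[symmetric] using S1(1) S2(1) S3(1) by (simp only: Bochner_Integration.integral_add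
          Bochner_Integration.integrable_add integrable_mult_right integral_mult_right_zero)
  qed
  also have "\<dots> \<le> 3 / T\<^sup>2 * (4 * h ^ 3 * s\<^sup>2 * (\<Sum>c\<in>(UNIV::'c set). \<Sum>a\<in>(UNIV::'p set). real n * ((3 + K) / 2))
      + 4 * h * s\<^sup>2 * (real n * (\<Sum>i<n. 1/2 * (h ^ 3 * (real CARD('c) * (\<Sum>c\<in>(UNIV::'c set). 3)) + (K * h ^ 6) / h ^ 3)))
      + real n * (\<Sum>i<n. 8 * (h ^ 4 * K + K * h ^ 6)))"
    using h(1) A(2) \<rho>4(2) b4(2) unfolding h_def[symmetric]
    by (intro mult_left_mono add_mono sum_mono divide_right_mono) auto
  \<comment> \<open>Every factor n is paired with one h, so that n h = T can be substituted and h^2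
    remains in each term.\<close>
  also have "\<dots> = 3 / T\<^sup>2 * (2 * h\<^sup>2 * (real n * h) * s\<^sup>2 * real CARD('c) * real CARD('p) * (3 + K)
      + 2 * s\<^sup>2 * (real n * h)\<^sup>2 * (3 * (real CARD('c))\<^sup>2 + K) * h\<^sup>2 + 8 * (real n * h)\<^sup>2 * (K + K * h\<^sup>2) * h\<^sup>2)"
    by (rule arg_cong[where f = "\<lambda>x. 3 / T\<^sup>2 * x"])
      (use h(1) in \<open>simp add: power2_eq_square power3_eq_cube eval_nat_numeral field_simps\<close>)
  also have "\<dots> = 3 / T\<^sup>2 * (2 * h\<^sup>2 * T * s\<^sup>2 * real CARD('c) * real CARD('p) * (3 + K)
      + 2 * s\<^sup>2 * T\<^sup>2 * (3 * (real CARD('c))\<^sup>2 + K) * h\<^sup>2 + 8 * T\<^sup>2 * (K + K * h\<^sup>2) * h\<^sup>2)"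
    by (simp only: h(2))
  also have "\<dots> \<le> 3 / T\<^sup>2 * (2 * h\<^sup>2 * T * s\<^sup>2 * real CARD('c) * real CARD('p) * (3 + K)
      + 2 * s\<^sup>2 * T\<^sup>2 * (3 * (real CARD('c))\<^sup>2 + K) * h\<^sup>2 + 8 * T\<^sup>2 * (K + K * T\<^sup>2) * h\<^sup>2)"
    using K0 hT h(1) by (intro mult_left_mono add_mono mult_right_mono power_mono order_refl) auto
  also have "\<dots> = 3 / T\<^sup>2 * (2 * T * s\<^sup>2 * real CARD('c) * real CARD('p) * (3 + K)
      + 2 * s\<^sup>2 * T\<^sup>2 * (3 * (real CARD('c))\<^sup>2 + K) + 8 * T\<^sup>2 * (K + K * T\<^sup>2)) * h\<^sup>2"
    by (simp add: distrib_left distrib_right mult_ac)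
  finally show "expectation (\<lambda>\<omega>. (norm (R \<omega>))\<^sup>2) \<le> 3 / T\<^sup>2 *
      (2 * T * (norm S)\<^sup>2 * real CARD('c) * real CARD('p) * (3 + K) + 2 * (norm S)\<^sup>2 * T\<^sup>2 * (3 * (real CARD('c))\<^sup>2 + K)
        + 8 * T\<^sup>2 * (K + K * T\<^sup>2)) * (T / n)\<^sup>2"
    by (simp add: s_def h_def)
qed

end

section \<open>Increments of diffusions\<close>

text \<open>Uniform continuity makes the error on each of the N pieces at most e h, hence at most
  e(b - a) in total. For a process, these finite sums of point values are random variables even if
  nothing is known about joint measurability.\<close>

lemma riemann_sums_tendsto_integral:
  fixes f :: "real \<Rightarrow> 'b::euclidean_space"
  assumes ab: "a \<le> b" and cont: "continuous_on {a..b} f"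
  shows "(\<lambda>N. ((b - a) / real N) *\<^sub>R (\<Sum>k<N. f (a + real k * ((b - a) / real N)))) \<longlonglongrightarrow> integral {a..b} f"
proof (rule LIMSEQ_I)
  fix r :: real assume r: "0 < r"
  define e where "e = r / (2 * (b - a + 1))"
  have e: "0 < e" "e * (b - a) < r"
  proof -
    show "0 < e" using r ab by (simp add: e_def)
    have "(b - a) / (2 * (b - a + 1)) < 1" using ab by (subst divide_less_eq_1_pos) auto
    then have "r * ((b - a) / (2 * (b - a + 1))) < r * 1" by (rule mult_strict_left_mono[OF _ r])
    then show "e * (b - a) < r" by (simp add: e_def)
  qed
  have "uniformly_continuous_on {a..b} f"
    by (rule compact_uniformly_continuous[OF cont]) simp
  then obtain d where d: "0 < d" "\<And>x y. x \<in> {a..b} \<Longrightarrow> y \<in> {a..b} \<Longrightarrow> dist x y < d \<Longrightarrow> dist (f x) (f y) < e"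
    using e(1) unfolding uniformly_continuous_on_def by metis
  obtain N0 where N0: "(b - a) / d < real N0" using reals_Archimedean2 by blast
  show "\<exists>no. \<forall>N\<ge>no. norm (((b - a) / real N) *\<^sub>R (\<Sum>k<N. f (a + real k * ((b - a) / real N))) - integral {a..b} f) < r"
  proof (intro exI[of _ "Suc N0"] allI impI)
    fix N assume N: "Suc N0 \<le> N"
    then have N1: "0 < real N" by simp
    define h where "h = (b - a) / real N"
    have h: "0 \<le> h" "real N * h = b - a" using ab N1 by (simp_all add: h_def)
    have hd: "h < d"
    proof -
      have "(b - a) / d < real N" using N0 N by linarith
      then show ?thesis using d(1) N1 by (simp add: h_def field_simps)
    qed
    define x where "x k = a + real k * h" for k
    have x_in: "x k \<in> {a..b}" if "k \<le> N" for k
    proof -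
      have "real k * h \<le> real N * h" using that h(1) by (intro mult_right_mono) auto
      then show ?thesis using h by (simp add: x_def)
    qed
    have xS: "x (Suc k) = x k + h" for k by (simp add: x_def algebra_simps)
    have int: "f integrable_on {u..v}" if "a \<le> u" "v \<le> b" for u v
      by (rule integrable_continuous_real[OF continuous_on_subset[OF cont]]) (use that in auto)
    have piece: "norm (integral {a..x (Suc k)} f - integral {a..x k} f - h *\<^sub>R f (x k)) \<le> e * h"
      if k: "k < N" for k
    proof -
      have xk: "a \<le> x k" "x k \<le> x (Suc k)" "x (Suc k) \<le> b"
        using x_in[of k] x_in[of "Suc k"] k h(1) by (auto simp: xS)
      have c1: "integral {a..x k} f + integral {x k..x (Suc k)} f = integral {a..x (Suc k)} f"
        by (rule Henstock_Kurzweil_Integration.integral_combine[OF xk(1,2) int]) (use xk in auto)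
      have c2: "integral {x k..x (Suc k)} (\<lambda>u. f u - f (x k)) = integral {x k..x (Suc k)} f - h *\<^sub>R f (x k)"
        using int[OF xk(1,3)] h(1) by (subst Henstock_Kurzweil_Integration.integral_diff) (auto simp: xS)
      have c3: "norm (integral {x k..x (Suc k)} (\<lambda>u. f u - f (x k))) \<le> e * (x (Suc k) - x k)"
      proof (rule integral_bound)
        show "continuous_on {x k..x (Suc k)} (\<lambda>u. f u - f (x k))"
          by (intro continuous_intros continuous_on_subset[OF cont]) (use xk in auto)
        fix u assume u: "u \<in> {x k..x (Suc k)}"
        then have "dist u (x k) < d" using hd by (auto simp: dist_real_def xS)
        then show "norm (f u - f (x k)) \<le> e"
          using d(2)[of u "x k"] u xk by (auto simp: dist_norm intro!: less_imp_le)
      qed (use xk in auto)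
      have "integral {a..x (Suc k)} f - integral {a..x k} f - h *\<^sub>R f (x k)
          = integral {x k..x (Suc k)} (\<lambda>u. f u - f (x k))"
        unfolding c2 c1[symmetric] by simp
      moreover have "x (Suc k) - x k = h" by (simp add: xS)
      ultimately show ?thesis using c3 by simp
    qed
    have xN: "x N = b" "x 0 = a" using h by (simp_all add: x_def)
    have "integral {a..b} f - h *\<^sub>R (\<Sum>k<N. f (x k))
        = (\<Sum>k<N. integral {a..x (Suc k)} f - integral {a..x k} f - h *\<^sub>R f (x k))"
      using sum_lessThan_telescope[of "\<lambda>k. integral {a..x k} f" N]
      by (simp add: sum_subtractf scaleR_sum_right xN)
    also have "norm \<dots> \<le> (\<Sum>k<N. e * h)"
      by (rule sum_norm_le) (use piece in auto)
    also have "\<dots> = e * (b - a)" using h(2) by simp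
    also have "\<dots> < r" by (rule e(2))
    finally show "norm (((b - a) / real N) *\<^sub>R (\<Sum>k<N. f (a + real k * ((b - a) / real N))) - integral {a..b} f) < r"
      by (simp add: norm_minus_commute h_def x_def)
  qed
qed

text \<open>Cauchy-Schwarz applied twice; the third power of the number of terms later cancels
  against the mesh of the Riemann sums.\<close>

lemma sum_pow4_le:
  fixes a :: "'i \<Rightarrow> real"
  shows "(\<Sum>k\<in>I. a k) ^ 4 \<le> real (card I) ^ 3 * (\<Sum>k\<in>I. a k ^ 4)"
proof -
  have "(\<Sum>k\<in>I. a k) ^ 4 = ((\<Sum>k\<in>I. a k)\<^sup>2)\<^sup>2" by (simp add: power_mult[symmetric])
  also have "\<dots> \<le> ((\<Sum>k\<in>I. (a k)\<^sup>2) * real (card I))\<^sup>2"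
    by (intro power_mono sum_squared_le_sum_of_squares) simp
  also have "\<dots> = (\<Sum>k\<in>I. (a k)\<^sup>2)\<^sup>2 * (real (card I))\<^sup>2" by (simp add: power_mult_distrib)
  also have "\<dots> \<le> ((\<Sum>k\<in>I. ((a k)\<^sup>2)\<^sup>2) * real (card I)) * (real (card I))\<^sup>2"
    by (intro mult_right_mono sum_squared_le_sum_of_squares) simp
  also have "(\<Sum>k\<in>I. ((a k)\<^sup>2)\<^sup>2) = (\<Sum>k\<in>I. a k ^ 4)" by (simp add: power_mult[symmetric])
  finally show ?thesis
    by (simp add: power2_eq_square power3_eq_cube mult_ac)
qed

context prob_space
begin

text \<open>Fatou's lemma along Riemann sums, which avoids joint measurability of the integrand.\<close>

lemma nn_integral_time_integral_pow4_le:
  fixes f :: "real \<Rightarrow> 'a \<Rightarrow> 'b::euclidean_space"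
  assumes ab: "a \<le> b"
    and meas: "\<And>u. u \<in> {a..b} \<Longrightarrow> f u \<in> borel_measurable M"
    and int: "AE \<omega> in M. continuous_on {a..b} (\<lambda>u. f u \<omega>) \<and> ((\<lambda>u. f u \<omega>) has_integral I \<omega>) {a..b}"
    and bound: "\<And>u. u \<in> {a..b} \<Longrightarrow> (\<integral>\<^sup>+\<omega>. ennreal (norm (f u \<omega>) ^ 4) \<partial>M) \<le> ennreal K"
    and K: "0 \<le> K"
  shows "(\<integral>\<^sup>+\<omega>. ennreal (norm (I \<omega>) ^ 4) \<partial>M) \<le> ennreal ((b - a) ^ 4 * K)"
proof -
  define u where "u N k = a + real k * ((b - a) / real N)" for N k
  have u: "u N k \<in> {a..b}" if "k < N" for N k
  proof -
    have "real k * ((b - a) / real N) \<le> real N * ((b - a) / real N)"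
      using that ab by (intro mult_right_mono) auto
    then show ?thesis using that ab by (simp add: u_def)
  qed
  define R where "R N \<omega> = ((b - a) / real N) *\<^sub>R (\<Sum>k<N. f (u N k) \<omega>)" for N \<omega>
  have [measurable]: "R N \<in> borel_measurable M" for N
    unfolding R_def using meas u by (intro borel_measurable_scaleR borel_measurable_const borel_measurable_sum) auto
  have "AE \<omega> in M. ennreal (norm (I \<omega>) ^ 4) \<le> liminf (\<lambda>N. ennreal (norm (R N \<omega>) ^ 4))"
    using int
  proof eventually_elim
    case (elim \<omega>)
    have "(\<lambda>N. R N \<omega>) \<longlonglongrightarrow> integral {a..b} (\<lambda>u. f u \<omega>)"
      unfolding R_def u_def using elim by (intro riemann_sums_tendsto_integral ab) auto
    moreover have "integral {a..b} (\<lambda>u. f u \<omega>) = I \<omega>" using elim by (intro integral_unique) auto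
    ultimately have "(\<lambda>N. ennreal (norm (R N \<omega>) ^ 4)) \<longlonglongrightarrow> ennreal (norm (I \<omega>) ^ 4)"
      by (intro tendsto_ennrealI tendsto_intros) simp
    then have "liminf (\<lambda>N. ennreal (norm (R N \<omega>) ^ 4)) = ennreal (norm (I \<omega>) ^ 4)"
      by (rule lim_imp_Liminf[OF sequentially_bot])
    then show ?case by (rule eq_refl[OF sym])
  qed
  then have "(\<integral>\<^sup>+\<omega>. ennreal (norm (I \<omega>) ^ 4) \<partial>M) \<le> (\<integral>\<^sup>+\<omega>. liminf (\<lambda>N. ennreal (norm (R N \<omega>) ^ 4)) \<partial>M)"
    by (rule nn_integral_mono_AE)
  also have "\<dots> \<le> liminf (\<lambda>N. \<integral>\<^sup>+\<omega>. ennreal (norm (R N \<omega>) ^ 4) \<partial>M)"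
    by (rule nn_integral_liminf) measurable
  also have "\<dots> \<le> liminf (\<lambda>N. ennreal ((b - a) ^ 4 * K))"
  proof (rule Liminf_mono, rule eventually_sequentiallyI[of 1])
    fix N :: nat assume N: "1 \<le> N"
    let ?h = "(b - a) / real N"
    have h: "0 \<le> ?h" using ab by simp
    \<comment> \<open>With mesh (b - a)/N the factor is (b - a)^4 / N, and the N summands bounded by
      K restore (b - a)^4 K, independently of N.\<close>
    have "norm (R N \<omega>) ^ 4 \<le> ?h ^ 4 * real N ^ 3 * (\<Sum>k<N. norm (f (u N k) \<omega>) ^ 4)" for \<omega>
    proof -
      have "norm (R N \<omega>) \<le> ?h * (\<Sum>k<N. norm (f (u N k) \<omega>))"
        unfolding R_def using h ab by (simp add: mult_left_mono norm_sum divide_right_mono)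
      then have "norm (R N \<omega>) ^ 4 \<le> (?h * (\<Sum>k<N. norm (f (u N k) \<omega>))) ^ 4" by (rule power_mono) simp
      also have "\<dots> = ?h ^ 4 * (\<Sum>k<N. norm (f (u N k) \<omega>)) ^ 4" by (rule power_mult_distrib)
      also have "\<dots> \<le> ?h ^ 4 * (real (card {..<N}) ^ 3 * (\<Sum>k<N. norm (f (u N k) \<omega>) ^ 4))"
        by (intro mult_left_mono sum_pow4_le) simp
      finally show ?thesis by simp
    qed
    then have "(\<integral>\<^sup>+\<omega>. ennreal (norm (R N \<omega>) ^ 4) \<partial>M)
        \<le> (\<integral>\<^sup>+\<omega>. ennreal (?h ^ 4 * real N ^ 3) * (\<Sum>k<N. ennreal (norm (f (u N k) \<omega>) ^ 4)) \<partial>M)"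
      by (intro nn_integral_mono) (simp add: sum_ennreal ennreal_mult'[symmetric] ab ennreal_leI)
    also have "\<dots> = ennreal (?h ^ 4 * real N ^ 3) * (\<Sum>k<N. \<integral>\<^sup>+\<omega>. ennreal (norm (f (u N k) \<omega>) ^ 4) \<partial>M)"
    proof -
      have m: "(\<lambda>\<omega>. ennreal (norm (f (u N k) \<omega>) ^ 4)) \<in> borel_measurable M" if "k < N" for k
        using meas[OF u[OF that]] by measurable
      have "(\<integral>\<^sup>+\<omega>. (\<Sum>k<N. ennreal (norm (f (u N k) \<omega>) ^ 4)) \<partial>M) = (\<Sum>k<N. \<integral>\<^sup>+\<omega>. ennreal (norm (f (u N k) \<omega>) ^ 4) \<partial>M)"
        by (rule nn_integral_sum, rule m, simp)
      moreover have "(\<integral>\<^sup>+\<omega>. ennreal (?h ^ 4 * real N ^ 3) * (\<Sum>k<N. ennreal (norm (f (u N k) \<omega>) ^ 4)) \<partial>M)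
          = ennreal (?h ^ 4 * real N ^ 3) * (\<integral>\<^sup>+\<omega>. (\<Sum>k<N. ennreal (norm (f (u N k) \<omega>) ^ 4)) \<partial>M)"
        by (rule nn_integral_cmult, rule borel_measurable_sum, rule m, simp)
      ultimately show ?thesis by (simp only:)
    qed
    also have "\<dots> \<le> ennreal (?h ^ 4 * real N ^ 3) * (\<Sum>k<N. ennreal K)"
      using bound u by (intro mult_left_mono sum_mono) auto
    also have "\<dots> = ennreal (?h ^ 4 * real N ^ 3 * (real N * K))"
      using K ab by (simp add: ennreal_mult'[symmetric] ennreal_of_nat_eq_real_of_nat mult_ac)
    also have "?h ^ 4 * real N ^ 3 * (real N * K) = (b - a) ^ 4 * K"
      using N by (simp add: field_simps power4_eq_xxxx power3_eq_cube)
    finally show "(\<integral>\<^sup>+\<omega>. ennreal (norm (R N \<omega>) ^ 4) \<partial>M) \<le> ennreal ((b - a) ^ 4 * K)" .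
  qed
  also have "\<dots> = ennreal ((b - a) ^ 4 * K)"
    by (intro lim_imp_Liminf sequentially_bot tendsto_const)
  finally show ?thesis .
qed

lemma integrable_pow4_if_nn_integral_le:
  fixes f :: "'a \<Rightarrow> 'b::euclidean_space"
  assumes [measurable]: "f \<in> borel_measurable M" and le: "(\<integral>\<^sup>+\<omega>. ennreal (norm (f \<omega>) ^ 4) \<partial>M) \<le> ennreal K" and K: "0 \<le> K"
  shows "integrable M (\<lambda>\<omega>. norm (f \<omega>) ^ 4)" "expectation (\<lambda>\<omega>. norm (f \<omega>) ^ 4) \<le> K"
proof -
  show i: "integrable M (\<lambda>\<omega>. norm (f \<omega>) ^ 4)"
    by (rule integrableI_bounded) (use le in \<open>auto simp: order_le_less_trans ennreal_less_top\<close>)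
  show "expectation (\<lambda>\<omega>. norm (f \<omega>) ^ 4) \<le> K"
    using le nn_integral_eq_integral[OF i] K by (simp add: ennreal_le_iff)
qed

lemma nn_integral_pow4_add_le:
  fixes f g :: "'a \<Rightarrow> 'b::euclidean_space"
  assumes [measurable]: "f \<in> borel_measurable M" "g \<in> borel_measurable M"
    and "(\<integral>\<^sup>+\<omega>. ennreal (norm (f \<omega>) ^ 4) \<partial>M) \<le> ennreal K" "(\<integral>\<^sup>+\<omega>. ennreal (norm (g \<omega>) ^ 4) \<partial>M) \<le> ennreal K'"
    and K: "0 \<le> K" "0 \<le> K'"
  shows "(\<integral>\<^sup>+\<omega>. ennreal (norm (f \<omega> + g \<omega>) ^ 4) \<partial>M) \<le> ennreal (8 * (K + K'))"
proof -
  have "norm (x + y) ^ 4 \<le> 8 * (norm x ^ 4 + norm y ^ 4)" for x y :: 'b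
  proof -
    have "norm (x + y) ^ 4 \<le> (norm x + norm y) ^ 4" by (intro power_mono norm_triangle_ineq) simp
    also have "\<dots> \<le> 8 * (norm x ^ 4 + norm y ^ 4)" by (rule power4_add_le)
    finally show ?thesis .
  qed
  then have "(\<integral>\<^sup>+\<omega>. ennreal (norm (f \<omega> + g \<omega>) ^ 4) \<partial>M)
      \<le> (\<integral>\<^sup>+\<omega>. 8 * (ennreal (norm (f \<omega>) ^ 4) + ennreal (norm (g \<omega>) ^ 4)) \<partial>M)"
  proof (intro nn_integral_mono)
    fix \<omega>
    have "ennreal (norm (f \<omega> + g \<omega>) ^ 4) \<le> ennreal (8 * (norm (f \<omega>) ^ 4 + norm (g \<omega>) ^ 4))"
      using \<open>\<And>x y :: 'b. norm (x + y) ^ 4 \<le> 8 * (norm x ^ 4 + norm y ^ 4)\<close> by (rule ennreal_leI)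
    then show "ennreal (norm (f \<omega> + g \<omega>) ^ 4) \<le> 8 * (ennreal (norm (f \<omega>) ^ 4) + ennreal (norm (g \<omega>) ^ 4))"
      by (simp add: ennreal_mult)
  qed
  also have "\<dots> = 8 * ((\<integral>\<^sup>+\<omega>. ennreal (norm (f \<omega>) ^ 4) \<partial>M) + (\<integral>\<^sup>+\<omega>. ennreal (norm (g \<omega>) ^ 4) \<partial>M))"
    by (simp add: nn_integral_cmult nn_integral_add)
  also have "\<dots> \<le> 8 * (ennreal K + ennreal K')"
    using assms by (intro mult_left_mono add_mono) auto
  also have "\<dots> = ennreal (8 * (K + K'))"
    using K by (simp add: ennreal_mult)
  finally show ?thesis .
qed

lemma nn_integral_pow4_scale_le:
  fixes f :: "'a \<Rightarrow> 'b::euclidean_space" and g :: "'a \<Rightarrow> 'c::euclidean_space"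
  assumes "f \<in> borel_measurable M"
    and "(\<integral>\<^sup>+\<omega>. ennreal (norm (f \<omega>) ^ 4) \<partial>M) \<le> ennreal K"
    and le: "\<And>\<omega>. norm (g \<omega>) \<le> l * norm (f \<omega>)" and l: "0 \<le> l"
  shows "(\<integral>\<^sup>+\<omega>. ennreal (norm (g \<omega>) ^ 4) \<partial>M) \<le> ennreal (l ^ 4 * K)"
proof -
  have "(\<integral>\<^sup>+\<omega>. ennreal (norm (g \<omega>) ^ 4) \<partial>M) \<le> (\<integral>\<^sup>+\<omega>. ennreal (l ^ 4) * ennreal (norm (f \<omega>) ^ 4) \<partial>M)"
  proof (intro nn_integral_mono)
    fix \<omega>
    have "norm (g \<omega>) ^ 4 \<le> (l * norm (f \<omega>)) ^ 4" by (rule power_mono[OF le]) simp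
    then show "ennreal (norm (g \<omega>) ^ 4) \<le> ennreal (l ^ 4) * ennreal (norm (f \<omega>) ^ 4)"
      using l by (simp add: ennreal_mult'[symmetric] power_mult_distrib ennreal_leI)
  qed
  also have "\<dots> = ennreal (l ^ 4) * (\<integral>\<^sup>+\<omega>. ennreal (norm (f \<omega>) ^ 4) \<partial>M)"
    using assms(1) by (intro nn_integral_cmult) measurable
  also have "\<dots> \<le> ennreal (l ^ 4) * ennreal K" using assms(2) by (rule mult_left_mono) simp
  also have "\<dots> = ennreal (l ^ 4 * K)" using l by (simp add: ennreal_mult')
  finally show ?thesis .
qed

end

section \<open>Moments of Wiener increments and of solutions\<close>

lemma wiener_increment_component:
  fixes W :: "real \<Rightarrow> 'a \<Rightarrow> real^'r"
  assumes "prob_space M" and W: "wiener_process M F W" and st: "0 \<le> s" "s < t"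
  shows "distributed M lborel (\<lambda>\<omega>. (W t \<omega> - W s \<omega>) $ k) (\<lambda>x. ennreal (normal_density 0 (sqrt (t - s)) x))"
    and "prob_space.indep_sets M (\<lambda>k. {(\<lambda>\<omega>. (W t \<omega> - W s \<omega>) $ k) -` A \<inter> space M | A. A \<in> sets borel}) UNIV"
proof -
  interpret prob_space M by fact
  have d: "distributed M lborel (\<lambda>\<omega>. W t \<omega> - W s \<omega>)
      (\<lambda>x. ennreal (\<Prod>i\<in>UNIV. normal_density 0 (sqrt (t - s)) (x $ i)))"
    using W st unfolding wiener_process_def by blast
  have n1: "(\<integral>\<^sup>+x. ennreal (normal_density 0 (sqrt (t - s)) x) \<partial>lborel) = 1"
    using st integral_normal_density[of "sqrt (t - s)" 0] integrable_normal_density[of "sqrt (t - s)" 0]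
    by (subst nn_integral_eq_integral) auto
  show "distributed M lborel (\<lambda>\<omega>. (W t \<omega> - W s \<omega>) $ k) (\<lambda>x. ennreal (normal_density 0 (sqrt (t - s)) x))"
    by (rule distributed_product_density_coordinates(2)[OF d _ _ n1]) auto
  show "indep_sets (\<lambda>k. {(\<lambda>\<omega>. (W t \<omega> - W s \<omega>) $ k) -` A \<inter> space M | A. A \<in> sets borel}) UNIV"
    by (rule distributed_product_density_coordinates(1)[OF d _ _ n1]) auto
qed

lemma adapted_process_measurable:
  assumes "stochastic_basis M F" "adapted_process F Y" "0 \<le> s"
  shows "Y s \<in> borel_measurable M" and "s \<le> t \<Longrightarrow> Y s \<in> borel_measurable (F t)"
proof -
  have sub: "subalgebra M (F r)" if "0 \<le> r" for r
    using assms(1) that by (simp add: stochastic_basis_def)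
  have Ys: "Y s \<in> borel_measurable (F s)" using assms(2,3) by (simp add: adapted_process_def)
  then show "Y s \<in> borel_measurable M" using measurable_from_subalg[OF sub[OF assms(3)]] by blast
  assume st: "s \<le> t"
  have "sets (F s) \<subseteq> sets (F t)" using assms(1,3) st unfolding stochastic_basis_def by blast
  then have "subalgebra (F t) (F s)"
    using sub[OF assms(3)] sub[of t] assms(3) st unfolding subalgebra_def by simp
  then show "Y s \<in> borel_measurable (F t)" using measurable_from_subalg Ys by blast
qed

lemma bounded_moment_4:
  fixes Y :: "real \<Rightarrow> 'a \<Rightarrow> 'b::euclidean_space"
  assumes "bounded_moment M Y 4"
  obtains K where "0 \<le> K" "\<And>t. 0 \<le> t \<Longrightarrow> (\<integral>\<^sup>+\<omega>. ennreal (norm (Y t \<omega>) ^ 4) \<partial>M) \<le> ennreal K"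
proof -
  have p: "norm y powr 4 = norm y ^ 4" for y :: 'b
    by (cases "y = 0") (simp_all add: powr_numeral)
  define s where "s = (SUP t\<in>{0..}. \<integral>\<^sup>+\<omega>. ennreal (norm (Y t \<omega>) ^ 4) \<partial>M)"
  have "s < \<infinity>" using assms by (simp add: bounded_moment_def p s_def)
  then obtain K where K: "0 \<le> K" "s = ennreal K"
    by (cases s) auto
  show ?thesis
  proof (rule that[OF K(1)])
    fix t :: real assume "0 \<le> t"
    then show "(\<integral>\<^sup>+\<omega>. ennreal (norm (Y t \<omega>) ^ 4) \<partial>M) \<le> ennreal K"
      unfolding K(2)[symmetric] s_def by (intro SUP_upper) simp
  qed
qed

text \<open>By the integral equation, the increment minus its noise is the time integral of B(Y),
  and after freezing the drift the remainder is the time integral of B(Y_u) - B(Y_s). Lipschitz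
  continuity and E|Y_u - Y_s|^4 = O((t - s)^2) give the sixth power: four from the length of the
  interval and two from the increment of Y.\<close>

lemma sde_increment_moments:
  fixes W :: "real \<Rightarrow> 'a \<Rightarrow> real^'r" and Y :: "real \<Rightarrow> 'a \<Rightarrow> real^'d" and B :: "real^'d \<Rightarrow> real^'d"
  assumes "prob_space M" and basis: "stochastic_basis M F" and W: "wiener_process M F W"
    and sde: "sde_solution M F W B S c Y" and lip: "L-lipschitz_on UNIV B"
    and mom: "bounded_moment M Y 4" and T: "0 < T"
  obtains K where "0 \<le> K"
    "\<And>t. 0 \<le> t \<Longrightarrow> (\<integral>\<^sup>+\<omega>. ennreal (norm (B (Y t \<omega>)) ^ 4) \<partial>M) \<le> ennreal K"
    "\<And>s t. 0 \<le> s \<Longrightarrow> s < t \<Longrightarrow> t - s \<le> T \<Longrightarrow>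
      (\<integral>\<^sup>+\<omega>. ennreal (norm (Y t \<omega> - Y s \<omega> - S *v (W t \<omega> - W s \<omega>) - (t - s) *\<^sub>R B (Y s \<omega>)) ^ 4) \<partial>M)
        \<le> ennreal (K * (t - s) ^ 6)"
proof -
  interpret prob_space M by fact
  have L: "0 \<le> L" using lip by (rule lipschitz_on_nonneg)
  have adY: "adapted_process F Y" and adW: "adapted_process F W"
    using sde W unfolding sde_solution_def wiener_process_def by blast+
  have Ym [measurable]: "Y t \<in> borel_measurable M" if "0 \<le> t" for t
    by (rule adapted_process_measurable(1)[OF basis adY that])
  have Wm [measurable]: "W t \<in> borel_measurable M" if "0 \<le> t" for t
    by (rule adapted_process_measurable(1)[OF basis adW that])
  have contB: "continuous_on A B" for A
    by (rule continuous_on_subset[OF lipschitz_on_continuous_on[OF lip] subset_UNIV])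
  have [measurable]: "B \<in> borel_measurable borel"
    by (rule borel_measurable_continuous_onI[OF contB])
  have Bdiff: "norm (B x - B y) \<le> L * norm (x - y)" for x y
    using lipschitz_onD[OF lip, of x y] by (simp add: dist_norm)
  obtain KY where KY: "0 \<le> KY" "\<And>t. 0 \<le> t \<Longrightarrow> (\<integral>\<^sup>+\<omega>. ennreal (norm (Y t \<omega>) ^ 4) \<partial>M) \<le> ennreal KY"
    using bounded_moment_4[OF mom] by blast
  define KB where "KB = 8 * (norm (B 0) ^ 4 + L ^ 4 * KY)"
  have KB: "0 \<le> KB" using KY L by (simp add: KB_def)
  have EB: "(\<integral>\<^sup>+\<omega>. ennreal (norm (B (Y t \<omega>)) ^ 4) \<partial>M) \<le> ennreal KB" if t: "0 \<le> t" for t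
  proof -
    note Ym[OF t, measurable]
    have 1: "(\<integral>\<^sup>+\<omega>. ennreal (norm (B (Y t \<omega>) - B 0) ^ 4) \<partial>M) \<le> ennreal (L ^ 4 * KY)"
      by (rule nn_integral_pow4_scale_le[OF _ KY(2)[OF t] _ L]) (use Bdiff[of _ 0] in auto)
    have 2: "(\<integral>\<^sup>+\<omega>. ennreal (norm (B 0) ^ 4) \<partial>M) \<le> ennreal (norm (B 0) ^ 4)"
      by (simp add: emeasure_space_1)
    have "(\<integral>\<^sup>+\<omega>. ennreal (norm (B 0 + (B (Y t \<omega>) - B 0)) ^ 4) \<partial>M) \<le> ennreal (8 * (norm (B 0) ^ 4 + L ^ 4 * KY))"
      by (rule nn_integral_pow4_add_le[OF _ _ 2 1]) (use KY L in auto)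
    then show ?thesis by (simp add: KB_def)
  qed
  \<comment> \<open>The Gaussian fourth moment 3, summed over the components, times the dimension
    factor of \<open>norm_pow4_vec_le_sum\<close>.\<close>
  define KW where "KW = real CARD('r) * (real CARD('r) * 3)"
  have EW: "(\<integral>\<^sup>+\<omega>. ennreal (norm (W t \<omega> - W s \<omega>) ^ 4) \<partial>M) \<le> ennreal (KW * (t - s)\<^sup>2)" if st: "0 \<le> s" "s < t" for s t
  proof -
    let ?\<sigma> = "sqrt (t - s)"
    have \<sigma>: "0 < ?\<sigma>" using st by simp
    have m4: "std_normal_moment 4 = 3"
      using std_normal_moment_simps(5) by (simp add: eval_nat_numeral)
    have k4: "integrable M (\<lambda>\<omega>. ((W t \<omega> - W s \<omega>) $ k) ^ 4)" "expectation (\<lambda>\<omega>. ((W t \<omega> - W s \<omega>) $ k) ^ 4) = 3 * (t - s)\<^sup>2" for k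
    proof -
      have d: "distributed M lborel (\<lambda>\<omega>. ((W t \<omega> - W s \<omega>) $ k - 0) / ?\<sigma>) std_normal_density"
        using wiener_increment_component(1)[OF \<open>prob_space M\<close> W st, of k]
        unfolding normal_standard_normal_convert[OF \<sigma>] .
      have eq: "((W t \<omega> - W s \<omega>) $ k) ^ 4 = (t - s)\<^sup>2 * (((W t \<omega> - W s \<omega>) $ k - 0) / ?\<sigma>) ^ 4" for \<omega>
      proof -
        have "?\<sigma> ^ 4 = (t - s)\<^sup>2" using st by (simp add: power4_eq_xxxx power2_eq_square mult.assoc[symmetric])
        then show ?thesis using st by (simp add: power_divide)
      qed
      show "integrable M (\<lambda>\<omega>. ((W t \<omega> - W s \<omega>) $ k) ^ 4)" "expectation (\<lambda>\<omega>. ((W t \<omega> - W s \<omega>) $ k) ^ 4) = 3 * (t - s)\<^sup>2"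
        unfolding eq using std_normal_power[OF d, of 4] by (simp_all add: m4)
    qed
    have "(\<integral>\<^sup>+\<omega>. ennreal (norm (W t \<omega> - W s \<omega>) ^ 4) \<partial>M)
        \<le> (\<integral>\<^sup>+\<omega>. ennreal (real CARD('r) * (\<Sum>k\<in>UNIV. ((W t \<omega> - W s \<omega>) $ k) ^ 4)) \<partial>M)"
      by (intro nn_integral_mono ennreal_leI norm_pow4_vec_le_sum)
    also have "\<dots> = ennreal (expectation (\<lambda>\<omega>. real CARD('r) * (\<Sum>k\<in>UNIV. ((W t \<omega> - W s \<omega>) $ k) ^ 4)))"
      using k4(1) by (intro nn_integral_eq_integral integrable_mult_right Bochner_Integration.integrable_sum AE_I2 mult_nonneg_nonneg sum_nonneg) auto
    also have "\<dots> = ennreal (KW * (t - s)\<^sup>2)"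
      using k4 by (simp add: KW_def Bochner_Integration.integral_sum del: vector_minus_component)
    finally show ?thesis .
  qed
  have int: "AE \<omega> in M. continuous_on {s..t} (\<lambda>u. B (Y u \<omega>)) \<and>
      ((\<lambda>u. B (Y u \<omega>)) has_integral (Y t \<omega> - Y s \<omega> - S *v (W t \<omega> - W s \<omega>))) {s..t}"
    if st: "0 \<le> s" "s < t" for s t
  proof -
    have "AE \<omega> in M. continuous_on {0..} (\<lambda>t. Y t \<omega>) \<and>
        (\<forall>t\<ge>0. ((\<lambda>s. B (Y s \<omega>)) has_integral (Y t \<omega> - c - S *v W t \<omega>)) {0..t})"
      using sde by (simp add: sde_solution_def)
    then show ?thesis
    proof eventually_elim
      case (elim \<omega>)
      have cont: "continuous_on {s..t} (\<lambda>u. B (Y u \<omega>))"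
      proof (rule continuous_on_compose2[OF contB[of UNIV]])
        show "continuous_on {s..t} (\<lambda>u. Y u \<omega>)"
          using elim continuous_on_subset[of "{0..}" _ "{s..t}"] st by auto
      qed simp
      have "(\<lambda>u. B (Y u \<omega>)) integrable_on {s..t}" by (rule integrable_continuous_real[OF cont])
      then obtain j where j: "((\<lambda>u. B (Y u \<omega>)) has_integral j) {s..t}" by blast
      \<comment> \<open>The integral equation at \<open>s\<close> and at \<open>t\<close> determines
        the integral over [s, t] by additivity and uniqueness; the initial value cancels.\<close>
      have "((\<lambda>u. B (Y u \<omega>)) has_integral (Y s \<omega> - c - S *v W s \<omega>) + j) {0..t}"
        by (rule has_integral_combine[OF _ _ _ j]) (use st elim in auto)
      moreover have "((\<lambda>u. B (Y u \<omega>)) has_integral (Y t \<omega> - c - S *v W t \<omega>)) {0..t}"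
        using elim st by auto
      ultimately have "(Y s \<omega> - c - S *v W s \<omega>) + j = Y t \<omega> - c - S *v W t \<omega>"
        by (rule has_integral_unique)
      then have "j = Y t \<omega> - Y s \<omega> - S *v (W t \<omega> - W s \<omega>)"
        by (simp add: matrix_vector_mult_diff_distrib algebra_simps)
      then show ?case using cont j by simp
    qed
  qed
  obtain l where l: "0 < l" "\<And>x. norm (S *v x) \<le> l * norm x"
    using linear_bounded_pos[OF matrix_vector_mul_linear[of S]] by blast
  \<comment> \<open>An increment has a drift part with fourth moment (t - s)^4 KB and a noise part
    of order (t - s)^2; the cap t - s <= T turns the former into T^2 (t - s)^2 KB.\<close>
  define KD where "KD = 8 * (T\<^sup>2 * KB + l ^ 4 * KW)"
  have KW0: "0 \<le> KW" by (simp add: KW_def)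
  have KD: "0 \<le> KD" using KB KW0 l by (simp add: KD_def)
  have ED: "(\<integral>\<^sup>+\<omega>. ennreal (norm (Y t \<omega> - Y s \<omega>) ^ 4) \<partial>M) \<le> ennreal (KD * (t - s)\<^sup>2)"
    if st: "0 \<le> s" "s < t" "t - s \<le> T" for s t
  proof -
    have [measurable]: "Y t \<in> borel_measurable M" "Y s \<in> borel_measurable M" "W t \<in> borel_measurable M" "W s \<in> borel_measurable M"
      using Ym Wm st by auto
    have SW: "(\<lambda>\<omega>. S *v (W t \<omega> - W s \<omega>)) \<in> borel_measurable M"
    proof -
      have "(\<lambda>x. S *v x) \<in> borel_measurable borel"
        by (intro borel_measurable_continuous_onI linear_continuous_on matrix_vector_mul_bounded_linear)
      then show ?thesis by measurable
    qed
    have 1: "(\<integral>\<^sup>+\<omega>. ennreal (norm (Y t \<omega> - Y s \<omega> - S *v (W t \<omega> - W s \<omega>)) ^ 4) \<partial>M) \<le> ennreal ((t - s) ^ 4 * KB)"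
      by (rule nn_integral_time_integral_pow4_le[OF _ _ int[OF st(1,2)] _ KB]) (use st EB Ym in auto)
    have 2: "(\<integral>\<^sup>+\<omega>. ennreal (norm (S *v (W t \<omega> - W s \<omega>)) ^ 4) \<partial>M) \<le> ennreal (l ^ 4 * (KW * (t - s)\<^sup>2))"
      by (rule nn_integral_pow4_scale_le[OF _ EW[OF st(1,2)] l(2)]) (use l in auto)
    have "(\<integral>\<^sup>+\<omega>. ennreal (norm ((Y t \<omega> - Y s \<omega> - S *v (W t \<omega> - W s \<omega>)) + S *v (W t \<omega> - W s \<omega>)) ^ 4) \<partial>M)
        \<le> ennreal (8 * ((t - s) ^ 4 * KB + l ^ 4 * (KW * (t - s)\<^sup>2)))"
      by (rule nn_integral_pow4_add_le[OF _ SW 1 2]) (use SW KB KW0 l in auto)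
    also have "\<dots> \<le> ennreal (KD * (t - s)\<^sup>2)"
    proof (rule ennreal_leI)
      have "(t - s)\<^sup>2 \<le> T\<^sup>2" using st by (intro power_mono) auto
      then have "(t - s)\<^sup>2 * (t - s)\<^sup>2 * KB \<le> T\<^sup>2 * (t - s)\<^sup>2 * KB"
        using KB by (intro mult_right_mono) auto
      then show "8 * ((t - s) ^ 4 * KB + l ^ 4 * (KW * (t - s)\<^sup>2)) \<le> KD * (t - s)\<^sup>2"
        by (simp add: KD_def power_add[symmetric] algebra_simps)
    qed
    finally show ?thesis by simp
  qed
  define K where "K = max KB (L ^ 4 * KD)"
  show ?thesis
  proof (rule that[of K])
    show "0 \<le> K" using KB by (simp add: K_def)
    show "(\<integral>\<^sup>+\<omega>. ennreal (norm (B (Y t \<omega>)) ^ 4) \<partial>M) \<le> ennreal K" if "0 \<le> t" for t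
      using EB[OF that] by (rule order_trans) (simp add: K_def ennreal_leI)
    fix s t :: real assume st: "0 \<le> s" "s < t" "t - s \<le> T"
    let ?\<rho> = "\<lambda>\<omega>. Y t \<omega> - Y s \<omega> - S *v (W t \<omega> - W s \<omega>) - (t - s) *\<^sub>R B (Y s \<omega>)"
    have "(\<integral>\<^sup>+\<omega>. ennreal (norm (?\<rho> \<omega>) ^ 4) \<partial>M) \<le> ennreal ((t - s) ^ 4 * (L ^ 4 * (KD * (t - s)\<^sup>2)))"
    proof (rule nn_integral_time_integral_pow4_le[where f = "\<lambda>u \<omega>. B (Y u \<omega>) - B (Y s \<omega>)"])
      show "s \<le> t" using st by simp
      show "(\<lambda>\<omega>. B (Y u \<omega>) - B (Y s \<omega>)) \<in> borel_measurable M" if "u \<in> {s..t}" for u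
      proof -
        have [measurable]: "Y u \<in> borel_measurable M" "Y s \<in> borel_measurable M" using Ym that st by auto
        show ?thesis by measurable
      qed
      show "AE \<omega> in M. continuous_on {s..t} (\<lambda>u. B (Y u \<omega>) - B (Y s \<omega>)) \<and>
          ((\<lambda>u. B (Y u \<omega>) - B (Y s \<omega>)) has_integral ?\<rho> \<omega>) {s..t}"
        using int[OF st(1,2)]
      proof eventually_elim
        case (elim \<omega>)
        have "((\<lambda>u. B (Y s \<omega>)) has_integral (t - s) *\<^sub>R B (Y s \<omega>)) {s..t}"
          using has_integral_const_real[of "B (Y s \<omega>)" s t] st by simp
        then show ?case
          using elim by (auto intro!: continuous_intros has_integral_diff)
      qed
      show "0 \<le> L ^ 4 * (KD * (t - s)\<^sup>2)" using L KD by simp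
      fix u assume u: "u \<in> {s..t}"
      show "(\<integral>\<^sup>+\<omega>. ennreal (norm (B (Y u \<omega>) - B (Y s \<omega>)) ^ 4) \<partial>M) \<le> ennreal (L ^ 4 * (KD * (t - s)\<^sup>2))"
      proof (rule nn_integral_pow4_scale_le[where f = "\<lambda>\<omega>. Y u \<omega> - Y s \<omega>", OF _ _ Bdiff L])
        show "(\<lambda>\<omega>. Y u \<omega> - Y s \<omega>) \<in> borel_measurable M"
          using Ym[of u] Ym[of s] u st by auto
        show "(\<integral>\<^sup>+\<omega>. ennreal (norm (Y u \<omega> - Y s \<omega>) ^ 4) \<partial>M) \<le> ennreal (KD * (t - s)\<^sup>2)"
        proof (cases "u = s")
          case False
          then have "(\<integral>\<^sup>+\<omega>. ennreal (norm (Y u \<omega> - Y s \<omega>) ^ 4) \<partial>M) \<le> ennreal (KD * (u - s)\<^sup>2)"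
            using u st by (intro ED) auto
          also have "\<dots> \<le> ennreal (KD * (t - s)\<^sup>2)"
            using u st KD by (intro ennreal_leI mult_left_mono power_mono) auto
          finally show ?thesis .
        qed simp
      qed
    qed
    also have "\<dots> \<le> ennreal (K * (t - s) ^ 6)"
    proof (rule ennreal_leI)
      have "(t - s) ^ 6 * (L ^ 4 * KD) \<le> (t - s) ^ 6 * K"
        using st by (intro mult_left_mono) (auto simp: K_def)
      moreover have "(t - s) ^ 4 * (L ^ 4 * (KD * (t - s)\<^sup>2)) = (t - s) ^ 6 * (L ^ 4 * KD)"
        by (simp add: eval_nat_numeral)
      ultimately show "(t - s) ^ 4 * (L ^ 4 * (KD * (t - s)\<^sup>2)) \<le> K * (t - s) ^ 6"
        by (simp only: mult.commute)
    qed
    finally show "(\<integral>\<^sup>+\<omega>. ennreal (norm (?\<rho> \<omega>) ^ 4) \<partial>M) \<le> ennreal (K * (t - s) ^ 6)" .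
  qed
qed

section \<open>Increments of the observable process\<close>

definition vstack :: "real^'n^'a \<Rightarrow> real^'n^'b \<Rightarrow> real^'n^('a + 'b)" where
  "vstack A B = (\<chi> i. case i of Inl a \<Rightarrow> A $ a | Inr b \<Rightarrow> B $ b)"

definition hcat :: "real^'a^'p \<Rightarrow> real^'b^'p \<Rightarrow> real^('a + 'b)^'p" where
  "hcat A B = (\<chi> i c. case c of Inl a \<Rightarrow> A $ i $ a | Inr b \<Rightarrow> B $ i $ b)"

lemma sum_UNIV_sum: "(\<Sum>c\<in>UNIV. f c) = (\<Sum>a\<in>UNIV. f (Inl a)) + (\<Sum>b\<in>UNIV. f (Inr b))"
  for f :: "'a::finite + 'b::finite \<Rightarrow> 'c::comm_monoid_add"
  unfolding UNIV_Plus_UNIV[symmetric] by (subst sum.Plus) auto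

lemma vstack_mult_vec: "vstack A B *v x = stack_vec (A *v x) (B *v x)"
  by (simp add: vstack_def stack_vec_def matrix_vector_mult_def vec_eq_iff split: sum.split)

lemma transpose_vstack_mult_vec:
  "transpose (vstack A B) *v x = transpose A *v (\<chi> a. x $ Inl a) + transpose B *v (\<chi> b. x $ Inr b)"
  by (simp add: vstack_def transpose_def matrix_vector_mult_def vec_eq_iff sum_UNIV_sum)

lemma hcat_mult_vec: "hcat A B *v w = A *v (\<chi> a. w $ Inl a) + B *v (\<chi> b. w $ Inr b)"
  by (simp add: hcat_def matrix_vector_mult_def vec_eq_iff sum_UNIV_sum)

lemma hcat_mult_transpose: "hcat A B ** transpose (hcat A B) = A ** transpose A + B ** transpose B"
  by (simp add: hcat_def matrix_matrix_mult_def transpose_def vec_eq_iff sum_UNIV_sum)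

text \<open>Symmetry of \<open>N\<close> makes the lower left block the transpose of the upper right
  one, as \<open>sym_block\<close> demands.\<close>

lemma vstack_congruence:
  assumes "transpose N = N"
  shows "vstack A B ** N ** transpose (vstack A B)
    = sym_block (A ** N ** transpose A) (A ** N ** transpose B) (B ** N ** transpose B)"
proof -
  have mult: "vstack A B ** N = vstack (A ** N) (B ** N)"
    by (simp add: vstack_def matrix_matrix_mult_def vec_eq_iff split: sum.split)
  have tr: "B ** N ** transpose A = transpose (A ** N ** transpose B)"
    by (simp add: matrix_transpose_mul assms matrix_mul_assoc)
  have "vstack (A ** N) (B ** N) ** transpose (vstack A B) = (\<chi> i j. case i of
       Inl a \<Rightarrow> (case j of Inl a' \<Rightarrow> (A ** N ** transpose A) $ a $ a' | Inr b' \<Rightarrow> (A ** N ** transpose B) $ a $ b')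
     | Inr b \<Rightarrow> (case j of Inl a' \<Rightarrow> (B ** N ** transpose A) $ b $ a' | Inr b' \<Rightarrow> (B ** N ** transpose B) $ b $ b'))"
    by (simp add: vec_eq_iff vstack_def matrix_matrix_mult_def[of "_ :: real^_^(_ + _)"] matrix_matrix_mult_def[of "_ ** N"]
        transpose_def split: sum.split)
  then show ?thesis unfolding mult tr sym_block_def .
qed

lemma sym_block_add: "sym_block A B D + sym_block A' B' D' = sym_block (A + A') (B + B') (D + D')"
  by (simp add: sym_block_def vec_eq_iff transpose_def split: sum.split)

text \<open>Coefficient of \<xi> in the observable once \<eta> is eliminated through \<eta> =
  \<Psi>^-1 (\<Gamma> \<xi> + \<zeta>); \<open>load2\<close>, \<open>load3\<close> and
  \<open>load4\<close> are the coefficients of \<delta>, \<epsilon> and \<zeta>. In this form the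
  observable is a linear image of the four diffusions.\<close>

definition load1 where "load1 P = vstack (Lambda_x1 P) (Lambda_x2 P ** matrix_inv (Psi_mat P) ** Gamma_mat P)"

definition load2 :: "('k1::finite, 'k2::finite, 'p1::finite, 'p2::finite,
    'r1::finite, 'r2::finite, 'r3::finite, 'r4::finite) sem \<Rightarrow> real^'p1^('p1 + 'p2)" where
  "load2 P = vstack (mat 1) 0"

definition load3 :: "('k1::finite, 'k2::finite, 'p1::finite, 'p2::finite,
    'r1::finite, 'r2::finite, 'r3::finite, 'r4::finite) sem \<Rightarrow> real^'p2^('p1 + 'p2)" where
  "load3 P = vstack 0 (mat 1)"

definition load4 :: "('k1::finite, 'k2::finite, 'p1::finite, 'p2::finite,
    'r1::finite, 'r2::finite, 'r3::finite, 'r4::finite) sem \<Rightarrow> real^'k2^('p1 + 'p2)" where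
  "load4 P = vstack 0 (Lambda_x2 P ** matrix_inv (Psi_mat P))"

text \<open>Merges the four Wiener processes into one noise vector. Up to transposition it is a
  square root of the model covariance: \<open>Sigma_sem P\<close> is this matrix times its
  transpose.\<close>

definition noise_mat where
  "noise_mat P = hcat (hcat (load1 P ** S1 P) (load2 P ** S2 P)) (hcat (load3 P ** S3 P) (load4 P ** S4 P))"

lemma transpose_mult_self: "transpose (A ** transpose A) = A ** transpose A" for A :: "real^'n^'m"
  by (simp add: matrix_transpose_mul)

text \<open>Only \<xi> loads on both parts of the observable, which is why its covariance alone
  appears in the off-diagonal block.\<close>

lemma Sigma_sem_eq_loads:
  "Sigma_sem P = load1 P ** Sigma_xixi P ** transpose (load1 P) + load2 P ** Sigma_deltadelta P ** transpose (load2 P)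
    + load3 P ** Sigma_epsilonepsilon P ** transpose (load3 P) + load4 P ** Sigma_zetazeta P ** transpose (load4 P)"
proof -
  have sym: "transpose (Sigma_xixi P) = Sigma_xixi P" "transpose (Sigma_deltadelta P) = Sigma_deltadelta P"
    "transpose (Sigma_epsilonepsilon P) = Sigma_epsilonepsilon P" "transpose (Sigma_zetazeta P) = Sigma_zetazeta P"
    by (simp_all add: Sigma_xixi_def Sigma_deltadelta_def Sigma_epsilonepsilon_def Sigma_zetazeta_def transpose_mult_self)
  have t0: "transpose (0 :: real^'x^'y) = 0" by (simp add: transpose_def vec_eq_iff)
  show ?thesis
    unfolding load1_def load2_def load3_def load4_def
      vstack_congruence[OF sym(1)] vstack_congruence[OF sym(2)] vstack_congruence[OF sym(3)] vstack_congruence[OF sym(4)]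
      sym_block_add
    by (simp add: Sigma_sem_def Let_def t0 transpose_mat matrix_transpose_mul matrix_mul_assoc
        matrix_mult.add_left matrix_mult.add_right matrix_mult.zero_left matrix_mult.zero_right add_ac)
qed

lemma Sigma_sem_eq_noise_mat: "Sigma_sem P = noise_mat P ** transpose (noise_mat P)"
  unfolding Sigma_sem_eq_loads noise_mat_def hcat_mult_transpose
  by (simp add: Sigma_xixi_def Sigma_deltadelta_def Sigma_epsilonepsilon_def Sigma_zetazeta_def
      matrix_transpose_mul matrix_mul_assoc add.assoc)

lemma inner_congruence_vec: "x \<bullet> ((C ** N ** transpose C) *v x) = (transpose C *v x) \<bullet> (N *v (transpose C *v x))"
  for C :: "real^'n^'m" and N :: "real^'n^'n"
  by (metis dot_lmul_matrix matrix_vector_mul_assoc transpose_matrix_vector transpose_transpose)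

lemma inner_mult_transpose_nonneg: "0 \<le> y \<bullet> ((A ** transpose A) *v y)" for A :: "real^'n^'m"
  by (metis dot_lmul_matrix inner_ge_zero matrix_vector_mul_assoc transpose_matrix_vector)

text \<open>The quadratic forms of all four summands are nonnegative. Those of \<delta> and
  \<epsilon> see the two halves of the coordinates, and a nonzero vector is nonzero in one of them,
  where the corresponding covariance is definite.\<close>

lemma pos_def_Sigma_sem:
  fixes P :: "('k1::finite, 'k2::finite, 'p1::finite, 'p2::finite,
    'r1::finite, 'r2::finite, 'r3::finite, 'r4::finite) sem"
  assumes "admissible_sem P"
  shows "pos_def (Sigma_sem P)"
  unfolding pos_def_def
proof (intro conjI allI impI)
  show "transpose (Sigma_sem P) = Sigma_sem P"
    unfolding Sigma_sem_eq_noise_mat by (rule transpose_mult_self)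
  fix x :: "real^('p1 + 'p2)" assume x: "x \<noteq> 0"
  let ?x1 = "\<chi> a. x $ Inl a" and ?x2 = "\<chi> b. x $ Inr b"
  have t0: "transpose (0 :: real^'x^'y) = 0" by (simp add: transpose_def vec_eq_iff)
  have x2: "transpose (load2 P) *v x = ?x1" and x3: "transpose (load3 P) *v x = ?x2"
    unfolding load2_def load3_def transpose_vstack_mult_vec
    by (simp_all add: transpose_mat t0 del: transpose_matrix_vector)
  have d: "pos_def (Sigma_deltadelta P)" "pos_def (Sigma_epsilonepsilon P)"
    using assms by (simp_all add: admissible_sem_def)
  have nn: "0 \<le> ?x1 \<bullet> (Sigma_deltadelta P *v ?x1)" "0 \<le> ?x2 \<bullet> (Sigma_epsilonepsilon P *v ?x2)"
    unfolding Sigma_deltadelta_def Sigma_epsilonepsilon_def by (rule inner_mult_transpose_nonneg)+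
  have pos: "0 < ?x1 \<bullet> (Sigma_deltadelta P *v ?x1) + ?x2 \<bullet> (Sigma_epsilonepsilon P *v ?x2)"
  proof (cases "?x1 = 0")
    case True
    have "?x2 \<noteq> 0"
    proof
      assume x2: "?x2 = 0"
      have "x $ c = 0" for c
        using True x2 by (cases c) (auto simp: vec_eq_iff)
      then show False using x by (simp add: vec_eq_iff)
    qed
    then have "0 < ?x2 \<bullet> (Sigma_epsilonepsilon P *v ?x2)" using d(2) unfolding pos_def_def by blast
    then show ?thesis using nn(1) by linarith
  next
    case False
    then have "0 < ?x1 \<bullet> (Sigma_deltadelta P *v ?x1)" using d(1) unfolding pos_def_def by blast
    then show ?thesis using nn(2) by linarith
  qed
  have "x \<bullet> (Sigma_sem P *v x) =
    x \<bullet> ((load1 P ** Sigma_xixi P ** transpose (load1 P)) *v x)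
    + ?x1 \<bullet> (Sigma_deltadelta P *v ?x1) + ?x2 \<bullet> (Sigma_epsilonepsilon P *v ?x2)
    + x \<bullet> ((load4 P ** Sigma_zetazeta P ** transpose (load4 P)) *v x)"
    unfolding Sigma_sem_eq_loads
    by (simp only: matrix_vector_mult_add_rdistrib inner_add_right inner_congruence_vec[of x "load2 P"]
        inner_congruence_vec[of x "load3 P"] x2 x3)
  moreover have "0 \<le> x \<bullet> ((load1 P ** Sigma_xixi P ** transpose (load1 P)) *v x)"
    "0 \<le> x \<bullet> ((load4 P ** Sigma_zetazeta P ** transpose (load4 P)) *v x)"
    unfolding inner_congruence_vec Sigma_xixi_def Sigma_zetazeta_def by (rule inner_mult_transpose_nonneg)+
  ultimately show "0 < x \<bullet> (Sigma_sem P *v x)" using pos by linarith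
qed

lemma observable_eq_loads:
  assumes inv: "invertible (Psi_mat P)"
    and eta: "\<eta> t \<omega> = B_mat P *v \<eta> t \<omega> + Gamma_mat P *v \<xi> t \<omega> + \<zeta> t \<omega>"
  shows "observable P \<xi> \<eta> \<delta> \<epsilon> t \<omega> = load1 P *v \<xi> t \<omega> + load2 P *v \<delta> t \<omega> + load3 P *v \<epsilon> t \<omega> + load4 P *v \<zeta> t \<omega>"
proof -
  have "Psi_mat P *v \<eta> t \<omega> = \<eta> t \<omega> - B_mat P *v \<eta> t \<omega>"
    by (simp add: Psi_mat_def matrix_vector_mult_diff_rdistrib)
  also have "\<dots> = Gamma_mat P *v \<xi> t \<omega> + \<zeta> t \<omega>" by (subst (1) eta) simp
  finally have "\<eta> t \<omega> = matrix_inv (Psi_mat P) *v (Gamma_mat P *v \<xi> t \<omega> + \<zeta> t \<omega>)"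
    by (metis matrix_inv_mult(2)[OF inv] matrix_vector_mul_assoc matrix_vector_mul_lid)
  then have "Lambda_x2 P *v \<eta> t \<omega> = Lambda_x2 P ** matrix_inv (Psi_mat P) ** Gamma_mat P *v \<xi> t \<omega>
      + Lambda_x2 P ** matrix_inv (Psi_mat P) *v \<zeta> t \<omega>"
    by (simp add: matrix_vector_right_distrib matrix_vector_mul_assoc matrix_mul_assoc)
  then show ?thesis
    by (simp add: observable_def load1_def load2_def load3_def load4_def vstack_mult_vec stack_vec_def vec_eq_iff
        split: sum.split)
qed

lemma noise_mat_mult_vec:
  "noise_mat P *v w = load1 P *v (S1 P *v (\<chi> k. w $ Inl (Inl k))) + load2 P *v (S2 P *v (\<chi> k. w $ Inl (Inr k)))
    + load3 P *v (S3 P *v (\<chi> k. w $ Inr (Inl k))) + load4 P *v (S4 P *v (\<chi> k. w $ Inr (Inr k)))"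
  by (simp add: noise_mat_def hcat_mult_vec matrix_vector_mul_assoc add.assoc)

section \<open>Standardized increments as one independent Gaussian family\<close>

definition scaled_increment :: "(real \<Rightarrow> 'a \<Rightarrow> real^'r) \<Rightarrow> real \<Rightarrow> nat \<Rightarrow> 'r \<Rightarrow> 'a \<Rightarrow> real" where
  "scaled_increment W h i k \<omega> = (W (real (Suc i) * h) \<omega> - W (real i * h) \<omega>) $ k / sqrt h"

text \<open>The nesting of the sum types follows \<open>noise_mat\<close>, so that the matrix
  applied to this family reproduces the noise of all four equations up to the factor sqrt h.\<close>

definition joint_noise where
  "joint_noise W1 W2 W3 W4 h = (\<lambda>(i, c). case c of
     Inl d \<Rightarrow> (case d of Inl k \<Rightarrow> scaled_increment W1 h i k | Inr k \<Rightarrow> scaled_increment W2 h i k)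
   | Inr d \<Rightarrow> (case d of Inl k \<Rightarrow> scaled_increment W3 h i k | Inr k \<Rightarrow> scaled_increment W4 h i k))"

lemma vimage_sets_compose_subset:
  assumes "\<phi> \<in> measurable N N'" "X \<in> measurable M N"
  shows "{(\<lambda>\<omega>. \<phi> (X \<omega>)) -` A \<inter> space M | A. A \<in> sets N'} \<subseteq> {X -` A \<inter> space M | A. A \<in> sets N}"
proof
  fix E assume "E \<in> {(\<lambda>\<omega>. \<phi> (X \<omega>)) -` A \<inter> space M | A. A \<in> sets N'}"
  then obtain A where A: "A \<in> sets N'" "E = (\<lambda>\<omega>. \<phi> (X \<omega>)) -` A \<inter> space M" by blast
  have "E = X -` (\<phi> -` A \<inter> space N) \<inter> space M"
    using A(2) measurable_space[OF assms(2)] by auto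
  then show "E \<in> {X -` A \<inter> space M | A. A \<in> sets N}"
    using measurable_sets[OF assms(1) A(1)] by blast
qed

lemma Int_stable_process_sigma: "Int_stable (process_sigma M X)"
proof -
  have "{X t -` A \<inter> space M | t A. 0 \<le> t \<and> A \<in> sets borel} \<subseteq> Pow (space M)" by auto
  then have "process_sigma M X = sets (sigma (space M) {X t -` A \<inter> space M | t A. 0 \<le> t \<and> A \<in> sets borel})"
    by (simp add: process_sigma_def)
  then show ?thesis by (auto simp: Int_stable_def)
qed

context
  fixes M :: "'a measure" and F and W :: "real \<Rightarrow> 'a \<Rightarrow> real^'r" and h :: real
  assumes M: "prob_space M" and basis: "stochastic_basis M F" and W: "wiener_process M F W" and h: "0 < h"
begin

interpretation prob_space M by (rule M)

lemma wiener_times: "0 \<le> real i * h" "real i * h < real (Suc i) * h" "real (Suc i) * h - real i * h = h"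
  using h by (simp_all add: algebra_simps)

lemma wiener_adapted: "adapted_process F W"
  using W by (simp add: wiener_process_def)

lemma wiener_increment_measurable:
  "(\<lambda>\<omega>. W (real (Suc i) * h) \<omega> - W (real i * h) \<omega>) \<in> borel_measurable (F (real (Suc i) * h))"
  using adapted_process_measurable(2)[OF basis wiener_adapted, of "real i * h" "real (Suc i) * h"]
    adapted_process_measurable(2)[OF basis wiener_adapted, of "real (Suc i) * h" "real (Suc i) * h"] wiener_times[of i]
  by (intro borel_measurable_diff) linarith+

lemma subalgebra_filtration: "0 \<le> t \<Longrightarrow> subalgebra M (F t)"
  using basis by (simp add: stochastic_basis_def)

lemma wiener_increment_indep:
  "indep_set (sets (F (real i * h))) {(\<lambda>\<omega>. W (real (Suc i) * h) \<omega> - W (real i * h) \<omega>) -` A \<inter> space M | A. A \<in> sets borel}"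
  using W wiener_times[of i] unfolding wiener_process_def by blast

lemma scaled_increment_subset:
  "{scaled_increment W h i k -` A \<inter> space M | A. A \<in> sets borel}
    \<subseteq> {(\<lambda>\<omega>. (W (real (Suc i) * h) \<omega> - W (real i * h) \<omega>) $ k) -` A \<inter> space M | A. A \<in> sets borel}"
  and scaled_increment_subset':
  "{scaled_increment W h i k -` A \<inter> space M | A. A \<in> sets borel}
    \<subseteq> {(\<lambda>\<omega>. W (real (Suc i) * h) \<omega> - W (real i * h) \<omega>) -` A \<inter> space M | A. A \<in> sets borel}"
proof -
  let ?D = "\<lambda>\<omega>. W (real (Suc i) * h) \<omega> - W (real i * h) \<omega>"
  have D: "?D \<in> borel_measurable M"
    using measurable_from_subalg[OF subalgebra_filtration wiener_increment_measurable] h by simp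
  have nth: "(\<lambda>x. x $ k) \<in> borel_measurable (borel :: (real^'r) measure)"
    by (intro borel_measurable_continuous_onI continuous_intros)
  have div: "(\<lambda>x. x / sqrt h) \<in> borel_measurable borel" by simp
  show 1: "{scaled_increment W h i k -` A \<inter> space M | A. A \<in> sets borel}
    \<subseteq> {(\<lambda>\<omega>. ?D \<omega> $ k) -` A \<inter> space M | A. A \<in> sets borel}"
    using vimage_sets_compose_subset[OF div measurable_compose[OF D nth]]
    by (simp add: scaled_increment_def[abs_def])
  also have "\<dots> \<subseteq> {?D -` A \<inter> space M | A. A \<in> sets borel}"
    by (rule vimage_sets_compose_subset[OF nth D])
  finally show "{scaled_increment W h i k -` A \<inter> space M | A. A \<in> sets borel}
    \<subseteq> {?D -` A \<inter> space M | A. A \<in> sets borel}" .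
qed

lemma scaled_increment_measurable: "scaled_increment W h i k \<in> borel_measurable (F (real (Suc i) * h))"
  unfolding scaled_increment_def[abs_def]
  by (intro borel_measurable_divide borel_measurable_vec_nth wiener_increment_measurable borel_measurable_const)

lemma scaled_increment_indep_past:
  "indep_set (sets (F (real i * h))) {scaled_increment W h i k -` A \<inter> space M | A. A \<in> sets borel}"
  using wiener_increment_indep[of i] unfolding indep_set_def
  by (rule indep_sets_mono_sets) (use scaled_increment_subset' in \<open>auto split: bool.split\<close>)

lemma scaled_increment_std_normal: "distributed M lborel (scaled_increment W h i k) std_normal_density"
proof -
  have "distributed M lborel (\<lambda>\<omega>. (W (real (Suc i) * h) \<omega> - W (real i * h) \<omega>) $ k) (\<lambda>x. ennreal (normal_density 0 (sqrt h) x))"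
    using wiener_increment_component(1)[OF M W wiener_times(1,2)[of i], of k] by (simp only: wiener_times(3))
  then have "distributed M lborel (\<lambda>\<omega>. ((W (real (Suc i) * h) \<omega> - W (real i * h) \<omega>) $ k - 0) / sqrt h) std_normal_density"
    by (subst (asm) normal_standard_normal_convert) (use h in auto)
  then show ?thesis by (simp add: scaled_increment_def[abs_def])
qed

lemma scaled_increment_process_sigma:
  "{scaled_increment W h i k -` A \<inter> space M | A. A \<in> sets borel} \<subseteq> process_sigma M W"
proof -
  define N where "N = sigma (space M) {W t -` A \<inter> space M | t A. 0 \<le> t \<and> A \<in> sets borel}"
  have gen: "{W t -` A \<inter> space M | t A. 0 \<le> t \<and> A \<in> sets borel} \<subseteq> Pow (space M)" by auto
  have N: "sets N = process_sigma M W" "space N = space M"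
    using gen by (simp_all add: N_def process_sigma_def)
  have WN: "W t \<in> borel_measurable N" if "0 \<le> t" for t
  proof (rule measurableI)
    fix A :: "(real^'r) set" assume "A \<in> sets borel"
    then show "W t -` A \<inter> space N \<in> sets N"
      unfolding N process_sigma_def using that by (intro sigma_sets.Basic) blast
  qed simp
  have "scaled_increment W h i k \<in> borel_measurable N"
    unfolding scaled_increment_def[abs_def] using WN[OF wiener_times(1)] WN[OF wiener_times(1)[of "Suc i"]]
    by (intro borel_measurable_divide borel_measurable_vec_nth borel_measurable_diff borel_measurable_const)
  then show ?thesis
    using measurable_sets[of "scaled_increment W h i k" N borel] N by auto
qed

text \<open>Blocks are the time steps: full increments are independent across steps by the
  filtration, and coordinates within a step by the product form of the density. The injection
  \<open>e\<close> places the coordinates inside the common index type of all four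
  processes.\<close>

lemma scaled_increments_indep:
  assumes e: "inj e" and g: "\<And>i k. g (i, e k) = scaled_increment W h i k"
  shows "indep_sets (\<lambda>p. {g p -` A \<inter> space M | A. A \<in> sets borel}) ({..<n} \<times> range e)"
proof (rule indep_sets_blocks[where J = UNIV and blk = fst])
  let ?D = "\<lambda>i \<omega>. W (real (Suc i) * h) \<omega> - W (real i * h) \<omega>"
  show "indep_sets (\<lambda>i. {?D i -` A \<inter> space M | A. A \<in> sets borel}) UNIV"
  proof (rule indep_sets_increments[where F = "\<lambda>i. F (real i * h)"])
    show "sets (F (real i * h)) \<subseteq> sets (F (real j * h))" if "i \<le> j" for i j
    proof -
      have "real i * h \<le> real j * h" using that h by (intro mult_right_mono) auto
      moreover have "\<forall>s t. 0 \<le> s \<and> s \<le> t \<longrightarrow> sets (F s) \<subseteq> sets (F t)"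
        using basis unfolding stochastic_basis_def by blast
      ultimately show ?thesis using wiener_times(1)[of i] by blast
    qed
  qed (use subalgebra_filtration h wiener_increment_measurable wiener_increment_indep in auto)
  show "Int_stable {?D i -` A \<inter> space M | A. A \<in> sets borel}" for i
    by (rule Int_stable_vimage)
  show "{g p -` A \<inter> space M | A. A \<in> sets borel} \<subseteq> {?D (fst p) -` A \<inter> space M | A. A \<in> sets borel}"
    if "p \<in> {..<n} \<times> range e" for p
  proof -
    from that obtain i k where p: "p = (i, e k)" by blast
    show ?thesis unfolding p g fst_conv by (rule scaled_increment_subset')
  qed
  fix i :: nat
  have "indep_sets (\<lambda>p. {g p -` A \<inter> space M | A. A \<in> sets borel}) ((\<lambda>k. (i, e k)) ` UNIV)"
  proof (rule indep_sets_image)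
    show "indep_sets (\<lambda>k. {g (i, e k) -` A \<inter> space M | A. A \<in> sets borel}) UNIV"
      using wiener_increment_component(2)[OF M W wiener_times(1,2)[of i]]
      by (rule indep_sets_mono_sets) (unfold g, rule scaled_increment_subset)
    show "inj (\<lambda>k. (i, e k))" using e by (auto simp: inj_def)
  qed
  then show "indep_sets (\<lambda>p. {g p -` A \<inter> space M | A. A \<in> sets borel}) {p \<in> {..<n} \<times> range e. fst p = i}"
    by (rule indep_sets_mono_index[rotated]) auto
qed simp

end

text \<open>Second level of blocks: independence across the four processes is the hypothesis on
  their generated sigma-algebras, independence inside a process is
  \<open>scaled_increments_indep\<close>. Independence of the past is needed coordinate by
  coordinate only, for the cross terms with the drift.\<close>

lemma joint_noise_indep_vars:
  fixes W1 :: "real \<Rightarrow> 'a \<Rightarrow> real^'r1" and W2 :: "real \<Rightarrow> 'a \<Rightarrow> real^'r2"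
    and W3 :: "real \<Rightarrow> 'a \<Rightarrow> real^'r3" and W4 :: "real \<Rightarrow> 'a \<Rightarrow> real^'r4"
  assumes M: "prob_space M" and basis: "stochastic_basis M F" and h: "0 < h"
    and W: "wiener_process M F W1" "wiener_process M F W2" "wiener_process M F W3" "wiener_process M F W4"
    and indep: "prob_space.indep_sets M
      (\<lambda>j. [process_sigma M W1, process_sigma M W2, process_sigma M W3, process_sigma M W4] ! j) {..<4}"
  shows "prob_space.indep_vars M (\<lambda>_. borel) (joint_noise W1 W2 W3 W4 h) ({..<n} \<times> UNIV)"
    and "distributed M lborel (joint_noise W1 W2 W3 W4 h (i, c)) std_normal_density"
    and "joint_noise W1 W2 W3 W4 h (i, c) \<in> borel_measurable (F (real (Suc i) * h))"
    and "prob_space.indep_set M (sets (F (real i * h))) {joint_noise W1 W2 W3 W4 h (i, c) -` A \<inter> space M | A. A \<in> sets borel}"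
proof -
  interpret prob_space M by (rule M)
  let ?g = "joint_noise W1 W2 W3 W4 h"
  show d: "distributed M lborel (?g (i, c)) std_normal_density" for i c
    using scaled_increment_std_normal[OF M basis W(1) h] scaled_increment_std_normal[OF M basis W(2) h]
      scaled_increment_std_normal[OF M basis W(3) h] scaled_increment_std_normal[OF M basis W(4) h]
    by (simp add: joint_noise_def split: sum.split)
  show "?g (i, c) \<in> borel_measurable (F (real (Suc i) * h))"
    using scaled_increment_measurable[OF M basis W(1) h, of i] scaled_increment_measurable[OF M basis W(2) h, of i]
      scaled_increment_measurable[OF M basis W(3) h, of i] scaled_increment_measurable[OF M basis W(4) h, of i]
    by (simp only: joint_noise_def prod.case split: sum.split) blast
  show "indep_set (sets (F (real i * h))) {?g (i, c) -` A \<inter> space M | A. A \<in> sets borel}"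
    using scaled_increment_indep_past[OF M basis W(1) h, of i] scaled_increment_indep_past[OF M basis W(2) h, of i]
      scaled_increment_indep_past[OF M basis W(3) h, of i] scaled_increment_indep_past[OF M basis W(4) h, of i]
    by (simp only: joint_noise_def prod.case split: sum.split) blast
  define blk :: "nat \<times> (('r1 + 'r2) + ('r3 + 'r4)) \<Rightarrow> nat" where
    "blk p = (case snd p of Inl d \<Rightarrow> (case d of Inl _ \<Rightarrow> 0 | Inr _ \<Rightarrow> 1) | Inr d \<Rightarrow> (case d of Inl _ \<Rightarrow> 2 | Inr _ \<Rightarrow> 3))" for p
  let ?A = "\<lambda>j. [process_sigma M W1, process_sigma M W2, process_sigma M W3, process_sigma M W4] ! j"
  have "indep_sets (\<lambda>p. {?g p -` A \<inter> space M | A. A \<in> sets borel}) ({..<n} \<times> UNIV)"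
  proof (rule indep_sets_blocks[OF indep, where blk = blk])
    show "Int_stable (?A j)" if "j \<in> {..<4}" for j
      using that Int_stable_process_sigma[of M W1] Int_stable_process_sigma[of M W2]
        Int_stable_process_sigma[of M W3] Int_stable_process_sigma[of M W4]
      by (auto simp: numeral_eq_Suc less_Suc_eq)
    show "blk p \<in> {..<4}" for p by (auto simp: blk_def split: sum.split)
    show "{?g p -` A \<inter> space M | A. A \<in> sets borel} \<subseteq> ?A (blk p)" for p
      using scaled_increment_process_sigma[OF M basis W(1) h] scaled_increment_process_sigma[OF M basis W(2) h]
        scaled_increment_process_sigma[OF M basis W(3) h] scaled_increment_process_sigma[OF M basis W(4) h]
      by (cases p) (simp add: joint_noise_def blk_def numeral_eq_Suc split: sum.split)
    fix j :: nat assume j: "j \<in> {..<4}"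
    have inj: "inj (\<lambda>k. Inl (Inl k))" "inj (\<lambda>k. Inl (Inr k))" "inj (\<lambda>k. Inr (Inl k))" "inj (\<lambda>k. Inr (Inr k))"
      by (auto simp: inj_def)
    have blk: "blk (i, Inl (Inl k1)) = 0" "blk (i, Inl (Inr k2)) = 1" "blk (i, Inr (Inl k3)) = 2" "blk (i, Inr (Inr k4)) = 3"
      for i k1 k2 k3 k4
      by (simp_all add: blk_def)
    have cases: "(\<exists>k. c = Inl (Inl k)) \<or> (\<exists>k. c = Inl (Inr k)) \<or> (\<exists>k. c = Inr (Inl k)) \<or> (\<exists>k. c = Inr (Inr k))"
      for c :: "('r1 + 'r2) + ('r3 + 'r4)"
      by (metis sum.exhaust)
    have blk_iff: "blk (i, c) = 0 \<longleftrightarrow> c \<in> range (\<lambda>k. Inl (Inl k))" "blk (i, c) = 1 \<longleftrightarrow> c \<in> range (\<lambda>k. Inl (Inr k))"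
      "blk (i, c) = 2 \<longleftrightarrow> c \<in> range (\<lambda>k. Inr (Inl k))" "blk (i, c) = 3 \<longleftrightarrow> c \<in> range (\<lambda>k. Inr (Inr k))" for i c
      using cases[of c] by (auto simp: blk)
    have block: "{p \<in> {..<n} \<times> UNIV. blk p = m} = {..<n} \<times> A" if "\<And>i c. blk (i, c) = m \<longleftrightarrow> c \<in> A" for m A
      using that by auto
    have "{p \<in> {..<n} \<times> UNIV. blk p = 0} = {..<n} \<times> range (\<lambda>k. Inl (Inl k))"
      "{p \<in> {..<n} \<times> UNIV. blk p = 1} = {..<n} \<times> range (\<lambda>k. Inl (Inr k))"
      "{p \<in> {..<n} \<times> UNIV. blk p = 2} = {..<n} \<times> range (\<lambda>k. Inr (Inl k))"
      "{p \<in> {..<n} \<times> UNIV. blk p = 3} = {..<n} \<times> range (\<lambda>k. Inr (Inr k))"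
      by (rule block, rule blk_iff)+
    moreover have "j = 0 \<or> j = 1 \<or> j = 2 \<or> j = 3" using j by auto
    moreover note scaled_increments_indep[OF M basis W(1) h inj(1), of ?g n] scaled_increments_indep[OF M basis W(2) h inj(2), of ?g n]
      scaled_increments_indep[OF M basis W(3) h inj(3), of ?g n] scaled_increments_indep[OF M basis W(4) h inj(4), of ?g n]
    ultimately show "indep_sets (\<lambda>p. {?g p -` A \<inter> space M | A. A \<in> sets borel}) {p \<in> {..<n} \<times> UNIV. blk p = j}"
      by (auto simp: joint_noise_def)
  qed
  moreover have "?g p \<in> borel_measurable M" for p
    using d[of "fst p" "snd p"] by (simp add: distributed_def)
  ultimately show "indep_vars (\<lambda>_. borel) ?g ({..<n} \<times> UNIV)"
    unfolding indep_vars_def2 by blast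
qed

lemma nn_integral_pow4_mult_vec_le:
  fixes f :: "'a \<Rightarrow> real^'n" and C :: "real^'n^'m"
  assumes "prob_space M" "f \<in> borel_measurable M"
    and "(\<integral>\<^sup>+\<omega>. ennreal (norm (f \<omega>) ^ 4) \<partial>M) \<le> ennreal K" and K: "0 \<le> K"
  shows "(\<integral>\<^sup>+\<omega>. ennreal (norm (C *v f \<omega>) ^ 4) \<partial>M) \<le> ennreal (onorm ((*v) C) ^ 4 * K)"
  by (rule prob_space.nn_integral_pow4_scale_le[OF assms(1-3)])
    (auto intro!: onorm onorm_pos_le matrix_vector_mul_bounded_linear)

lemma borel_measurable_mult_vec:
  fixes f :: "'a \<Rightarrow> real^'n" and C :: "real^'n^'m"
  assumes "f \<in> borel_measurable M"
  shows "(\<lambda>\<omega>. C *v f \<omega>) \<in> borel_measurable M"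
  using assms by (rule borel_measurable_continuous_on[rotated]) (intro linear_continuous_on matrix_vector_mul_bounded_linear)

text \<open>Each of the three additions costs a factor 8, whence 512 = 8^3. The common factor
  \<open>z\<close> is 1 for the drift at a grid point and h^6 for the remainders.\<close>

lemma nn_integral_pow4_sum4_le:
  fixes f1 :: "'a \<Rightarrow> real^'n1" and f2 :: "'a \<Rightarrow> real^'n2" and f3 :: "'a \<Rightarrow> real^'n3" and f4 :: "'a \<Rightarrow> real^'n4"
    and C1 :: "real^'n1^'m" and C2 :: "real^'n2^'m" and C3 :: "real^'n3^'m" and C4 :: "real^'n4^'m"
  assumes M: "prob_space M"
    and meas: "f1 \<in> borel_measurable M" "f2 \<in> borel_measurable M" "f3 \<in> borel_measurable M" "f4 \<in> borel_measurable M"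
    and le: "(\<integral>\<^sup>+\<omega>. ennreal (norm (f1 \<omega>) ^ 4) \<partial>M) \<le> ennreal (K1 * z)"
      "(\<integral>\<^sup>+\<omega>. ennreal (norm (f2 \<omega>) ^ 4) \<partial>M) \<le> ennreal (K2 * z)"
      "(\<integral>\<^sup>+\<omega>. ennreal (norm (f3 \<omega>) ^ 4) \<partial>M) \<le> ennreal (K3 * z)"
      "(\<integral>\<^sup>+\<omega>. ennreal (norm (f4 \<omega>) ^ 4) \<partial>M) \<le> ennreal (K4 * z)"
    and K: "0 \<le> K1" "0 \<le> K2" "0 \<le> K3" "0 \<le> K4" and z: "0 \<le> z"
  defines "f \<equiv> \<lambda>\<omega>. C1 *v f1 \<omega> + C2 *v f2 \<omega> + C3 *v f3 \<omega> + C4 *v f4 \<omega>"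
    and "o4 \<equiv> 512 * (onorm ((*v) C1) ^ 4 * K1 + onorm ((*v) C2) ^ 4 * K2 + onorm ((*v) C3) ^ 4 * K3 + onorm ((*v) C4) ^ 4 * K4)"
  shows "f \<in> borel_measurable M" "integrable M (\<lambda>\<omega>. norm (f \<omega>) ^ 4)" "integral\<^sup>L M (\<lambda>\<omega>. norm (f \<omega>) ^ 4) \<le> o4 * z"
proof -
  interpret prob_space M by fact
  define a1 where "a1 = onorm ((*v) C1) ^ 4 * (K1 * z)"
  define a2 where "a2 = onorm ((*v) C2) ^ 4 * (K2 * z)"
  define a3 where "a3 = onorm ((*v) C3) ^ 4 * (K3 * z)"
  define a4 where "a4 = onorm ((*v) C4) ^ 4 * (K4 * z)"
  have a: "0 \<le> a1" "0 \<le> a2" "0 \<le> a3" "0 \<le> a4"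
    using K z by (simp_all add: a1_def a2_def a3_def a4_def)
  note m = meas[THEN borel_measurable_mult_vec]
  have 1: "(\<integral>\<^sup>+\<omega>. ennreal (norm (C1 *v f1 \<omega>) ^ 4) \<partial>M) \<le> ennreal a1"
    unfolding a1_def using K z by (intro nn_integral_pow4_mult_vec_le[OF M meas(1) le(1)]) simp
  have 2: "(\<integral>\<^sup>+\<omega>. ennreal (norm (C2 *v f2 \<omega>) ^ 4) \<partial>M) \<le> ennreal a2"
    unfolding a2_def using K z by (intro nn_integral_pow4_mult_vec_le[OF M meas(2) le(2)]) simp
  have 3: "(\<integral>\<^sup>+\<omega>. ennreal (norm (C3 *v f3 \<omega>) ^ 4) \<partial>M) \<le> ennreal a3"
    unfolding a3_def using K z by (intro nn_integral_pow4_mult_vec_le[OF M meas(3) le(3)]) simp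
  have 4: "(\<integral>\<^sup>+\<omega>. ennreal (norm (C4 *v f4 \<omega>) ^ 4) \<partial>M) \<le> ennreal a4"
    unfolding a4_def using K z by (intro nn_integral_pow4_mult_vec_le[OF M meas(4) le(4)]) simp
  have 12: "(\<integral>\<^sup>+\<omega>. ennreal (norm (C1 *v f1 \<omega> + C2 *v f2 \<omega>) ^ 4) \<partial>M) \<le> ennreal (8 * (a1 + a2))"
    by (rule nn_integral_pow4_add_le[OF m(1) m(2) 1 2 a(1,2)])
  have 123: "(\<integral>\<^sup>+\<omega>. ennreal (norm (C1 *v f1 \<omega> + C2 *v f2 \<omega> + C3 *v f3 \<omega>) ^ 4) \<partial>M) \<le> ennreal (8 * (8 * (a1 + a2) + a3))"
    by (rule nn_integral_pow4_add_le[OF borel_measurable_add[OF m(1) m(2)] m(3) 12 3]) (use a in auto)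
  have 1234: "(\<integral>\<^sup>+\<omega>. ennreal (norm (f \<omega>) ^ 4) \<partial>M) \<le> ennreal (8 * (8 * (8 * (a1 + a2) + a3) + a4))"
    unfolding f_def
    by (rule nn_integral_pow4_add_le[OF borel_measurable_add[OF borel_measurable_add[OF m(1) m(2)] m(3)] m(4) 123 4]) (use a in auto)
  show fm: "f \<in> borel_measurable M"
    unfolding f_def by (intro borel_measurable_add m)
  have nn: "0 \<le> 8 * (8 * (8 * (a1 + a2) + a3) + a4)" using a by simp
  show "integrable M (\<lambda>\<omega>. norm (f \<omega>) ^ 4)"
    by (rule integrable_pow4_if_nn_integral_le(1)[OF fm 1234 nn])
  have "expectation (\<lambda>\<omega>. norm (f \<omega>) ^ 4) \<le> 8 * (8 * (8 * (a1 + a2) + a3) + a4)"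
    by (rule integrable_pow4_if_nn_integral_le(2)[OF fm 1234 nn])
  also have "\<dots> \<le> 512 * (a1 + a2 + a3 + a4)" using a by simp
  also have "\<dots> = o4 * z" by (simp add: o4_def a1_def a2_def a3_def a4_def algebra_simps)
  finally show "expectation (\<lambda>\<omega>. norm (f \<omega>) ^ 4) \<le> o4 * z" .
qed

definition sde_remainder where
  "sde_remainder Y W B S h i = (\<lambda>\<omega>. Y (real (Suc i) * h) \<omega> - Y (real i * h) \<omega>
    - S *v (W (real (Suc i) * h) \<omega> - W (real i * h) \<omega>) - h *\<^sub>R B (Y (real i * h) \<omega>))"

text \<open>Multiplying the four integral equations by their loadings puts the observable in the
  form treated before, with the single noise matrix \<open>noise_mat P0\<close>, one frozen drift
  and one remainder. The constants \<open>B\<close> and \<open>C\<close> do not depend on n.\<close>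

lemma realized_covariance_decomposition:
  fixes M :: "'w measure" and F :: "real \<Rightarrow> 'w measure"
    and W1 :: "real \<Rightarrow> 'w \<Rightarrow> real ^ 'r1" and W2 :: "real \<Rightarrow> 'w \<Rightarrow> real ^ 'r2"
    and W3 :: "real \<Rightarrow> 'w \<Rightarrow> real ^ 'r3" and W4 :: "real \<Rightarrow> 'w \<Rightarrow> real ^ 'r4"
    and X :: "real \<Rightarrow> 'w \<Rightarrow> real ^ ('p1::finite + 'p2::finite)"
    and P0 :: "('k1::finite, 'k2::finite, 'p1::finite, 'p2::finite,
                'r1::finite, 'r2::finite, 'r3::finite, 'r4::finite) sem"
  assumes M: "prob_space M" and basis: "stochastic_basis M F"
    and wiener: "wiener_process M F W1" "wiener_process M F W2" "wiener_process M F W3" "wiener_process M F W4"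
    and indep: "prob_space.indep_sets M
      (\<lambda>j. [process_sigma M W1, process_sigma M W2, process_sigma M W3, process_sigma M W4] ! j) {..<4}"
    and sde: "sde_solution M F W1 B1 (S1 P0) c1 \<xi>" "sde_solution M F W2 B2 (S2 P0) c2 \<delta>"
      "sde_solution M F W3 B3 (S3 P0) c3 \<epsilon>" "sde_solution M F W4 B4 (S4 P0) c4 \<zeta>"
    and lipschitz: "L1-lipschitz_on UNIV B1" "L2-lipschitz_on UNIV B2" "L3-lipschitz_on UNIV B3" "L4-lipschitz_on UNIV B4"
    and moments: "bounded_moment M \<xi> 4" "bounded_moment M \<delta> 4" "bounded_moment M \<epsilon> 4" "bounded_moment M \<zeta> 4"
    and T: "0 < T"
    and X: "\<And>t \<omega>. 0 \<le> t \<Longrightarrow> \<omega> \<in> space M \<Longrightarrow>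
      X t \<omega> = load1 P0 *v \<xi> t \<omega> + load2 P0 *v \<delta> t \<omega> + load3 P0 *v \<epsilon> t \<omega> + load4 P0 *v \<zeta> t \<omega>"
  obtains G R :: "nat \<Rightarrow> 'w \<Rightarrow> real^('p1 + 'p2)^('p1 + 'p2)" and B C :: real where
    "\<And>n. G n \<in> borel_measurable M" "\<And>n. R n \<in> borel_measurable M"
    "\<And>n \<omega>. 1 \<le> n \<Longrightarrow> \<omega> \<in> space M \<Longrightarrow>
      (1 / T) *\<^sub>R (\<Sum>i<n. outer_square (X (real (Suc i) * (T / n)) \<omega> - X (real i * (T / n)) \<omega>))
        = Sigma_sem P0 + (G n \<omega> + R n \<omega>)"
    "\<And>n. 1 \<le> n \<Longrightarrow> integral\<^sup>L M (G n) = 0"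
    "\<And>n. 1 \<le> n \<Longrightarrow> integrable M (\<lambda>\<omega>. norm (G n \<omega>) ^ 4)"
    "\<And>n. 1 \<le> n \<Longrightarrow> (real n)\<^sup>2 * integral\<^sup>L M (\<lambda>\<omega>. norm (G n \<omega>) ^ 4) \<le> B"
    "\<And>n A E. 1 \<le> n \<Longrightarrow> transpose E = E \<Longrightarrow> real n * integral\<^sup>L M (\<lambda>\<omega>. (A \<bullet> G n \<omega>) * (E \<bullet> G n \<omega>))
      = 2 * trace (A ** Sigma_sem P0 ** E ** Sigma_sem P0)"
    "\<And>n. 1 \<le> n \<Longrightarrow> integrable M (\<lambda>\<omega>. (norm (R n \<omega>))\<^sup>2)"
    "\<And>n. 1 \<le> n \<Longrightarrow> integral\<^sup>L M (\<lambda>\<omega>. (norm (R n \<omega>))\<^sup>2) \<le> C * (T / n)\<^sup>2"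
proof -
  interpret prob_space M by (rule M)
  obtain K1 where K1: "0 \<le> K1"
    "\<And>t. 0 \<le> t \<Longrightarrow> (\<integral>\<^sup>+\<omega>. ennreal (norm (B1 (\<xi> t \<omega>)) ^ 4) \<partial>M) \<le> ennreal K1"
    "\<And>s t. 0 \<le> s \<Longrightarrow> s < t \<Longrightarrow> t - s \<le> T \<Longrightarrow>
      (\<integral>\<^sup>+\<omega>. ennreal (norm (\<xi> t \<omega> - \<xi> s \<omega> - S1 P0 *v (W1 t \<omega> - W1 s \<omega>) - (t - s) *\<^sub>R B1 (\<xi> s \<omega>)) ^ 4) \<partial>M)
        \<le> ennreal (K1 * (t - s) ^ 6)"
    using sde_increment_moments[OF M basis wiener(1) sde(1) lipschitz(1) moments(1) T] by blast
  obtain K2 where K2: "0 \<le> K2"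
    "\<And>t. 0 \<le> t \<Longrightarrow> (\<integral>\<^sup>+\<omega>. ennreal (norm (B2 (\<delta> t \<omega>)) ^ 4) \<partial>M) \<le> ennreal K2"
    "\<And>s t. 0 \<le> s \<Longrightarrow> s < t \<Longrightarrow> t - s \<le> T \<Longrightarrow>
      (\<integral>\<^sup>+\<omega>. ennreal (norm (\<delta> t \<omega> - \<delta> s \<omega> - S2 P0 *v (W2 t \<omega> - W2 s \<omega>) - (t - s) *\<^sub>R B2 (\<delta> s \<omega>)) ^ 4) \<partial>M)
        \<le> ennreal (K2 * (t - s) ^ 6)"
    using sde_increment_moments[OF M basis wiener(2) sde(2) lipschitz(2) moments(2) T] by blast
  obtain K3 where K3: "0 \<le> K3"
    "\<And>t. 0 \<le> t \<Longrightarrow> (\<integral>\<^sup>+\<omega>. ennreal (norm (B3 (\<epsilon> t \<omega>)) ^ 4) \<partial>M) \<le> ennreal K3"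
    "\<And>s t. 0 \<le> s \<Longrightarrow> s < t \<Longrightarrow> t - s \<le> T \<Longrightarrow>
      (\<integral>\<^sup>+\<omega>. ennreal (norm (\<epsilon> t \<omega> - \<epsilon> s \<omega> - S3 P0 *v (W3 t \<omega> - W3 s \<omega>) - (t - s) *\<^sub>R B3 (\<epsilon> s \<omega>)) ^ 4) \<partial>M)
        \<le> ennreal (K3 * (t - s) ^ 6)"
    using sde_increment_moments[OF M basis wiener(3) sde(3) lipschitz(3) moments(3) T] by blast
  obtain K4 where K4: "0 \<le> K4"
    "\<And>t. 0 \<le> t \<Longrightarrow> (\<integral>\<^sup>+\<omega>. ennreal (norm (B4 (\<zeta> t \<omega>)) ^ 4) \<partial>M) \<le> ennreal K4"
    "\<And>s t. 0 \<le> s \<Longrightarrow> s < t \<Longrightarrow> t - s \<le> T \<Longrightarrow>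
      (\<integral>\<^sup>+\<omega>. ennreal (norm (\<zeta> t \<omega> - \<zeta> s \<omega> - S4 P0 *v (W4 t \<omega> - W4 s \<omega>) - (t - s) *\<^sub>R B4 (\<zeta> s \<omega>)) ^ 4) \<partial>M)
        \<le> ennreal (K4 * (t - s) ^ 6)"
    using sde_increment_moments[OF M basis wiener(4) sde(4) lipschitz(4) moments(4) T] by blast
  define K where "K = 512 * (onorm ((*v) (load1 P0)) ^ 4 * K1 + onorm ((*v) (load2 P0)) ^ 4 * K2
    + onorm ((*v) (load3 P0)) ^ 4 * K3 + onorm ((*v) (load4 P0)) ^ 4 * K4)"
  let ?S = "noise_mat P0"
  define b where "b h i \<omega> = load1 P0 *v B1 (\<xi> (real i * h) \<omega>) + load2 P0 *v B2 (\<delta> (real i * h) \<omega>)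
    + load3 P0 *v B3 (\<epsilon> (real i * h) \<omega>) + load4 P0 *v B4 (\<zeta> (real i * h) \<omega>)" for h :: real and i \<omega>
  define \<rho> where "\<rho> h i \<omega> = load1 P0 *v sde_remainder \<xi> W1 B1 (S1 P0) h i \<omega> + load2 P0 *v sde_remainder \<delta> W2 B2 (S2 P0) h i \<omega>
    + load3 P0 *v sde_remainder \<epsilon> W3 B3 (S3 P0) h i \<omega> + load4 P0 *v sde_remainder \<zeta> W4 B4 (S4 P0) h i \<omega>" for h :: real and i \<omega>
  define g where "g h = joint_noise W1 W2 W3 W4 h" for h
  define U where "U h i \<omega> = sqrt h *\<^sub>R (?S *v (\<chi> c. g h (i, c) \<omega>))" for h i \<omega>
  define D where "D h i \<omega> = h *\<^sub>R b h i \<omega> + \<rho> h i \<omega>" for h i \<omega>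
  \<comment> \<open>For n = 0 the step length is a division by zero; the value 0 keeps
    \<open>G\<close> and \<open>R\<close> measurable for every n.\<close>
  define G where "G n \<omega> = (if n = 0 then 0 else ?S ** empirical_cov_error n (g (T / real n)) \<omega> ** transpose ?S)" for n \<omega>
  define R where "R n \<omega> = (if n = 0 then 0 else (1 / T) *\<^sub>R (\<Sum>i<n. outer (U (T / real n) i \<omega>) (D (T / real n) i \<omega>)
    + outer (D (T / real n) i \<omega>) (U (T / real n) i \<omega>) + outer (D (T / real n) i \<omega>) (D (T / real n) i \<omega>)))" for n \<omega>
  define C where "C = 3 / T\<^sup>2 *
      (2 * T * (norm ?S)\<^sup>2 * real CARD(('r1 + 'r2) + ('r3 + 'r4)) * real CARD('p1 + 'p2) * (3 + K)
        + 2 * (norm ?S)\<^sup>2 * T\<^sup>2 * (3 * (real CARD(('r1 + 'r2) + ('r3 + 'r4)))\<^sup>2 + K) + 8 * T\<^sup>2 * (K + K * T\<^sup>2))"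
  define B where "B = (norm ?S) ^ 8 * (real (CARD(('r1 + 'r2) + ('r3 + 'r4)) * CARD(('r1 + 'r2) + ('r3 + 'r4))))\<^sup>2
    * (24 * (std_normal_moment 8 + 1))"
  have adapted: "adapted_process F \<xi>" "adapted_process F \<delta>" "adapted_process F \<epsilon>" "adapted_process F \<zeta>"
    "adapted_process F W1" "adapted_process F W2" "adapted_process F W3" "adapted_process F W4"
    using sde wiener unfolding sde_solution_def wiener_process_def by blast+
  have F_sub: "subalgebra M (F t)" if "0 \<le> t" for t
    using basis that by (simp add: stochastic_basis_def)
  have F_mono: "sets (F s) \<subseteq> sets (F t)" if "0 \<le> s" "s \<le> t" for s t
    using basis that unfolding stochastic_basis_def by blast
  have inc: "X (real (Suc i) * h) \<omega> - X (real i * h) \<omega> = U h i \<omega> + D h i \<omega>"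
    if h: "0 < h" and \<omega>: "\<omega> \<in> space M" for h i \<omega>
  proof -
    have scale: "sqrt h *\<^sub>R (\<chi> k. scaled_increment W h i k \<omega>) = W (real (Suc i) * h) \<omega> - W (real i * h) \<omega>"
      for W :: "real \<Rightarrow> 'w \<Rightarrow> real^'x"
      using h by (simp add: scaled_increment_def vec_eq_iff)
    have "U h i \<omega> = load1 P0 *v (S1 P0 *v (W1 (real (Suc i) * h) \<omega> - W1 (real i * h) \<omega>))
      + load2 P0 *v (S2 P0 *v (W2 (real (Suc i) * h) \<omega> - W2 (real i * h) \<omega>))
      + load3 P0 *v (S3 P0 *v (W3 (real (Suc i) * h) \<omega> - W3 (real i * h) \<omega>))
      + load4 P0 *v (S4 P0 *v (W4 (real (Suc i) * h) \<omega> - W4 (real i * h) \<omega>))"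
      unfolding scale[symmetric]
      by (simp add: U_def noise_mat_mult_vec g_def joint_noise_def matrix_vector_mult_scaleR scaleR_add_right)
    moreover have "0 \<le> real (Suc i) * h" "0 \<le> real i * h" using h by simp_all
    ultimately show ?thesis
      unfolding D_def \<rho>_def b_def sde_remainder_def
      by (simp only: X[OF _ \<omega>]) (simp add: algebra_simps matrix_vector_mult_scaleR scaleR_add_right)
  qed
  have h0: "0 \<le> real i * h" "real (Suc i) * h - real i * h = h" if "0 < h" for h i
    using that by (simp_all add: algebra_simps)
  have cont: "B1 \<in> borel_measurable borel" "B2 \<in> borel_measurable borel" "B3 \<in> borel_measurable borel" "B4 \<in> borel_measurable borel"
    using lipschitz by (auto intro!: borel_measurable_continuous_onI lipschitz_on_continuous_on)
  have Bm: "(\<lambda>\<omega>. B1 (\<xi> (real i * h) \<omega>)) \<in> borel_measurable (F (real i * h))"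
    "(\<lambda>\<omega>. B2 (\<delta> (real i * h) \<omega>)) \<in> borel_measurable (F (real i * h))"
    "(\<lambda>\<omega>. B3 (\<epsilon> (real i * h) \<omega>)) \<in> borel_measurable (F (real i * h))"
    "(\<lambda>\<omega>. B4 (\<zeta> (real i * h) \<omega>)) \<in> borel_measurable (F (real i * h))" if "0 < h" for h i
    using adapted(1-4) h0(1)[OF that] unfolding adapted_process_def
    by (auto intro!: measurable_compose[OF _ cont(1)] measurable_compose[OF _ cont(2)]
        measurable_compose[OF _ cont(3)] measurable_compose[OF _ cont(4)])
  have BM: "(\<lambda>\<omega>. B1 (\<xi> (real i * h) \<omega>)) \<in> borel_measurable M" "(\<lambda>\<omega>. B2 (\<delta> (real i * h) \<omega>)) \<in> borel_measurable M"
    "(\<lambda>\<omega>. B3 (\<epsilon> (real i * h) \<omega>)) \<in> borel_measurable M" "(\<lambda>\<omega>. B4 (\<zeta> (real i * h) \<omega>)) \<in> borel_measurable M"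
    if "0 < h" for h i
    using Bm[OF that] measurable_from_subalg[OF F_sub[OF h0(1)[OF that]]] by blast+
  have bF: "b h i \<in> borel_measurable (F (real i * h))" if "0 < h" for h i
    unfolding b_def by (intro borel_measurable_add borel_measurable_mult_vec Bm that)
  have b4: "integrable M (\<lambda>\<omega>. norm (b h i \<omega>) ^ 4)" "expectation (\<lambda>\<omega>. norm (b h i \<omega>) ^ 4) \<le> K" if "0 < h" for h i
    using nn_integral_pow4_sum4_le[OF M BM[OF that], of i K1 1 i K2 i K3 i K4 "load1 P0" "load2 P0" "load3 P0" "load4 P0"]
      K1(1,2) K2(1,2) K3(1,2) K4(1,2) h0(1)[OF that]
    by (simp_all add: b_def K_def)
  have remM: "sde_remainder Y W B' S h i \<in> borel_measurable M"
    if "0 < h" "adapted_process F Y" "adapted_process F W" "B' \<in> borel_measurable borel"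
    for Y :: "real \<Rightarrow> 'w \<Rightarrow> real^'x" and W :: "real \<Rightarrow> 'w \<Rightarrow> real^'y" and B' S h i
    unfolding sde_remainder_def
    using adapted_process_measurable(1)[OF basis that(2)] adapted_process_measurable(1)[OF basis that(3)] h0(1)[OF that(1)]
    by (intro borel_measurable_diff borel_measurable_mult_vec borel_measurable_scaleR borel_measurable_const
        measurable_compose[OF _ that(4)]) blast+
  note remM4 = remM[OF _ adapted(1,5) cont(1)] remM[OF _ adapted(2,6) cont(2)] remM[OF _ adapted(3,7) cont(3)] remM[OF _ adapted(4,8) cont(4)]
  have rem_le: "(\<integral>\<^sup>+\<omega>. ennreal (norm (sde_remainder Y W B' S h i \<omega>) ^ 4) \<partial>M) \<le> ennreal (k * h ^ 6)"
    if "\<And>s t. 0 \<le> s \<Longrightarrow> s < t \<Longrightarrow> t - s \<le> T \<Longrightarrow>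
      (\<integral>\<^sup>+\<omega>. ennreal (norm (Y t \<omega> - Y s \<omega> - S *v (W t \<omega> - W s \<omega>) - (t - s) *\<^sub>R B' (Y s \<omega>)) ^ 4) \<partial>M) \<le> ennreal (k * (t - s) ^ 6)"
      and h: "0 < h" "h \<le> T"
    for Y :: "real \<Rightarrow> 'w \<Rightarrow> real^'x" and W :: "real \<Rightarrow> 'w \<Rightarrow> real^'y" and B' S k h i
    using that(1)[of "real i * h" "real (Suc i) * h"] h h0(1)[OF h(1), of i]
    by (simp only: sde_remainder_def h0(2)[OF h(1)]) (simp add: algebra_simps)
  have \<rho>M: "\<rho> h i \<in> borel_measurable M" if "0 < h" for h i
    unfolding \<rho>_def by (intro borel_measurable_add borel_measurable_mult_vec remM4 that)
  have \<rho>4: "integrable M (\<lambda>\<omega>. norm (\<rho> h i \<omega>) ^ 4)" "expectation (\<lambda>\<omega>. norm (\<rho> h i \<omega>) ^ 4) \<le> K * h ^ 6"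
    if h: "0 < h" "h \<le> T" for h i
  proof -
    note sum4 = nn_integral_pow4_sum4_le[OF M remM4[OF h(1)] rem_le[OF K1(3) h] rem_le[OF K2(3) h] rem_le[OF K3(3) h] rem_le[OF K4(3) h]
        K1(1) K2(1) K3(1) K4(1) zero_le_power[OF less_imp_le[OF h(1)]]]
    show "integrable M (\<lambda>\<omega>. norm (\<rho> h i \<omega>) ^ 4)"
      unfolding \<rho>_def by (rule sum4(2))
    show "expectation (\<lambda>\<omega>. norm (\<rho> h i \<omega>) ^ 4) \<le> K * h ^ 6"
      unfolding \<rho>_def K_def by (rule sum4(3))
  qed
  show ?thesis
  proof (rule that[of G R B C])
    have step: "0 < T / real n" "T / real n \<le> T" if "1 \<le> n" for n
      using that T by (simp_all add: field_simps)
    note noise = joint_noise_indep_vars[OF M basis _ wiener indep, folded g_def]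
    note cong = congruence_empirical_cov_error[OF noise(1)[OF step(1)] noise(2)[OF step(1)], where S = ?S]
    have G_n: "G n = (\<lambda>\<omega>. ?S ** empirical_cov_error n (g (T / real n)) \<omega> ** transpose ?S)" if "1 \<le> n" for n
      by (rule ext) (use that in \<open>simp add: G_def\<close>)
    have rem: "(1 / T) *\<^sub>R (\<Sum>i<n. outer_square (U (T / real n) i \<omega> + D (T / real n) i \<omega>))
        = ?S ** transpose ?S + ?S ** empirical_cov_error n (g (T / real n)) \<omega> ** transpose ?S + R n \<omega>"
      "R n \<in> borel_measurable M" "integrable M (\<lambda>\<omega>. (norm (R n \<omega>))\<^sup>2)"
      "expectation (\<lambda>\<omega>. (norm (R n \<omega>))\<^sup>2) \<le> C * (T / n)\<^sup>2" if n: "1 \<le> n" for n \<omega>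
    proof -
      let ?h = "T / real n"
      have h: "0 < ?h" "?h \<le> T" using step[OF n] by auto
      have sub: "subalgebra M (F (real i * ?h))" for i
        using F_sub[OF h0(1)[OF h(1)]] .
      have mono: "sets (F (real i * ?h)) \<subseteq> sets (F (real j * ?h))" if "i \<le> j" for i j
      proof -
        have "real i * ?h \<le> real j * ?h" using that h(1) by (intro mult_right_mono) auto
        then show ?thesis by (rule F_mono[OF h0(1)[OF h(1)]])
      qed
      note qcr = quadratic_covariation_remainder[where F = "\<lambda>i. F (real i * (T / real n))" and g = "g (T / real n)"
          and b = "b (T / real n)" and \<rho> = "\<rho> (T / real n)" and S = ?S and T = T and n = n and K = K,
          OF n T sub mono noise(3)[OF h(1)] noise(4)[OF h(1)] noise(2)[OF h(1)] bF[OF h(1)] b4[OF h(1)] \<rho>M[OF h(1)] \<rho>4[OF h]]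
      have Rn: "R n = (\<lambda>\<omega>. (1 / T) *\<^sub>R (\<Sum>i<n. outer (U ?h i \<omega>) (D ?h i \<omega>) + outer (D ?h i \<omega>) (U ?h i \<omega>) + outer (D ?h i \<omega>) (D ?h i \<omega>)))"
        by (rule ext) (use n in \<open>simp add: R_def\<close>)
      show "(1 / T) *\<^sub>R (\<Sum>i<n. outer_square (U ?h i \<omega> + D ?h i \<omega>))
        = ?S ** transpose ?S + ?S ** empirical_cov_error n (g ?h) \<omega> ** transpose ?S + R n \<omega>"
        unfolding Rn U_def D_def by (rule qcr(1))
      show "R n \<in> borel_measurable M"
        unfolding Rn U_def D_def by (rule qcr(2))
      show "integrable M (\<lambda>\<omega>. (norm (R n \<omega>))\<^sup>2)"
        unfolding Rn U_def D_def by (rule qcr(3))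
      show "expectation (\<lambda>\<omega>. (norm (R n \<omega>))\<^sup>2) \<le> C * (T / n)\<^sup>2"
        unfolding Rn U_def D_def C_def by (rule qcr(4))
    qed
    show "G n \<in> borel_measurable M" for n
    proof (cases "1 \<le> n")
      case True
      show ?thesis unfolding G_n[OF True] by (rule cong(1)[OF True True True])
    qed (simp add: G_def[abs_def])
    show "R n \<in> borel_measurable M" for n
    proof (cases "1 \<le> n")
      case True
      then show ?thesis by (rule rem(2))
    qed (simp add: R_def[abs_def])
    show "(1 / T) *\<^sub>R (\<Sum>i<n. outer_square (X (real (Suc i) * (T / n)) \<omega> - X (real i * (T / n)) \<omega>))
        = Sigma_sem P0 + (G n \<omega> + R n \<omega>)" if "1 \<le> n" "\<omega> \<in> space M" for n \<omega>
      using rem(1)[OF that(1)] by (simp only: inc[OF step(1)[OF that(1)] that(2)] Sigma_sem_eq_noise_mat G_n[OF that(1)] add.assoc)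
    show "expectation (G n) = 0" if "1 \<le> n" for n
      unfolding G_n[OF that] by (rule cong(2)[OF that that that])
    show "integrable M (\<lambda>\<omega>. norm (G n \<omega>) ^ 4)" if "1 \<le> n" for n
      unfolding G_n[OF that] by (rule cong(3)[OF that that that])
    show "(real n)\<^sup>2 * expectation (\<lambda>\<omega>. norm (G n \<omega>) ^ 4) \<le> B" if "1 \<le> n" for n
      unfolding G_n[OF that] B_def by (rule cong(4)[OF that that that])
    show "real n * expectation (\<lambda>\<omega>. (A \<bullet> G n \<omega>) * (E \<bullet> G n \<omega>)) = 2 * trace (A ** Sigma_sem P0 ** E ** Sigma_sem P0)"
      if "1 \<le> n" "transpose E = E" for n A E
      unfolding G_n[OF that(1)] Sigma_sem_eq_noise_mat by (rule cong(5)[OF that(1) that(1) that(1) that(2)])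
    show "integrable M (\<lambda>\<omega>. (norm (R n \<omega>))\<^sup>2)" if "1 \<le> n" for n
      by (rule rem(3)[OF that])
    show "expectation (\<lambda>\<omega>. (norm (R n \<omega>))\<^sup>2) \<le> C * (T / n)\<^sup>2" if "1 \<le> n" for n
      by (rule rem(4)[OF that])
  qed
qed

section \<open>The quasi-likelihood\<close>

definition realized_cov :: "real \<Rightarrow> nat \<Rightarrow> (nat \<Rightarrow> real^'p) \<Rightarrow> real^'p^'p" where
  "realized_cov T n x = (1 / T) *\<^sub>R (\<Sum>i=1..n. outer_square (x i - x (i - 1)))"

text \<open>The normalization of \<open>realized_cov\<close> by T makes 1 / (2h) times the sum of
  brackets equal to n / 2 times one bracket.\<close>

lemma quasi_likelihood_eq_exp:
  fixes \<Sigma> :: "'q \<Rightarrow> real^'p^'p"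
  assumes n: "1 \<le> n" and T: "0 < T" and pd: "pos_def (\<Sigma> \<theta>)"
  shows "quasi_likelihood T n \<Sigma> x \<theta> = exp (- (real n / 2) *
    (real CARD('p) * ln (2 * pi * (T / real n)) + ln (det (\<Sigma> \<theta>)) + matrix_inv (\<Sigma> \<theta>) \<bullet> realized_cov T n x))"
proof -
  define h where "h = T / real n"
  have h: "0 < h" using n T by (simp add: h_def)
  have d: "0 < det (\<Sigma> \<theta>)" by (rule pos_def_det_pos[OF pd])
  let ?M = "matrix_inv (\<Sigma> \<theta>)"
  let ?c = "real CARD('p) / 2 * ln (2 * pi * h) + 1/2 * ln (det (\<Sigma> \<theta>))"
  have factor: "1 / ((2 * pi * h) powr (real CARD('p) / 2) * det (\<Sigma> \<theta>) powr (1 / 2)) * exp y = exp (y - ?c)" for y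
    using h d by (simp add: powr_def exp_diff exp_add)
  have "quasi_likelihood T n \<Sigma> x \<theta> = (\<Prod>i=1..n. exp (- 1 / (2 * h) * (?M \<bullet> outer_square (x i - x (i - 1))) - ?c))"
    unfolding quasi_likelihood_def Let_def h_def[symmetric] mat_bracket_eq_inner factor ..
  also have "\<dots> = exp (\<Sum>i=1..n. - 1 / (2 * h) * (?M \<bullet> outer_square (x i - x (i - 1))) - ?c)"
    by (simp add: exp_sum)
  also have "(\<Sum>i=1..n. - 1 / (2 * h) * (?M \<bullet> outer_square (x i - x (i - 1))) - ?c)
      = - 1 / (2 * h) * (?M \<bullet> (\<Sum>i=1..n. outer_square (x i - x (i - 1)))) - real n * ?c"
    by (simp add: sum_subtractf inner_sum_right sum_distrib_left)
  also have "(\<Sum>i=1..n. outer_square (x i - x (i - 1))) = T *\<^sub>R realized_cov T n x"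
    using T by (simp add: realized_cov_def)
  also have "- 1 / (2 * h) * (?M \<bullet> (T *\<^sub>R realized_cov T n x)) - real n * ?c
      = - (real n / 2) * (real CARD('p) * ln (2 * pi * h) + ln (det (\<Sigma> \<theta>)) + ?M \<bullet> realized_cov T n x)"
    using n T by (simp add: h_def algebra_simps)
  finally show ?thesis by (simp add: h_def)
qed

lemma realized_cov_sample:
  assumes n: "1 \<le> n"
  shows "realized_cov T n (sample T n X \<omega>) =
    (1 / T) *\<^sub>R (\<Sum>i<n. outer_square (X (real (Suc i) * (T / n)) \<omega> - X (real i * (T / n)) \<omega>))"
proof -
  have "(\<Sum>i=1..n. outer_square (sample T n X \<omega> i - sample T n X \<omega> (i - 1)))
      = (\<Sum>i<n. outer_square (sample T n X \<omega> (Suc i) - sample T n X \<omega> i))"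
    by (rule sum.reindex_bij_witness[of _ Suc "\<lambda>i. i - 1"]) auto
  also have "\<dots> = (\<Sum>i<n. outer_square (X (real (Suc i) * (T / n)) \<omega> - X (real i * (T / n)) \<omega>))"
    by (intro sum.cong) (auto simp: sample_def)
  finally show ?thesis by (simp add: realized_cov_def)
qed

lemma realized_cov_measurable:
  "(realized_cov T n :: (nat \<Rightarrow> real^'p) \<Rightarrow> _) \<in> borel_measurable (data_space n)"
proof -
  have comp: "(\<lambda>x. x i) \<in> borel_measurable (data_space n :: (nat \<Rightarrow> real^'p) measure)" if "i \<le> n" for i
    unfolding data_space_def by (rule measurable_component_singleton) (use that in simp)
  have os: "(outer_square :: real^'p \<Rightarrow> _) \<in> borel_measurable borel"
    unfolding outer_square_eq_outer[abs_def]
    by (intro borel_measurable_continuous_onI outer.continuous_on continuous_intros)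
  show ?thesis
    unfolding realized_cov_def
    by (intro borel_measurable_scaleR borel_measurable_const borel_measurable_sum measurable_compose[OF _ os]
        borel_measurable_diff comp) auto
qed

text \<open>Around an interior point transposition does not change \<open>\<Sigma>\<close>, so by
  uniqueness it does not change the derivative. The covariance formula for the Gaussian part asks
  for symmetric matrices.\<close>

lemma has_derivative_symmetric:
  fixes \<Sigma> :: "real^'q \<Rightarrow> real^'p^'p"
  assumes sym: "\<And>\<theta>. \<theta> \<in> \<Theta> \<Longrightarrow> transpose (\<Sigma> \<theta>) = \<Sigma> \<theta>" and int: "\<theta>0 \<in> interior \<Theta>"
    and D: "(\<Sigma> has_derivative D) (at \<theta>0)"
  shows "transpose (D u) = D u"
proof -
  have bl: "bounded_linear (transpose :: real^'p^'p \<Rightarrow> real^'p^'p)"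
  proof (rule bounded_linear_intro[of _ 1])
    show "norm (transpose A) \<le> norm A * 1" for A :: "real^'p^'p" by (simp add: norm_transpose)
  qed (simp_all add: transpose_def vec_eq_iff)
  have "((\<lambda>\<theta>. transpose (\<Sigma> \<theta>)) has_derivative (\<lambda>u. transpose (D u))) (at \<theta>0)"
    by (rule bounded_linear.has_derivative[OF bl D])
  then have "(\<Sigma> has_derivative (\<lambda>u. transpose (D u))) (at \<theta>0)"
    by (rule has_derivative_transform_within_open[OF _ open_interior int]) (use sym interior_subset in blast)
  then show ?thesis
    using has_derivative_unique[OF D] by metis
qed

text \<open>Identifies the trace in the divergence expansion with the form of a matrix on the
  parameter space; for N the inverse of the true covariance this matrix is twice the Gaussian
  information.\<close>

lemma quadratic_form_eq_trace:
  fixes D :: "real^'q \<Rightarrow> real^'p^'p" and N :: "real^'p^'p"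
  assumes D: "linear D"
  shows "u \<bullet> ((\<chi> i j. trace (N ** D (axis i 1) ** N ** D (axis j 1))) *v u) = trace (N ** D u ** N ** D u)"
proof -
  have Du: "D u = (\<Sum>i\<in>UNIV. u $ i *\<^sub>R D (axis i 1))"
  proof -
    have "D u = D (\<Sum>i\<in>UNIV. u $ i *\<^sub>R axis i 1)"
      by (metis basis_expansion scalar_mult_eq_scaleR)
    then show ?thesis by (simp add: linear_sum[OF D] linear_scale[OF D])
  qed
  have tsum: "trace (\<Sum>i\<in>I. f i) = (\<Sum>i\<in>I. trace (f i))" for f :: "'i \<Rightarrow> real^'p^'p" and I
    unfolding trace_def by (simp add: sum.swap[of _ I])
  have "trace (N ** D u ** N ** D u) = (\<Sum>j\<in>UNIV. \<Sum>i\<in>UNIV. u $ j * (u $ i * trace (N ** D (axis i 1) ** N ** D (axis j 1))))"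
    unfolding Du
    by (simp add: matrix_mult.sum_left matrix_mult.sum_right matrix_mult.scaleR_left matrix_mult.scaleR_right
        tsum trace_scaleR sum_distrib_left)
  also have "\<dots> = (\<Sum>i\<in>UNIV. \<Sum>j\<in>UNIV. u $ j * (u $ i * trace (N ** D (axis i 1) ** N ** D (axis j 1))))"
    by (rule sum.swap)
  finally show ?thesis
    by (simp add: inner_vec_def matrix_vector_mult_def sum_distrib_left mult_ac)
qed

text \<open>The contrast is -2/n times the log-likelihood, minus its value at
  \<open>\<theta>0\<close>, so maximizers become minimizers. Continuity on the compact set bounds
  the likelihood above, so that the supremum really dominates every other parameter.\<close>

lemma qmle_contrast_minimal:
  fixes \<Sigma> :: "'q::topological_space \<Rightarrow> real^'p^'p"
  assumes n: "1 \<le> n" and T: "0 < T" and pd: "\<And>\<theta>. \<theta> \<in> \<Theta> \<Longrightarrow> pos_def (\<Sigma> \<theta>)"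
    and cont: "continuous_on \<Theta> \<Sigma>" and cpt: "compact \<Theta>"
    and mem: "\<theta>0 \<in> \<Theta>" "\<theta> \<in> \<Theta>" "\<theta>' \<in> \<Theta>"
    and max: "quasi_likelihood T n \<Sigma> x \<theta> = (SUP \<theta>\<in>\<Theta>. quasi_likelihood T n \<Sigma> x \<theta>)"
  defines "K \<equiv> \<lambda>\<theta>. matrix_inv (\<Sigma> \<theta>) - matrix_inv (\<Sigma> \<theta>0)" and "H \<equiv> realized_cov T n x - \<Sigma> \<theta>0"
  shows "- 2 * Y_fun \<Sigma> \<theta>0 \<theta> + K \<theta> \<bullet> H \<le> - 2 * Y_fun \<Sigma> \<theta>0 \<theta>' + K \<theta>' \<bullet> H"
proof -
  let ?u = "\<lambda>\<theta>. ln (det (\<Sigma> \<theta>)) + matrix_inv (\<Sigma> \<theta>) \<bullet> realized_cov T n x"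
  have dpos: "0 < det (\<Sigma> \<theta>)" if "\<theta> \<in> \<Theta>" for \<theta> by (rule pos_def_det_pos[OF pd[OF that]])
  have ql: "quasi_likelihood T n \<Sigma> x \<theta> = exp (- (real n / 2) * (real CARD('p) * ln (2 * pi * (T / real n)) + ?u \<theta>))"
    if "\<theta> \<in> \<Theta>" for \<theta>
    using quasi_likelihood_eq_exp[of n T \<Sigma> \<theta> x, OF n T pd[OF that]] by (simp only: add.assoc)
  have "continuous_on \<Theta> (\<lambda>\<theta>. exp (- (real n / 2) * (real CARD('p) * ln (2 * pi * (T / real n)) + ?u \<theta>)))"
  proof (intro continuous_intros cont)
    show "\<forall>\<theta>\<in>\<Theta>. det (\<Sigma> \<theta>) \<noteq> 0" using dpos by (metis less_irrefl)
    show "\<And>\<theta>. \<theta> \<in> \<Theta> \<Longrightarrow> invertible (\<Sigma> \<theta>)" by (rule pos_def_invertible[OF pd])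
  qed
  then have "compact ((\<lambda>\<theta>. quasi_likelihood T n \<Sigma> x \<theta>) ` \<Theta>)"
    using cpt by (intro compact_continuous_image) (simp_all add: ql cong: continuous_on_cong)
  then have "quasi_likelihood T n \<Sigma> x \<theta>' \<le> quasi_likelihood T n \<Sigma> x \<theta>"
    unfolding max by (intro cSUP_upper mem bounded_imp_bdd_above compact_imp_bounded)
  then have u: "?u \<theta> \<le> ?u \<theta>'"
    using n by (simp add: ql mem)
  have eq: "- 2 * Y_fun \<Sigma> \<theta>0 \<theta> + K \<theta> \<bullet> H = ?u \<theta> - ?u \<theta>0" if "\<theta> \<in> \<Theta>" for \<theta>
    using dpos[OF that] dpos[OF mem(1)]
    by (simp add: Y_fun_def K_def H_def mat_bracket_eq_inner ln_div inner_diff_left inner_diff_right field_simps)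
  show ?thesis using u unfolding eq[OF mem(2)] eq[OF mem(3)] by simp
qed

text \<open>For a parameter that is fixed with respect to the copy, the log-likelihood is affine in
  the realized covariance, so averaging over the copy replaces that matrix by its mean.\<close>

lemma expectation_log_quasi_likelihood:
  fixes \<Sigma> :: "'q \<Rightarrow> real^'p^'p"
  assumes M: "prob_space M" and S: "sample T n X \<in> measurable M (data_space n)"
    and int: "integrable M (\<lambda>\<omega>. realized_cov T n (sample T n X \<omega>))"
    and n: "1 \<le> n" and T: "0 < T" and pd: "pos_def (\<Sigma> \<theta>)"
  shows "integrable (sample_law M T n X) (\<lambda>z. ln (quasi_likelihood T n \<Sigma> z \<theta>))"
    and "(\<integral>z. ln (quasi_likelihood T n \<Sigma> z \<theta>) \<partial>sample_law M T n X) = - (real n / 2) *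
      (real CARD('p) * ln (2 * pi * (T / real n)) + ln (det (\<Sigma> \<theta>)) +
       matrix_inv (\<Sigma> \<theta>) \<bullet> (\<integral>\<omega>. realized_cov T n (sample T n X \<omega>) \<partial>M))"
proof -
  interpret prob_space M by (rule M)
  note [measurable] = realized_cov_measurable S
  have ql: "ln (quasi_likelihood T n \<Sigma> z \<theta>) = - (real n / 2) *
      (real CARD('p) * ln (2 * pi * (T / real n)) + ln (det (\<Sigma> \<theta>)) + matrix_inv (\<Sigma> \<theta>) \<bullet> realized_cov T n z)" for z
    by (simp only: quasi_likelihood_eq_exp[of n T \<Sigma> \<theta> z, OF n T pd] ln_exp)
  show "integrable (sample_law M T n X) (\<lambda>z. ln (quasi_likelihood T n \<Sigma> z \<theta>))"
    unfolding ql sample_law_def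
    by (subst integrable_distr_eq)
      (auto intro!: integrable_mult_right Bochner_Integration.integrable_add integrable_inner_right int)
  show "(\<integral>z. ln (quasi_likelihood T n \<Sigma> z \<theta>) \<partial>sample_law M T n X) = - (real n / 2) *
      (real CARD('p) * ln (2 * pi * (T / real n)) + ln (det (\<Sigma> \<theta>)) +
       matrix_inv (\<Sigma> \<theta>) \<bullet> (\<integral>\<omega>. realized_cov T n (sample T n X \<omega>) \<partial>M))"
  proof -
    have "(\<integral>z. ln (quasi_likelihood T n \<Sigma> z \<theta>) \<partial>sample_law M T n X) = (\<integral>\<omega>. - (real n / 2) *
      (real CARD('p) * ln (2 * pi * (T / real n)) + ln (det (\<Sigma> \<theta>)) +
       matrix_inv (\<Sigma> \<theta>) \<bullet> realized_cov T n (sample T n X \<omega>)) \<partial>M)"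
      unfolding ql sample_law_def by (subst integral_distr) auto
    also have "\<dots> = - (real n / 2) * (\<integral>\<omega>. (real CARD('p) * ln (2 * pi * (T / real n)) + ln (det (\<Sigma> \<theta>)) +
       matrix_inv (\<Sigma> \<theta>) \<bullet> realized_cov T n (sample T n X \<omega>)) \<partial>M)"
      by (rule integral_mult_right_zero)
    also have "(\<integral>\<omega>. (real CARD('p) * ln (2 * pi * (T / real n)) + ln (det (\<Sigma> \<theta>)) +
       matrix_inv (\<Sigma> \<theta>) \<bullet> realized_cov T n (sample T n X \<omega>)) \<partial>M)
      = real CARD('p) * ln (2 * pi * (T / real n)) + ln (det (\<Sigma> \<theta>)) +
       matrix_inv (\<Sigma> \<theta>) \<bullet> (\<integral>\<omega>. realized_cov T n (sample T n X \<omega>) \<partial>M)"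
      by (subst Bochner_Integration.integral_add) (auto intro!: integrable_inner_right int simp: prob_space integral_inner_right[OF int])
    finally show ?thesis .
  qed
qed

section \<open>The limit of the bias\<close>

lemma (in prob_space) qmle_log_likelihood_bias:
  fixes X :: "real \<Rightarrow> 'a \<Rightarrow> real^'p" and \<Sigma> :: "real^'q \<Rightarrow> real^'p^'p"
    and G R :: "nat \<Rightarrow> 'a \<Rightarrow> real^'p^'p"
  assumes X: "\<And>t. 0 \<le> t \<Longrightarrow> X t \<in> borel_measurable M" and T: "0 < T"
    and cpt: "compact \<Theta>" and int: "\<theta>0 \<in> interior \<Theta>" and pd: "\<And>\<theta>. \<theta> \<in> \<Theta> \<Longrightarrow> pos_def (\<Sigma> \<theta>)"
    and cont: "continuous_on \<Theta> \<Sigma>" and diff: "\<Sigma> differentiable (at \<theta>0)"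
    and qmle: "\<And>n. 1 \<le> n \<Longrightarrow> is_qmle M T n X \<Sigma> \<Theta> (est n)"
    and c: "0 < c" "\<And>\<theta>. \<theta> \<in> \<Theta> \<Longrightarrow> Y_fun \<Sigma> \<theta>0 \<theta> \<le> - c * (norm (\<theta> - \<theta>0))\<^sup>2"
    and meas [measurable]: "\<And>n. G n \<in> borel_measurable M" "\<And>n. R n \<in> borel_measurable M"
    and decomp: "\<And>n \<omega>. 1 \<le> n \<Longrightarrow> \<omega> \<in> space M \<Longrightarrow>
      (1 / T) *\<^sub>R (\<Sum>i<n. outer_square (X (real (Suc i) * (T / n)) \<omega> - X (real i * (T / n)) \<omega>))
        = \<Sigma> \<theta>0 + (G n \<omega> + R n \<omega>)"
    and G0: "\<And>n. 1 \<le> n \<Longrightarrow> expectation (G n) = 0"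
    and G4: "\<And>n. 1 \<le> n \<Longrightarrow> integrable M (\<lambda>\<omega>. norm (G n \<omega>) ^ 4)"
      "\<And>n. 1 \<le> n \<Longrightarrow> (real n)\<^sup>2 * expectation (\<lambda>\<omega>. norm (G n \<omega>) ^ 4) \<le> B"
    and cov: "\<And>n A E. 1 \<le> n \<Longrightarrow> transpose E = E \<Longrightarrow>
      real n * expectation (\<lambda>\<omega>. (A \<bullet> G n \<omega>) * (E \<bullet> G n \<omega>)) = 2 * trace (A ** \<Sigma> \<theta>0 ** E ** \<Sigma> \<theta>0)"
    and R2: "\<And>n. 1 \<le> n \<Longrightarrow> integrable M (\<lambda>\<omega>. (norm (R n \<omega>))\<^sup>2)"
      "\<And>n. 1 \<le> n \<Longrightarrow> expectation (\<lambda>\<omega>. (norm (R n \<omega>))\<^sup>2) \<le> C * (T / n)\<^sup>2"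
  shows "\<And>n \<theta>. 1 \<le> n \<Longrightarrow> \<theta> \<in> \<Theta> \<Longrightarrow> integrable (sample_law M T n X) (\<lambda>z. ln (quasi_likelihood T n \<Sigma> z \<theta>))"
    and "\<And>n. 1 \<le> n \<Longrightarrow> integrable (sample_law M T n X)
      (\<lambda>x. ln (quasi_likelihood T n \<Sigma> x (est n x)) -
        (\<integral>z. ln (quasi_likelihood T n \<Sigma> z (est n x)) \<partial>sample_law M T n X))"
    and "(\<lambda>n. \<integral>x. (ln (quasi_likelihood T n \<Sigma> x (est n x)) -
        (\<integral>z. ln (quasi_likelihood T n \<Sigma> z (est n x)) \<partial>sample_law M T n X))
      \<partial>sample_law M T n X) \<longlonglongrightarrow> real CARD('q)"
proof -
  have \<theta>0: "\<theta>0 \<in> \<Theta>" using int interior_subset by blast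
  define M0 where "M0 = matrix_inv (\<Sigma> \<theta>0)"
  have inv0: "invertible (\<Sigma> \<theta>0)" by (rule pos_def_invertible[OF pd[OF \<theta>0]])
  have M0\<Sigma>: "M0 ** \<Sigma> \<theta>0 = mat 1" unfolding M0_def by (rule matrix_inv_mult[OF inv0])
  have sym\<Sigma>: "transpose (\<Sigma> \<theta>) = \<Sigma> \<theta>" if "\<theta> \<in> \<Theta>" for \<theta> using pd[OF that] by (simp add: pos_def_def)
  have symM0: "transpose M0 = M0" unfolding M0_def by (rule transpose_matrix_inv[OF sym\<Sigma>[OF \<theta>0] inv0])
  obtain D where D: "(\<Sigma> has_derivative D) (at \<theta>0)" using diff unfolding differentiable_def by blast
  have lD: "linear D" by (rule has_derivative_linear[OF D])
  have symD: "transpose (D u) = D u" for u by (rule has_derivative_symmetric[OF sym\<Sigma> int D])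
  define L where "L u = M0 ** D u ** M0" for u
  have lL: "linear L"
    by (rule linearI) (simp_all add: L_def linear_add[OF lD] linear_scale[OF lD] matrix_mult.add_left
        matrix_mult.add_right matrix_mult.scaleR_left matrix_mult.scaleR_right)
  have symL: "transpose (L u) = L u" for u
    by (simp add: L_def matrix_transpose_mul symM0 symD matrix_mul_assoc)
  define J :: "real^'q^'q" where "J = (\<chi> i j. trace (M0 ** D (axis i 1) ** M0 ** D (axis j 1)))"
  have J: "transpose J = J"
  proof -
    have "trace (M0 ** a ** M0 ** b) = trace (M0 ** b ** M0 ** a)" for a b :: "real^'p^'p"
      using trace_mul_sym[of "M0 ** a" "M0 ** b"] by (simp add: matrix_mul_assoc)
    then show ?thesis by (simp add: J_def transpose_def vec_eq_iff)
  qed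
  define v where "v \<theta> = - 2 * Y_fun \<Sigma> \<theta>0 \<theta>" for \<theta>
  define K where "K \<theta> = matrix_inv (\<Sigma> \<theta>) - M0" for \<theta>
  have contK: "continuous_on \<Theta> K"
    unfolding K_def by (intro continuous_intros cont pos_def_invertible pd)
  obtain k where k: "\<And>\<theta>. \<theta> \<in> \<Theta> \<Longrightarrow> norm (K \<theta>) \<le> k"
    using compact_imp_bounded[OF compact_continuous_image[OF contK cpt]] unfolding bounded_iff by blast
  define minimal where "minimal \<theta> H \<longleftrightarrow> \<theta> \<in> \<Theta> \<and> (\<forall>\<theta>'\<in>\<Theta>. v \<theta> + K \<theta> \<bullet> H \<le> v \<theta>' + K \<theta>' \<bullet> H)" for \<theta> H
  define w where "w H = (\<chi> i. L (axis i 1) \<bullet> H)" for H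
  \<comment> \<open>Condition (a) enters with 2c because v = -2Y.\<close>
  have vc: "(2 * c) * (norm (\<theta> - \<theta>0))\<^sup>2 \<le> v \<theta>" if "\<theta> \<in> \<Theta>" for \<theta>
    using c(2)[OF that] by (simp add: v_def)
  have expand: "\<exists>d>0. \<forall>\<theta>\<in>\<Theta>. norm (\<theta> - \<theta>0) < d \<longrightarrow>
      norm (K \<theta> + L (\<theta> - \<theta>0)) \<le> e * norm (\<theta> - \<theta>0) \<and>
      \<bar>v \<theta> - 1/2 * ((\<theta> - \<theta>0) \<bullet> (J *v (\<theta> - \<theta>0)))\<bar> \<le> e * (norm (\<theta> - \<theta>0))\<^sup>2" if "0 < e" for e
    using gaussian_divergence_expansion[of \<Theta> \<Sigma>, OF pd \<theta>0 D that]
    unfolding J_def quadratic_form_eq_trace[OF lD] K_def L_def v_def M0_def .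
  have c2: "0 < 2 * c" using c(1) by simp
  have invJ: "invertible J"
    by (rule m_estimator_expansion(1)[where K = K and v = v and J = J and L = L, OF int c2 vc k lL J expand])
  have est_le: "\<exists>C. \<forall>\<theta> H. minimal \<theta> H \<longrightarrow> norm (K \<theta>) \<le> C * norm H"
    unfolding minimal_def
    by (rule m_estimator_expansion(2)[where K = K and v = v and J = J and L = L, OF int c2 vc k lL J expand])
  have est_expand: "\<exists>d>0. \<forall>\<theta> H. minimal \<theta> H \<longrightarrow> norm H < d \<longrightarrow>
      \<bar>K \<theta> \<bullet> H + w H \<bullet> (matrix_inv J *v w H)\<bar> \<le> e * (norm H)\<^sup>2" if e: "0 < e" for e
    unfolding minimal_def w_def
    by (rule m_estimator_expansion(3)[where K = K and v = v and J = J and L = L, OF int c2 vc k lL J expand])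
      (assumption | rule e)+
  have JJ: "matrix_inv J ** J = mat 1" by (rule matrix_inv_mult[OF invJ])
  obtain CK where CK: "\<And>\<theta> H. minimal \<theta> H \<Longrightarrow> norm (K \<theta>) \<le> CK * norm H" using est_le by blast

  define S where "S n = sample T n X" for n
  have S [measurable]: "S n \<in> measurable M (data_space n)" for n
    unfolding S_def data_space_def sample_def
    by (rule measurable_restrict) (use T in \<open>auto intro!: X\<close>)
  have Sspace: "S n \<omega> \<in> space (data_space n)" if "\<omega> \<in> space M" for n \<omega>
    using measurable_space[OF S that] .
  \<comment> \<open>\<open>K\<close> is continuous on \<open>\<Theta>\<close> only, so the estimator
    is viewed as a map into the restricted space before composing.\<close>
  have estm: "est n \<in> measurable (data_space n) (restrict_space borel \<Theta>)" if "1 \<le> n" for n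
    using qmle[OF that] by (intro measurable_restrict_space2) (auto simp: is_qmle_def)
  have est\<Theta>: "est n x \<in> \<Theta>" if "1 \<le> n" "x \<in> space (data_space n)" for n x
    using qmle[OF that(1)] that(2) by (simp add: is_qmle_def)
  have Kest: "(\<lambda>x. K (est n x)) \<in> borel_measurable (data_space n)" if "1 \<le> n" for n
    by (rule measurable_compose[OF estm[OF that] borel_measurable_continuous_on_restrict[OF contK]])
  \<comment> \<open>The value at n = 0 is a dummy that makes \<open>Kn n\<close> measurable for all
    n.\<close>
  define Kn where "Kn n \<omega> = (if n = 0 then 0 else K (est n (S n \<omega>)))" for n \<omega>
  have Kn [measurable]: "Kn n \<in> borel_measurable M" for n
    using measurable_compose[OF S Kest] by (cases "n = 0") (simp_all add: Kn_def[abs_def])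
  define H where "H n \<omega> = G n \<omega> + R n \<omega>" for n \<omega>
  have Hm [measurable]: "H n \<in> borel_measurable M" for n unfolding H_def[abs_def] by measurable
  have Q: "realized_cov T n (S n \<omega>) = \<Sigma> \<theta>0 + H n \<omega>" if "1 \<le> n" "\<omega> \<in> space M" for n \<omega>
    unfolding S_def realized_cov_sample[OF that(1)] decomp[OF that] H_def ..
  have minH: "AE \<omega> in M. minimal (est n (S n \<omega>)) (H n \<omega>)" if n: "1 \<le> n" for n
  proof -
    have "AE \<omega> in M. quasi_likelihood T n \<Sigma> (S n \<omega>) (est n (S n \<omega>)) = (SUP \<theta>\<in>\<Theta>. quasi_likelihood T n \<Sigma> (S n \<omega>) \<theta>)"
      using qmle[OF n] by (simp add: is_qmle_def S_def)
    with AE_space show ?thesis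
    proof eventually_elim
      case (elim \<omega>)
      have mem: "est n (S n \<omega>) \<in> \<Theta>" by (rule est\<Theta>[OF n Sspace[OF elim(1)]])
      have "v (est n (S n \<omega>)) + K (est n (S n \<omega>)) \<bullet> H n \<omega> \<le> v \<theta>' + K \<theta>' \<bullet> H n \<omega>" if "\<theta>' \<in> \<Theta>" for \<theta>'
        using qmle_contrast_minimal[of n T \<Theta> \<Sigma>, OF n T pd cont cpt \<theta>0 mem that elim(2)]
        by (simp add: v_def K_def M0_def Q[OF n elim(1)])
      then show ?case using mem by (simp add: minimal_def)
    qed
  qed
  have intG: "integrable M (G n)" if "1 \<le> n" for n
  proof (rule Bochner_Integration.integrable_bound)
    show "integrable M (\<lambda>\<omega>. 1 + norm (G n \<omega>) ^ 4)" using G4(1)[OF that] by simp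
    have "x \<le> 1 + x ^ 4" if "0 \<le> x" for x :: real
      using that self_le_power[of x 4] by (cases "1 \<le> x") (auto intro: add_increasing2)
    then show "AE \<omega> in M. norm (G n \<omega>) \<le> norm (1 + norm (G n \<omega>) ^ 4)" by simp
  qed simp
  have intR: "integrable M (R n)" if "1 \<le> n" for n
  proof (rule Bochner_Integration.integrable_bound)
    show "integrable M (\<lambda>\<omega>. 1 + (norm (R n \<omega>))\<^sup>2)" using R2(1)[OF that] by simp
    have "x \<le> 1 + x ^ 2" if "0 \<le> x" for x :: real
      using that self_le_power[of x 2] by (cases "1 \<le> x") (auto intro: add_increasing2)
    then show "AE \<omega> in M. norm (R n \<omega>) \<le> norm (1 + (norm (R n \<omega>))\<^sup>2)" by simp
  qed simp
  have intH: "integrable M (H n)" if "1 \<le> n" for n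
    unfolding H_def[abs_def] using intG[OF that] intR[OF that] by simp

  have Rlim: "(\<lambda>n. real n * expectation (\<lambda>\<omega>. (norm (R n \<omega>))\<^sup>2)) \<longlonglongrightarrow> 0"
  proof (rule tendsto_sandwich[of "\<lambda>_. 0" _ _ "\<lambda>n. (C * T\<^sup>2) * (1 / real n)"])
    show "\<forall>\<^sub>F n in sequentially. 0 \<le> real n * expectation (\<lambda>\<omega>. (norm (R n \<omega>))\<^sup>2)"
      by (intro always_eventually allI mult_nonneg_nonneg Bochner_Integration.integral_nonneg) auto
    have "real n * expectation (\<lambda>\<omega>. (norm (R n \<omega>))\<^sup>2) \<le> (C * T\<^sup>2) * (1 / real n)" if n: "1 \<le> n" for n
      using mult_left_mono[OF R2(2)[OF n], of "real n"] n by (simp add: power2_eq_square)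
    then show "\<forall>\<^sub>F n in sequentially. real n * expectation (\<lambda>\<omega>. (norm (R n \<omega>))\<^sup>2) \<le> (C * T\<^sup>2) * (1 / real n)"
      by (rule eventually_sequentiallyI)
    show "(\<lambda>n. (C * T\<^sup>2) * (1 / real n)) \<longlonglongrightarrow> 0"
      using tendsto_mult_right_zero[OF lim_1_over_n, of "C * T\<^sup>2"] by simp
  qed simp
  \<comment> \<open>Every \<open>\<Sigma> \<theta>0\<close> meets a neighbouring \<open>M0\<close>
    and cancels, which turns tr(L \<Sigma> L \<Sigma>) into an entry of \<open>J\<close>.\<close>
  have covJ: "real n * expectation (\<lambda>\<omega>. (L (axis i 1) \<bullet> G n \<omega>) * (L (axis j 1) \<bullet> G n \<omega>)) = 2 * J $ i $ j"
    if n: "1 \<le> n" for n i j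
  proof -
    have "L a ** \<Sigma> \<theta>0 ** L b ** \<Sigma> \<theta>0 = M0 ** D a ** (M0 ** \<Sigma> \<theta>0) ** M0 ** D b ** (M0 ** \<Sigma> \<theta>0)" for a b
      by (simp add: L_def matrix_mul_assoc)
    then show ?thesis by (simp add: cov[OF n symL] J_def M0\<Sigma>)
  qed
  have K_le: "AE \<omega> in M. norm (Kn n \<omega>) \<le> CK * norm (G n \<omega> + R n \<omega>)" if n: "1 \<le> n" for n
    using minH[OF n] by eventually_elim (use n CK in \<open>auto simp: Kn_def H_def\<close>)
  have K_expand: "\<exists>d>0. \<forall>n\<ge>1. AE \<omega> in M. norm (G n \<omega> + R n \<omega>) < d \<longrightarrow>
      \<bar>Kn n \<omega> \<bullet> (G n \<omega> + R n \<omega>) + (\<chi> i. L (axis i 1) \<bullet> (G n \<omega> + R n \<omega>)) \<bullet>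
        (matrix_inv J *v (\<chi> i. L (axis i 1) \<bullet> (G n \<omega> + R n \<omega>)))\<bar> \<le> e * (norm (G n \<omega> + R n \<omega>))\<^sup>2" if e: "0 < e" for e
  proof -
    obtain d where d: "0 < d" "\<And>\<theta> H. minimal \<theta> H \<Longrightarrow> norm H < d \<Longrightarrow>
        \<bar>K \<theta> \<bullet> H + w H \<bullet> (matrix_inv J *v w H)\<bar> \<le> e * (norm H)\<^sup>2"
      using est_expand[OF e] by blast
    have "AE \<omega> in M. norm (G n \<omega> + R n \<omega>) < d \<longrightarrow>
      \<bar>Kn n \<omega> \<bullet> (G n \<omega> + R n \<omega>) + (\<chi> i. L (axis i 1) \<bullet> (G n \<omega> + R n \<omega>)) \<bullet>
        (matrix_inv J *v (\<chi> i. L (axis i 1) \<bullet> (G n \<omega> + R n \<omega>)))\<bar> \<le> e * (norm (G n \<omega> + R n \<omega>))\<^sup>2" if n: "1 \<le> n" for n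
      using minH[OF n]
    proof eventually_elim
      case (elim \<omega>)
      then show ?case using d(2)[OF elim] n unfolding Kn_def H_def w_def by simp
    qed
    then show ?thesis using d(1) by blast
  qed
  have int2: "integrable M (\<lambda>\<omega>. Kn n \<omega> \<bullet> (H n \<omega> - expectation (H n)))" if n: "1 \<le> n" for n
    unfolding H_def[abs_def]
    by (rule expectation_m_estimator_limit(1)[where G = G and R = R and K = Kn and L = "\<lambda>i. L (axis i 1)" and J = J
        and Ji = "matrix_inv J", OF meas Kn K_le K_expand G4 R2(1) Rlim G0 covJ J JJ]) (assumption | rule n)+
  have limit: "(\<lambda>n. real n * expectation (\<lambda>\<omega>. Kn n \<omega> \<bullet> (H n \<omega> - expectation (H n)))) \<longlonglongrightarrow> - 2 * real CARD('q)"
    unfolding H_def[abs_def]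
    by (rule expectation_m_estimator_limit(2)[where G = G and R = R and K = Kn and L = "\<lambda>i. L (axis i 1)" and J = J
        and Ji = "matrix_inv J", OF meas Kn K_le K_expand G4 R2(1) Rlim G0 covJ J JJ])

  note [measurable] = realized_cov_measurable
  have intQ: "integrable M (\<lambda>\<omega>. realized_cov T n (sample T n X \<omega>))" if n: "1 \<le> n" for n
    using intH[OF n] by (subst Bochner_Integration.integrable_cong[OF refl Q[OF n, unfolded S_def]]) auto
  have EQ: "(\<integral>\<omega>. realized_cov T n (sample T n X \<omega>) \<partial>M) = \<Sigma> \<theta>0 + expectation (H n)" if n: "1 \<le> n" for n
    using intH[OF n] by (subst Bochner_Integration.integral_cong[OF refl Q[OF n, unfolded S_def]]) (auto simp: prob_space)
  show "integrable (sample_law M T n X) (\<lambda>z. ln (quasi_likelihood T n \<Sigma> z \<theta>))" if "1 \<le> n" "\<theta> \<in> \<Theta>" for n \<theta>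
    by (rule expectation_log_quasi_likelihood(1)[where \<Sigma> = \<Sigma> and \<theta> = \<theta>, OF prob_space_axioms S[unfolded S_def] intQ[OF that(1)] that(1) T pd[OF that(2)]])
  define g where "g n x = ln (quasi_likelihood T n \<Sigma> x (est n x)) -
      (\<integral>z. ln (quasi_likelihood T n \<Sigma> z (est n x)) \<partial>sample_law M T n X)" for n x
  \<comment> \<open>Explicit form of \<open>g\<close>: determinants and normalization cancel between
    data and copy, and \<open>K + M0\<close> is the inverse covariance at the estimator. The
    \<open>M0\<close> part is linear in H - E H and has mean 0, so only the \<open>K\<close> part
    survives in expectation.\<close>
  define f where "f n x = - (real n / 2) * ((K (est n x) + M0) \<bullet> (realized_cov T n x - (\<Sigma> \<theta>0 + expectation (H n))))" for n x
  have gf: "g n x = f n x" if n: "1 \<le> n" and x: "x \<in> space (data_space n)" for n x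
  proof -
    note mem = est\<Theta>[OF n x]
    show ?thesis
      unfolding g_def f_def expectation_log_quasi_likelihood(2)[where \<Sigma> = \<Sigma> and \<theta> = "est n x", OF prob_space_axioms S[unfolded S_def] intQ[OF n] n T pd[OF mem]] EQ[OF n] K_def
        quasi_likelihood_eq_exp[of n T \<Sigma> "est n x" x, OF n T pd[OF mem]] ln_exp
      by (simp add: inner_diff_right algebra_simps)
  qed
  have fm: "f n \<in> borel_measurable (data_space n)" if n: "1 \<le> n" for n
    unfolding f_def[abs_def] using Kest[OF n] by measurable
  have fS: "f n (S n \<omega>) = - (real n / 2) * (Kn n \<omega> \<bullet> (H n \<omega> - expectation (H n)) + M0 \<bullet> (H n \<omega> - expectation (H n)))"
    if n: "1 \<le> n" and \<omega>: "\<omega> \<in> space M" for n \<omega>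
    using n by (simp add: f_def Q[OF n \<omega>] Kn_def inner_add_left)
  have int3: "integrable M (\<lambda>\<omega>. M0 \<bullet> (H n \<omega> - expectation (H n)))" if n: "1 \<le> n" for n
    using intH[OF n] by (intro integrable_inner_right) auto
  have law: "space (sample_law M T n X) = space (data_space n)" for n by (simp add: sample_law_def)
  have intf: "integrable (sample_law M T n X) (f n)" if n: "1 \<le> n" for n
  proof -
    have "integrable M (\<lambda>\<omega>. f n (S n \<omega>))"
      by (subst Bochner_Integration.integrable_cong[OF refl fS[OF n]])
        (auto intro!: integrable_mult_right Bochner_Integration.integrable_add int2[OF n] int3[OF n])
    then show ?thesis
      unfolding sample_law_def using integrable_distr_eq[OF S fm[OF n]] by (simp add: S_def)
  qed
  have intg: "integrable (sample_law M T n X) (g n)" if n: "1 \<le> n" for n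
    using intf[OF n] by (subst Bochner_Integration.integrable_cong[OF refl gf[OF n]]) (simp_all add: law)
  then show "integrable (sample_law M T n X)
      (\<lambda>x. ln (quasi_likelihood T n \<Sigma> x (est n x)) -
        (\<integral>z. ln (quasi_likelihood T n \<Sigma> z (est n x)) \<partial>sample_law M T n X))" if "1 \<le> n" for n
    using that by (simp add: g_def[abs_def])
  have Eg: "(\<integral>x. g n x \<partial>sample_law M T n X) = - (1 / 2) * (real n * expectation (\<lambda>\<omega>. Kn n \<omega> \<bullet> (H n \<omega> - expectation (H n))))"
    if n: "1 \<le> n" for n
  proof -
    have zero: "expectation (\<lambda>\<omega>. M0 \<bullet> (H n \<omega> - expectation (H n))) = 0"
    proof -
      have "expectation (\<lambda>\<omega>. M0 \<bullet> (H n \<omega> - expectation (H n))) = M0 \<bullet> expectation (\<lambda>\<omega>. H n \<omega> - expectation (H n))"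
        using intH[OF n] by (intro integral_inner_right) auto
      also have "expectation (\<lambda>\<omega>. H n \<omega> - expectation (H n)) = 0"
        using intH[OF n] by (simp add: prob_space)
      finally show ?thesis by simp
    qed
    have "(\<integral>x. g n x \<partial>sample_law M T n X) = (\<integral>x. f n x \<partial>sample_law M T n X)"
      by (rule Bochner_Integration.integral_cong) (simp_all add: law gf[OF n])
    also have "\<dots> = expectation (\<lambda>\<omega>. f n (S n \<omega>))"
      unfolding sample_law_def S_def[symmetric] by (rule integral_distr[OF S fm[OF n]])
    also have "\<dots> = expectation (\<lambda>\<omega>. - (real n / 2) * (Kn n \<omega> \<bullet> (H n \<omega> - expectation (H n)) + M0 \<bullet> (H n \<omega> - expectation (H n))))"
      by (rule Bochner_Integration.integral_cong) (simp_all add: fS[OF n])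
    also have "\<dots> = - (real n / 2) * expectation (\<lambda>\<omega>. Kn n \<omega> \<bullet> (H n \<omega> - expectation (H n)) + M0 \<bullet> (H n \<omega> - expectation (H n)))"
      by (rule integral_mult_right_zero)
    also have "expectation (\<lambda>\<omega>. Kn n \<omega> \<bullet> (H n \<omega> - expectation (H n)) + M0 \<bullet> (H n \<omega> - expectation (H n)))
        = expectation (\<lambda>\<omega>. Kn n \<omega> \<bullet> (H n \<omega> - expectation (H n)))"
      by (subst Bochner_Integration.integral_add[OF int2[OF n] int3[OF n]]) (simp only: zero add_0_right)
    finally show ?thesis by simp
  qed
  have "(\<lambda>n. - (1 / 2) * (real n * expectation (\<lambda>\<omega>. Kn n \<omega> \<bullet> (H n \<omega> - expectation (H n))))) \<longlonglongrightarrow> - (1 / 2) * (- 2 * real CARD('q))"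
    by (intro tendsto_mult tendsto_const limit)
  moreover have "\<forall>\<^sub>F n in sequentially. (\<integral>x. g n x \<partial>sample_law M T n X)
      = - (1 / 2) * (real n * expectation (\<lambda>\<omega>. Kn n \<omega> \<bullet> (H n \<omega> - expectation (H n))))"
    using Eg by (rule eventually_sequentiallyI)
  ultimately show "(\<lambda>n. \<integral>x. (ln (quasi_likelihood T n \<Sigma> x (est n x)) -
        (\<integral>z. ln (quasi_likelihood T n \<Sigma> z (est n x)) \<partial>sample_law M T n X))
      \<partial>sample_law M T n X) \<longlonglongrightarrow> real CARD('q)"
    by (simp add: tendsto_cong g_def)
qed

text \<open>The expectations are numbers, so the o_p(1) of the claim is convergence of a real
  sequence. The integrability clauses make sure that the Bochner integrals are genuine expectations
  and not the default value 0.\<close>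

theorem theorem1:
  fixes M :: "'w measure" and F :: "real \<Rightarrow> 'w measure"
    and W1 :: "real \<Rightarrow> 'w \<Rightarrow> real ^ 'r1" and W2 :: "real \<Rightarrow> 'w \<Rightarrow> real ^ 'r2"
    and W3 :: "real \<Rightarrow> 'w \<Rightarrow> real ^ 'r3" and W4 :: "real \<Rightarrow> 'w \<Rightarrow> real ^ 'r4"
    and B1 :: "real ^ 'k1 \<Rightarrow> real ^ 'k1" and B2 :: "real ^ 'p1 \<Rightarrow> real ^ 'p1"
    and B3 :: "real ^ 'p2 \<Rightarrow> real ^ 'p2" and B4 :: "real ^ 'k2 \<Rightarrow> real ^ 'k2"
    and c1 :: "real ^ 'k1" and c2 :: "real ^ 'p1" and c3 :: "real ^ 'p2" and c4 :: "real ^ 'k2"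
    and \<xi> :: "real \<Rightarrow> 'w \<Rightarrow> real ^ 'k1" and \<delta> :: "real \<Rightarrow> 'w \<Rightarrow> real ^ 'p1"
    and \<epsilon> :: "real \<Rightarrow> 'w \<Rightarrow> real ^ 'p2" and \<zeta> \<eta> :: "real \<Rightarrow> 'w \<Rightarrow> real ^ 'k2"
    and X :: "real \<Rightarrow> 'w \<Rightarrow> real ^ ('p1 + 'p2)"
    and P0 :: "('k1::finite, 'k2::finite, 'p1::finite, 'p2::finite,
                'r1::finite, 'r2::finite, 'r3::finite, 'r4::finite) sem"
    and P :: "real ^ 'q \<Rightarrow> ('k1, 'k2, 'p1, 'p2, 'r1, 'r2, 'r3, 'r4) sem"
    and \<Theta> :: "(real ^ 'q) set" and \<theta>0 :: "real ^ 'q"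
    and \<Sigma> :: "real ^ 'q \<Rightarrow> real ^ ('p1 + 'p2) ^ ('p1 + 'p2)"
    and est :: "nat \<Rightarrow> (nat \<Rightarrow> real ^ ('p1 + 'p2)) \<Rightarrow> real ^ 'q"
    and T :: real
  assumes dims: "CARD('k1) \<le> CARD('p1)" "CARD('k2) \<le> CARD('p2)"
    and basis: "stochastic_basis M F"
    and wiener: "wiener_process M F W1" "wiener_process M F W2"
      "wiener_process M F W3" "wiener_process M F W4"
    and indep: "prob_space.indep_sets M
      (\<lambda>j. [process_sigma M W1, process_sigma M W2, process_sigma M W3, process_sigma M W4] ! j)
      {..<4}"
    and sde: "sde_solution M F W1 B1 (S1 P0) c1 \<xi>" "sde_solution M F W2 B2 (S2 P0) c2 \<delta>"
      "sde_solution M F W3 B3 (S3 P0) c3 \<epsilon>" "sde_solution M F W4 B4 (S4 P0) c4 \<zeta>"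
    and true_model: "admissible_sem P0"
    and eta: "\<And>t \<omega>. 0 \<le> t \<Longrightarrow> \<omega> \<in> space M \<Longrightarrow>
      \<eta> t \<omega> = B_mat P0 *v \<eta> t \<omega> + Gamma_mat P0 *v \<xi> t \<omega> + \<zeta> t \<omega>"
    and X_def: "X = observable P0 \<xi> \<eta> \<delta> \<epsilon>"
    and lipschitz: "\<exists>C>0. C-lipschitz_on UNIV B1" "\<exists>C>0. C-lipschitz_on UNIV B2"
      "\<exists>C>0. C-lipschitz_on UNIV B3" "\<exists>C>0. C-lipschitz_on UNIV B4"
    and smooth: "C_up 4 B1" "C_up 4 B2" "C_up 4 B3" "C_up 4 B4"
    and moments: "\<And>l. 0 < l \<Longrightarrow> bounded_moment M \<xi> l" "\<And>l. 0 \<le> l \<Longrightarrow> bounded_moment M \<delta> l"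
      "\<And>l. 0 \<le> l \<Longrightarrow> bounded_moment M \<epsilon> l" "\<And>l. 0 \<le> l \<Longrightarrow> bounded_moment M \<zeta> l"
    and T: "0 < T"
    and model: "competing_model P \<Theta> \<theta>0 P0"
    and Sigma_def: "\<Sigma> = (\<lambda>\<theta>. Sigma_sem (P \<theta>))"
    and qmle: "\<And>n. 1 \<le> n \<Longrightarrow> is_qmle M T n X \<Sigma> \<Theta> (est n)"
    and cond_a: "\<exists>c>0. \<forall>\<theta>\<in>\<Theta>. Y_fun \<Sigma> \<theta>0 \<theta> \<le> - c * (norm (\<theta> - \<theta>0))\<^sup>2"
    and cond_b: "rank (Delta_mat \<Sigma> \<theta>0) = CARD('q)"
  shows "(\<forall>n\<ge>1.
           (\<forall>\<theta>\<in>\<Theta>. integrable (sample_law M T n X) (\<lambda>z. ln (quasi_likelihood T n \<Sigma> z \<theta>))) \<and>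
           integrable (sample_law M T n X)
             (\<lambda>x. ln (quasi_likelihood T n \<Sigma> x (est n x)) -
               (\<integral>z. ln (quasi_likelihood T n \<Sigma> z (est n x)) \<partial>sample_law M T n X))) \<and>
         (\<lambda>n. \<integral>x. (ln (quasi_likelihood T n \<Sigma> x (est n x)) -
               (\<integral>z. ln (quasi_likelihood T n \<Sigma> z (est n x)) \<partial>sample_law M T n X))
             \<partial>sample_law M T n X) \<longlonglongrightarrow> real CARD('q)"
proof -
  interpret prob_space M using basis by (simp add: stochastic_basis_def)
  have X: "X t \<omega> = load1 P0 *v \<xi> t \<omega> + load2 P0 *v \<delta> t \<omega> + load3 P0 *v \<epsilon> t \<omega> + load4 P0 *v \<zeta> t \<omega>"
    if "0 \<le> t" "\<omega> \<in> space M" for t \<omega>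
    unfolding X_def
    by (rule observable_eq_loads) (use true_model eta[OF that] in \<open>simp_all add: admissible_sem_def\<close>)
  have Xm: "X t \<in> borel_measurable M" if t: "0 \<le> t" for t
  proof -
    have [measurable]: "\<xi> t \<in> borel_measurable M" "\<delta> t \<in> borel_measurable M"
        "\<epsilon> t \<in> borel_measurable M" "\<zeta> t \<in> borel_measurable M"
      using sde by (auto simp: sde_solution_def intro: adapted_process_measurable(1)[OF basis _ t])
    have "(\<lambda>\<omega>. load1 P0 *v \<xi> t \<omega> + load2 P0 *v \<delta> t \<omega> + load3 P0 *v \<epsilon> t \<omega> + load4 P0 *v \<zeta> t \<omega>) \<in> borel_measurable M"
      by (intro borel_measurable_add borel_measurable_mult_vec) measurable
    then show ?thesis by (subst measurable_cong[OF X[OF t]])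
  qed
  obtain L1 L2 L3 L4 where L: "L1-lipschitz_on UNIV B1" "L2-lipschitz_on UNIV B2" "L3-lipschitz_on UNIV B3" "L4-lipschitz_on UNIV B4"
    using lipschitz by blast
  have moments4: "bounded_moment M \<xi> 4" "bounded_moment M \<delta> 4" "bounded_moment M \<epsilon> 4" "bounded_moment M \<zeta> 4"
    using moments by simp_all
  have \<Sigma>0: "Sigma_sem P0 = \<Sigma> \<theta>0" using model by (simp add: competing_model_def Sigma_def)
  obtain c where c: "0 < c" "\<And>\<theta>. \<theta> \<in> \<Theta> \<Longrightarrow> Y_fun \<Sigma> \<theta>0 \<theta> \<le> - c * (norm (\<theta> - \<theta>0))\<^sup>2"
    using cond_a by blast
  obtain G R :: "nat \<Rightarrow> 'w \<Rightarrow> real^('p1 + 'p2)^('p1 + 'p2)" and B C :: real where GR: "\<And>n. G n \<in> borel_measurable M" "\<And>n. R n \<in> borel_measurable M"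
    "\<And>n \<omega>. 1 \<le> n \<Longrightarrow> \<omega> \<in> space M \<Longrightarrow>
      (1 / T) *\<^sub>R (\<Sum>i<n. outer_square (X (real (Suc i) * (T / n)) \<omega> - X (real i * (T / n)) \<omega>))
        = \<Sigma> \<theta>0 + (G n \<omega> + R n \<omega>)"
    "\<And>n. 1 \<le> n \<Longrightarrow> integral\<^sup>L M (G n) = 0"
    "\<And>n. 1 \<le> n \<Longrightarrow> integrable M (\<lambda>\<omega>. norm (G n \<omega>) ^ 4)"
    "\<And>n. 1 \<le> n \<Longrightarrow> (real n)\<^sup>2 * integral\<^sup>L M (\<lambda>\<omega>. norm (G n \<omega>) ^ 4) \<le> B"
    "\<And>n A E. 1 \<le> n \<Longrightarrow> transpose E = E \<Longrightarrow> real n * integral\<^sup>L M (\<lambda>\<omega>. (A \<bullet> G n \<omega>) * (E \<bullet> G n \<omega>))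
      = 2 * trace (A ** \<Sigma> \<theta>0 ** E ** \<Sigma> \<theta>0)"
    "\<And>n. 1 \<le> n \<Longrightarrow> integrable M (\<lambda>\<omega>. (norm (R n \<omega>))\<^sup>2)"
    "\<And>n. 1 \<le> n \<Longrightarrow> integral\<^sup>L M (\<lambda>\<omega>. (norm (R n \<omega>))\<^sup>2) \<le> C * (T / n)\<^sup>2"
    by (rule realized_covariance_decomposition[OF prob_space_axioms basis wiener indep sde L moments4 T X, unfolded \<Sigma>0])
      (assumption | rule that)+
  have reg: "compact \<Theta>" "\<theta>0 \<in> interior \<Theta>" "continuous_on \<Theta> \<Sigma>" "\<Sigma> differentiable (at \<theta>0)"
    using model by (simp_all add: competing_model_def Sigma_def)
  have pd: "pos_def (\<Sigma> \<theta>)" if "\<theta> \<in> \<Theta>" for \<theta>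
    unfolding Sigma_def by (rule pos_def_Sigma_sem) (use model that in \<open>simp add: competing_model_def\<close>)
  note bias = qmle_log_likelihood_bias[where X = X and \<Sigma> = \<Sigma> and G = G and R = R and est = est and \<Theta> = \<Theta>,
      OF Xm T reg(1,2) pd reg(3,4) qmle c GR]
  show ?thesis
    by (intro conjI allI impI ballI bias) assumption+
qed

end
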